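(* Let $\delta\in(0,1)$, $c=10^{-10}\delta$, let $k\ge2$ be an integer and $x\ge k-1$ real, and let $\mathcal{A}\subset\{0,1\}^n$ with $|\mathcal{A}|=\binom{n}{\ge k+1}+\binom{x}{k}$. If $|\partial_v(\mathcal{A})|\le B_{lov}(\mathcal{A})+\frac{ck(x-k)}{x^3}\binom{x}{k-1}$, where $B_{lov}(\mathcal{A})=\binom{n}{k}-\binom{x}{k}+\binom{x}{k-1}$, then $|\mathcal{A}\triangle\mathcal{G}|\le\delta\binom{x-3}{k-2}$ for some generalised Hamming ball $\mathcal{G}$. Furthermore, writing $m=|\mathcal{G}|$, $D=|\mathcal{G}\setminus\mathcal{A}|$ and $E=|\mathcal{A}\setminus\mathcal{G}|$, we have $|\partial_v(\mathcal{A})|\ge|\partial_v(\mathcal{J}_{m,D,E})|$.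
   Context: Subsets of $[n]$ are identified with $\{0,1\}^n$; $Q_n$ is the cube graph (adjacency = differing in one coordinate). For $\mathcal{A}\subset\{0,1\}^n$, $\partial_v(\mathcal{A})=\{x'\notin\mathcal{A}: x'\text{ adjacent in }Q_n\text{ to some }x\in\mathcal{A}\}$. $\binom{x}{k}=x(x-1)\cdots(x-k+1)/k!$ for real $x$; $\binom{n}{\ge j}=\sum_{i\ge j}\binom{n}{i}$; $\binom{[n]}{\ge j}$ is the family of subsets of $[n]$ of size at least $j$. A generalised Hamming ball is the image under an automorphism of $Q_n$ (a coordinate permutation composed with a map $A\mapsto A\triangle C$) of a family $\binom{[n]}{\ge\ell+1}\cup\binom{[s]}{\ell}$ or $\binom{[n]}{\ge \ell+1}\cup\binom{[s-1]}{\ell}\cup\binom{[s-1]}{\ell-1}$ for integers $\ell\le s\le n$. The simplicial order on subsets of $[n]$: $A<B$ if $|A|>|B|$, or $|A|=|B|$ and $\max(A\triangle B)\in B$; $\mathcal{I}_m$ is its initial segment of size $m$, and $\mathcal{J}_{m,D,E}=\mathcal{I}_{m-D}\cup(\mathcal{I}_{m+E}\setminus\mathcal{I}_m)$.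
   Formalization: The formal theorem also assumes x ≤ n (so that B_lov depends only on the family), that the family is nonempty, and (k,x) ≠ (3,2), where the bound is −δ; without these the claim fails, e.g. for n=k=3 and the cube minus two antipodal points. *)

theory Defs
  imports Complex_Main "HOL-Combinatorics.Permutations"
begin

text \<open>A vertex of \<open>Q_n\<close> is a subset of \<open>{1..n}\<close>.\<close>

definition cube :: "nat \<Rightarrow> nat set set"
  where "cube n = Pow {1..n}"

definition adjacent :: "nat set \<Rightarrow> nat set \<Rightarrow> bool"
  where "adjacent X Y \<longleftrightarrow> card (sym_diff X Y) = 1"

definition vboundary :: "nat \<Rightarrow> nat set set \<Rightarrow> nat set set"
  where "vboundary n \<A> = {Y \<in> cube n. Y \<notin> \<A> \<and> (\<exists>X\<in>\<A>. adjacent X Y)}"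

definition binom_ge :: "nat \<Rightarrow> nat \<Rightarrow> nat"
  where "binom_ge n j = (\<Sum>i=j..n. n choose i)"

text \<open>Lovasz-type boundary bound \<open>B_lov(\<A>)\<close>, as a function of the parameters \<open>k\<close>, \<open>x\<close> in
  \<open>|\<A>| = binom_ge n (k + 1) + (x gchoose k)\<close>.\<close>

definition B_lov :: "nat \<Rightarrow> nat \<Rightarrow> real \<Rightarrow> real"
  where "B_lov n k x = real (n choose k) - (x gchoose k) + (x gchoose (k - 1))"

text \<open>Layer indices are integers, so that \<open>s - 1\<close> and \<open>\<ell> - 1\<close> are genuine differences:
  there are no sets of negative size, and \<open>[s]\<close> is empty for \<open>s \<le> 0\<close>.\<close>

definition layer :: "int \<Rightarrow> int \<Rightarrow> nat set set"
  where "layer s j = {A. A \<subseteq> {1..nat s} \<and> int (card A) = j}"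

definition upper_layers :: "nat \<Rightarrow> int \<Rightarrow> nat set set"
  where "upper_layers n j = {A. A \<subseteq> {1..n} \<and> int (card A) \<ge> j}"

definition cube_automorphism :: "nat \<Rightarrow> (nat set \<Rightarrow> nat set) \<Rightarrow> bool"
  where "cube_automorphism n \<phi> \<longleftrightarrow>
    (\<exists>\<pi> C. \<pi> permutes {1..n} \<and> C \<subseteq> {1..n} \<and> \<phi> = (\<lambda>A. sym_diff (\<pi> ` A) C))"

definition gen_hamming_ball :: "nat \<Rightarrow> nat set set \<Rightarrow> bool"
  where "gen_hamming_ball n \<G> \<longleftrightarrow>
    (\<exists>\<phi> l s. cube_automorphism n \<phi> \<and> l \<le> s \<and> s \<le> int n \<and>
      (\<G> = \<phi> ` (upper_layers n (l + 1) \<union> layer s l) \<or>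
       \<G> = \<phi> ` (upper_layers n (l + 1) \<union> layer (s - 1) l \<union> layer (s - 1) (l - 1))))"

definition simplicial_less :: "nat set \<Rightarrow> nat set \<Rightarrow> bool"
  where "simplicial_less A B \<longleftrightarrow>
    card A > card B \<or> (card A = card B \<and> A \<noteq> B \<and> Max (sym_diff A B) \<in> B)"

definition is_initial_segment :: "nat \<Rightarrow> nat set set \<Rightarrow> bool"
  where "is_initial_segment n \<I> \<longleftrightarrow>
    \<I> \<subseteq> cube n \<and> (\<forall>B\<in>\<I>. \<forall>A\<in>cube n. simplicial_less A B \<longrightarrow> A \<in> \<I>)"

text \<open>Meaningful for \<open>m \<le> 2 ^ n\<close>; see \<open>initial_segment_unique\<close> below.\<close>

definition initial_segment :: "nat \<Rightarrow> nat \<Rightarrow> nat set set"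
  where "initial_segment n m = (THE \<I>. is_initial_segment n \<I> \<and> card \<I> = m)"

definition J_family :: "nat \<Rightarrow> nat \<Rightarrow> nat \<Rightarrow> nat \<Rightarrow> nat set set"
  where "J_family n m D E =
    initial_segment n (m - D) \<union> (initial_segment n (m + E) - initial_segment n m)"

lemma finite_cube: "finite (cube n)"
  by (simp add: cube_def)

lemma finite_in_cube: "A \<in> cube n \<Longrightarrow> finite A"
  by (auto simp: cube_def intro: finite_subset)

lemma simplicial_less_irrefl: "\<not> simplicial_less A A"
  by (simp add: simplicial_less_def)

lemma simplicial_less_linear:
  assumes "A \<in> cube n" "B \<in> cube n" "A \<noteq> B"
  shows "simplicial_less A B \<or> simplicial_less B A"
proof -
  have "finite (sym_diff A B)" "sym_diff A B \<noteq> {}"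
    using assms finite_in_cube by auto
  then have "Max (sym_diff A B) \<in> sym_diff A B" by (rule Max_in)
  moreover have "sym_diff B A = sym_diff A B" by blast
  ultimately show ?thesis
    unfolding simplicial_less_def using assms(3) by (cases "card A" "card B" rule: linorder_cases) auto
qed

lemma simplicial_less_trans:
  assumes fin: "finite A" "finite B" "finite C"
    and AB: "simplicial_less A B" and BC: "simplicial_less B C"
  shows "simplicial_less A C"
proof (cases "card A = card B \<and> card B = card C")
  case False
  then show ?thesis using AB BC by (auto simp: simplicial_less_def)
next
  case True
  define p where "p = Max (sym_diff A B)"
  define q where "q = Max (sym_diff B C)"
  have ne: "sym_diff A B \<noteq> {}" "sym_diff B C \<noteq> {}"
    using True AB BC by (auto simp: simplicial_less_def)
  have pB: "p \<in> B" and qC: "q \<in> C"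
    using True AB BC by (auto simp: simplicial_less_def p_def q_def)
  have fAB: "finite (sym_diff A B)" and fBC: "finite (sym_diff B C)" using fin by auto
  have "p \<in> sym_diff A B" unfolding p_def by (rule Max_in[OF fAB ne(1)])
  moreover have "q \<in> sym_diff B C" unfolding q_def by (rule Max_in[OF fBC ne(2)])
  ultimately have pA: "p \<notin> A" and qB: "q \<notin> B" using pB qC by auto
  have pmax: "z \<in> A \<longleftrightarrow> z \<in> B" if "z > p" for z
    proof (rule ccontr)
    assume "(z \<in> A) \<noteq> (z \<in> B)"
    then have "z \<le> p" unfolding p_def using fin by (intro Max_ge) auto
    with that show False by simp
  qed
  have qmax: "z \<in> B \<longleftrightarrow> z \<in> C" if "z > q" for z
    proof (rule ccontr)
    assume "(z \<in> B) \<noteq> (z \<in> C)"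
    then have "z \<le> q" unfolding q_def using fin by (intro Max_ge) auto
    with that show False by simp
  qed
  have "p \<noteq> q" using pB qB by auto
  define r where "r = max p q"
  have rC: "r \<in> C" and rA: "r \<notin> A"
    using pB qC pA qB pmax[of q] qmax[of p] \<open>p \<noteq> q\<close>
    by (cases p q rule: linorder_cases; simp add: r_def max_def)+
  have "z \<le> r" if "z \<in> sym_diff A C" for z
    proof (rule ccontr)
    assume "\<not> z \<le> r"
    then have "z > p" "z > q" by (auto simp: r_def)
    then show False using that pmax qmax by blast
  qed
  then have "Max (sym_diff A C) = r"
    using fin rC rA by (intro Max_eqI) auto
  then show ?thesis
    using True rC rA by (auto simp: simplicial_less_def)
qed

lemma initial_segments_nested:
  assumes "is_initial_segment n \<I>" "is_initial_segment n \<I>'"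
  shows "\<I> \<subseteq> \<I>' \<or> \<I>' \<subseteq> \<I>"
proof (rule ccontr)
  assume "\<not> ?thesis"
  then obtain A B where "A \<in> \<I>" "A \<notin> \<I>'" "B \<in> \<I>'" "B \<notin> \<I>" by blast
  with assms simplicial_less_linear[of A n B] show False
    unfolding is_initial_segment_def by blast
qed

lemma initial_segment_unique:
  assumes "m \<le> 2 ^ n"
  shows "\<exists>!\<I>. is_initial_segment n \<I> \<and> card \<I> = m"
proof (rule ex_ex1I)
  show "\<exists>\<I>. is_initial_segment n \<I> \<and> card \<I> = m"
    using assms
  proof (induction m)
    case 0
    show ?case by (rule exI[of _ "{}"]) (simp add: is_initial_segment_def)
  next
    case (Suc m)
    then obtain \<I> where I: "is_initial_segment n \<I>" "card \<I> = m" by auto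
    have sub: "\<I> \<subseteq> cube n" using I by (simp add: is_initial_segment_def)
    define R where "R = {(A, B). A \<in> cube n \<and> B \<in> cube n \<and> simplicial_less A B}"
    have "card (cube n) = 2 ^ n" by (simp add: cube_def card_Pow)
    then have "cube n - \<I> \<noteq> {}" using I Suc.prems sub by auto
    moreover have "finite R"
      by (rule finite_subset[of _ "cube n \<times> cube n"]) (auto simp: R_def finite_cube)
    moreover have "trans R"
      by (rule transI) (auto simp: R_def intro: simplicial_less_trans[OF finite_in_cube finite_in_cube finite_in_cube])
    then have "acyclic R"
      by (auto simp: acyclic_irrefl irrefl_def R_def simplicial_less_irrefl trancl_id)
    ultimately obtain M where M: "M \<in> cube n - \<I>" "\<And>A. (A, M) \<in> R \<Longrightarrow> A \<notin> cube n - \<I>"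
      using wfE_min'[OF finite_acyclic_wf, of R "cube n - \<I>"] by blast
    have "is_initial_segment n (insert M \<I>)"
      using I M unfolding is_initial_segment_def R_def by blast
    moreover have "card (insert M \<I>) = Suc m"
      using I M finite_subset[OF sub finite_cube] by simp
    ultimately show ?case by blast
  qed
  show "\<I> = \<I>'"
    if "is_initial_segment n \<I> \<and> card \<I> = m" "is_initial_segment n \<I>' \<and> card \<I>' = m" for \<I> \<I>'
  proof -
    have "finite \<I>" "finite \<I>'"
      using that finite_cube[of n] by (auto simp: is_initial_segment_def intro: finite_subset)
    then show ?thesis
      using that initial_segments_nested[of n \<I> \<I>'] card_subset_eq[of \<I> \<I>'] card_subset_eq[of \<I>' \<I>]
      by auto
  qed
qed

end

theory Submission
 imports Defs
begin

text \<open>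
Measured against the tangent at \<open>x = s\<close> of the curve \<open>(C(x, k), C(x, k - 1))\<close>, the excess of the
closed neighbourhood of a family over the Lovasz bound is superadditive when the family is split
into its two sections along a coordinate. Hence an almost extremal family has an almost extremal
section in one of the smaller cubes; by induction that section is close to a Hamming ball, and the
local bound \<open>excess_lower\<close> forces the other section to be close to the matching ball. The direction
is chosen in the distinguished set of the ball if possible, and outside it when \<open>s\<close> is small compared
to the dimension, where one section is nearly a full ball. Harper's theorem and the Kruskal-Katona
theorem in Lovasz's form supply the lower bounds. Finally the real parameter \<open>x\<close> is moved to an
adjacent integer \<open>s\<close>, at a cost absorbed by the slack.
\<close>

section \<open>Closed neighbourhoods\<close>

text \<open>The obstacle is to avoid losing a constant at every passage to a smaller cube. Along an
  inside direction the error budget \<open>\<eta> * Zc s k\<close> splits by Pascal's rule just as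
  the excess does, so one section stays within its own share for the same \<open>\<eta>\<close>. The
  glued ball need only be close at the scale of \<open>incr s k\<close>, the increment C(s,k) -
  C(s-1,k): in that range the excess is bounded below by a concave function of the two one-sided
  differences, and \<open>excess_stable\<close> restores the factor 4. No ball is known in advance.
  The direction is therefore arbitrary, and the size of the larger section tells whether it acts as
  an inside or as an outside direction. The lower bound on the excess holds only in a window of
  sizes around the ball, so the sizes of the sections have to be confined before induction can be
  applied to them. The induction ends where integrality makes everything exact: for k = 2 the budget
  is below 1, and for s = k with k at least 3 it is 0. The slack allowed in the theorem, multiplied
  by s - k + 1, is of the order of c times C(x-3,k-2), the real analogue of
  \<open>Zc\<close>.\<close>

abbreviation (input) incr :: "nat \<Rightarrow> nat \<Rightarrow> real"
 where "incr s k \<equiv> real ((s - 1) choose (k - 1))"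

text \<open>Closed neighbourhoods replace the vertex boundary because they are monotone and commute
  with unions; \<open>card_vboundary\<close> translates back. The ground set is arbitrary, so that
  sections along \<open>i\<close> live in the cube on \<open>V - {i}\<close>.\<close>

definition nbd :: "nat set \<Rightarrow> nat set set \<Rightarrow> nat set set"
 where "nbd V \<A> = {y. y \<subseteq> V \<and> (\<exists>x\<in>\<A>. card (sym_diff x y) \<le> 1)}"

lemma nbd_mono: "\<A> \<subseteq> \<B> \<Longrightarrow> nbd V \<A> \<subseteq> nbd V \<B>"
 by (auto simp: nbd_def)

lemma nbd_Un: "nbd V (\<A> \<union> \<B>) = nbd V \<A> \<union> nbd V \<B>"
 by (auto simp: nbd_def)

lemma nbd_empty [simp]: "nbd V {} = {}"
 by (simp add: nbd_def)

lemma nbd_superset: "\<A> \<subseteq> Pow V \<Longrightarrow> \<A> \<subseteq> nbd V \<A>"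
 by (auto simp: nbd_def intro!: bexI)

lemma nbd_subset_Pow: "nbd V \<A> \<subseteq> Pow V"
 by (auto simp: nbd_def)

lemma finite_nbd [simp]: "finite V \<Longrightarrow> finite (nbd V \<A>)"
 by (rule finite_subset[OF nbd_subset_Pow]) simp

lemma finite_subset_Pow: "\<A> \<subseteq> Pow V \<Longrightarrow> finite V \<Longrightarrow> finite \<A>"
 by (meson finite_Pow_iff finite_subset)

lemma card_nbd_mono: "finite V \<Longrightarrow> \<A> \<subseteq> \<B> \<Longrightarrow> card (nbd V \<A>) \<le> card (nbd V \<B>)"
 by (intro card_mono finite_nbd nbd_mono)

lemma sym_diff_card_le_1_iff:
 assumes "finite x" "finite y"
 shows "card (sym_diff x y) \<le> 1 \<longleftrightarrow>
  x = y \<or> (\<exists>a. a \<notin> x \<and> y = insert a x) \<or> (\<exists>a. a \<notin> y \<and> x = insert a y)"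
proof
 assume "card (sym_diff x y) \<le> 1"
 moreover have "finite (sym_diff x y)" using assms by auto
 ultimately consider "sym_diff x y = {}" | a where "sym_diff x y = {a}"
  by (metis One_nat_def card_1_singletonE card_0_eq le_Suc_eq le_zero_eq)
 thus "x = y \<or> (\<exists>a. a \<notin> x \<and> y = insert a x) \<or> (\<exists>a. a \<notin> y \<and> x = insert a y)"
 proof cases
  case 2
  hence "a \<in> sym_diff x y" by simp
  then consider "a \<in> x" "a \<notin> y" | "a \<in> y" "a \<notin> x" by blast
  thus ?thesis
  proof cases
   case b: 1
   have "y - x \<subseteq> {a}" "x - y \<subseteq> {a}" using 2 by auto
   hence "y - x = {}" "x - y = {a}" using b by auto
   hence "x = insert a y" using b by blast
   with b show ?thesis by blast
  next
   case b: 2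
   have "y - x \<subseteq> {a}" "x - y \<subseteq> {a}" using 2 by auto
   hence "x - y = {}" "y - x = {a}" using b by auto
   hence "y = insert a x" using b by blast
   with b show ?thesis by blast
  qed
 qed auto
next
 assume "x = y \<or> (\<exists>a. a \<notin> x \<and> y = insert a x) \<or> (\<exists>a. a \<notin> y \<and> x = insert a y)"
 thus "card (sym_diff x y) \<le> 1"
 proof (elim disjE exE conjE)
  fix a assume "a \<notin> x" "y = insert a x"
  hence "sym_diff x y = {a}" by auto
  thus ?thesis by simp
 next
  fix a assume "a \<notin> y" "x = insert a y"
  hence "sym_diff x y = {a}" by auto
  thus ?thesis by simp
 qed simp
qed

lemma nbd_iff:
 assumes "finite V" "\<A> \<subseteq> Pow V"
 shows "y \<in> nbd V \<A> \<longleftrightarrow> y \<subseteq> V \<and>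
  (y \<in> \<A> \<or> (\<exists>a. a \<in> V - y \<and> insert a y \<in> \<A>) \<or> (\<exists>a\<in>y. y - {a} \<in> \<A>))" (is "?L = ?R")
proof
 assume ?L
 then obtain x where x: "x \<in> \<A>" "card (sym_diff x y) \<le> 1" and yV: "y \<subseteq> V" by (auto simp: nbd_def)
 have fin: "finite x" "finite y" using x yV assms by (auto intro: finite_subset)
 from x(2) consider "x = y" | a where "a \<notin> x" "y = insert a x" | a where "a \<notin> y" "x = insert a y"
  unfolding sym_diff_card_le_1_iff[OF fin] by blast
 thus ?R
 proof cases
  case 1 thus ?thesis using x yV by auto
 next
  case (2 a) hence "y - {a} = x" by auto
  thus ?thesis using x yV 2 by auto
 next
  case (3 a) hence "a \<in> V - y" using x assms by auto
  thus ?thesis using x yV 3 by auto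
 qed
next
 assume R: ?R
 have fin: "finite y" using R assms by (auto intro: finite_subset)
 show ?L
 proof -
  from R consider "y \<in> \<A>" | a where "a \<in> V - y" "insert a y \<in> \<A>" | a where "a \<in> y" "y - {a} \<in> \<A>" by blast
  thus ?thesis
  proof cases
   case 1 thus ?thesis using R by (auto simp: nbd_def intro!: bexI[of _ y])
  next
   case (2 a)
   have "card (sym_diff (insert a y) y) \<le> 1" using 2 fin
    by (subst sym_diff_card_le_1_iff) auto
   thus ?thesis using R 2 unfolding nbd_def by blast
  next
   case (3 a)
   have "card (sym_diff (y - {a}) y) \<le> 1" using 3 fin
    by (subst sym_diff_card_le_1_iff) auto
   thus ?thesis using R 3 unfolding nbd_def by blast
  qed
 qed
qed

lemma nbdI_insert:
 assumes "finite V" "\<A> \<subseteq> Pow V" "insert a y \<in> \<A>" shows "y \<in> nbd V \<A>"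
 using assms by (cases "a \<in> y") (auto simp: nbd_iff insert_absorb)

lemma nbdI_remove:
 assumes "finite V" "\<A> \<subseteq> Pow V" "x \<in> \<A>" "y = insert a x" "a \<in> V" shows "y \<in> nbd V \<A>"
proof (cases "a \<in> x")
 case True hence "y = x" using assms by auto
 thus ?thesis using assms nbd_superset by blast
next
 case False hence "y - {a} = x" using assms by auto
 thus ?thesis using assms by (auto simp: nbd_iff)
qed

text \<open>\<open>nbd\<close> preserves unions, and the neighbourhood of an intersection lies in
  both neighbourhoods. With a ball as the second family this replaces \<open>\<A>\<close> by its
  union and its intersection with the ball, to each of which Harper's theorem applies.\<close>

lemma card_submodular_nbd:
 assumes "finite V"
 shows "card (nbd V (\<A> \<inter> \<B>)) + card (nbd V (\<A> \<union> \<B>)) \<le> card (nbd V \<A>) + card (nbd V \<B>)"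
proof -
 have "card (nbd V (\<A> \<inter> \<B>)) \<le> card (nbd V \<A> \<inter> nbd V \<B>)"
  using assms by (intro card_mono) (auto simp: nbd_def)
 thus ?thesis
  using card_Un_Int[of "nbd V \<A>" "nbd V \<B>"] assms by (simp add: nbd_Un)
qed

section \<open>Sections along a coordinate\<close>

definition upsec :: "nat \<Rightarrow> nat set set \<Rightarrow> nat set set"
 where "upsec i \<A> = {x. i \<notin> x \<and> insert i x \<in> \<A>}"

definition dnsec :: "nat \<Rightarrow> nat set set \<Rightarrow> nat set set"
 where "dnsec i \<A> = {x \<in> \<A>. i \<notin> x}"

lemma upsec_subset: "\<A> \<subseteq> Pow V \<Longrightarrow> upsec i \<A> \<subseteq> Pow (V - {i})"
 by (auto simp: upsec_def)

lemma dnsec_subset: "\<A> \<subseteq> Pow V \<Longrightarrow> dnsec i \<A> \<subseteq> Pow (V - {i})"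
 by (auto simp: dnsec_def)

lemma card_sections:
 assumes "finite \<A>"
 shows "card \<A> = card (upsec i \<A>) + card (dnsec i \<A>)"
proof -
 have "bij_betw (insert i) (upsec i \<A>) {x \<in> \<A>. i \<in> x}"
  by (rule bij_betwI[where g = "\<lambda>x. x - {i}"]) (auto simp: upsec_def insert_absorb)
 hence "card (upsec i \<A>) = card {x \<in> \<A>. i \<in> x}" by (rule bij_betw_same_card)
 moreover have "\<A> = {x \<in> \<A>. i \<in> x} \<union> dnsec i \<A>" by (auto simp: dnsec_def)
 moreover have "card ({x \<in> \<A>. i \<in> x} \<union> dnsec i \<A>) = card {x \<in> \<A>. i \<in> x} + card (dnsec i \<A>)"
  using assms by (intro card_Un_disjoint) (auto simp: dnsec_def)
 ultimately show ?thesis by simp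
qed

lemma upsec_nbd:
 assumes "finite V" "\<A> \<subseteq> Pow V" "i \<in> V"
 shows "upsec i (nbd V \<A>) = nbd (V - {i}) (upsec i \<A>) \<union> dnsec i \<A>"
proof -
 have fV: "finite (V - {i})" using assms by simp
 show ?thesis
 proof (intro set_eqI)
  fix y
  show "y \<in> upsec i (nbd V \<A>) \<longleftrightarrow> y \<in> nbd (V - {i}) (upsec i \<A>) \<union> dnsec i \<A>"
  proof (cases "i \<in> y")
   case True thus ?thesis
    using nbd_subset_Pow[of "V - {i}" "upsec i \<A>"] by (auto simp: upsec_def dnsec_def)
  next
   case False
   have N: "y \<in> nbd (V - {i}) (upsec i \<A>) \<longleftrightarrow> y \<subseteq> V - {i} \<and> (y \<in> upsec i \<A>
     \<or> (\<exists>a. a \<in> V - {i} - y \<and> insert a y \<in> upsec i \<A>) \<or> (\<exists>a\<in>y. y - {a} \<in> upsec i \<A>))"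
    by (rule nbd_iff[OF fV upsec_subset[OF assms(2)]])
   have 1: "insert i y - {i} = y" using False by auto
   have 2: "insert i y - {a} = insert i (y - {a})" if "a \<in> y" for a using False that by auto
   have 3: "(\<exists>a\<in>insert i y. insert i y - {a} \<in> \<A>) \<longleftrightarrow> y \<in> \<A> \<or> (\<exists>a\<in>y. insert i (y - {a}) \<in> \<A>)"
    using 1 2 by auto
   have sub: "y \<in> \<A> \<Longrightarrow> y \<subseteq> V" using assms by auto
   have "y \<in> upsec i (nbd V \<A>) \<longleftrightarrow> insert i y \<in> nbd V \<A>" using False by (simp add: upsec_def)
   also have "\<dots> \<longleftrightarrow> y \<in> nbd (V - {i}) (upsec i \<A>) \<union> dnsec i \<A>"
    unfolding Un_iff N nbd_iff[OF assms(1,2), of "insert i y"] 3 using False assms(3) sub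
    by (auto simp: upsec_def dnsec_def insert_commute)
   finally show ?thesis .
  qed
 qed
qed

lemma dnsec_nbd:
 assumes "finite V" "\<A> \<subseteq> Pow V" "i \<in> V"
 shows "dnsec i (nbd V \<A>) = nbd (V - {i}) (dnsec i \<A>) \<union> upsec i \<A>"
proof -
 have fV: "finite (V - {i})" using assms by simp
 show ?thesis
 proof (intro set_eqI)
  fix y
  show "y \<in> dnsec i (nbd V \<A>) \<longleftrightarrow> y \<in> nbd (V - {i}) (dnsec i \<A>) \<union> upsec i \<A>"
  proof (cases "i \<in> y")
   case True thus ?thesis
    using nbd_subset_Pow[of "V - {i}" "dnsec i \<A>"] by (auto simp: upsec_def dnsec_def)
  next
   case False
   have N: "y \<in> nbd (V - {i}) (dnsec i \<A>) \<longleftrightarrow> y \<subseteq> V - {i} \<and> (y \<in> dnsec i \<A>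
     \<or> (\<exists>a. a \<in> V - {i} - y \<and> insert a y \<in> dnsec i \<A>) \<or> (\<exists>a\<in>y. y - {a} \<in> dnsec i \<A>))"
    by (rule nbd_iff[OF fV dnsec_subset[OF assms(2)]])
   have sub: "insert i y \<in> \<A> \<Longrightarrow> y \<subseteq> V" using assms by auto
   have "y \<in> dnsec i (nbd V \<A>) \<longleftrightarrow> y \<in> nbd V \<A>" using False by (simp add: dnsec_def)
   also have "\<dots> \<longleftrightarrow> y \<in> nbd (V - {i}) (dnsec i \<A>) \<union> upsec i \<A>"
    unfolding Un_iff N nbd_iff[OF assms(1,2), of "y"] using False assms(3) sub
    by (auto simp: upsec_def dnsec_def)
   finally show ?thesis .
  qed
 qed
qed

text \<open>In either half of the cube the neighbourhood is the union of the section's own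
  neighbourhood and the opposite section, reached by changing \<open>i\<close>. Each half thus has
  two lower bounds, one from each term.\<close>

lemma card_nbd_sections:
 assumes "finite V" "\<A> \<subseteq> Pow V" "i \<in> V"
 shows "card (nbd V \<A>) = card (nbd (V - {i}) (upsec i \<A>) \<union> dnsec i \<A>)
  + card (nbd (V - {i}) (dnsec i \<A>) \<union> upsec i \<A>)"
 using card_sections[OF finite_nbd[OF assms(1)], of \<A> i] upsec_nbd[OF assms] dnsec_nbd[OF assms] by simp

section \<open>Harper's theorem\<close>

text \<open>The compressions replace the part \<open>W\<close> of a set by \<open>U\<close>, where
  the two may have different sizes; a member moves only if its image is not yet present. Closedness
  under all disjoint pairs with \<open>U\<close> before \<open>W\<close> forces an initial
  segment.\<close>

definition uv_shift :: "nat set \<Rightarrow> nat set \<Rightarrow> nat set \<Rightarrow> nat set"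
 where "uv_shift U W x = (if W \<subseteq> x \<and> U \<inter> x = {} then x - W \<union> U else x)"

definition uv_compress :: "nat set \<Rightarrow> nat set \<Rightarrow> nat set set \<Rightarrow> nat set set"
 where "uv_compress U W \<A> = (\<lambda>x. if uv_shift U W x \<in> \<A> then x else uv_shift U W x) ` \<A>"

definition uv_closed :: "nat set \<Rightarrow> nat set \<Rightarrow> nat set set \<Rightarrow> bool"
 where "uv_closed U W \<A> \<longleftrightarrow> (\<forall>x\<in>\<A>. W \<subseteq> x \<longrightarrow> U \<inter> x = {} \<longrightarrow> x - W \<union> U \<in> \<A>)"

lemma uv_shift_fixed: "\<not> (W \<subseteq> x \<and> U \<inter> x = {}) \<Longrightarrow> uv_shift U W x = x"
 by (auto simp: uv_shift_def)

lemma inj_on_uv_compress: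
 assumes "U \<inter> W = {}"
 shows "inj_on (\<lambda>x. if uv_shift U W x \<in> \<A> then x else uv_shift U W x) \<A>"
proof -
 have inj: "x = y" if "W \<subseteq> x" "U \<inter> x = {}" "W \<subseteq> y" "U \<inter> y = {}" "x - W \<union> U = y - W \<union> U" for x y
  using that assms by blast
 show ?thesis by (auto simp: inj_on_def uv_shift_def split: if_splits intro: inj)
qed

lemma card_uv_compress: "U \<inter> W = {} \<Longrightarrow> card (uv_compress U W \<A>) = card \<A>"
 unfolding uv_compress_def by (rule card_image[OF inj_on_uv_compress])

text \<open>Sets meeting \<open>U \<union> W\<close> in exactly \<open>U\<close> or exactly
  \<open>W\<close> come in pairs \<open>R \<union> U\<close>, \<open>R \<union> W\<close>. The
  compression acts on each pair separately: the \<open>U\<close> member is present afterwards if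
  either was, the \<open>W\<close> member only if both were. Sets of neither kind are
  unaffected.\<close>

lemma uv_compress_up:
 assumes "U \<inter> W = {}" "U \<noteq> W" "R \<inter> U = {}" "R \<inter> W = {}"
 shows "R \<union> U \<in> uv_compress U W \<A> \<longleftrightarrow> R \<union> U \<in> \<A> \<or> R \<union> W \<in> \<A>"
proof -
 have ne: "\<not> (W \<subseteq> R \<union> U \<and> U \<inter> (R \<union> U) = {})" using assms by blast
 have s1: "uv_shift U W (R \<union> U) = R \<union> U" using ne by (rule uv_shift_fixed)
 have s2: "uv_shift U W (R \<union> W) = R \<union> U" using assms by (auto simp: uv_shift_def)
 show ?thesis
 proof
  assume "R \<union> U \<in> uv_compress U W \<A>"
  then obtain x where x: "x \<in> \<A>" "R \<union> U = (if uv_shift U W x \<in> \<A> then x else uv_shift U W x)"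
   by (auto simp: uv_compress_def)
  show "R \<union> U \<in> \<A> \<or> R \<union> W \<in> \<A>"
  proof (cases "W \<subseteq> x \<and> U \<inter> x = {} \<and> uv_shift U W x \<notin> \<A>")
   case True
   hence "R \<union> U = x - W \<union> U" using x by (auto simp: uv_shift_def)
   hence "x = R \<union> W" using True assms by blast
   thus ?thesis using x by simp
  next
   case False
   hence "R \<union> U = x" using x by (auto simp: uv_shift_def split: if_splits)
   thus ?thesis using x by simp
  qed
 next
  assume "R \<union> U \<in> \<A> \<or> R \<union> W \<in> \<A>"
  thus "R \<union> U \<in> uv_compress U W \<A>"
  proof (cases "R \<union> U \<in> \<A>")
   case True
   thus ?thesis using s1 unfolding uv_compress_def by (intro image_eqI[of _ _ "R \<union> U"]) simp_all
  next
   case False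
   assume "R \<union> U \<in> \<A> \<or> R \<union> W \<in> \<A>"
   hence "R \<union> W \<in> \<A>" using False by simp
   thus ?thesis using s2 False unfolding uv_compress_def
    by (intro image_eqI[of _ _ "R \<union> W"]) simp_all
  qed
 qed
qed

lemma uv_compress_dn:
 assumes "U \<inter> W = {}" "U \<noteq> W" "R \<inter> U = {}" "R \<inter> W = {}"
 shows "R \<union> W \<in> uv_compress U W \<A> \<longleftrightarrow> R \<union> U \<in> \<A> \<and> R \<union> W \<in> \<A>"
proof -
 have s2: "uv_shift U W (R \<union> W) = R \<union> U" using assms by (auto simp: uv_shift_def)
 show ?thesis
 proof
  assume "R \<union> W \<in> uv_compress U W \<A>"
  then obtain x where x: "x \<in> \<A>" "R \<union> W = (if uv_shift U W x \<in> \<A> then x else uv_shift U W x)"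
   by (auto simp: uv_compress_def)
  have "x = R \<union> W"
  proof (rule ccontr)
   assume "x \<noteq> R \<union> W"
   hence "R \<union> W = x - W \<union> U" "W \<subseteq> x" "U \<inter> x = {}"
    using x by (auto simp: uv_shift_def split: if_splits)
   thus False using assms by blast
  qed
  moreover have "uv_shift U W x \<in> \<A>"
  proof (rule ccontr)
   assume "uv_shift U W x \<notin> \<A>"
   hence e: "R \<union> W = R \<union> U" using x(2) \<open>x = R \<union> W\<close> s2 by metis
   have "U \<subseteq> R \<union> W" unfolding e by blast
   hence "U \<subseteq> {}" using assms by blast
   have "W \<subseteq> R \<union> U" unfolding e[symmetric] by blast
   hence "W \<subseteq> {}" using assms by blast
   thus False using \<open>U \<subseteq> {}\<close> assms by simp
  qed
  ultimately show "R \<union> U \<in> \<A> \<and> R \<union> W \<in> \<A>" using x s2 by simp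
 next
  assume "R \<union> U \<in> \<A> \<and> R \<union> W \<in> \<A>"
  thus "R \<union> W \<in> uv_compress U W \<A>" using s2 unfolding uv_compress_def
   by (intro image_eqI[of _ _ "R \<union> W"]) simp_all
 qed
qed

lemma uv_compress_neither:
 assumes "U \<inter> W = {}" "\<not> (W \<subseteq> y \<and> U \<inter> y = {})" "\<not> (U \<subseteq> y \<and> W \<inter> y = {})"
 shows "y \<in> uv_compress U W \<A> \<longleftrightarrow> y \<in> \<A>"
proof
 assume "y \<in> uv_compress U W \<A>"
 then obtain x where x: "x \<in> \<A>" "y = (if uv_shift U W x \<in> \<A> then x else uv_shift U W x)"
  by (auto simp: uv_compress_def)
 have "y = x"
 proof (rule ccontr)
  assume "y \<noteq> x"
  hence "y = x - W \<union> U" "U \<inter> x = {}" using x by (auto simp: uv_shift_def split: if_splits)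
  thus False using assms by blast
 qed
 thus "y \<in> \<A>" using x by simp
next
 assume "y \<in> \<A>"
 thus "y \<in> uv_compress U W \<A>" using uv_shift_fixed[OF assms(2)] unfolding uv_compress_def
  by (intro image_eqI[of _ _ y]) simp_all
qed

lemma uv_compress_subset_Pow:
 assumes "\<A> \<subseteq> Pow V" "U \<subseteq> V" shows "uv_compress U W \<A> \<subseteq> Pow V"
 using assms by (auto simp: uv_compress_def uv_shift_def split: if_splits)

text \<open>A change outside \<open>U \<union> W\<close> keeps the pattern of a set on
  \<open>U \<union> W\<close>, and the partner is reached by the same change. A change inside
  destroys or creates the pattern; then the required neighbour comes from compressions with fewer
  elements, which the last two hypotheses provide. For \<open>W = {}\<close> the element
  \<open>w\<close> is arbitrary, since \<open>W - {w}\<close> is empty anyway.\<close>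

lemma nbd_uv_compress:
 assumes V: "finite V" "\<A> \<subseteq> Pow V" and UW: "U \<subseteq> V" "W \<subseteq> V" "U \<inter> W = {}" "U \<noteq> {}"
  and F1: "\<And>w. w \<in> W \<Longrightarrow> uv_closed U (W - {w}) \<A>"
  and F2: "\<And>u. u \<in> U \<Longrightarrow> \<exists>w. (W = {} \<or> w \<in> W) \<and> uv_closed (U - {u}) (W - {w}) \<A>"
 shows "nbd V (uv_compress U W \<A>) \<subseteq> uv_compress U W (nbd V \<A>)"
proof
 fix y assume y: "y \<in> nbd V (uv_compress U W \<A>)"
 define \<C> where "\<C> = uv_compress U W \<A>"
 have CV: "\<C> \<subseteq> Pow V" unfolding \<C>_def using V UW by (intro uv_compress_subset_Pow)
 have ne: "U \<noteq> W" using UW by auto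
 note up = uv_compress_up[OF UW(3) ne] and dn = uv_compress_dn[OF UW(3) ne]
  and nn = uv_compress_neither[OF UW(3)]
 have yV: "y \<subseteq> V" using y nbd_subset_Pow by auto
 obtain z where z: "z \<in> \<C>" "card (sym_diff z y) \<le> 1" using y by (auto simp: nbd_def \<C>_def)
 have zV: "z \<subseteq> V" using z CV by auto
 have adj: "y' \<in> nbd V \<A>" if "z' \<in> \<A>" "y' \<subseteq> V" "sym_diff z' y' \<subseteq> {a}" for z' y' a
 proof -
  have "card (sym_diff z' y') \<le> card {a}" using that(3) by (intro card_mono) auto
  thus ?thesis using that unfolding nbd_def by auto
 qed
 have AB: "\<A> \<subseteq> nbd V \<A>" using nbd_superset[OF V(2)] .
 have "finite (sym_diff z y)" using zV yV V by (auto intro: finite_subset)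
 then obtain h where h: "sym_diff z y \<subseteq> {h}" using z(2)
  by (cases "sym_diff z y = {}") (auto simp: le_Suc_eq card_1_singleton_iff)
 have hE: "z - {h} = y - {h}" using h by auto
 have hy: "y = z \<or> h \<in> z \<and> y = z - {h} \<or> h \<notin> z \<and> y = insert h z"
 proof (cases "h \<in> z"; cases "h \<in> y")
  assume "h \<in> z" "h \<in> y" thus ?thesis using hE by (metis insert_Diff)
 next
  assume "h \<in> z" "h \<notin> y" thus ?thesis using hE by simp
 next
  assume "h \<notin> z" "h \<in> y" thus ?thesis using hE by (metis Diff_empty Diff_insert0 insert_Diff)
 next
  assume "h \<notin> z" "h \<notin> y" thus ?thesis using hE by simp
 qed
 define R where "R = z - U - W"
 define R' where "R' = y - U - W"
 have R: "R \<inter> U = {}" "R \<inter> W = {}" "R \<subseteq> V" and R': "R' \<inter> U = {}" "R' \<inter> W = {}" "R' \<subseteq> V"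
  using zV yV by (auto simp: R_def R'_def)
 \<comment> \<open>The pattern of the member \<open>z\<close> on \<open>U \<union> W\<close>:
   exactly \<open>W\<close>, exactly \<open>U\<close>, or neither. The set \<open>y\<close> is
   classified in the same way below.\<close>
 consider (zd) "W \<subseteq> z" "U \<inter> z = {}" | (zu) "U \<subseteq> z" "W \<inter> z = {}" "\<not> (W \<subseteq> z \<and> U \<inter> z = {})"
  | (zn) "\<not> (W \<subseteq> z \<and> U \<inter> z = {})" "\<not> (U \<subseteq> z \<and> W \<inter> z = {})" by blast
 thus "y \<in> uv_compress U W (nbd V \<A>)"
 proof cases
  case zd
  hence zR: "z = R \<union> W" using R_def by auto
  have zA: "R \<union> U \<in> \<A>" "R \<union> W \<in> \<A>" using z(1) dn[OF R(1,2)] unfolding \<C>_def zR by auto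
  have yB: "y \<in> nbd V \<A>" using adj[OF _ yV h] zA zR by simp
  show ?thesis
  proof (cases "W \<subseteq> y \<and> U \<inter> y = {}")
   case True
   hence yR: "y = R' \<union> W" using R'_def by auto
   have "sym_diff (R \<union> U) (R' \<union> U) \<subseteq> {h}" using h zR yR R R' by auto
   hence "R' \<union> U \<in> nbd V \<A>" using adj[OF zA(1)] R' UW by auto
   thus ?thesis using yB dn[OF R'(1,2)] yR by simp
  next
   case False
   show ?thesis
   proof (cases "U \<subseteq> y \<and> W \<inter> y = {}")
    case True
    hence yR: "y = R' \<union> U" using R'_def by auto
    thus ?thesis using up[OF R'(1,2)] yB by simp
   next
    case F: False thus ?thesis using nn[OF False F] yB by simp
   qed
  qed
 next
  case zu
  hence zR: "z = R \<union> U" using R_def by auto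
  have zA: "R \<union> U \<in> \<A> \<or> R \<union> W \<in> \<A>" using z(1) up[OF R(1,2)] unfolding \<C>_def zR by auto
  consider (yd) "W \<subseteq> y" "U \<inter> y = {}" | (yu) "U \<subseteq> y" "W \<inter> y = {}"
   | (yn) "\<not> (W \<subseteq> y \<and> U \<inter> y = {})" "\<not> (U \<subseteq> y \<and> W \<inter> y = {})" by blast
  thus ?thesis
  proof cases
   case yd
   hence yR: "y = R' \<union> W" using R'_def by auto
   \<comment> \<open>Going from pattern \<open>U\<close> to pattern \<open>W\<close> changes all of
     \<open>U\<close> and all of \<open>W\<close>, so a single change forces \<open>W = {}\<close>
     and \<open>U = {h}\<close>.\<close>
   have "U \<subseteq> sym_diff z y" "W \<subseteq> sym_diff z y" using zu yd by auto
   hence "U \<subseteq> {h}" "W \<subseteq> {h}" using h by (meson subset_trans)+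
   hence "W = {}" "U = {h}" using UW by auto
   moreover have "R - R' \<subseteq> {h}" "R' - R \<subseteq> {h}" using h zR yR R R' by auto
   ultimately have "R' = R" using R R' by auto
   have "R \<union> W \<in> nbd V \<A> \<and> R \<union> U \<in> nbd V \<A>"
   proof (rule conjI)
    have s: "sym_diff (R \<union> U) (R \<union> W) \<subseteq> {h}" "sym_diff (R \<union> W) (R \<union> U) \<subseteq> {h}"
     using \<open>W = {}\<close> \<open>U = {h}\<close> by auto
    have v: "R \<union> U \<subseteq> V" "R \<union> W \<subseteq> V" using R UW by auto
    show "R \<union> W \<in> nbd V \<A>" using zA AB adj[OF _ v(2) s(1)] by blast
    show "R \<union> U \<in> nbd V \<A>" using zA AB adj[OF _ v(1) s(2)] by blast
   qed
   thus ?thesis using dn[OF R(1,2)] yR \<open>R' = R\<close> by simp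
  next
   case yu
   hence yR: "y = R' \<union> U" using R'_def by auto
   have "sym_diff (R \<union> U) (R' \<union> U) \<subseteq> {h}" "sym_diff (R \<union> W) (R' \<union> W) \<subseteq> {h}"
    using h zR yR R R' by auto
   hence "R' \<union> U \<in> nbd V \<A> \<or> R' \<union> W \<in> nbd V \<A>"
    using zA adj[of "R \<union> U" "R' \<union> U" h] adj[of "R \<union> W" "R' \<union> W" h] R' UW by blast
   thus ?thesis using up[OF R'(1,2)] yR by simp
  next
   case yn
   have "y \<in> nbd V \<A>"
   proof (cases "R \<union> U \<in> \<A>")
    case True thus ?thesis using adj[OF _ yV h] zR by simp
   next
    case False
    \<comment> \<open>Only \<open>R \<union> W\<close> is a member here; a smaller compression of it
      yields a member equal or adjacent to \<open>y\<close>.\<close>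
    hence RW: "R \<union> W \<in> \<A>" using zA by simp
    have yz: "y \<noteq> z" using yn zu by auto
    have hz: "h \<in> U \<or> h \<in> W"
    proof (rule ccontr)
     assume n: "\<not> (h \<in> U \<or> h \<in> W)"
     have "U \<subseteq> y" "W \<inter> y = {}" using hy zu n by auto
     thus False using yn by simp
    qed
    thus ?thesis
    proof
     assume hU: "h \<in> U"
     hence "h \<in> z" using zR by simp
     hence "y = z - {h}" using hy yz by simp
     hence yeq: "y = R \<union> (U - {h})" using zR R hU by auto
     obtain w where w: "W = {} \<or> w \<in> W" "uv_closed (U - {h}) (W - {w}) \<A>" using F2[OF hU] by blast
     have "W - {w} \<subseteq> R \<union> W" "(U - {h}) \<inter> (R \<union> W) = {}" using R UW by auto
     hence "(R \<union> W) - (W - {w}) \<union> (U - {h}) \<in> \<A>"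
      using w(2) RW unfolding uv_closed_def by blast
     moreover have "sym_diff ((R \<union> W) - (W - {w}) \<union> (U - {h})) y \<subseteq> {w}" using yeq R by auto
     ultimately show ?thesis using adj yV by blast
    next
     assume hW: "h \<in> W"
     hence "h \<notin> z" using zu by auto
     hence "y = insert h z" using hy yz by simp
     hence yeq: "y = R \<union> U \<union> {h}" using zR by auto
     have "W - {h} \<subseteq> R \<union> W" "U \<inter> (R \<union> W) = {}" using R UW by auto
     hence "(R \<union> W) - (W - {h}) \<union> U \<in> \<A>"
      using F1[OF hW] RW unfolding uv_closed_def by blast
     moreover have "(R \<union> W) - (W - {h}) \<union> U = y" using yeq R hW by auto
     ultimately show ?thesis using AB by auto
    qed
   qed
   thus ?thesis using nn[OF yn] by simp
  qed
 next
  case zn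
  hence zA: "z \<in> \<A>" using z(1) nn[OF zn] unfolding \<C>_def by simp
  have yB: "y \<in> nbd V \<A>" using adj[OF zA yV h] .
  consider (yd) "W \<subseteq> y" "U \<inter> y = {}" | (yu) "U \<subseteq> y" "W \<inter> y = {}"
   | (yn) "\<not> (W \<subseteq> y \<and> U \<inter> y = {})" "\<not> (U \<subseteq> y \<and> W \<inter> y = {})" by blast
  thus ?thesis
  proof cases
   case yd
   hence yR: "y = R' \<union> W" using R'_def by auto
   have yz: "y \<noteq> z" using zn yd by auto
   have hz: "h \<in> U \<or> h \<in> W"
   proof (rule ccontr)
    assume n: "\<not> (h \<in> U \<or> h \<in> W)"
    have "W \<subseteq> z" "U \<inter> z = {}" using hE yd n by auto
    thus False using zn by simp
   qed
   have vU: "R' \<union> U \<subseteq> V" using R' UW by auto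
   have "R' \<union> U \<in> nbd V \<A>"
    using hz
   proof
    assume hU: "h \<in> U"
    hence "h \<notin> y" using yd by auto
    hence "h \<in> z" "y = z - {h}" using hy yz by auto
    hence zeq: "z = R' \<union> W \<union> {h}" using yR by auto
    obtain w where w: "W = {} \<or> w \<in> W" "uv_closed (U - {h}) (W - {w}) \<A>" using F2[OF hU] by blast
    have "W - {w} \<subseteq> z" "(U - {h}) \<inter> z = {}" using zeq R' UW by auto
    hence "z - (W - {w}) \<union> (U - {h}) \<in> \<A>"
     using w(2) zA unfolding uv_closed_def by blast
    moreover have "sym_diff (z - (W - {w}) \<union> (U - {h})) (R' \<union> U) \<subseteq> {w}" using zeq hU R' UW by auto
    ultimately show ?thesis using adj vU by blast
   next
    assume hW: "h \<in> W"
    hence "h \<in> y" using yd by auto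
    hence "h \<notin> z" "y = insert h z" using hy yz by auto
    hence zeq: "z = R' \<union> (W - {h})" using yR R' hW by auto
    have "W - {h} \<subseteq> z" "U \<inter> z = {}" using zeq R' UW by auto
    hence "z - (W - {h}) \<union> U \<in> \<A>"
     using F1[OF hW] zA unfolding uv_closed_def by blast
    moreover have "z - (W - {h}) \<union> U = R' \<union> U" using zeq R' by auto
    ultimately show ?thesis using AB by auto
   qed
   thus ?thesis using dn[OF R'(1,2)] yR yB by simp
  next
   case yu
   hence yR: "y = R' \<union> U" using R'_def by auto
   thus ?thesis using up[OF R'(1,2)] yB by simp
  next
   case yn thus ?thesis using nn[OF yn] yB by simp
  qed
 qed
qed

lemma simplicial_less_Un_iff:
 assumes "finite R" "finite U" "finite W" "R \<inter> U = {}" "R \<inter> W = {}"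
 shows "simplicial_less (R \<union> U) (R \<union> W) \<longleftrightarrow> simplicial_less U W"
proof -
 have "card (R \<union> U) = card R + card U" "card (R \<union> W) = card R + card W"
  using assms by (simp_all add: card_Un_disjoint)
 moreover have sd: "sym_diff (R \<union> U) (R \<union> W) = sym_diff U W" using assms by auto
 moreover have "R \<union> U = R \<union> W \<longleftrightarrow> U = W" using assms by blast
 moreover have "Max (sym_diff U W) \<in> R \<union> W \<longleftrightarrow> Max (sym_diff U W) \<in> W" if "U \<noteq> W"
 proof -
  have "Max (sym_diff U W) \<in> sym_diff U W" using assms that by (intro Max_in) auto
  thus ?thesis using assms by blast
 qed
 ultimately show ?thesis unfolding simplicial_less_def by auto
qed

lemma simplicial_less_Diff_iff:
 assumes "finite x" "finite y"
 shows "simplicial_less x y \<longleftrightarrow> simplicial_less (x - y) (y - x)"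
proof -
 have "x \<inter> y \<union> (x - y) = x" "x \<inter> y \<union> (y - x) = y" by auto
 thus ?thesis
  using simplicial_less_Un_iff[of "x \<inter> y" "x - y" "y - x"] assms by auto
qed

lemma simplicial_less_card: "simplicial_less x y \<Longrightarrow> card y \<le> card x"
 by (auto simp: simplicial_less_def)

text \<open>If \<open>x\<close> precedes \<open>y\<close>, then \<open>y\<close> turns into
  \<open>x\<close> by exchanging \<open>y - x\<close> for \<open>x - y\<close>, and this pair is
  ordered like \<open>x\<close> and \<open>y\<close> because the common part does not affect the
  order.\<close>

lemma uv_closed_imp_initial_segment:
 assumes "\<A> \<subseteq> cube n"
  and "\<And>U W. U \<subseteq> {1..n} \<Longrightarrow> W \<subseteq> {1..n} \<Longrightarrow> U \<inter> W = {} \<Longrightarrow> simplicial_less U W \<Longrightarrow> uv_closed U W \<A>"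
 shows "is_initial_segment n \<A>"
 unfolding is_initial_segment_def
proof (intro conjI ballI impI assms(1))
 fix y x assume y: "y \<in> \<A>" and x: "x \<in> cube n" and less: "simplicial_less x y"
 have fin: "finite x" "finite y" using x y assms(1) finite_in_cube by auto
 have "uv_closed (x - y) (y - x) \<A>"
  using x y assms(1) less by (intro assms(2)) (auto simp: cube_def simplicial_less_Diff_iff[OF fin])
 hence "y - (y - x) \<union> (x - y) \<in> \<A>" using y unfolding uv_closed_def by blast
 moreover have "y - (y - x) \<union> (x - y) = x" by auto
 ultimately show "x \<in> \<A>" by simp
qed

text \<open>Among the ordered pairs under which the family is not closed, one of least total size is
  compressed. This keeps the cardinality, does not enlarge the neighbourhood and moves members
  strictly down in the simplicial order, so the sum of ranks drops; a family without such a pair is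
  an initial segment.\<close>

theorem Harper:
 assumes "\<A> \<subseteq> cube n"
 shows "card (nbd {1..n} (initial_segment n (card \<A>))) \<le> card (nbd {1..n} \<A>)"
 using assms
proof (induction "\<Sum>x\<in>\<A>. card {y \<in> cube n. simplicial_less y x}" arbitrary: \<A> rule: less_induct)
 case less
 define rank where "rank x = card {y \<in> cube n. simplicial_less y x}" for x
 define bad where "bad k \<longleftrightarrow> (\<exists>U W. U \<subseteq> {1..n} \<and> W \<subseteq> {1..n} \<and> U \<inter> W = {} \<and> simplicial_less U W \<and>
   \<not> uv_closed U W \<A> \<and> card U + card W = k)" for k
 have AP: "\<A> \<subseteq> Pow {1..n}" using less.prems by (simp add: cube_def)
 have finA: "finite \<A>" using less.prems finite_cube finite_subset by blast
 show ?case
 proof (cases "\<exists>k. bad k")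
  case False
  hence seg: "is_initial_segment n \<A>"
   unfolding bad_def by (intro uv_closed_imp_initial_segment[OF less.prems]) blast
  have "card \<A> \<le> 2 ^ n"
   using card_mono[OF finite_cube less.prems] by (simp add: cube_def card_Pow)
  hence "initial_segment n (card \<A>) = \<A>"
   unfolding initial_segment_def using seg by (intro the1_equality initial_segment_unique) simp_all
  thus ?thesis by simp
 next
  case True
  define k where "k = (LEAST k. bad k)"
  have "bad k" using True unfolding k_def by (auto intro: LeastI)
  then obtain U W where UW: "U \<subseteq> {1..n}" "W \<subseteq> {1..n}" "U \<inter> W = {}" "simplicial_less U W"
   "\<not> uv_closed U W \<A>" "card U + card W = k" unfolding bad_def by blast
  have fin: "finite U" "finite W" using UW by (auto intro: finite_subset)
  \<comment> \<open>Minimality gives closedness under every smaller ordered pair inside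
    \<open>U\<close>, \<open>W\<close>, as \<open>nbd_uv_compress\<close> demands.\<close>
  have min: "uv_closed U' W' \<A>" if "U' \<subseteq> U" "W' \<subseteq> W" "simplicial_less U' W'" "card U' + card W' < k" for U' W'
  proof (rule ccontr)
   assume nc: "\<not> ?thesis"
   have "U' \<subseteq> {1..n}" "W' \<subseteq> {1..n}" "U' \<inter> W' = {}" using that(1,2) UW(1-3) by auto
   hence "bad (card U' + card W')" using that(3) nc unfolding bad_def by blast
   thus False using that(4) not_less_Least unfolding k_def by blast
  qed
  have Une: "U \<noteq> {}" using UW(3,4) fin by (auto simp: simplicial_less_def)
  have cards: "card W \<le> card U" using UW(4) by (rule simplicial_less_card)
  have triv: "uv_closed {} {} \<A>" by (simp add: uv_closed_def)
  have F1: "uv_closed U (W - {w}) \<A>" if "w \<in> W" for w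
  proof (rule min)
   have c: "card (W - {w}) < card W" using that fin by (meson card_Diff1_less)
   thus "simplicial_less U (W - {w})" using cards by (simp add: simplicial_less_def)
   show "card U + card (W - {w}) < k" using c UW(6) by simp
  qed auto
  have F2: "\<exists>w. (W = {} \<or> w \<in> W) \<and> uv_closed (U - {u}) (W - {w}) \<A>" if u: "u \<in> U" for u
  proof -
   have "card U > 0" using u fin by (auto simp: card_gt_0_iff)
   hence cu: "card (U - {u}) = card U - 1" "card (U - {u}) < card U" "card U > 0"
    using u fin by auto
   show ?thesis
   proof (cases "W = {}")
    case True
    thus ?thesis
    proof (cases "U = {u}")
     case F: False
     hence "U - {u} \<noteq> {}" using u by auto
     hence "simplicial_less (U - {u}) {}" using fin by (simp add: simplicial_less_def card_gt_0_iff)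
     hence "uv_closed (U - {u}) (W - {u}) \<A>" using True cu UW(6) by (intro min) auto
     thus ?thesis using True by blast
    qed (use triv in auto)
   next
    case False
    \<comment> \<open>When the sizes agree, the order is decided by the largest element, which lies
      in \<open>W\<close>; deleting the least element of \<open>W\<close> keeps it there as long as
      \<open>W\<close> has at least two elements.\<close>
    define w where "w = Min W"
    have w: "w \<in> W" using False fin by (simp add: w_def)
    have cw: "card (W - {w}) = card W - 1" "card W > 0" using w fin by (auto simp: card_gt_0_iff)
    have lt: "card (U - {u}) + card (W - {w}) < k" using cu cw UW(6) by simp
    show ?thesis
    proof (cases "card W = card U")
     case F: False
     hence "card (W - {w}) < card (U - {u})"
      unfolding cu(1) cw(1) using cards cw(2) by linarith
     hence "simplicial_less (U - {u}) (W - {w})" by (simp add: simplicial_less_def)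
     hence "uv_closed (U - {u}) (W - {w}) \<A>" using lt by (intro min) auto
     thus ?thesis using w by blast
    next
     case eq: True
     show ?thesis
     proof (cases "card W = 1")
      case True
      hence "U - {u} = {}" "W - {w} = {}" using eq u w
       by (metis card_1_singletonE Diff_eq_empty_iff order_refl singletonD)+
      thus ?thesis using triv w by metis
     next
      case F: False
      have sd: "sym_diff U W = U \<union> W" using UW(3) by auto
      have M: "Max (U \<union> W) \<in> W" using UW(4) eq unfolding simplicial_less_def sd by auto
      have "Max (U \<union> W) \<noteq> w"
      proof
       assume "Max (U \<union> W) = w"
       have "W \<subseteq> {w}"
       proof
        fix v assume v: "v \<in> W"
        have "w \<le> v" using v fin by (simp add: w_def)
        moreover have "v \<le> Max (U \<union> W)" using v fin by (intro Max_ge) auto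
        ultimately show "v \<in> {w}" using \<open>Max (U \<union> W) = w\<close> by simp
       qed
       thus False using F w by (auto simp: subset_singleton_iff)
      qed
      hence Mw: "Max (U \<union> W) \<in> W - {w}" using M by simp
      have sd': "sym_diff (U - {u}) (W - {w}) = (U - {u}) \<union> (W - {w})" using UW(3) by auto
      have "Max ((U - {u}) \<union> (W - {w})) = Max (U \<union> W)"
       using fin Mw by (intro Max_eqI) auto
      moreover have "U - {u} \<noteq> W - {w}" using Mw UW(3) by blast
      moreover have "card (U - {u}) = card (W - {w})" unfolding cu(1) cw(1) eq ..
      ultimately have "simplicial_less (U - {u}) (W - {w})"
       using Mw unfolding simplicial_less_def sd' by simp
      hence "uv_closed (U - {u}) (W - {w}) \<A>" using lt by (intro min) auto
      thus ?thesis using w by blast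
     qed
    qed
   qed
  qed
  define \<C> where "\<C> = uv_compress U W \<A>"
  define f where "f x = (if uv_shift U W x \<in> \<A> then x else uv_shift U W x)" for x
  have Cf: "\<C> = f ` \<A>" by (simp add: \<C>_def uv_compress_def f_def)
  have injf: "inj_on f \<A>" using inj_on_uv_compress[OF UW(3)] unfolding f_def .
  have CV: "\<C> \<subseteq> cube n" using uv_compress_subset_Pow[OF AP UW(1)] by (simp add: \<C>_def cube_def)
  have cC: "card \<C> = card \<A>" unfolding \<C>_def by (rule card_uv_compress[OF UW(3)])
  have "nbd {1..n} \<C> \<subseteq> uv_compress U W (nbd {1..n} \<A>)"
   unfolding \<C>_def by (rule nbd_uv_compress[OF finite_atLeastAtMost AP UW(1-3) Une F1 F2])
  hence "card (nbd {1..n} \<C>) \<le> card (uv_compress U W (nbd {1..n} \<A>))"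
   by (intro card_mono) (simp_all add: uv_compress_def)
  hence nle: "card (nbd {1..n} \<C>) \<le> card (nbd {1..n} \<A>)" by (simp add: card_uv_compress[OF UW(3)])
  have rank_less: "rank (x - W \<union> U) < rank x" if "x \<subseteq> {1..n}" "W \<subseteq> x" "U \<inter> x = {}" for x
  proof -
   have fx: "finite x" using that by (auto intro: finite_subset)
   have "simplicial_less (x - W \<union> U) ((x - W) \<union> W)"
    using fx fin UW(4) that by (subst simplicial_less_Un_iff) auto
   moreover have "(x - W) \<union> W = x" using that by auto
   ultimately have l: "simplicial_less (x - W \<union> U) x" by simp
   have c: "x - W \<union> U \<in> cube n" using that UW by (auto simp: cube_def)
   have "{y \<in> cube n. simplicial_less y (x - W \<union> U)} \<subset> {y \<in> cube n. simplicial_less y x}"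
   proof
    show "{y \<in> cube n. simplicial_less y (x - W \<union> U)} \<subseteq> {y \<in> cube n. simplicial_less y x}"
     using l fx fin by (auto intro: simplicial_less_trans[OF finite_in_cube, of _ n "x - W \<union> U" x])
    show "{y \<in> cube n. simplicial_less y (x - W \<union> U)} \<noteq> {y \<in> cube n. simplicial_less y x}"
    proof
     assume e: "{y \<in> cube n. simplicial_less y (x - W \<union> U)} = {y \<in> cube n. simplicial_less y x}"
     have "x - W \<union> U \<in> {y \<in> cube n. simplicial_less y x}" using l c by simp
     hence "x - W \<union> U \<in> {y \<in> cube n. simplicial_less y (x - W \<union> U)}" unfolding e .
     thus False by (simp add: simplicial_less_irrefl)
    qed
   qed
   thus ?thesis unfolding rank_def by (intro psubset_card_mono) (auto simp: finite_cube)
  qed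
  obtain x0 where x0: "x0 \<in> \<A>" "W \<subseteq> x0" "U \<inter> x0 = {}" "x0 - W \<union> U \<notin> \<A>"
   using UW(5) unfolding uv_closed_def by blast
  have "(\<Sum>x\<in>\<C>. rank x) = (\<Sum>x\<in>\<A>. rank (f x))" unfolding Cf using injf by (simp add: sum.reindex)
  also have "\<dots> < (\<Sum>x\<in>\<A>. rank x)"
  proof (rule sum_strict_mono_ex1[OF finA])
   show "\<forall>x\<in>\<A>. rank (f x) \<le> rank x"
    using rank_less AP unfolding f_def uv_shift_def by (auto simp: less_imp_le)
   have "rank (f x0) < rank x0" using rank_less[of x0] x0 AP unfolding f_def uv_shift_def by auto
   thus "\<exists>x\<in>\<A>. rank (f x) < rank x" using x0 by blast
  qed
  finally have "card (nbd {1..n} (initial_segment n (card \<C>))) \<le> card (nbd {1..n} \<C>)"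
   using less.hyps[OF _ CV] unfolding rank_def by simp
  thus ?thesis using nle cC by simp
 qed
qed

section \<open>Real binomial coefficients\<close>

lemma gb_prod: "x gchoose k = (\<Prod>i<k. x - real i) / fact k" for x :: real
 by (simp add: gbinomial_prod_rev atLeast0LessThan)

lemma gb_nonneg: "real k - 1 \<le> x \<Longrightarrow> 0 \<le> x gchoose k" for x :: real
 unfolding gb_prod by (intro divide_nonneg_nonneg prod_nonneg) auto

lemma gb_pos: "real k - 1 < x \<Longrightarrow> 0 < x gchoose k" for x :: real
 unfolding gb_prod by (intro divide_pos_pos prod_pos) auto

lemma gb_mono: "real k - 1 \<le> x \<Longrightarrow> x \<le> y \<Longrightarrow> x gchoose k \<le> y gchoose k" for x :: real
 unfolding gb_prod by (intro divide_right_mono prod_mono) auto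

lemma gb_strict_mono:
 fixes x y :: real
 assumes "real k - 1 \<le> x" "x < y" "1 \<le> k"
 shows "x gchoose k < y gchoose k"
proof -
 obtain j where k: "k = Suc j" using assms(3) by (cases k) auto
 have "(\<Prod>i<j. x - real i) \<le> (\<Prod>i<j. y - real i)"
  using assms k by (intro prod_mono) auto
 hence "(\<Prod>i<j. x - real i) * (x - real j) \<le> (\<Prod>i<j. y - real i) * (x - real j)"
  using assms k by (intro mult_right_mono) auto
 also have "\<dots> < (\<Prod>i<j. y - real i) * (y - real j)"
  using assms k by (intro mult_strict_left_mono prod_pos) auto
 finally show ?thesis unfolding gb_prod k prod.lessThan_Suc by (intro divide_strict_right_mono) simp_all
qed

lemma gb_less_cancel:
 fixes x y :: real
 assumes "real k - 1 \<le> x" "real k - 1 \<le> y" "x gchoose k < y gchoose k"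
 shows "x < y"
 using gb_mono[of k y x] assms by (meson not_le)

lemma gb_le_cancel:
 fixes x y :: real
 assumes "real k - 1 \<le> x" "real k - 1 \<le> y" "x gchoose k \<le> y gchoose k" "1 \<le> k"
 shows "x \<le> y"
 using gb_strict_mono[of k y x] assms by (meson not_le)

lemma gb_step: "(x - real k) * (x gchoose k) = real (Suc k) * (x gchoose Suc k)" for x :: real
 unfolding gb_prod prod.lessThan_Suc fact_Suc by (simp del: of_nat_Suc)

lemma gb_step': "1 \<le> k \<Longrightarrow> (x - real k + 1) * (x gchoose (k - 1)) = real k * (x gchoose k)" for x :: real
proof -
 assume k: "1 \<le> k"
 hence "x - real (k - 1) = x - real k + 1" by (simp add: of_nat_diff)
 from gb_step[of x "k - 1", unfolded this] show ?thesis using k by simp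
qed

lemma gb_pascal: "1 \<le> k \<Longrightarrow> x gchoose k = ((x - 1) gchoose (k - 1)) + ((x - 1) gchoose k)" for x :: real
 using gbinomial_reduce_nat[of k x] by simp

lemma gb_nat: "real n gchoose k = real (n choose k)"
 by (simp add: binomial_gbinomial)

text \<open>A linear lower bound, which provides the upper end point for the intermediate value
  theorem in \<open>gb_ex\<close>.\<close>

lemma gb_lower: "real k \<le> x \<Longrightarrow> 1 \<le> k \<Longrightarrow> x - real k + 1 \<le> x gchoose k" for x :: real
proof (induction k arbitrary: x)
 case (Suc k)
 show ?case
 proof (cases "k = 0")
  case True thus ?thesis by simp
 next
  case False
  have "(x - real k) * 1 \<le> (x / real (Suc k)) * ((x - 1) gchoose k)"
  proof -
   have "x - real k \<le> (x - 1) gchoose k" using Suc.IH[of "x - 1"] Suc.prems False by simp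
   moreover have "1 \<le> x / real (Suc k)" using Suc.prems by simp
   moreover have "0 \<le> x - real k" using Suc.prems by simp
   ultimately show ?thesis by (metis mult.commute mult_mono zero_le_one order_trans)
  qed
  also have "\<dots> = x gchoose Suc k" using gbinomial_absorption'[of "Suc k" x] by simp
  finally show ?thesis by simp
 qed
qed simp

lemma gb_continuous: "continuous_on A (\<lambda>x::real. x gchoose k)"
 unfolding gb_prod by (intro continuous_intros) auto

lemma gb_ex:
 fixes g :: real
 assumes "1 \<le> k" "0 \<le> g"
 obtains y where "real k - 1 \<le> y" "y gchoose k = g"
proof -
 define b where "b = real k + g"
 have "real k - 1 \<le> b" using assms by (simp add: b_def)
 moreover have "(real k - 1) gchoose k \<le> g"
 proof -
  have "(real k - 1) gchoose k = real (k - 1) gchoose k" using assms by (simp add: of_nat_diff)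
  also have "\<dots> = 0" using assms unfolding gb_nat by simp
  finally show ?thesis using assms by simp
 qed
 moreover have "g \<le> b gchoose k" using gb_lower[of k b] assms by (simp add: b_def)
 ultimately have "\<exists>y\<ge>real k - 1. y \<le> b \<and> y gchoose k = g"
  by (intro IVT') (auto intro: gb_continuous)
 thus ?thesis using that by blast
qed

text \<open>The Weierstrass product inequality. It gives first-order lower bounds for ratios such as
  C(y,r)/C(N,r).\<close>

lemma prod_ge_one_minus_sum:
 fixes a :: "'b \<Rightarrow> real"
 assumes "finite I" "\<And>i. i \<in> I \<Longrightarrow> 0 \<le> a i \<and> a i \<le> 1"
 shows "1 - (\<Sum>i\<in>I. a i) \<le> (\<Prod>i\<in>I. 1 - a i)"
 using assms
proof (induction I)
 case (insert j I)
 have p: "0 \<le> (\<Prod>i\<in>I. 1 - a i)" "(\<Prod>i\<in>I. 1 - a i) \<le> 1"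
  using insert by (auto intro!: prod_nonneg prod_le_1)
 have "a j * (\<Prod>i\<in>I. 1 - a i) \<le> a j" using p insert by (intro mult_left_le) auto
 thus ?case using insert by (simp add: algebra_simps)
qed simp

section \<open>Lovasz's form of the Kruskal-Katona theorem\<close>

definition shadow :: "nat set set \<Rightarrow> nat set set"
 where "shadow \<F> = {y. \<exists>x\<in>\<F>. \<exists>a\<in>x. y = x - {a}}"

definition uniform :: "nat \<Rightarrow> nat set set \<Rightarrow> bool"
 where "uniform r \<F> \<longleftrightarrow> finite \<F> \<and> (\<forall>x\<in>\<F>. finite x \<and> card x = r)"

lemma finite_shadow: "uniform r \<F> \<Longrightarrow> finite (shadow \<F>)"
proof -
 assume u: "uniform r \<F>"
 have "shadow \<F> \<subseteq> (\<Union>x\<in>\<F>. (\<lambda>a. x - {a}) ` x)" by (auto simp: shadow_def)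
 moreover have "finite (\<Union>x\<in>\<F>. (\<lambda>a. x - {a}) ` x)" using u by (auto simp: uniform_def)
 ultimately show ?thesis by (rule finite_subset)
qed

lemma uniform_shadow: "uniform (Suc r) \<F> \<Longrightarrow> uniform r (shadow \<F>)"
 using finite_shadow[of "Suc r" \<F>] by (auto simp: uniform_def shadow_def)

lemma finite_upsec: "finite \<A> \<Longrightarrow> finite (upsec v \<A>)"
proof -
 assume "finite \<A>"
 moreover have "upsec v \<A> \<subseteq> (\<lambda>x. x - {v}) ` \<A>"
 proof
  fix x assume "x \<in> upsec v \<A>"
  hence "x = insert v x - {v}" "insert v x \<in> \<A>" by (auto simp: upsec_def)
  thus "x \<in> (\<lambda>x. x - {v}) ` \<A>" by (rule image_eqI)
 qed
 ultimately show ?thesis by (meson finite_imageI finite_subset)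
qed

lemma uniform_upsec:
 assumes "uniform (Suc r) \<F>" shows "uniform r (upsec v \<F>)"
 unfolding uniform_def
proof (intro conjI ballI)
 show "finite (upsec v \<F>)" using assms by (intro finite_upsec) (simp add: uniform_def)
 fix x assume "x \<in> upsec v \<F>"
 hence "insert v x \<in> \<F>" "v \<notin> x" by (auto simp: upsec_def)
 hence "finite (insert v x)" "card (insert v x) = Suc r" "v \<notin> x" using assms by (auto simp: uniform_def)
 thus "finite x" "card x = r" by auto
qed

lemma shadow_upsec_subset: "shadow (upsec v \<F>) \<subseteq> upsec v (shadow \<F>)"
proof
 fix y assume "y \<in> shadow (upsec v \<F>)"
 then obtain x a where "v \<notin> x" "insert v x \<in> \<F>" "a \<in> x" "y = x - {a}"
  unfolding shadow_def upsec_def by blast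
 moreover from this have "insert v y = insert v x - {a}" by auto
 ultimately show "y \<in> upsec v (shadow \<F>)" unfolding shadow_def upsec_def by blast
qed

lemma upsec_subset_dnsec_shadow: "upsec v \<F> \<subseteq> dnsec v (shadow \<F>)"
proof
 fix x assume x: "x \<in> upsec v \<F>"
 hence "x = insert v x - {v}" "insert v x \<in> \<F>" "v \<notin> x" by (auto simp: upsec_def)
 thus "x \<in> dnsec v (shadow \<F>)" unfolding shadow_def dnsec_def by blast
qed

lemma sum_card_upsec:
 assumes "uniform r \<F>" "finite X" "\<Union>\<F> \<subseteq> X"
 shows "(\<Sum>v\<in>X. card (upsec v \<F>)) = r * card \<F>"
proof -
 have "card (upsec v \<F>) = card {x\<in>\<F>. v \<in> x}" for v
 proof -
  have "bij_betw (insert v) (upsec v \<F>) {x \<in> \<F>. v \<in> x}"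
   by (rule bij_betwI[where g = "\<lambda>x. x - {v}"]) (auto simp: upsec_def insert_absorb)
  thus ?thesis by (rule bij_betw_same_card)
 qed
 moreover have "(\<Sum>v\<in>X. card {x\<in>\<F>. v \<in> x}) = (\<Sum>x\<in>\<F>. r)"
 proof (rule sum_multicount_gen)
  show "\<forall>x\<in>\<F>. card {v \<in> X. v \<in> x} = r"
  proof
   fix x assume x: "x \<in> \<F>"
   hence "{v \<in> X. v \<in> x} = x" using assms(3) by auto
   thus "card {v \<in> X. v \<in> x} = r" using x assms(1) by (simp add: uniform_def)
  qed
 qed (use assms in \<open>auto simp: uniform_def\<close>)
 ultimately show ?thesis by simp
qed

text \<open>Write the size of an r-uniform family as C(z,r) with real z. If some vertex has a link
  of at least C(z-1,r-1) sets, then the link itself and its shadow account for disjoint parts of the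
  shadow, and Pascal's rule finishes. If every link is smaller, induction gives each link a shadow
  larger than proportional, and summing over all vertices by double counting finishes.\<close>

theorem Lovasz_Kruskal_Katona:
 fixes y :: real
 assumes "uniform r \<F>" "1 \<le> r" "real r \<le> y" "y gchoose r \<le> real (card \<F>)"
 shows "y gchoose (r - 1) \<le> real (card (shadow \<F>))"
 using assms
proof (induction r arbitrary: \<F> y)
 case (Suc r)
 show ?case
 proof (cases "r = 0")
  case True
  have "0 < real (card \<F>)" using Suc.prems True by auto
  hence "\<F> \<noteq> {}" by auto
  then obtain x where x: "x \<in> \<F>" by blast
  then obtain a where "x = {a}" using Suc.prems(1) True by (auto simp: uniform_def card_1_singleton_iff)
  hence "{} \<in> shadow \<F>" using x by (auto simp: shadow_def)
  hence "card (shadow \<F>) \<noteq> 0" using finite_shadow[OF Suc.prems(1)] by auto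
  thus ?thesis using True by simp
 next
  case False
  hence r1: "1 \<le> r" by simp
  obtain z where z: "real (Suc r) - 1 \<le> z" "z gchoose Suc r = real (card \<F>)"
   by (rule gb_ex[of "Suc r" "real (card \<F>)"]) simp_all
  have yz: "y \<le> z"
  proof (rule gb_le_cancel[of "Suc r"])
   show "real (Suc r) - 1 \<le> y" using Suc.prems(3) by linarith
   show "y gchoose Suc r \<le> z gchoose Suc r" unfolding z(2) by (rule Suc.prems(4))
  qed (use z in auto)
  have zr: "real (Suc r) \<le> z" using yz Suc.prems by simp
  have fsh: "finite (shadow \<F>)" using finite_shadow[OF Suc.prems(1)] .
  have IH: "w gchoose (r - 1) \<le> real (card (shadow (upsec v \<F>)))"
   if "real r \<le> w" "w gchoose r \<le> real (card (upsec v \<F>))" for w v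
   using Suc.IH[OF uniform_upsec[OF Suc.prems(1)] r1 that] .
  have fin_up: "finite (upsec v (shadow \<F>))" for v by (rule finite_upsec[OF fsh])
  have "z gchoose r \<le> real (card (shadow \<F>))"
  proof (cases "\<exists>v. (z - 1) gchoose r \<le> real (card (upsec v \<F>))")
   case True
   then obtain v where v: "(z - 1) gchoose r \<le> real (card (upsec v \<F>))" by blast
   have 1: "(z - 1) gchoose (r - 1) \<le> real (card (shadow (upsec v \<F>)))"
    using zr by (intro IH v) simp
   have "card (shadow (upsec v \<F>)) \<le> card (upsec v (shadow \<F>))"
    by (intro card_mono fin_up shadow_upsec_subset)
   moreover have "card (upsec v \<F>) \<le> card (dnsec v (shadow \<F>))"
    using fsh by (intro card_mono upsec_subset_dnsec_shadow) (auto simp: dnsec_def)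
   moreover have "z gchoose r = ((z - 1) gchoose (r - 1)) + ((z - 1) gchoose r)"
    using gb_pascal[OF r1] .
   ultimately show ?thesis using 1 v card_sections[OF fsh, of v] by simp
  next
   case no: False
   define X where "X = \<Union>\<F>"
   have X: "finite X" "\<Union>\<F> \<subseteq> X" "\<Union>(shadow \<F>) \<subseteq> X"
    using Suc.prems(1) by (auto simp: X_def uniform_def shadow_def)
   \<comment> \<open>A link of real index \<open>w < z - 1\<close> has shadow at least
     \<open>r / (w - r + 1)\<close> times its size, and this ratio only grows as \<open>w\<close>
     decreases; it is weakened to the uniform denominator \<open>z - r\<close>.\<close>
   have v: "real r * real (card (upsec v \<F>)) \<le> (z - real r) * real (card (upsec v (shadow \<F>)))" for v
   proof (cases "card (upsec v \<F>) = 0")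
    case True thus ?thesis using zr by simp
   next
    case F: False
    obtain w where w: "real r - 1 \<le> w" "w gchoose r = real (card (upsec v \<F>))"
     by (rule gb_ex[OF r1, of "real (card (upsec v \<F>))"]) simp_all
    have "1 \<le> real (card (upsec v \<F>))" using F by linarith
    hence "real r gchoose r \<le> w gchoose r" unfolding w(2) gb_nat by simp
    hence wr: "real r \<le> w" using gb_le_cancel[OF _ w(1) _ r1, of "real r"] by simp
    have "w gchoose r < (z - 1) gchoose r" using no w(2) by (metis not_le)
    hence wz: "w < z - 1" by (rule gb_less_cancel[OF w(1), rotated]) (use zr in simp)
    have "real r * real (card (upsec v \<F>)) = (w - real r + 1) * (w gchoose (r - 1))"
     using gb_step'[OF r1, of w] w(2) by simp
    also have "\<dots> \<le> (z - real r) * (w gchoose (r - 1))"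
    proof (intro mult_right_mono gb_nonneg)
     show "real (r - 1) - 1 \<le> w" using w(1) by linarith
    qed (use wz in simp)
    also have "\<dots> \<le> (z - real r) * real (card (shadow (upsec v \<F>)))"
     using zr by (intro mult_left_mono IH[OF wr]) (simp_all add: w(2))
    also have "\<dots> \<le> (z - real r) * real (card (upsec v (shadow \<F>)))"
     using zr by (intro mult_left_mono of_nat_mono card_mono fin_up shadow_upsec_subset) auto
    finally show ?thesis .
   qed
   have s1: "(\<Sum>v\<in>X. real (card (upsec v \<F>))) = real (Suc r) * real (card \<F>)"
    unfolding of_nat_sum[symmetric] sum_card_upsec[OF Suc.prems(1) X(1,2)] by (rule of_nat_mult)
   have s2: "(\<Sum>v\<in>X. real (card (upsec v (shadow \<F>)))) = real r * real (card (shadow \<F>))"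
    unfolding of_nat_sum[symmetric] sum_card_upsec[OF uniform_shadow[OF Suc.prems(1)] X(1,3)] by (rule of_nat_mult)
   have "(\<Sum>v\<in>X. real r * real (card (upsec v \<F>))) \<le>
     (\<Sum>v\<in>X. (z - real r) * real (card (upsec v (shadow \<F>))))"
    using v by (intro sum_mono)
   hence "real r * (real (Suc r) * real (card \<F>)) \<le> (z - real r) * (real r * real (card (shadow \<F>)))"
    unfolding sum_distrib_left[symmetric] s1 s2 .
   hence "real r * (real (Suc r) * real (card \<F>)) \<le> real r * ((z - real r) * real (card (shadow \<F>)))"
    by (simp only: mult.left_commute)
   hence "real (Suc r) * real (card \<F>) \<le> (z - real r) * real (card (shadow \<F>))"
    using r1 by simp
   moreover have "real (Suc r) * real (card \<F>) = (z - real r) * (z gchoose r)"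
    using gb_step[of z r] z by simp
   ultimately show ?thesis using zr by simp
  qed
  moreover have "y gchoose r \<le> z gchoose r"
   by (rule gb_mono[OF _ yz]) (use Suc.prems(3) in simp)
  ultimately show ?thesis by simp
 qed
qed simp

section \<open>Lower bounds for the neighbourhood\<close>

lemma binom_ge_rec: "binom_ge n k = (n choose k) + binom_ge n (Suc k)"
proof (cases "k \<le> n")
 case True thus ?thesis by (simp add: binom_ge_def sum.atLeast_Suc_atMost)
next
 case False thus ?thesis by (simp add: binom_ge_def)
qed

lemma binom_ge_pascal: "binom_ge (Suc n) (Suc k) = binom_ge n (Suc k) + binom_ge n k"
proof -
 have "binom_ge (Suc n) (Suc k) = (\<Sum>i=k..n. (Suc n choose Suc i))"
  unfolding binom_ge_def by (rule sum.shift_bounds_cl_Suc_ivl)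
 also have "\<dots> = binom_ge n k + (\<Sum>i=k..n. n choose Suc i)" by (simp add: binom_ge_def sum.distrib)
 also have "(\<Sum>i=k..n. n choose Suc i) = (\<Sum>i=Suc k..Suc n. n choose i)"
  by (rule sum.shift_bounds_cl_Suc_ivl[symmetric])
 also have "\<dots> = binom_ge n (Suc k)"
  by (cases "k \<le> n") (simp_all add: binom_ge_def sum.cl_ivl_Suc)
 finally show ?thesis by simp
qed

lemma card_subsets_ge:
 assumes "finite V"
 shows "card {x. x \<subseteq> V \<and> k \<le> card x} = binom_ge (card V) k"
proof -
 have "{x. x \<subseteq> V \<and> k \<le> card x} = (\<Union>i\<in>{k..card V}. {x. x \<subseteq> V \<and> card x = i})"
  using assms by (auto intro: card_mono)
 also have "card \<dots> = (\<Sum>i\<in>{k..card V}. card {x. x \<subseteq> V \<and> card x = i})"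
  using assms by (intro card_UN_disjoint) auto
 also have "\<dots> = binom_ge (card V) k" using assms by (simp add: n_subsets binom_ge_def)
 finally show ?thesis .
qed

text \<open>The first standard Hamming ball. For \<open>S = {1..j}\<close> it is an initial segment
  of the simplicial order, and these segments cut the layer \<open>k\<close> of the order into
  blocks indexed by \<open>j\<close>.\<close>

definition T1 :: "nat set \<Rightarrow> nat \<Rightarrow> nat set \<Rightarrow> nat set set"
 where "T1 V k S = {x. x \<subseteq> V \<and> (Suc k \<le> card x \<or> card x = k \<and> x \<subseteq> S)}"

lemma T1_subset: "T1 V k S \<subseteq> Pow V"
 by (auto simp: T1_def)

lemma card_T1:
 assumes "finite V" "S \<subseteq> V"
 shows "card (T1 V k S) = binom_ge (card V) (Suc k) + (card S choose k)"
proof -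
 have "T1 V k S = {x. x \<subseteq> V \<and> Suc k \<le> card x} \<union> {x. x \<subseteq> S \<and> card x = k}"
  using assms by (auto simp: T1_def)
 moreover have "card \<dots> = card {x. x \<subseteq> V \<and> Suc k \<le> card x} + card {x. x \<subseteq> S \<and> card x = k}"
  using assms finite_subset[OF assms(2,1)] by (intro card_Un_disjoint) auto
 ultimately show ?thesis
  using assms finite_subset[OF assms(2,1)] by (simp add: card_subsets_ge n_subsets)
qed

lemma T1_initial: "is_initial_segment n (T1 {1..n} k {1..j})"
 unfolding is_initial_segment_def
proof (intro conjI ballI impI)
 show "T1 {1..n} k {1..j} \<subseteq> cube n" by (auto simp: T1_def cube_def)
 fix B A assume B: "B \<in> T1 {1..n} k {1..j}" and A: "A \<in> cube n" and less: "simplicial_less A B"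
 have fin: "finite A" "finite B" using A B by (auto simp: T1_def cube_def intro: finite_subset)
 show "A \<in> T1 {1..n} k {1..j}"
 proof (cases "Suc k \<le> card A")
  case True thus ?thesis using A by (simp add: T1_def cube_def)
 next
  case False
  hence c: "card A = k" "card B = k" and Bj: "B \<subseteq> {1..j}"
   using less B by (auto simp: simplicial_less_def T1_def)
  hence M: "Max (sym_diff A B) \<in> B" using less by (auto simp: simplicial_less_def)
  have "x \<in> {1..j}" if x: "x \<in> A" for x
  proof (cases "x \<in> B")
   case True thus ?thesis using Bj by auto
  next
   case F: False
   hence "x \<le> Max (sym_diff A B)" using x fin by (intro Max_ge) auto
   moreover have "Max (sym_diff A B) \<le> j" using M Bj by auto
   moreover have "1 \<le> x" using x A by (auto simp: cube_def)
   ultimately show ?thesis by simp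
  qed
  thus ?thesis using c A by (auto simp: T1_def cube_def)
 qed
qed

lemma initial_segment_props:
 assumes "m \<le> 2 ^ n"
 shows "is_initial_segment n (initial_segment n m)" "card (initial_segment n m) = m"
 using theI'[OF initial_segment_unique[OF assms]] unfolding initial_segment_def by auto

lemma initial_segment_eqI:
 assumes "is_initial_segment n \<I>" shows "initial_segment n (card \<I>) = \<I>"
proof -
 have "card \<I> \<le> 2 ^ n"
  using card_mono[OF finite_cube, of \<I> n] assms by (simp add: is_initial_segment_def cube_def card_Pow)
 thus ?thesis
  unfolding initial_segment_def using assms by (intro the1_equality initial_segment_unique) simp_all
qed

lemma initial_segments_mono:
 assumes "is_initial_segment n \<I>" "is_initial_segment n \<J>" "card \<I> \<le> card \<J>"
 shows "\<I> \<subseteq> \<J>"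
proof -
 have fin: "finite \<I>" "finite \<J>"
  using assms finite_cube[of n] by (auto simp: is_initial_segment_def intro: finite_subset)
 from initial_segments_nested[OF assms(1,2)] show ?thesis
 proof
  assume "\<J> \<subseteq> \<I>"
  hence "\<J> = \<I>" using fin assms(3) by (intro card_seteq) auto
  thus ?thesis by simp
 qed
qed

lemma upper_subset_nbd:
 assumes "finite V" "\<A> \<subseteq> Pow V" "{x. x \<subseteq> V \<and> Suc k \<le> card x} \<subseteq> \<A>" "k < card V"
 shows "{x. x \<subseteq> V \<and> k \<le> card x} \<subseteq> nbd V \<A>"
proof
 fix x assume "x \<in> {x. x \<subseteq> V \<and> k \<le> card x}"
 hence x: "x \<subseteq> V" "k \<le> card x" by auto
 show "x \<in> nbd V \<A>"
 proof (cases "Suc k \<le> card x")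
  case True thus ?thesis using x assms(3) nbd_superset[OF assms(2)] by auto
 next
  case False
  hence c: "card x = k" using x by simp
  hence "x \<noteq> V" using assms(4) by auto
  then obtain a where a: "a \<in> V" "a \<notin> x" using x by auto
  have "insert a x \<in> \<A>" using a x c assms(1,3) finite_subset[OF x(1) assms(1)] by auto
  thus ?thesis by (rule nbdI_insert[OF assms(1,2)])
 qed
qed

lemma shadow_subset_nbd:
 assumes "finite V" "\<A> \<subseteq> Pow V" "\<F> \<subseteq> \<A>"
 shows "shadow \<F> \<subseteq> nbd V \<A>"
proof
 fix y assume "y \<in> shadow \<F>"
 then obtain x a where x: "x \<in> \<F>" "a \<in> x" "y = x - {a}" by (auto simp: shadow_def)
 hence "insert a y = x" by auto
 hence "insert a y \<in> \<A>" using x(1) assms(3) by auto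
 thus "y \<in> nbd V \<A>" by (rule nbdI_insert[OF assms(1,2)])
qed

text \<open>The segment consists of all sets of size at least \<open>k\<close> and of
  \<open>g\<close> sets of size \<open>k - 1\<close>. Its neighbourhood fills the layer
  \<open>k - 1\<close>, and below that layer it contains the shadow of these \<open>g\<close>
  sets.\<close>

lemma nbd_bound_initial_full:
 assumes I: "is_initial_segment n \<I>" "card \<I> = binom_ge n k + g"
  and k: "1 \<le> k" "k \<le> n" "g \<le> n choose (k - 1)"
 obtains \<F> where "uniform (k - 1) \<F>" "card \<F> = g"
  "binom_ge n (k - 1) + card (shadow \<F>) \<le> card (nbd {1..n} \<I>)"
proof -
 define V where "V = {1..n}"
 have V: "finite V" "card V = n" by (auto simp: V_def)
 have IV: "\<I> \<subseteq> Pow V" using I by (simp add: is_initial_segment_def V_def cube_def)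
 have finI: "finite \<I>" using IV V finite_subset_Pow by auto
 define B0 where "B0 = T1 V k V"
 define B1 where "B1 = T1 V (k - 1) V"
 have B0: "B0 = {x. x \<subseteq> V \<and> k \<le> card x}" by (auto simp: B0_def T1_def)
 have B1: "B1 = {x. x \<subseteq> V \<and> k - 1 \<le> card x}" by (auto simp: B1_def T1_def)
 have c: "card B0 = binom_ge n k" "card B1 = binom_ge n (k - 1)"
  unfolding B0 B1 using V by (simp_all add: card_subsets_ge)
 have "B0 \<subseteq> \<I>" using initial_segments_mono[OF _ I(1), of B0] T1_initial[of n k n] c I(2)
  by (simp add: B0_def V_def)
 have "binom_ge n (k - 1) = (n choose (k - 1)) + binom_ge n k" using binom_ge_rec[of n "k - 1"] k by simp
 hence "\<I> \<subseteq> B1" using initial_segments_mono[OF I(1), of B1] T1_initial[of n "k-1" n] c I(2) k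
  by (simp add: B1_def V_def)
 define \<F> where "\<F> = \<I> - B0"
 have "card \<F> = g" unfolding \<F>_def using c I(2) \<open>B0 \<subseteq> \<I>\<close> finI
  by (subst card_Diff_subset) (auto intro: finite_subset)
 have Fk: "card x = k - 1" "x \<subseteq> V" if "x \<in> \<F>" for x
  using that \<open>\<I> \<subseteq> B1\<close> unfolding \<F>_def B0 B1 by auto
 have un: "uniform (k - 1) \<F>" using Fk finI V by (auto simp: uniform_def \<F>_def intro: finite_subset)
 have "{x. x \<subseteq> V \<and> Suc (k - 1) \<le> card x} \<subseteq> \<I>" using \<open>B0 \<subseteq> \<I>\<close> k by (simp add: B0)
 hence s1: "B1 \<subseteq> nbd V \<I>" unfolding B1
  using k V by (intro upper_subset_nbd[OF V(1) IV]) auto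
 have s2: "shadow \<F> \<subseteq> nbd V \<I>" by (rule shadow_subset_nbd[OF V(1) IV]) (simp add: \<F>_def)
 have dis: "B1 \<inter> shadow \<F> = {}"
 proof (rule ccontr)
  assume "B1 \<inter> shadow \<F> \<noteq> {}"
  then obtain x a where x: "x \<in> \<F>" "a \<in> x" "x - {a} \<in> B1" by (auto simp: shadow_def)
  have "finite x" using Fk(2)[OF x(1)] V finite_subset by auto
  hence "card (x - {a}) < card x" using x(2) by (meson card_Diff1_less)
  thus False using x(3) Fk(1)[OF x(1)] unfolding B1 by simp
 qed
 have "card (B1 \<union> shadow \<F>) = card B1 + card (shadow \<F>)"
  using dis finite_shadow[OF un] V by (intro card_Un_disjoint) (auto simp: B1)
 moreover have "card (B1 \<union> shadow \<F>) \<le> card (nbd V \<I>)" using s1 s2 V by (intro card_mono) auto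
 ultimately show ?thesis using that[OF un \<open>card \<F> = g\<close>] c by (simp add: V_def)
qed

text \<open>The members beyond \<open>T1 {1..n} k {1..j}\<close> have the form
  \<open>insert (Suc j) y\<close> with \<open>y\<close> a (k-1)-subset of \<open>{1..j}\<close>; the
  sets \<open>y\<close> form \<open>\<F>\<close>. Three disjoint parts of the neighbourhood are
  counted: all sets of size at least \<open>k\<close>, all (k-1)-subsets of \<open>{1..j}\<close>,
  and the shadow of \<open>\<F>\<close> with \<open>Suc j\<close> added.\<close>

lemma nbd_bound_initial_block:
 assumes I: "is_initial_segment n \<I>" "card \<I> = binom_ge n (Suc k) + (j choose k) + g"
  and k: "1 \<le> k" "k \<le> n" "g \<le> j choose (k - 1)" "j < n" "k \<le> j \<or> 1 \<le> g"
 obtains \<F> where "uniform (k - 1) \<F>" "card \<F> = g"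
  "binom_ge n k + (j choose (k - 1)) + card (shadow \<F>) \<le> card (nbd {1..n} \<I>)"
proof -
 define V where "V = {1..n}"
 have V: "finite V" "card V = n" by (auto simp: V_def)
 have IV: "\<I> \<subseteq> Pow V" using I by (simp add: is_initial_segment_def V_def cube_def)
 have finI: "finite \<I>" using IV V finite_subset_Pow by auto
 define B0 where "B0 = T1 V k {1..j}"
 define B1 where "B1 = T1 V k {1..Suc j}"
 have jV: "{1..j} \<subseteq> V" "{1..Suc j} \<subseteq> V" using k by (auto simp: V_def)
 have c: "card B0 = binom_ge n (Suc k) + (j choose k)" "card B1 = binom_ge n (Suc k) + (Suc j choose k)"
  unfolding B0_def B1_def card_T1[OF V(1) jV(1)] card_T1[OF V(1) jV(2)] using V by simp_all
 have pas: "Suc j choose k = (j choose (k - 1)) + (j choose k)" using k by (cases k) auto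
 have B0I: "B0 \<subseteq> \<I>" using initial_segments_mono[OF _ I(1), of B0] T1_initial[of n k j] c I(2)
  by (simp add: B0_def V_def)
 have IB1: "\<I> \<subseteq> B1" using initial_segments_mono[OF I(1), of B1] T1_initial[of n k "Suc j"] c I(2) k pas
  by (simp add: B1_def V_def)
 define \<F> where "\<F> = {y. y \<subseteq> {1..j} \<and> card y = k - 1 \<and> insert (Suc j) y \<in> \<I>}"
 have un: "uniform (k - 1) \<F>"
  unfolding uniform_def \<F>_def by (auto intro: finite_subset)
 have "bij_betw (insert (Suc j)) \<F> (\<I> - B0)"
 proof (rule bij_betwI[where g = "\<lambda>x. x - {Suc j}"])
  show "insert (Suc j) \<in> \<F> \<rightarrow> \<I> - B0"
  proof
   fix y assume y: "y \<in> \<F>"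
   hence yf: "finite y" "Suc j \<notin> y" by (auto simp: \<F>_def intro: finite_subset)
   hence "card (insert (Suc j) y) = k" using y k by (simp add: \<F>_def)
   hence "insert (Suc j) y \<notin> B0" by (auto simp: B0_def T1_def)
   thus "insert (Suc j) y \<in> \<I> - B0" using y by (simp add: \<F>_def)
  qed
  have x: "x \<subseteq> {1..Suc j}" "card x = k" "Suc j \<in> x" if "x \<in> \<I> - B0" for x
  proof -
   have "x \<in> B1" "x \<notin> B0" using that IB1 by auto
   thus "x \<subseteq> {1..Suc j}" "card x = k" by (auto simp: B0_def B1_def T1_def)
   hence "\<not> x \<subseteq> {1..j}" using \<open>x \<notin> B0\<close> \<open>x \<in> B1\<close> by (auto simp: B0_def B1_def T1_def)
   thus "Suc j \<in> x" using \<open>x \<subseteq> {1..Suc j}\<close> by (auto simp: atLeastAtMostSuc_conv)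
  qed
  show "(\<lambda>x. x - {Suc j}) \<in> \<I> - B0 \<rightarrow> \<F>"
  proof
   fix z assume z: "z \<in> \<I> - B0"
   have "z - {Suc j} \<subseteq> {1..j}" using x(1)[OF z] by auto
   moreover have "card (z - {Suc j}) = k - 1" using x[OF z] by simp
   moreover have "insert (Suc j) (z - {Suc j}) = z" using x(3)[OF z] by auto
   ultimately show "z - {Suc j} \<in> \<F>" using z by (simp add: \<F>_def)
  qed
  show "insert (Suc j) y - {Suc j} = y" if "y \<in> \<F>" for y using that by (auto simp: \<F>_def)
  show "insert (Suc j) (z - {Suc j}) = z" if "z \<in> \<I> - B0" for z using x(3)[OF that] by auto
 qed
 hence "card \<F> = card (\<I> - B0)" by (rule bij_betw_same_card)
 also have "\<dots> = g" using c I(2) B0I finI by (subst card_Diff_subset) (auto intro: finite_subset)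
 finally have cF: "card \<F> = g" .
 define X where "X = {x. x \<subseteq> V \<and> k \<le> card x}"
 define Y where "Y = {x. x \<subseteq> {1..j} \<and> card x = k - 1}"
 define W where "W = insert (Suc j) ` shadow \<F>"
 have upI: "{x. x \<subseteq> V \<and> Suc k \<le> card x} \<subseteq> \<I>" using B0I by (auto simp: B0_def T1_def)
 have s1: "X \<subseteq> nbd V \<I>" unfolding X_def
 proof (cases "k < card V")
  case True thus "{x. x \<subseteq> V \<and> k \<le> card x} \<subseteq> nbd V \<I>" by (rule upper_subset_nbd[OF V(1) IV upI])
 next
  case False
  hence kn: "k = n" using k V by simp
  hence "1 \<le> g" using k by auto
  hence "\<F> \<noteq> {}" using cF by auto
  then obtain y where "y \<in> \<F>" by blast
  hence y: "y \<subseteq> {1..j}" "card y = k - 1" "insert (Suc j) y \<in> \<I>" by (auto simp: \<F>_def)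
  have "card (insert (Suc j) y) = k"
   using y k finite_subset[OF y(1)] by (subst card_insert_disjoint) auto
  hence "insert (Suc j) y = V" using y jV kn V by (intro card_subset_eq) auto
  hence "V \<in> \<I>" using y by simp
  moreover have "x = V" if "x \<in> {x. x \<subseteq> V \<and> k \<le> card x}" for x
   using that V kn by (intro card_seteq) auto
  ultimately show "{x. x \<subseteq> V \<and> k \<le> card x} \<subseteq> nbd V \<I>" using nbd_superset[OF IV] by blast
 qed
 have s2: "Y \<subseteq> nbd V \<I>"
 proof
  fix x assume "x \<in> Y"
  hence x: "x \<subseteq> {1..j}" "card x = k - 1" by (auto simp: Y_def)
  have fx: "finite x" using x finite_subset by auto
  show "x \<in> nbd V \<I>"
  proof (cases "k \<le> j")
   case True
   hence "card x < card {1..j}" using x k by simp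
   hence "x \<noteq> {1..j}" by auto
   hence "\<not> {1..j} \<subseteq> x" using x(1) by blast
   then obtain a where a: "a \<in> {1..j}" "a \<notin> x" by blast
   have "insert a x \<in> B0" using a x fx k jV by (auto simp: B0_def T1_def)
   thus ?thesis using nbdI_insert[OF V(1) IV] B0I by blast
  next
   case False
   \<comment> \<open>For \<open>j < k\<close> the only candidate is \<open>{1..j}\<close> itself,
     and what lies above it is a member of the form \<open>insert (Suc j) y\<close>, available
     because \<open>\<F>\<close> is non-empty.\<close>
   hence "card {1..j} \<le> card x" using x by simp
   hence xj: "x = {1..j}" using x by (intro card_seteq) auto
   have "1 \<le> g" using k(5) False by simp
   hence "\<F> \<noteq> {}" using cF by auto
   then obtain y where y: "y \<subseteq> {1..j}" "card y = k - 1" "insert (Suc j) y \<in> \<I>" by (auto simp: \<F>_def)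
   have "y = x" using y x xj by (intro card_seteq) auto
   thus ?thesis using y nbdI_insert[OF V(1) IV] by blast
  qed
 qed
 have Fj: "y \<subseteq> {1..j}" "card y = k - 1" "finite y" if "y \<in> \<F>" for y
  using that by (auto simp: \<F>_def intro: finite_subset)
 have s3: "W \<subseteq> nbd V \<I>"
 proof
  fix w assume "w \<in> W"
  then obtain y a where y: "y \<in> \<F>" "a \<in> y" "w = insert (Suc j) (y - {a})" unfolding W_def shadow_def by blast
  have "insert a w = insert (Suc j) y" using y by auto
  hence "insert a w \<in> \<I>" using y by (simp add: \<F>_def)
  thus "w \<in> nbd V \<I>" by (rule nbdI_insert[OF V(1) IV])
 qed
 have sh: "z \<subseteq> {1..j} \<and> card z < k - 1" if zsh: "z \<in> shadow \<F>" for z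
 proof -
  obtain y a where y: "y \<in> \<F>" "a \<in> y" "z = y - {a}" using zsh unfolding shadow_def by blast
  have "card z < card y" using y Fj[OF y(1)] by (metis card_Diff1_less)
  thus ?thesis using y Fj[OF y(1)] by auto
 qed
 have cW: "card W = card (shadow \<F>)" unfolding W_def
 proof (rule card_image, rule inj_onI)
  fix z z' assume "z \<in> shadow \<F>" "z' \<in> shadow \<F>" "insert (Suc j) z = insert (Suc j) z'"
  moreover have "Suc j \<notin> z" "Suc j \<notin> z'" using calculation sh by fastforce+
  ultimately show "z = z'" by (metis insert_ident)
 qed
 have Wk: "card w < k" "Suc j \<in> w" if wW: "w \<in> W" for w
 proof -
  obtain z where z: "z \<in> shadow \<F>" "w = insert (Suc j) z" using wW by (auto simp: W_def)
  have "card w \<le> Suc (card z)" using z(2) by (simp add: card_insert_le_m1 card_insert_if finite_subset)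
  thus "card w < k" "Suc j \<in> w" using sh[OF z(1)] z by auto
 qed
 have "X \<inter> Y = {}" "(X \<union> Y) \<inter> W = {}" using Wk k by (force simp: X_def Y_def)+
 hence "card (X \<union> Y \<union> W) = card X + card Y + card W"
  using V finite_shadow[OF un] by (simp add: card_Un_disjoint X_def Y_def W_def)
 moreover have "card (X \<union> Y \<union> W) \<le> card (nbd V \<I>)" using s1 s2 s3 V by (intro card_mono) auto
 moreover have "card X = binom_ge n k" unfolding X_def using V by (simp add: card_subsets_ge)
 moreover have "card Y = j choose (k - 1)" unfolding Y_def by (simp add: n_subsets)
 ultimately show ?thesis using that[OF un cF] cW by (simp add: V_def)
qed

lemma nbd_bound_cube:
 assumes "\<A> \<subseteq> cube n" "binom_ge n (Suc k) + (j choose k) + g \<le> card \<A>"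
  and k: "1 \<le> k" "k \<le> n" "g \<le> j choose (k - 1)" "j \<le> n" "k \<le> j \<or> 1 \<le> g"
 obtains \<F> where "uniform (k - 1) \<F>" "card \<F> = g"
  "binom_ge n k + (j choose (k - 1)) + card (shadow \<F>) \<le> card (nbd {1..n} \<A>)"
proof -
 obtain \<B> where B: "\<B> \<subseteq> \<A>" "card \<B> = binom_ge n (Suc k) + (j choose k) + g"
  using obtain_subset_with_card_n[OF assms(2)] by blast
 have BV: "\<B> \<subseteq> cube n" using B assms by auto
 have "card \<B> \<le> 2 ^ n" using card_mono[OF finite_cube BV] by (simp add: cube_def card_Pow)
 note I = initial_segment_props[OF this]
 have H: "card (nbd {1..n} (initial_segment n (card \<B>))) \<le> card (nbd {1..n} \<A>)"
  using Harper[OF BV] card_nbd_mono[OF _ B(1), of "{1..n}"] by simp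
 show ?thesis
 proof (cases "j = n")
  case True
  have b: "binom_ge n k = (n choose k) + binom_ge n (Suc k)" by (rule binom_ge_rec)
  have b': "binom_ge n (k - 1) = (n choose (k - 1)) + binom_ge n k" using binom_ge_rec[of n "k - 1"] k by simp
  obtain \<F> where "uniform (k - 1) \<F>" "card \<F> = g"
   "binom_ge n (k - 1) + card (shadow \<F>) \<le> card (nbd {1..n} (initial_segment n (card \<B>)))"
   using nbd_bound_initial_full[OF I(1), of k g] k True B(2) b I(2) by auto
  thus ?thesis using that[of \<F>] H b' True by simp
 next
  case False
  obtain \<F> where "uniform (k - 1) \<F>" "card \<F> = g"
   "binom_ge n k + (j choose (k - 1)) + card (shadow \<F>) \<le> card (nbd {1..n} (initial_segment n (card \<B>)))"
   using nbd_bound_initial_block[OF I(1), of k j g] k False B(2) I(2) by auto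
  thus ?thesis using that[of \<F>] H by simp
 qed
qed

lemma card_nbd_image:
 assumes f: "bij_betw f V W" and "finite V" "\<A> \<subseteq> Pow V"
 shows "card (nbd W ((`) f ` \<A>)) \<le> card (nbd V \<A>)"
proof -
 have inj: "inj_on f V" and W: "f ` V = W" using f by (auto simp: bij_betw_def)
 have "nbd W ((`) f ` \<A>) \<subseteq> (`) f ` nbd V \<A>"
 proof
  fix y assume "y \<in> nbd W ((`) f ` \<A>)"
  then obtain x where x: "x \<in> \<A>" "y \<subseteq> W" "card (sym_diff (f ` x) y) \<le> 1" by (auto simp: nbd_def)
  define z where "z = {v\<in>V. f v \<in> y}"
  have y: "y = f ` z" using x(2) W by (auto simp: z_def)
  have xV: "x \<subseteq> V" "z \<subseteq> V" using x assms by (auto simp: z_def)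
  have "sym_diff (f ` x) y = f ` (sym_diff x z)"
   unfolding y image_Un using inj_on_image_set_diff[OF inj, of x z] inj_on_image_set_diff[OF inj, of z x] xV by auto
  moreover have "card (f ` (sym_diff x z)) = card (sym_diff x z)"
   using xV by (intro card_image inj_on_subset[OF inj]) auto
  ultimately have "z \<in> nbd V \<A>" using x xV by (auto simp: nbd_def)
  thus "y \<in> (`) f ` nbd V \<A>" using y by blast
 qed
 thus ?thesis using assms by (intro surj_card_le) auto
qed

text \<open>Harper's theorem in the form used from here on. The bound contains the shadow of some
  uniform family of \<open>g\<close> sets instead of a number, so that every application may choose
  its own shadow estimate. The last assumption makes the (k-1)-subsets of the block reachable: with
  \<open>j < k\<close> and \<open>g = 0\<close> the initial segment has no member adjacent to
  them.\<close>

theorem nbd_bound: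
 assumes "finite V" "\<A> \<subseteq> Pow V" "binom_ge (card V) (Suc k) + (j choose k) + g \<le> card \<A>"
  and k: "1 \<le> k" "k \<le> card V" "g \<le> j choose (k - 1)" "j \<le> card V" "k \<le> j \<or> 1 \<le> g"
 obtains \<F> where "uniform (k - 1) \<F>" "card \<F> = g"
  "binom_ge (card V) k + (j choose (k - 1)) + card (shadow \<F>) \<le> card (nbd V \<A>)"
proof -
 obtain f where f: "bij_betw f V {1..card V}"
  using assms(1) by (metis card_atLeastAtMost diff_Suc_1 finite_atLeastAtMost finite_same_card_bij)
 have inj: "inj_on f V" and W: "f ` V = {1..card V}" using f by (auto simp: bij_betw_def)
 have "(`) f ` \<A> \<subseteq> cube (card V)" using assms(2) W by (auto simp: cube_def)
 moreover have "card ((`) f ` \<A>) = card \<A>"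
  using inj_on_image_Pow[OF inj] assms(2) by (intro card_image) (rule inj_on_subset)
 ultimately obtain \<F> where "uniform (k - 1) \<F>" "card \<F> = g"
  "binom_ge (card V) k + (j choose (k - 1)) + card (shadow \<F>) \<le> card (nbd {1..card V} ((`) f ` \<A>))"
  using nbd_bound_cube[of "(`) f ` \<A>" "card V" k j g] assms(3) k by auto
 thus ?thesis using that[of \<F>] card_nbd_image[OF f assms(1,2)] by simp
qed

section \<open>Slopes of the Lovasz curve\<close>

text \<open>The logarithmic derivative of \<open>x gchoose r\<close> at
  \<open>x = N\<close>.\<close>

definition Sg :: "nat \<Rightarrow> nat \<Rightarrow> real"
 where "Sg N r = (\<Sum>i<r. 1 / (real N - real i))"

text \<open>The factor of the concave term in \<open>gb_shadow_bound\<close>, chosen so that both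
  sides there agree to first order at \<open>g = C(N,r)\<close>.\<close>

definition th :: "nat \<Rightarrow> nat \<Rightarrow> real"
 where "th N r = real r / ((real N - real r + 1) * Sg N r)"

text \<open>The curve \<open>(C(x, k), C(x, k - 1))\<close> has slope \<open>rho s k / (s - k + 1)\<close> at \<open>x = s\<close>.\<close>

definition rho :: "nat \<Rightarrow> nat \<Rightarrow> real"
 where "rho s k = real k * (1 - 1 / ((real s - real k + 1) * Sg s k))"

lemma Sg_pos: "1 \<le> r \<Longrightarrow> r \<le> N \<Longrightarrow> 0 < Sg N r"
 unfolding Sg_def by (rule sum_pos) (auto simp: lessThan_empty_iff)

lemma Sg_ge: "r \<le> N \<Longrightarrow> real r \<le> real N * Sg N r"
proof -
 assume "r \<le> N"
 hence "(\<Sum>i<r. 1) \<le> (\<Sum>i<r. real N * (1 / (real N - real i)))"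
  by (intro sum_mono) (auto simp: field_simps)
 thus ?thesis by (simp add: Sg_def sum_distrib_left)
qed

lemma Sg_le: "r \<le> N \<Longrightarrow> (real N - real r + 1) * Sg N r \<le> real r"
proof -
 assume "r \<le> N"
 hence "(\<Sum>i<r. (real N - real r + 1) * (1 / (real N - real i))) \<le> (\<Sum>i<r. 1)"
  by (intro sum_mono) (auto simp: field_simps)
 thus ?thesis by (simp add: Sg_def sum_distrib_left)
qed

lemma Sg_Suc: "Sg (Suc N) (Suc r) = Sg N r + 1 / real (Suc N)"
 unfolding Sg_def sum.lessThan_Suc_shift by simp

lemma Sg_last: "Sg N (Suc r) = Sg N r + 1 / (real N - real r)"
 by (simp add: Sg_def)

lemma Sg_ge_inverse: "1 \<le> r \<Longrightarrow> r \<le> N \<Longrightarrow> 1 / (real N - real r + 1) \<le> Sg N r"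
proof -
 assume r: "1 \<le> r" "r \<le> N"
 then obtain j where j: "r = Suc j" by (cases r) auto
 have "0 \<le> Sg N j" using Sg_pos[of j N] r j by (cases "j = 0") (auto simp: Sg_def less_imp_le)
 thus ?thesis using j by (simp add: Sg_last algebra_simps)
qed

text \<open>With p = N - r + 1, the last two summands 1/p + 1/(p+1) already give 3/(2p).\<close>

lemma Sg_ge_three_halves:
 assumes "2 \<le> r" "r \<le> N" shows "3 / 2 \<le> (real N - real r + 1) * Sg N r"
proof -
 define j where "j = r - 2"
 have j: "r = Suc (Suc j)" using assms(1) by (simp add: j_def)
 define p where "p = real N - real r + 1"
 have p: "1 \<le> p" using assms by (simp add: p_def)
 have "0 \<le> Sg N j" using Sg_pos[of j N] assms j by (cases "j = 0") (auto simp: Sg_def less_imp_le)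
 moreover have "Sg N r = Sg N j + 1 / (p + 1) + 1 / p"
 proof -
  have "real N - real j = p + 1" "real N - real (Suc j) = p" using j by (simp_all add: p_def)
  thus ?thesis unfolding j Sg_last by simp
 qed
 moreover have "1 / p + 1 / (p + 1) \<ge> 3 / 2 / p"
 proof -
  have "1 / (2 * p) \<le> 1 / (p + 1)" using p by (intro divide_left_mono) auto
  moreover have "3 / 2 / p = 1 / p + 1 / (2 * p)" using p by simp
  ultimately show ?thesis by linarith
 qed
 ultimately have "3 / 2 / p \<le> Sg N r" by simp
 hence "p * (3 / 2 / p) \<le> p * Sg N r" using p by (intro mult_left_mono) auto
 thus ?thesis using p by (simp add: p_def[symmetric])
qed

lemma th_ge_1: "1 \<le> r \<Longrightarrow> r \<le> N \<Longrightarrow> 1 \<le> th N r"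
 unfolding th_def using Sg_le[of r N] Sg_pos[of r N] by (subst le_divide_eq) auto

lemma th_le: "1 \<le> r \<Longrightarrow> r \<le> N \<Longrightarrow> th N r * (real N - real r + 1) \<le> real N"
proof -
 assume r: "1 \<le> r" "r \<le> N"
 define q where "q = real N - real r + 1"
 have "0 < q" using r by (simp add: q_def)
 hence "th N r * q = real r / Sg N r" unfolding th_def q_def by simp
 also have "\<dots> \<le> real N" using Sg_ge[OF r(2)] Sg_pos[OF r] by (simp add: divide_le_eq)
 finally show ?thesis by (simp add: q_def)
qed

text \<open>The linear estimate is improved by a term vanishing at both ends \<open>g = 0\<close>
  and \<open>g = C(N,r)\<close>. The ratio C(y,r)/C(N,r) is a product of factors
  \<open>1 - (N - y) / (N - i)\<close>, bounded below by \<open>1 - (N - y) * Sg N r\<close>; the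
  rest is the absorption identity for C(y,r-1).\<close>

lemma gb_shadow_bound:
 fixes y :: real
 assumes "1 \<le> r" "r \<le> N" "real r - 1 < y" "y \<le> real N"
 defines "g \<equiv> y gchoose r"
 shows "real r * g + th N r * g * (1 - g / real (N choose r))
  \<le> (real N - real r + 1) * (y gchoose (r - 1))"
proof -
 define p where "p = real N - real r + 1"
 define v where "v = y - real r + 1"
 have pv: "1 \<le> p" "0 < v" "v \<le> p" using assms by (auto simp: p_def v_def)
 have g: "0 < g" using assms(3) by (simp add: g_def gb_pos)
 have S: "0 < Sg N r" using assms by (intro Sg_pos)
 have Npos: "0 < real N - real i" if "i < r" for i using that assms by simp
 have "1 - (\<Sum>i<r. (p - v) / (real N - real i)) \<le> (\<Prod>i<r. 1 - (p - v) / (real N - real i))"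
 proof (rule prod_ge_one_minus_sum)
  fix i assume "i \<in> {..<r}"
  hence i: "i < r" by simp
  have "real N - real i \<ge> p" using i by (simp add: p_def)
  thus "0 \<le> (p - v) / (real N - real i) \<and> (p - v) / (real N - real i) \<le> 1"
   using pv Npos[OF i] by simp
 qed simp
 also have "(\<Prod>i<r. 1 - (p - v) / (real N - real i)) = (\<Prod>i<r. (y - real i) / (real N - real i))"
 proof (rule prod.cong[OF refl])
  fix i assume "i \<in> {..<r}"
  thus "1 - (p - v) / (real N - real i) = (y - real i) / (real N - real i)"
   using Npos[of i] by (simp add: field_simps p_def v_def)
 qed
 also have "\<dots> = g / real (N choose r)"
  unfolding g_def gb_nat[symmetric] gb_prod prod_dividef by simp
 finally have "1 - g / real (N choose r) \<le> (p - v) * Sg N r"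
  by (simp add: Sg_def sum_distrib_left)
 also have "\<dots> \<le> (p / v) * ((p - v) * Sg N r)"
  using pv S by (intro mult_left_mono[of 1, simplified] mult_le_cancel_right1[THEN iffD2]) (auto simp: field_simps)
 finally have 1: "1 - g / real (N choose r) \<le> (p / v) * ((p - v) * Sg N r)" .
 have "th N r * g * (1 - g / real (N choose r)) \<le> th N r * g * ((p / v) * ((p - v) * Sg N r))"
  using 1 g th_ge_1[OF assms(1,2)] by (intro mult_left_mono) auto
 also have "\<dots> = real r * g * (p - v) / v"
 proof -
  have "th N r * (p * Sg N r) = real r" using S pv by (simp add: th_def p_def[symmetric])
  hence "th N r * g * ((p / v) * ((p - v) * Sg N r)) = real r * (g * (p - v) / v)"
   by (metis (no_types, lifting) mult.assoc mult.commute mult.left_commute times_divide_eq_left times_divide_eq_right)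
  thus ?thesis by simp
 qed
 finally have "real r * g + th N r * g * (1 - g / real (N choose r)) \<le> real r * g + real r * g * (p - v) / v"
  by simp
 also have "\<dots> = p * (real r * g / v)" using pv by (simp add: field_simps)
 also have "real r * g / v = y gchoose (r - 1)"
  using gb_step'[OF assms(1), of y] pv by (simp add: g_def v_def field_simps)
 finally show ?thesis by (simp add: p_def)
qed

text \<open>The concave term is positive strictly between its ends, so a family that is neither
  nearly empty nor nearly full has a visibly larger shadow. This is the source of all stability
  below.\<close>

lemma shadow_bound:
 assumes "uniform r \<F>" "1 \<le> r" "r \<le> N" "card \<F> \<le> N choose r"
 defines "g \<equiv> real (card \<F>)"
 shows "real r * g + th N r * g * (1 - g / real (N choose r))
  \<le> (real N - real r + 1) * real (card (shadow \<F>))"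
proof (cases "card \<F> = 0")
 case True
 thus ?thesis using assms by (simp add: g_def)
next
 case False
 obtain y where y: "real r - 1 \<le> y" "y gchoose r = g"
  by (rule gb_ex[OF assms(2), of g]) (simp_all add: g_def)
 have "real r gchoose r \<le> y gchoose r" unfolding y gb_nat g_def using False by simp
 hence yr: "real r \<le> y" using gb_le_cancel[OF _ y(1) _ assms(2), of "real r"] by simp
 have "y gchoose r \<le> real N gchoose r" unfolding y gb_nat g_def using assms(4) by simp
 hence yN: "y \<le> real N" using gb_le_cancel[OF y(1) _ _ assms(2), of "real N"] assms(3) by simp
 have "y gchoose (r - 1) \<le> real (card (shadow \<F>))"
  by (rule Lovasz_Kruskal_Katona[OF assms(1,2) yr]) (simp add: y g_def)
 hence "(real N - real r + 1) * (y gchoose (r - 1)) \<le> (real N - real r + 1) * real (card (shadow \<F>))"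
  using assms(3) by (intro mult_left_mono) auto
 thus ?thesis
  using gb_shadow_bound[OF assms(2,3), of y] yr yN unfolding y by linarith
qed

lemma shadow_bound_linear:
 assumes "uniform r \<F>" "1 \<le> r" "r \<le> N" "card \<F> \<le> N choose r"
 shows "real r * real (card \<F>) \<le> (real N - real r + 1) * real (card (shadow \<F>))"
proof -
 have "0 \<le> th N r * real (card \<F>) * (1 - real (card \<F>) / real (N choose r))"
  using assms th_ge_1[OF assms(2,3)] by (intro mult_nonneg_nonneg) (auto simp: divide_le_eq_1)
 thus ?thesis using shadow_bound[OF assms] by simp
qed

text \<open>The essential item is the second: \<open>rho s k\<close> exceeds
  \<open>k - 1 - \<theta>\<close> by at least 1/3, so that a deficit relative to the ball costs a
  fixed multiple of its size, as a surplus does. The margin is 1 - 1/(pS) with S =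
  \<open>Sg s k\<close>, and pS is at least 3/2.\<close>

lemma slope_facts:
 assumes "2 \<le> k" "k \<le> s"
 defines "p \<equiv> real s - real k + 1" and "\<theta> \<equiv> th (s - 1) (k - 1)"
 shows "rho s k \<le> real k - 1" "real k - 1 - \<theta> + 1 / 3 \<le> rho s k" "1 \<le> \<theta>" "\<theta> * p \<le> real s - 1"
  "real k - 1 - rho s k \<le> (real k - 1) / p" "0 \<le> rho s k" "1 \<le> p"
proof -
 define T where "T = Sg (s - 1) (k - 1)"
 define S where "S = Sg s k"
 have ks: "s = Suc (s - 1)" "k = Suc (k - 1)" "1 \<le> k - 1" "k - 1 \<le> s - 1" using assms by auto
 have rs: "real (s - 1) = real s - 1" "real (k - 1) = real k - 1" using assms by (auto simp: of_nat_diff)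
 have ST: "S = T + 1 / real s" unfolding S_def T_def using Sg_Suc[of "s - 1" "k - 1"] ks by simp
 have p: "1 \<le> p" using assms by (simp add: p_def)
 thus "1 \<le> p" .
 have T: "0 < T" unfolding T_def using ks by (intro Sg_pos) auto
 have s: "2 \<le> real s" "real k \<le> real s" "2 \<le> real k" using assms by auto
 have S: "0 < S" unfolding ST using T s by (intro add_pos_nonneg) auto
 have pS: "3 / 2 \<le> p * S" "p * S \<le> real k" unfolding p_def S_def
  using Sg_ge_three_halves[OF assms(1,2)] Sg_le[OF assms(2)] by auto
 have rho: "rho s k = real k - real k / (p * S)" by (simp add: rho_def p_def S_def algebra_simps)
 have kpS: "1 \<le> real k / (p * S)" using pS by (simp add: le_divide_eq)
 thus "rho s k \<le> real k - 1" by (simp add: rho)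
 have "real k / (p * S) \<le> real k * (2/3)"
 proof -
  have "real k / (p * S) \<le> real k / (3/2)" using pS s by (intro divide_left_mono) auto
  thus ?thesis by simp
 qed
 hence "real k / (p * S) \<le> real k" using s by linarith
 thus "0 \<le> rho s k" unfolding rho by linarith
 have th: "\<theta> = (real k - 1) / (p * T)"
  unfolding \<theta>_def th_def rs T_def p_def by simp
 show "1 \<le> \<theta>" unfolding \<theta>_def using ks by (intro th_ge_1)
 show "\<theta> * p \<le> real s - 1"
  using th_le[OF ks(3,4)] unfolding \<theta>_def rs p_def by (simp only: diff_diff_eq2 diff_add_cancel add_diff_eq)
 have "real k / (p * S) \<le> real s / p"
  using Sg_ge[OF assms(2)] p S by (simp add: S_def[symmetric] field_simps)
 hence "real k - 1 - rho s k \<le> real s / p - 1" by (simp add: rho)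
 also have "\<dots> = (real k - 1) / p" using p by (simp add: p_def field_simps)
 finally show "real k - 1 - rho s k \<le> (real k - 1) / p" .
 have "real k / (p * S) - (real k - 1) / (p * T) \<le> 1 / (p * S)"
 proof -
  have "(real k - 1) / (p * S) \<le> (real k - 1) / (p * T)"
   using p T S ST s by (intro divide_left_mono mult_left_mono) auto
  moreover have "real k / (p * S) = 1 / (p * S) + (real k - 1) / (p * S)" by (simp add: diff_divide_distrib)
  ultimately show ?thesis by simp
 qed
 also have "1 / (p * S) \<le> 1 / (3/2)" using pS by (intro divide_left_mono) auto
 also have "1 / (3/2) = (2/3 :: real)" by simp
 finally show "real k - 1 - \<theta> + 1 / 3 \<le> rho s k" unfolding rho th by linarith
qed

text \<open>\<open>\<kappa>\<close> is the derivative of C(x-1,k-1) divided by that of C(x,k) at x =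
  s: the share of additional members that goes to the upper section of a ball. The first equation
  splits the growth of the whole neighbourhood into that of the upper section and of its
  neighbourhood; the second says that the upper section and the neighbourhood of the lower one grow
  equally. The inequalities serve other divisions of the additional members.\<close>

lemma slope_recursion:
 assumes "3 \<le> k" "k < s"
 defines "p \<equiv> real s - real k + 1"
 obtains \<kappa> where "0 \<le> \<kappa>" "\<kappa> \<le> 1" "1 - \<kappa> \<le> 3 * (p - 1) / real s"
  "(1 + rho (s - 1) (k - 1) / p) * \<kappa> = rho s k / p"
  "rho (s - 1) k / (p - 1) * (1 - \<kappa>) = \<kappa>"
  "rho (s - 1) (k - 1) / p \<le> rho (s - 1) k / (p - 1)"
  "rho (s - 1) k \<le> rho (s - 1) (k - 1) + 1"
  "real s / 2 \<le> p + rho (s - 1) (k - 1)"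
proof -
 define T where "T = Sg (s - 1) (k - 1)"
 define S where "S = Sg s k"
 define S' where "S' = Sg (s - 1) k"
 define K where "K = real k"
 define s' where "s' = real s"
 have rs: "real (s - 1) = s' - 1" "real (k - 1) = K - 1" using assms by (auto simp: of_nat_diff s'_def K_def)
 have p: "2 \<le> p" using assms by (simp add: p_def)
 have K: "3 \<le> K" "K + p = s' + 1" using assms by (auto simp: K_def s'_def p_def)
 have s: "4 \<le> s'" using p K by simp
 have T: "0 < T" unfolding T_def using assms by (intro Sg_pos) auto
 have ST: "S = T + 1 / s'" unfolding S_def T_def s'_def using Sg_Suc[of "s - 1" "k - 1"] assms by simp
 have S'T: "S' = T + 1 / (p - 1)"
 proof -
  have "S' = Sg (s - 1) (Suc (k - 1))" using assms by (simp add: S'_def)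
  also have "\<dots> = T + 1 / (s' - 1 - (K - 1))" unfolding Sg_last T_def rs ..
  also have "s' - 1 - (K - 1) = p - 1" using K by simp
  finally show ?thesis .
 qed
 have TS: "0 < S" "0 < S'" unfolding ST S'T using T p s by (auto intro!: add_pos_nonneg)
 have rho: "rho s k = K * (1 - 1 / (p * S))"
  by (simp add: rho_def K_def p_def S_def)
 have "rho (s - 1) (k - 1) = (K - 1) * (1 - 1 / ((s' - 1 - (K - 1) + 1) * T))"
  unfolding rho_def rs T_def ..
 also have "s' - 1 - (K - 1) + 1 = p" using K by simp
 finally have rho1: "rho (s - 1) (k - 1) = (K - 1) * (1 - 1 / (p * T))" .
 have "rho (s - 1) k = K * (1 - 1 / ((s' - 1 - K + 1) * S'))"
  unfolding rho_def rs S'_def K_def ..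
 also have "s' - 1 - K + 1 = p - 1" using K by simp
 finally have rho2: "rho (s - 1) k = K * (1 - 1 / ((p - 1) * S'))" .
 have rho2': "rho (s - 1) k = K * ((p - 1) * T) / ((p - 1) * T + 1)"
 proof -
  have "(p - 1) * S' = (p - 1) * T + 1" using p by (simp add: S'T field_simps)
  moreover have "0 < (p - 1) * T + 1" using p T by (intro add_nonneg_pos) auto
  hence "1 - 1 / ((p - 1) * T + 1) = (p - 1) * T / ((p - 1) * T + 1)"
   by (subst diff_divide_eq_iff) auto
  ultimately show ?thesis unfolding rho2 by simp
 qed
 define \<kappa> where "\<kappa> = K * T / (s' * S)"
 have sS: "s' * S = s' * T + 1" using s by (simp add: ST field_simps)
 have k1: "1 - \<kappa> = ((p - 1) * T + 1) / (s' * S)"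
 proof -
  have "s' * S - K * T = (p - 1) * T + 1" 
  proof -
   have s': "s' = K + p - 1" using K by simp
   show ?thesis unfolding sS unfolding s' by (simp add: algebra_simps)
  qed
  thus ?thesis unfolding \<kappa>_def using s TS by (simp add: field_simps)
 qed
 have \<kappa>0: "0 \<le> \<kappa>" unfolding \<kappa>_def using K T s TS by simp
 have "0 \<le> 1 - \<kappa>" unfolding k1 using p T s TS by (intro divide_nonneg_nonneg add_nonneg_nonneg mult_nonneg_nonneg) auto
 hence \<kappa>1: "\<kappa> \<le> 1" by simp
 have \<kappa>3: "1 - \<kappa> \<le> 3 * (p - 1) / real s"
 proof -
  have "1 / p \<le> S" using Sg_ge_inverse[of k s] assms by (simp add: S_def p_def)
  hence "1 \<le> p * S" using p by (simp add: field_simps)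
  also have "p * S \<le> (2 * (p - 1)) * S" using p TS by (intro mult_right_mono) auto
  finally have "1 \<le> 2 * (p - 1) * S" .
  moreover have "(p - 1) * T \<le> (p - 1) * S" using p ST s by (intro mult_left_mono) auto
  ultimately have "(p - 1) * T + 1 \<le> (p - 1) * S + 2 * (p - 1) * S" by linarith
  also have "\<dots> = 3 * (p - 1) * S" by (simp add: algebra_simps)
  finally have "(p - 1) * T + 1 \<le> 3 * (p - 1) * S" .
  hence "1 - \<kappa> \<le> 3 * (p - 1) * S / (s' * S)" unfolding k1 using s TS by (intro divide_right_mono) auto
  thus ?thesis using TS s by (simp add: s'_def)
 qed
 have e1: "(1 + rho (s - 1) (k - 1) / p) * \<kappa> = rho s k / p"
 proof -
  have "1 + rho (s - 1) (k - 1) / p = (p * p * T + (K - 1) * (p * T - 1)) / (p * p * T)"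
   unfolding rho1 using p T by (simp add: field_simps)
  also have "p * p * T + (K - 1) * (p * T - 1) = (p + K - 1) * (p * T) - (K - 1)" by (simp add: algebra_simps)
  also have "p + K - 1 = s'" using K by simp
  finally have "(1 + rho (s - 1) (k - 1) / p) * \<kappa> = (s' * (p * T) - (K - 1)) / (p * p * T) * (K * T / (s' * S))"
   by (simp add: \<kappa>_def)
  also have "\<dots> = K / p * ((s' * (p * T) - (K - 1)) / (s' * (p * S)))" using p T by (simp add: mult_ac)
  also have "s' * (p * T) - (K - 1) = s' * (p * S) - s'"
  proof -
   have "s' * (p * S) = p * (s' * S)" by simp
   also have "\<dots> = s' * (p * T) + p" unfolding sS by (simp add: algebra_simps)
   finally show ?thesis using K by simp
  qed
  also have "(s' * (p * S) - s') / (s' * (p * S)) = 1 - 1 / (p * S)" using s p TS by (simp add: field_simps)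
  finally show ?thesis unfolding rho by simp
 qed
 have e2: "rho (s - 1) k / (p - 1) * (1 - \<kappa>) = \<kappa>"
 proof -
  have "0 < (p - 1) * T + 1" using p T by (intro add_nonneg_pos) auto
  moreover have "K * (x * T) / q / x * (q / (s' * S)) = K * T / (s' * S)" if "x \<noteq> 0" "q \<noteq> 0" for x q
   using that by simp
  ultimately show ?thesis unfolding rho2' k1 unfolding \<kappa>_def using p by auto
 qed
 have e3: "rho (s - 1) (k - 1) / p \<le> rho (s - 1) k / (p - 1)"
 proof -
  have q: "0 < (p - 1) * T + 1" using p T by (intro add_nonneg_pos) auto
  have "T - 1 \<le> p * T^2"
  proof (cases "T \<le> 1")
   case True thus ?thesis using p by (smt (verit) zero_le_power2 mult_nonneg_nonneg)
  next
   case False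
   hence "T * 1 \<le> T * (p * T)" using p T by (intro mult_left_mono) (auto intro: order_trans[OF _ mult_mono[of 1 p 1 T]])
   thus ?thesis by (simp add: power2_eq_square mult_ac)
  qed
  hence "(p * T - 1) * ((p - 1) * T + 1) \<le> (p * T) * (p * T)"
   by (simp add: algebra_simps power2_eq_square)
  hence a: "(p * T - 1) / (p * T) \<le> (p * T) / ((p - 1) * T + 1)"
   using q p T by (simp add: field_simps)
  have "rho (s - 1) (k - 1) / p = (K - 1) / p * ((p * T - 1) / (p * T))"
   unfolding rho1 using p T by (simp add: field_simps)
  also have "\<dots> \<le> (K - 1) / p * ((p * T) / ((p - 1) * T + 1))"
   using a K p by (intro mult_left_mono) auto
  also have "\<dots> = (K - 1) * T / ((p - 1) * T + 1)" using p by simp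
  also have "\<dots> \<le> K * T / ((p - 1) * T + 1)" using q T by (intro divide_right_mono mult_right_mono) auto
  also have "\<dots> = rho (s - 1) k / (p - 1)" unfolding rho2' using p by simp
  finally show ?thesis .
 qed
 have e4: "rho (s - 1) k \<le> rho (s - 1) (k - 1) + 1"
 proof -
  have q: "0 < (p - 1) * T + 1" using p T by (intro add_nonneg_pos) auto
  have "K - 1 \<le> (s' - 1) * T" using Sg_ge[of "k - 1" "s - 1"] assms unfolding rs T_def by simp
  also have "\<dots> \<le> s' * T" using T by simp
  finally have "K - 1 \<le> s' * T" .
  hence "(K - 1) * ((p - 1) * T + 1) \<le> K * (p * T)" 
  proof -
   have "K * (p * T) - (K - 1) * ((p - 1) * T + 1) = (K + p - 1) * T - (K - 1)" by (simp add: algebra_simps)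
   also have "K + p - 1 = s'" using K by simp
   finally show ?thesis using \<open>K - 1 \<le> s' * T\<close> by simp
  qed
  hence "(K - 1) / (p * T) \<le> K / ((p - 1) * T + 1)" using q p T by (simp add: field_simps)
  moreover have "rho (s - 1) k = K - K / ((p - 1) * T + 1)" unfolding rho2' using q by (simp add: field_simps)
  moreover have "rho (s - 1) (k - 1) = K - 1 - (K - 1) / (p * T)" unfolding rho1 by (simp add: algebra_simps)
  ultimately show ?thesis by simp
 qed
 have e5: "real s / 2 \<le> p + rho (s - 1) (k - 1)"
 proof -
  have "real (k - 1) - 1 - rho (s - 1) (k - 1) \<le> (real (k - 1) - 1) / (real (s - 1) - real (k - 1) + 1)"
   using slope_facts(5)[of "k - 1" "s - 1"] assms by auto
  also have "real (s - 1) - real (k - 1) + 1 = p" unfolding rs using K by simp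
  also have "(real (k - 1) - 1) / p \<le> (K - 2) / 2" unfolding rs using p K by (intro frac_le) auto
  finally have "(K - 2) / 2 \<le> rho (s - 1) (k - 1)" unfolding rs by simp
  thus ?thesis using K p by (simp add: s'_def[symmetric])
 qed
 show ?thesis using that[OF \<kappa>0 \<kappa>1 \<kappa>3 e1 e2 e3 e4 e5] .
qed

section \<open>Local stability\<close>

text \<open>The size of a ball with parameters \<open>s\<close>, \<open>k\<close> in dimension
  \<open>n\<close>; \<open>msize_nbd\<close> is the size of its closed neighbourhood, as
  \<open>nbd_std_ball\<close> shows.\<close>

definition msize :: "nat \<Rightarrow> nat \<Rightarrow> nat \<Rightarrow> nat"
 where "msize n s k = binom_ge n (Suc k) + (s choose k)"

definition msize_nbd :: "nat \<Rightarrow> nat \<Rightarrow> nat \<Rightarrow> nat"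
 where "msize_nbd n s k = binom_ge n k + (s choose (k - 1))"

text \<open>The excess of \<open>\<A>\<close> over the tangent of the Lovasz curve at \<open>x = s\<close>, scaled by \<open>s - k + 1\<close>
 so as to become superadditive under passing to sections.\<close>

definition excess :: "nat set \<Rightarrow> nat \<Rightarrow> nat \<Rightarrow> nat set set \<Rightarrow> real"
 where "excess V s k \<A> =
  (real s - real k + 1) * (real (card (nbd V \<A>)) - real (msize_nbd (card V) s k))
  - rho s k * (real (card \<A>) - real (msize (card V) s k))"

lemma binom_M_shift:
 assumes "1 \<le> k" "k \<le> s"
 shows "s choose k = ((s - 1) choose k) + ((s - 1) choose (k - 1))"
 using assms by (cases s; cases k) auto

lemma binom_ratio:
 assumes "2 \<le> k" "k \<le> s"
 shows "(real s - real k + 1) * real ((s - 1) choose (k - 2)) = (real k - 1) * incr s k"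
proof -
 have e: "real (s - 1) - real (k - 2) = real s - real k + 1" "Suc (k - 2) = k - 1" "real (k - 1) = real k - 1"
  using assms by (auto simp: of_nat_diff)
 show ?thesis using gb_step[of "real (s - 1)" "k - 2", unfolded e gb_nat] .
qed

text \<open>The surplus \<open>E\<close> fills the block following \<open>s\<close>. Its shadow is
  estimated as if on \<open>s - 1\<close> points, so that the factor N - r + 1 of
  \<open>shadow_bound\<close> becomes the scaling factor s - k + 1; this is why \<open>E\<close> is
  at most \<open>incr s k\<close>.\<close>

lemma nbd_bound_above:
 assumes V: "finite V" "\<A> \<subseteq> Pow V" and k: "2 \<le> k" "k \<le> s" "s \<le> card V"
  and E: "E \<le> (s - 1) choose (k - 1)" "msize (card V) s k + E \<le> card \<A>"
 defines "M \<equiv> incr s k"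
 shows "(real k - 1) * real E + th (s - 1) (k - 1) * real E * (1 - real E / M)
  \<le> (real s - real k + 1) * (real (card (nbd V \<A>)) - real (msize_nbd (card V) s k))"
proof -
 have "E \<le> s choose (k - 1)" using E(1) binom_M_shift[of "k - 1" s] k by simp
 then obtain \<F> where F: "uniform (k - 1) \<F>" "card \<F> = E"
  "binom_ge (card V) k + (s choose (k - 1)) + card (shadow \<F>) \<le> card (nbd V \<A>)"
  using nbd_bound[OF V, of k s E] k E(2) by (auto simp: msize_def)
 have rs: "real (s - 1) = real s - 1" "real (k - 1) = real k - 1" using k by (auto simp: of_nat_diff)
 have "(real k - 1) * real E + th (s - 1) (k - 1) * real E * (1 - real E / M)
   \<le> (real s - real k + 1) * real (card (shadow \<F>))"
  using shadow_bound[OF F(1), of "s - 1"] k E(1) unfolding F(2) rs M_def by (simp add: algebra_simps)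
 also have "\<dots> \<le> (real s - real k + 1) * (real (card (nbd V \<A>)) - real (msize_nbd (card V) s k))"
  using k F(3) by (intro mult_left_mono) (auto simp: msize_nbd_def)
 finally show ?thesis .
qed

text \<open>With deficit \<open>D\<close>, there remain \<open>incr s k - D\<close> members in the
  block following \<open>s - 1\<close>. The concave term is symmetric under exchanging the filled
  and the missing part of a block, so it is again expressed by \<open>D\<close>, while the linear
  term changes sign. For \<open>s = k\<close> the block must contain a member, whence the
  alternative \<open>D = 0\<close>.\<close>

lemma nbd_bound_below:
 assumes V: "finite V" "\<A> \<subseteq> Pow V" and k: "2 \<le> k" "k \<le> s" "s \<le> card V"
  and D: "D \<le> (s - 1) choose (k - 1)" "msize (card V) s k \<le> card \<A> + D" "k < s \<or> D = 0"
 defines "M \<equiv> incr s k"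
 shows "th (s - 1) (k - 1) * real D * (1 - real D / M) - (real k - 1) * real D
  \<le> (real s - real k + 1) * (real (card (nbd V \<A>)) - real (msize_nbd (card V) s k))"
proof -
 have M0: "0 < (s - 1) choose (k - 1)" using k by simp
 obtain \<F> where F: "uniform (k - 1) \<F>" "card \<F> = ((s - 1) choose (k - 1)) - D"
  "binom_ge (card V) k + ((s - 1) choose (k - 1)) + card (shadow \<F>) \<le> card (nbd V \<A>)"
 proof (rule nbd_bound[OF V])
  show "binom_ge (card V) (Suc k) + (s - 1 choose k) + ((s - 1 choose (k - 1)) - D) \<le> card \<A>"
  proof -
   have "s choose k = (s - 1 choose k) + (s - 1 choose (k - 1))" using k by (intro binom_M_shift) auto
   thus ?thesis using D(1,2) unfolding msize_def by linarith
  qed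
  show "k \<le> s - 1 \<or> 1 \<le> (s - 1 choose (k - 1)) - D" using D(3) k M0 by linarith
  show "1 \<le> k" "k \<le> card V" "s - 1 \<le> card V" using k by auto
  show "(s - 1 choose (k - 1)) - D \<le> s - 1 choose (k - 1)" by simp
 qed blast
 have rs: "real (s - 1) = real s - 1" "real (k - 1) = real k - 1" using k by (auto simp: of_nat_diff)
 have cF: "real (card \<F>) = M - real D" unfolding F(2) M_def using D by (simp add: of_nat_diff)
 have Mp: "0 < M" using M0 by (simp add: M_def)
 define P where "P = real s - real k + 1"
 have "(real k - 1) * (M - real D) + th (s - 1) (k - 1) * (M - real D) * (1 - (M - real D) / M)
   \<le> P * real (card (shadow \<F>))"
  using shadow_bound[OF F(1), of "s - 1"] k F(2) unfolding cF rs M_def[symmetric] P_def by (simp add: algebra_simps)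
 moreover have "(M - real D) * (1 - (M - real D) / M) = real D * (1 - real D / M)"
  using Mp by (simp add: field_simps)
 ultimately have f1: "(real k - 1) * (M - real D) + th (s - 1) (k - 1) * (real D * (1 - real D / M))
   \<le> P * real (card (shadow \<F>))" by (simp only: mult.assoc)
 have f2: "P * real (s choose (k - 1)) = P * M + (real k - 1) * M"
 proof -
  have "s choose (k - 1) = ((s - 1) choose (k - 1)) + ((s - 1) choose (k - 2))"
   using binom_M_shift[of "k - 1" s] k by (simp add: numeral_2_eq_2)
  thus ?thesis using binom_ratio[OF k(1,2)] by (simp add: M_def P_def distrib_left)
 qed
 have "P * (real (binom_ge (card V) k) + M + real (card (shadow \<F>))) \<le> P * real (card (nbd V \<A>))"
  using F(3) k unfolding M_def P_def by (intro mult_left_mono) auto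
 hence f3: "P * real (binom_ge (card V) k) + P * M + P * real (card (shadow \<F>)) \<le> P * real (card (nbd V \<A>))"
  by (simp only: distrib_left)
 have "P * (real (card (nbd V \<A>)) - real (msize_nbd (card V) s k))
   = P * real (card (nbd V \<A>)) - P * real (binom_ge (card V) k) - P * real (s choose (k - 1))"
  unfolding msize_nbd_def by (simp add: algebra_simps)
 moreover have "(real k - 1) * (M - real D) = (real k - 1) * M - (real k - 1) * real D"
  by (rule right_diff_distrib)
 ultimately show ?thesis using f1 f2 f3 unfolding P_def[symmetric] mult.assoc by linarith
qed

text \<open>Submodularity moves the excess to \<open>\<A> \<union> \<G>\<close>, which has surplus
  \<open>E\<close>, and to \<open>\<A> \<inter> \<G>\<close>, which has deficit \<open>D\<close>;
  there the two preceding bounds apply.\<close>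

lemma excess_local:
 assumes V: "finite V" "\<A> \<subseteq> Pow V" "\<G> \<subseteq> Pow V" and k: "2 \<le> k" "k \<le> s" "s \<le> card V"
  and G: "card \<G> = msize (card V) s k" "card (nbd V \<G>) = msize_nbd (card V) s k"
 defines "M \<equiv> incr s k" and "D \<equiv> card (\<G> - \<A>)" and "E \<equiv> card (\<A> - \<G>)"
 assumes DE: "D \<le> (s - 1) choose (k - 1)" "E \<le> (s - 1) choose (k - 1)" "k < s \<or> D = 0"
 shows "(real k - 1 - rho s k) * (real E - real D)
   + th (s - 1) (k - 1) * (real E * (1 - real E / M) + real D * (1 - real D / M)) \<le> excess V s k \<A>"
  "real (card \<A>) - real (msize (card V) s k) = real E - real D"
proof -
 have fin: "finite \<A>" "finite \<G>" using V(2,3) V(1) by (auto intro: finite_subset_Pow)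
 have c1: "card (\<A> \<inter> \<G>) + D = card \<G>"
  unfolding D_def using fin card_Diff_subset_Int[of \<G> \<A>] card_mono[of \<G> "\<G> \<inter> \<A>"] by (simp add: Int_commute)
 have c2: "card (\<A> \<union> \<G>) = card \<G> + E"
  unfolding E_def using fin card_Un_disjoint[of \<G> "\<A> - \<G>"] by (simp add: Un_Diff_cancel Un_commute)
 have c3: "card \<A> + D = card \<G> + E"
  using c1 c2 card_Un_Int[of \<A> \<G>] fin by simp
 thus t: "real (card \<A>) - real (msize (card V) s k) = real E - real D"
  unfolding G(1)[symmetric] by linarith
 have "(real k - 1) * real E + th (s - 1) (k - 1) * real E * (1 - real E / M)
  \<le> (real s - real k + 1) * (real (card (nbd V (\<A> \<union> \<G>))) - real (msize_nbd (card V) s k))"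
  unfolding M_def using V k DE c2 G by (intro nbd_bound_above) auto
 moreover have "th (s - 1) (k - 1) * real D * (1 - real D / M) - (real k - 1) * real D
  \<le> (real s - real k + 1) * (real (card (nbd V (\<A> \<inter> \<G>))) - real (msize_nbd (card V) s k))"
  unfolding M_def using V k DE c1 G by (intro nbd_bound_below) auto
 moreover have "(real s - real k + 1) * (real (card (nbd V (\<A> \<inter> \<G>))) + real (card (nbd V (\<A> \<union> \<G>)))) \<le>
  (real s - real k + 1) * (real (card (nbd V \<A>)) + real (msize_nbd (card V) s k))"
  using card_submodular_nbd[OF V(1), of \<A> \<G>] k G(2) by (intro mult_left_mono) auto
 ultimately show "(real k - 1 - rho s k) * (real E - real D)
   + th (s - 1) (k - 1) * (real E * (1 - real E / M) + real D * (1 - real D / M)) \<le> excess V s k \<A>"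
  unfolding excess_def t by (simp add: algebra_simps)
qed

text \<open>The window is not symmetric. Above the ball a surplus costs
  \<open>\<theta> * (1 - t / M)\<close> each, at least 1/2. Below it the margin 1/3 of
  \<open>slope_facts\<close> has to pay for the loss \<open>\<theta> * D / M\<close>, which the
  window keeps at most 1/6; what remains is 1/6.\<close>

lemma excess_lower:
 assumes V: "finite V" "\<A> \<subseteq> Pow V" and k: "2 \<le> k" "k \<le> s" "s \<le> card V"
 defines "M \<equiv> incr s k" and "t \<equiv> real (card \<A>) - real (msize (card V) s k)"
 assumes t: "2 * t \<le> M" "- 6 * th (s - 1) (k - 1) * t \<le> M"
 shows "\<bar>t\<bar> \<le> 6 * excess V s k \<A>"
proof -
 define \<theta> where "\<theta> = th (s - 1) (k - 1)"
 note sf = slope_facts[OF k(1,2), folded \<theta>_def]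
 have M: "0 < M" using k by (simp add: M_def)
 show ?thesis
 proof (cases "0 \<le> t")
  case True
  define E where "E = card \<A> - msize (card V) s k"
  have E: "real E = t" "card \<A> = msize (card V) s k + E" using True by (auto simp: E_def t_def of_nat_diff)
  have "E \<le> (s - 1) choose (k - 1)" using t(1) E(1) True unfolding M_def by linarith
  hence "(real k - 1) * t + \<theta> * t * (1 - t / M)
   \<le> (real s - real k + 1) * (real (card (nbd V \<A>)) - real (msize_nbd (card V) s k))"
   using nbd_bound_above[OF V k, of E] E unfolding M_def \<theta>_def by simp
  moreover have "t / 2 \<le> \<theta> * t * (1 - t / M)"
  proof -
   have "1 / 2 \<le> 1 - t / M" using t(1) M by (simp add: field_simps)
   hence "1 * (1/2) \<le> \<theta> * (1 - t / M)" using sf(3) by (intro mult_mono) auto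
   hence "t * (1 * (1/2)) \<le> t * (\<theta> * (1 - t / M))" using True by (intro mult_left_mono)
   thus ?thesis by (simp add: algebra_simps)
  qed
  moreover have "0 \<le> (real k - 1 - rho s k) * t" using True sf(1) by simp
  ultimately have "t / 2 \<le> excess V s k \<A>" unfolding excess_def t_def[symmetric] by (simp add: algebra_simps)
  thus ?thesis using True by simp
 next
  case False
  define D where "D = msize (card V) s k - card \<A>"
  have D: "real D = - t" "msize (card V) s k = card \<A> + D" using False by (auto simp: D_def t_def of_nat_diff)
  have "1 * real D \<le> \<theta> * real D" using sf(3) by (intro mult_right_mono) auto
  hence "real D * 6 \<le> 6 * \<theta> * real D" by simp
  also have "\<dots> \<le> M" using t(2) D(1) by (simp add: \<theta>_def)
  finally have D6: "6 * real D \<le> M" by simp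
  hence Dle: "6 * D \<le> (s - 1) choose (k - 1)" unfolding M_def by linarith
  have ks: "k < s \<or> D = 0"
  proof (cases "k = s")
   case True thus ?thesis using Dle by simp
  qed (use k in auto)
  have "\<theta> * real D * (1 - real D / M) - (real k - 1) * real D
   \<le> (real s - real k + 1) * (real (card (nbd V \<A>)) - real (msize_nbd (card V) s k))"
   using nbd_bound_below[OF V k, of D] D Dle ks unfolding M_def \<theta>_def by simp
  hence "\<theta> * real D * (1 - real D / M) - (real k - 1 - rho s k) * real D \<le> excess V s k \<A>"
   unfolding excess_def t_def[symmetric] using D(1) by (simp add: algebra_simps)
  moreover have "real D / 6 \<le> \<theta> * real D * (1 - real D / M) - (real k - 1 - rho s k) * real D"
  proof -
   have "\<theta> * real D / M \<le> 1 / 6" using t(2) D(1) M by (simp add: \<theta>_def field_simps)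
   moreover have "\<theta> * (1 - real D / M) = \<theta> - \<theta> * real D / M" by (simp add: algebra_simps)
   ultimately have "1 / 6 \<le> \<theta> * (1 - real D / M) - (real k - 1 - rho s k)" using sf(2) by linarith
   hence "real D * (1 / 6) \<le> real D * (\<theta> * (1 - real D / M) - (real k - 1 - rho s k))" by (intro mult_left_mono) auto
   thus ?thesis by (simp add: algebra_simps)
  qed
  ultimately show ?thesis using D(1) False by simp
 qed
qed

text \<open>Two passes. With both differences at most a tenth of \<open>M\<close>, the concave terms
  dominate and a crude bound \<open>8 * U\<close> follows. Then \<open>\<theta> * D / M\<close> and
  \<open>\<theta> * E / M\<close> are at most 1/12, as 96 = 8 * 12, and the margin 1/3 - 1/12 = 1/4
  in both coefficients gives the factor 4.\<close>

lemma excess_stable: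
 assumes V: "finite V" "\<A> \<subseteq> Pow V" "\<G> \<subseteq> Pow V" and k: "2 \<le> k" "k \<le> s" "s \<le> card V"
  and G: "card \<G> = msize (card V) s k" "card (nbd V \<G>) = msize_nbd (card V) s k"
 defines "M \<equiv> incr s k" and "\<theta> \<equiv> th (s - 1) (k - 1)"
  and "D \<equiv> card (\<G> - \<A>)" and "E \<equiv> card (\<A> - \<G>)"
  and "t \<equiv> real (card \<A>) - real (msize (card V) s k)"
 assumes U: "excess V s k \<A> \<le> U" "96 * \<theta> * U \<le> M" "\<bar>t\<bar> \<le> 6 * U"
  and DE: "10 * real D \<le> M" "10 * real E \<le> M"
 shows "real D + real E \<le> 4 * U"
proof -
 note sf = slope_facts[OF k(1,2), folded \<theta>_def]
 have M: "0 < M" using k by (simp add: M_def)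
 have U0: "0 \<le> U" using U(3) by linarith
 have le: "10 * D \<le> (s - 1) choose (k - 1)" "10 * E \<le> (s - 1) choose (k - 1)" using DE unfolding M_def by linarith+
 have ks: "k < s \<or> D = 0"
 proof (cases "k = s")
  case True thus ?thesis using le by simp
 qed (use k in auto)
 have loc: "(real k - 1 - rho s k) * (real E - real D)
   + \<theta> * (real E * (1 - real E / M) + real D * (1 - real D / M)) \<le> U"
  and tED: "t = real E - real D"
  using excess_local[OF V k G] le ks U(1) unfolding M_def D_def E_def \<theta>_def t_def by auto
 define c where "c = real k - 1 - rho s k"
 have c: "0 \<le> c" "c \<le> \<theta> - 1 / 3" using sf unfolding c_def by auto
 have fr: "9 / 10 \<le> 1 - real E / M" "9 / 10 \<le> 1 - real D / M" using DE M by (auto simp: field_simps)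
 have s1: "\<theta> * (9 / 10 * (real E + real D)) \<le> \<theta> * (real E * (1 - real E / M) + real D * (1 - real D / M))"
 proof -
  have "real E * (9/10) \<le> real E * (1 - real E / M)" "real D * (9/10) \<le> real D * (1 - real D / M)"
   using fr by (intro mult_left_mono; simp)+
  thus ?thesis using sf(3) by (intro mult_left_mono) auto
 qed
 have "\<theta> * (9 / 10 * (real E + real D)) \<le> U + c * \<bar>t\<bar>"
 proof -
  have "- (c * \<bar>t\<bar>) \<le> c * t" using c(1) by (simp add: abs_if mult_le_0_iff)
  thus ?thesis using loc s1 unfolding tED[symmetric] c_def[symmetric] by linarith
 qed
 also have "\<dots> \<le> \<theta> * U + \<theta> * (6 * U)"
 proof (rule add_mono)
  show "U \<le> \<theta> * U" using sf(3) U0 by (simp add: mult_le_cancel_right1)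
  show "c * \<bar>t\<bar> \<le> \<theta> * (6 * U)" using c U(3) by (intro mult_mono) auto
 qed
 finally have "\<theta> * (9 / 10 * (real E + real D)) \<le> \<theta> * (7 * U)" by (simp add: algebra_simps)
 hence s2: "real E + real D \<le> 8 * U" using sf(3) U0 by simp
 have DU: "\<theta> * real x / M \<le> 1 / 12" if "real x \<le> 8 * U" for x :: nat
 proof -
  have "\<theta> * real x \<le> \<theta> * (8 * U)" using that sf(3) by (intro mult_left_mono) auto
  hence "12 * (\<theta> * real x) \<le> M" using U(2) by simp
  thus ?thesis using M by (simp add: field_simps)
 qed
 have ex: "\<theta> * (1 - real x / M) = \<theta> - \<theta> * real x / M" for x :: nat by (simp add: algebra_simps)
 have "real E \<le> 8 * U" "real D \<le> 8 * U"
  using s2 of_nat_0_le_iff[of D, where ?'a = real] of_nat_0_le_iff[of E, where ?'a = real] by linarith+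
 hence "\<theta> * real E / M \<le> 1 / 12" "\<theta> * real D / M \<le> 1 / 12" using DU by blast+
 note DE12 = this
 have "1 / 4 \<le> c + \<theta> * (1 - real E / M)" using DE12 c(1) sf(3) unfolding ex by linarith
 hence 1: "real E * (1/4) \<le> real E * (c + \<theta> * (1 - real E / M))" by (intro mult_left_mono) auto
 have "1 / 4 \<le> - c + \<theta> * (1 - real D / M)" using DE12 c(2) unfolding ex by linarith
 hence 2: "real D * (1/4) \<le> real D * (- c + \<theta> * (1 - real D / M))" by (intro mult_left_mono) auto
 have "real E * (c + \<theta> * (1 - real E / M)) + real D * (- c + \<theta> * (1 - real D / M)) \<le> U"
  using loc unfolding c_def[symmetric] by (simp add: algebra_simps)
 thus ?thesis using 1 2 by linarith
qed

section \<open>Generalised Hamming balls\<close>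

definition flip :: "nat set \<Rightarrow> nat set set \<Rightarrow> nat set set"
 where "flip C \<A> = {x. sym_diff x C \<in> \<A>}"

lemma sym_diff_cancel [simp]: "sym_diff (sym_diff x C) C = x"
 by auto

lemma flip_image: "flip C \<A> = (\<lambda>x. sym_diff x C) ` \<A>"
proof (intro set_eqI iffI)
 fix x assume "x \<in> flip C \<A>"
 hence "sym_diff x C \<in> \<A>" by (simp add: flip_def)
 hence "sym_diff (sym_diff x C) C \<in> (\<lambda>x. sym_diff x C) ` \<A>" by (rule imageI)
 thus "x \<in> (\<lambda>x. sym_diff x C) ` \<A>" by simp
next
 fix x assume "x \<in> (\<lambda>x. sym_diff x C) ` \<A>"
 then obtain y where "y \<in> \<A>" "x = sym_diff y C" by blast
 thus "x \<in> flip C \<A>" by (simp add: flip_def)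
qed

lemma flip_flip [simp]: "flip C (flip C \<A>) = \<A>"
 by (simp add: flip_def)

lemma flip_empty_set [simp]: "flip {} \<A> = \<A>"
 by (simp add: flip_def)

lemma flip_flip_sym_diff: "flip C (flip D \<A>) = flip (sym_diff C D) \<A>"
proof -
 have "sym_diff (sym_diff x C) D = sym_diff x (sym_diff C D)" for x by auto
 thus ?thesis by (simp add: flip_def)
qed

lemma inj_sym_diff: "inj (\<lambda>x. sym_diff x C)"
 by (rule inj_on_inverseI[where g = "\<lambda>x. sym_diff x C"]) simp

lemma card_flip [simp]: "card (flip C \<A>) = card \<A>"
 unfolding flip_image by (intro card_image inj_on_subset[OF inj_sym_diff]) simp

lemma flip_subset_Pow: "C \<subseteq> V \<Longrightarrow> \<A> \<subseteq> Pow V \<Longrightarrow> flip C \<A> \<subseteq> Pow V"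
 unfolding flip_image by auto

lemma flip_Diff: "flip C (\<A> - \<B>) = flip C \<A> - flip C \<B>"
 by (auto simp: flip_def)

lemma flip_mono: "\<A> \<subseteq> \<B> \<Longrightarrow> flip C \<A> \<subseteq> flip C \<B>"
 by (auto simp: flip_def)

lemma nbd_flip:
 assumes "C \<subseteq> V" shows "nbd V (flip C \<A>) = flip C (nbd V \<A>)"
proof (rule set_eqI)
 fix y
 have sd: "sym_diff (sym_diff x C) y = sym_diff x (sym_diff y C)" for x by auto
 have "y \<in> nbd V (flip C \<A>) \<longleftrightarrow> y \<subseteq> V \<and> (\<exists>x\<in>\<A>. card (sym_diff (sym_diff x C) y) \<le> 1)"
  unfolding nbd_def flip_image by auto
 also have "\<dots> \<longleftrightarrow> sym_diff y C \<subseteq> V \<and> (\<exists>x\<in>\<A>. card (sym_diff x (sym_diff y C)) \<le> 1)"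
 proof -
  have "y \<subseteq> V \<longleftrightarrow> sym_diff y C \<subseteq> V" using assms by auto
  thus ?thesis unfolding sd by simp
 qed
 finally show "y \<in> nbd V (flip C \<A>) \<longleftrightarrow> y \<in> flip C (nbd V \<A>)"
  by (simp add: flip_def nbd_def)
qed

lemma upsec_flip1: "upsec i (flip {i} \<A>) = dnsec i \<A>"
proof (rule set_eqI)
 fix x
 show "x \<in> upsec i (flip {i} \<A>) \<longleftrightarrow> x \<in> dnsec i \<A>"
 proof (cases "i \<in> x")
  case False
  hence "sym_diff (insert i x) {i} = x" by auto
  thus ?thesis using False by (simp add: upsec_def dnsec_def flip_def)
 qed (simp add: upsec_def dnsec_def)
qed

lemma dnsec_flip1: "dnsec i (flip {i} \<A>) = upsec i \<A>"
 using upsec_flip1[of i "flip {i} \<A>"] by simp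

lemma excess_flip: "C \<subseteq> V \<Longrightarrow> excess V s k (flip C \<A>) = excess V s k \<A>"
 by (simp add: excess_def nbd_flip)

text \<open>The second extremal shape. By Pascal's rule its part inside \<open>S\<close> has size
  C(card S + 1, k), so it corresponds to \<open>s = card S + 1\<close>.\<close>

definition T2 :: "nat set \<Rightarrow> nat \<Rightarrow> nat set \<Rightarrow> nat set set"
 where "T2 V k S = {x. x \<subseteq> V \<and> (Suc k \<le> card x \<or> x \<subseteq> S \<and> (card x = k \<or> Suc (card x) = k))}"

definition std_ball :: "bool \<Rightarrow> nat set \<Rightarrow> nat \<Rightarrow> nat set \<Rightarrow> nat set set"
 where "std_ball b V k S = (if b then T1 V k S else T2 V k S)"

text \<open>Coordinate permutations are absorbed in the free choice of \<open>S\<close> and reappear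
  only in \<open>gball_gen_hamming_ball\<close>; \<open>b\<close> selects the shape.\<close>

definition gball :: "nat set \<Rightarrow> nat \<Rightarrow> nat \<Rightarrow> nat set set \<Rightarrow> bool"
 where "gball V s k \<G> \<longleftrightarrow> (\<exists>b C S. C \<subseteq> V \<and> S \<subseteq> V \<and> card S + (if b then 0 else 1) = s \<and>
  s \<le> card V \<and> \<G> = flip C (std_ball b V k S))"

lemma std_ball_subset: "std_ball b V k S \<subseteq> Pow V"
 by (auto simp: std_ball_def T1_def T2_def)

lemma gball_subset: "gball V s k \<G> \<Longrightarrow> \<G> \<subseteq> Pow V"
 unfolding gball_def using flip_subset_Pow[OF _ std_ball_subset] by blast

lemma gball_flip: "gball V s k \<G> \<Longrightarrow> C \<subseteq> V \<Longrightarrow> gball V s k (flip C \<G>)"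
proof -
 assume g: "gball V s k \<G>" and C: "C \<subseteq> V"
 obtain b D S where D: "D \<subseteq> V" "S \<subseteq> V" "card S + (if b then 0 else 1) = s" "s \<le> card V"
  "\<G> = flip D (std_ball b V k S)" using g unfolding gball_def by blast
 have "sym_diff C D \<subseteq> V" using C D by auto
 moreover have "flip C \<G> = flip (sym_diff C D) (std_ball b V k S)" unfolding D(5) flip_flip_sym_diff ..
 ultimately show ?thesis unfolding gball_def using D by blast
qed

lemma card_T2:
 assumes "finite V" "S \<subseteq> V" "1 \<le> k"
 shows "card (T2 V k S) = binom_ge (card V) (Suc k) + (Suc (card S) choose k)"
proof -
 have fS: "finite S" using assms finite_subset by auto
 have "T2 V k S = {x. x \<subseteq> V \<and> Suc k \<le> card x} \<union> ({x. x \<subseteq> S \<and> card x = k} \<union> {x. x \<subseteq> S \<and> card x = k - 1})"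
  using assms by (auto simp: T2_def)
 moreover have "card \<dots> = card {x. x \<subseteq> V \<and> Suc k \<le> card x} + card ({x. x \<subseteq> S \<and> card x = k} \<union> {x. x \<subseteq> S \<and> card x = k - 1})"
  using assms fS by (intro card_Un_disjoint) auto
 moreover have "card ({x. x \<subseteq> S \<and> card x = k} \<union> {x. x \<subseteq> S \<and> card x = k - 1})
   = card {x. x \<subseteq> S \<and> card x = k} + card {x. x \<subseteq> S \<and> card x = k - 1}"
  using assms(3) fS by (intro card_Un_disjoint) auto
 moreover have "Suc (card S) choose k = (card S choose k) + (card S choose (k - 1))"
  using assms(3) by (cases k) auto
 ultimately show ?thesis
  by (simp add: card_subsets_ge[OF assms(1)] n_subsets[OF fS])
qed

lemma card_std_ball:
 assumes "finite V" "S \<subseteq> V" "1 \<le> k"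
 shows "card (std_ball b V k S) = msize (card V) (card S + (if b then 0 else 1)) k"
 using assms by (simp add: std_ball_def card_T1 card_T2 msize_def)

lemma nbd_std_ball_subset:
 assumes "finite V" "S \<subseteq> V" "1 \<le> k"
 shows "nbd V (std_ball b V k S) \<subseteq> std_ball b V (k - 1) S"
proof
 fix y assume "y \<in> nbd V (std_ball b V k S)"
 then obtain x where x: "x \<in> std_ball b V k S" "y \<subseteq> V" "card (sym_diff x y) \<le> 1" by (auto simp: nbd_def)
 have "x \<subseteq> V" using x(1) std_ball_subset[of b V k S] by auto
 hence fin: "finite x" "finite y" using x(2) assms(1) by (auto intro: finite_subset)
 from x(3) consider "y = x" | a where "a \<notin> x" "y = insert a x" | a where "a \<notin> y" "x = insert a y"
  unfolding sym_diff_card_le_1_iff[OF fin] by blast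
 thus "y \<in> std_ball b V (k - 1) S"
  using x(1,2) fin assms(3) by cases (auto simp: std_ball_def T1_def T2_def)
qed

text \<open>Only the easy inclusion is proved by hand. The lower bound
  \<open>nbd_bound_above\<close> with \<open>E = 0\<close> shows that the cardinalities agree, which
  turns it into an equality.\<close>

lemma nbd_std_ball:
 assumes "finite V" "S \<subseteq> V" "2 \<le> k" "s = card S + (if b then 0 else 1)" "k \<le> s" "s \<le> card V"
 shows "nbd V (std_ball b V k S) = std_ball b V (k - 1) S"
  "card (nbd V (std_ball b V k S)) = msize_nbd (card V) s k"
proof -
 have c: "card (std_ball b V k S) = msize (card V) s k" "card (std_ball b V (k - 1) S) = msize (card V) s (k - 1)"
  using assms by (simp_all add: card_std_ball)
 have e: "msize (card V) s (k - 1) = msize_nbd (card V) s k" using assms by (simp add: msize_def msize_nbd_def)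
 have h: "0 \<le> (real s - real k + 1) * (real (card (nbd V (std_ball b V k S))) - real (msize_nbd (card V) s k))"
  using nbd_bound_above[OF assms(1) std_ball_subset assms(3,5,6), of 0 b k S] c(1) by simp
 have "0 < real s - real k + 1" using assms(5) by simp
 hence "0 \<le> real (card (nbd V (std_ball b V k S))) - real (msize_nbd (card V) s k)"
  using h by (metis mult_less_0_iff not_le)
 hence ge: "msize_nbd (card V) s k \<le> card (nbd V (std_ball b V k S))" by simp
 have sub: "nbd V (std_ball b V k S) \<subseteq> std_ball b V (k - 1) S"
  using assms by (intro nbd_std_ball_subset) auto
 have fin: "finite (std_ball b V (k - 1) S)" by (rule finite_subset_Pow[OF std_ball_subset assms(1)])
 show eq: "nbd V (std_ball b V k S) = std_ball b V (k - 1) S"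
  using ge c e by (intro card_seteq[OF fin sub]) simp
 show "card (nbd V (std_ball b V k S)) = msize_nbd (card V) s k" unfolding eq using c e by simp
qed

lemma card_gball:
 assumes "finite V" "gball V s k \<G>" "2 \<le> k" "k \<le> s"
 shows "card \<G> = msize (card V) s k" "card (nbd V \<G>) = msize_nbd (card V) s k"
proof -
 obtain b C S where g: "C \<subseteq> V" "S \<subseteq> V" "card S + (if b then 0 else 1) = s" "s \<le> card V"
  "\<G> = flip C (std_ball b V k S)" using assms(2) unfolding gball_def by blast
 show "card \<G> = msize (card V) s k" using g assms card_std_ball[of V S k b] by simp
 show "card (nbd V \<G>) = msize_nbd (card V) s k"
  unfolding g(5) nbd_flip[OF g(1)] card_flip using g assms by (intro nbd_std_ball(2)) auto
qed

section \<open>Reassembling a family from its two sections\<close>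

definition glue :: "nat \<Rightarrow> nat set set \<Rightarrow> nat set set \<Rightarrow> nat set set"
 where "glue i \<P> \<Q> = {x. if i \<in> x then x - {i} \<in> \<P> else x \<in> \<Q>}"

lemma glue_sections: "glue i (upsec i \<A>) (dnsec i \<A>) = \<A>"
 by (auto simp: glue_def upsec_def dnsec_def insert_absorb)

text \<open>Along a direction of the distinguished set both sections are balls with the same
  \<open>S\<close> and shape; the upper one has \<open>k\<close> lowered by one, since
  \<open>i\<close> accounts for one element.\<close>

lemma std_ball_glue:
 assumes "finite V" "i \<in> V" "S \<subseteq> V - {i}" "1 \<le> k"
 shows "glue i (std_ball b (V - {i}) (k - 1) S) (std_ball b (V - {i}) k S) = std_ball b V k (insert i S)"
proof (rule set_eqI)
 fix x
 show "x \<in> glue i (std_ball b (V - {i}) (k - 1) S) (std_ball b (V - {i}) k S) \<longleftrightarrow> x \<in> std_ball b V k (insert i S)"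
 proof (cases "x \<subseteq> V")
  case False
  hence "\<not> (x - {i} \<subseteq> V - {i})" using assms(2) by auto
  thus ?thesis using False by (auto simp: glue_def std_ball_def T1_def T2_def)
 next
  case True
  hence fx: "finite x" using assms(1) finite_subset by auto
  show ?thesis
  proof (cases "i \<in> x")
   case i: True
   have c: "card x = Suc (card (x - {i}))" by (rule card.remove[OF fx i])
   have "x - {i} \<subseteq> S \<longleftrightarrow> x \<subseteq> insert i S" by auto
   moreover have "x - {i} \<subseteq> V - {i}" using True by auto
   ultimately show ?thesis using i True assms(4) c by (auto simp: glue_def std_ball_def T1_def T2_def)
  next
   case i: False
   hence "x \<subseteq> insert i S \<longleftrightarrow> x \<subseteq> S" "x \<subseteq> V - {i}" using True by auto
   thus ?thesis using i True by (auto simp: glue_def std_ball_def T1_def T2_def)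
  qed
 qed
qed

lemma flip_glue: "i \<notin> C \<Longrightarrow> glue i (flip C \<P>) (flip C \<Q>) = flip C (glue i \<P> \<Q>)"
proof (rule set_eqI)
 fix x assume i: "i \<notin> C"
 have "sym_diff (x - {i}) C = sym_diff x C - {i}" using i by auto
 thus "x \<in> glue i (flip C \<P>) (flip C \<Q>) \<longleftrightarrow> x \<in> flip C (glue i \<P> \<Q>)"
  using i by (auto simp: glue_def flip_def)
qed

lemma gball_glue:
 assumes V: "finite V" "i \<in> V" and S: "S \<subseteq> V - {i}" "C \<subseteq> V - {i}" and k: "1 \<le> k"
  and s: "card S + (if b then 0 else 1) = s - 1" "1 \<le> s" "s \<le> card V"
 shows "gball V s k (glue i (flip C (std_ball b (V - {i}) (k - 1) S)) (flip C (std_ball b (V - {i}) k S)))"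
proof -
 have fS: "finite S" "i \<notin> S" using S(1) V(1) by (auto intro: finite_subset)
 have "glue i (flip C (std_ball b (V - {i}) (k - 1) S)) (flip C (std_ball b (V - {i}) k S))
   = flip C (std_ball b V k (insert i S))"
 proof -
  have "i \<notin> C" using S by auto
  show ?thesis unfolding flip_glue[OF \<open>i \<notin> C\<close>] std_ball_glue[OF V S(1) k] ..
 qed
 moreover have "card (insert i S) + (if b then 0 else 1) = s" using fS s by simp
 moreover have "C \<subseteq> V" "insert i S \<subseteq> V" using S V by auto
 ultimately show ?thesis unfolding gball_def using s by blast
qed

lemma card_Diff_sections:
 assumes "finite \<A>" "finite \<B>"
 shows "card (\<A> - \<B>) = card (upsec i \<A> - upsec i \<B>) + card (dnsec i \<A> - dnsec i \<B>)"
proof -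
 have "upsec i (\<A> - \<B>) = upsec i \<A> - upsec i \<B>" "dnsec i (\<A> - \<B>) = dnsec i \<A> - dnsec i \<B>"
  by (auto simp: upsec_def dnsec_def)
 thus ?thesis using card_sections[of "\<A> - \<B>" i] assms by simp
qed

lemma upsec_glue: "\<P> \<subseteq> Pow (V - {i}) \<Longrightarrow> upsec i (glue i \<P> \<Q>) = \<P>"
proof -
 assume "\<P> \<subseteq> Pow (V - {i})"
 hence "i \<notin> x" if "x \<in> \<P>" for x using that by auto
 thus ?thesis by (auto simp: upsec_def glue_def)
qed

lemma dnsec_glue: "\<Q> \<subseteq> Pow (V - {i}) \<Longrightarrow> dnsec i (glue i \<P> \<Q>) = \<Q>"
 by (auto simp: dnsec_def glue_def)

section \<open>The case \<open>k = 2\<close>\<close>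

lemma two_choose_two: "2 * int (m choose 2) = int m * (int m - 1)"
proof (induction m)
 case (Suc m)
 have "Suc m choose 2 = m + (m choose 2)" by (simp add: numeral_2_eq_2)
 thus ?case using Suc by (simp add: algebra_simps)
qed simp

text \<open>The mixed second difference of C(m,2) is \<open>\<alpha> * \<beta>\<close>; this product
  is the slack that decides the equality case.\<close>

lemma choose_two_split:
 "((P + \<alpha> + \<beta>) choose 2) + (P choose 2) = ((P + \<alpha>) choose 2) + ((P + \<beta>) choose 2) + \<alpha> * \<beta>"
proof -
 have "2 * int (((P + \<alpha> + \<beta>) choose 2) + (P choose 2)) =
    2 * int (((P + \<alpha>) choose 2) + ((P + \<beta>) choose 2) + \<alpha> * \<beta>)"
  by (simp add: distrib_left two_choose_two) (simp add: algebra_simps)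
 hence "int (((P + \<alpha> + \<beta>) choose 2) + (P choose 2)) = int (((P + \<alpha>) choose 2) + ((P + \<beta>) choose 2) + \<alpha> * \<beta>)"
  by (metis mult_left_cancel zero_neq_numeral)
 thus ?thesis by (simp only: of_nat_eq_iff)
qed

text \<open>Adds the bounds for two sections of sizes \<open>c1\<close> and \<open>c2\<close> in
  dimension \<open>n - 1\<close>. The slack \<open>(c1 - 1) * (c2 - 1)\<close> vanishes only if one
  of the sections is a single set.\<close>

lemma star_count:
 assumes n: "1 \<le> (n::nat)" and c: "1 \<le> c1" "1 \<le> c2" "c1 + c2 \<le> n + 1"
  and N1: "n + ((n - 1) choose 2) \<le> N1 + ((n - c1) choose 2)"
  and N2: "n + ((n - 1) choose 2) \<le> N2 + ((n - c2) choose 2)"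
 shows "1 + n + (n choose 2) + (c1 - 1) * (c2 - 1) \<le> N1 + N2 + ((n + 1 - (c1 + c2)) choose 2)"
proof -
 define P \<alpha> \<beta> where "P = n + 1 - (c1 + c2)" and "\<alpha> = c1 - 1" and "\<beta> = c2 - 1"
 have e: "n - 1 = P + \<alpha> + \<beta>" "n - c1 = P + \<beta>" "n - c2 = P + \<alpha>"
  using c by (auto simp: P_def \<alpha>_def \<beta>_def)
 have "n choose 2 = (n - 1) + ((n - 1) choose 2)" using n by (cases n) (auto simp: numeral_2_eq_2)
 moreover have "((n - 1) choose 2) + (P choose 2) = ((n - c2) choose 2) + ((n - c1) choose 2) + \<alpha> * \<beta>"
  unfolding e by (rule choose_two_split)
 ultimately have "1 + n + (n choose 2) + \<alpha> * \<beta> \<le> N1 + N2 + (P choose 2)" using N1 N2 n by linarith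
 thus ?thesis unfolding P_def \<alpha>_def \<beta>_def .
qed

text \<open>Attained by the subsets of a star, that is, of a closed ball of radius 1. The family is
  split along a coordinate in which two members differ, so that both sections are non-empty; a
  single set is split along any coordinate.\<close>

lemma nbd_small:
 assumes "finite V" "\<C> \<subseteq> Pow V" "1 \<le> card \<C>" "card \<C> \<le> card V + 1"
 shows "1 + card V + (card V choose 2) \<le> card (nbd V \<C>) + ((card V + 1 - card \<C>) choose 2)"
 using assms
proof (induction "card V" arbitrary: V \<C>)
 case 0
 hence "card \<C> = 1" "V = {}" by auto
 hence "card \<C> \<le> card (nbd V \<C>)"
  using 0 nbd_superset[of \<C> V] by (intro card_mono) auto
 thus ?case using 0 \<open>card \<C> = 1\<close> by simp
next
 case (Suc n')
 have fC: "finite \<C>" using Suc.prems finite_subset_Pow by blast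
 have n: "card V = Suc n'" using Suc.hyps(2) by simp
 show ?case
 proof (cases "card \<C> = 1")
  case True
  obtain i where i: "i \<in> V" using n by fastforce
  have cV: "card (V - {i}) = n'" using i n Suc.prems by simp
  have IH: "1 + n' + (n' choose 2) \<le> card (nbd (V - {i}) \<D>) + (n' choose 2)" if "\<D> \<subseteq> Pow (V - {i})" "card \<D> = 1" for \<D>
   using Suc.hyps(1)[of "V - {i}" \<D>] cV Suc.prems that by auto
  have cs: "card (upsec i \<C>) + card (dnsec i \<C>) = 1" using True card_sections[OF fC, of i] by simp
  have cn: "card (nbd V \<C>) = card (nbd (V - {i}) (upsec i \<C>) \<union> dnsec i \<C>)
    + card (nbd (V - {i}) (dnsec i \<C>) \<union> upsec i \<C>)"
   by (rule card_nbd_sections[OF Suc.prems(1,2) i])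
  have fin: "finite (upsec i \<C>)" "finite (dnsec i \<C>)" using fC finite_upsec by (auto simp: dnsec_def)
  consider "card (upsec i \<C>) = 1" "dnsec i \<C> = {}" | "card (dnsec i \<C>) = 1" "upsec i \<C> = {}"
   proof -
   have "card (upsec i \<C>) = 1 \<and> card (dnsec i \<C>) = 0 \<or> card (dnsec i \<C>) = 1 \<and> card (upsec i \<C>) = 0"
    using cs by linarith
   thus ?thesis using that fin by auto
  qed
  hence "1 + Suc n' \<le> card (nbd V \<C>)"
  proof cases
   case 1
   thus ?thesis using IH[of "upsec i \<C>"] upsec_subset[OF Suc.prems(2), of i] cn by simp
  next
   case 2
   thus ?thesis using IH[of "dnsec i \<C>"] dnsec_subset[OF Suc.prems(2), of i] cn by simp
  qed
  thus ?thesis using True n by simp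
 next
  case False
  hence c2: "2 \<le> card \<C>" using Suc.prems by simp
  obtain x y where xy: "x \<in> \<C>" "y \<in> \<C>" "x \<noteq> y"
   using c2 fC by (metis card_le_Suc0_iff_eq not_less_eq_eq numeral_2_eq_2)
  then obtain i where i0: "(i \<in> x) \<noteq> (i \<in> y)" by blast
  hence i: "i \<in> V" using xy Suc.prems by blast
  have cV: "card (V - {i}) = n'" using i n Suc.prems by simp
  define c1 c2 where "c1 = card (upsec i \<C>)" and "c2 = card (dnsec i \<C>)"
  have fin: "finite (upsec i \<C>)" "finite (dnsec i \<C>)" using fC finite_upsec by (auto simp: dnsec_def)
  have "upsec i \<C> \<noteq> {}" "dnsec i \<C> \<noteq> {}"
  proof -
   obtain u d where ud: "u \<in> \<C>" "i \<in> u" "d \<in> \<C>" "i \<notin> d" using xy i0 by blast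
   have "insert i (u - {i}) = u" using ud by auto
   hence "u - {i} \<in> upsec i \<C>" using ud by (simp add: upsec_def)
   thus "upsec i \<C> \<noteq> {}" by auto
   show "dnsec i \<C> \<noteq> {}" using ud by (auto simp: dnsec_def)
  qed
  hence c: "1 \<le> c1" "1 \<le> c2" using fin by (auto simp: c1_def c2_def Suc_le_eq card_gt_0_iff)
  have cs: "card \<C> = c1 + c2" using card_sections[OF fC, of i] by (simp add: c1_def c2_def)
  have le: "c1 \<le> n' + 1" "c2 \<le> n' + 1" using cs c Suc.prems n by auto
  have "1 + n' + (n' choose 2) \<le> card (nbd (V - {i}) (upsec i \<C>)) + ((n' + 1 - c1) choose 2)"
   using Suc.hyps(1)[of "V - {i}" "upsec i \<C>"] cV Suc.prems upsec_subset[OF Suc.prems(2), of i] c le by (auto simp: c1_def)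
  moreover have "1 + n' + (n' choose 2) \<le> card (nbd (V - {i}) (dnsec i \<C>)) + ((n' + 1 - c2) choose 2)"
   using Suc.hyps(1)[of "V - {i}" "dnsec i \<C>"] cV Suc.prems dnsec_subset[OF Suc.prems(2), of i] c le by (auto simp: c2_def)
  moreover have "card (nbd (V - {i}) (upsec i \<C>)) + card (nbd (V - {i}) (dnsec i \<C>)) \<le> card (nbd V \<C>)"
   unfolding card_nbd_sections[OF Suc.prems(1,2) i]
   using Suc.prems(1) fin by (intro add_mono card_mono) auto
  ultimately show ?thesis
   using star_count[of "Suc n'" c1 c2 "card (nbd (V - {i}) (upsec i \<C>))" "card (nbd (V - {i}) (dnsec i \<C>))"]
    c cs Suc.prems n by auto
 qed
qed

text \<open>Equality leaves no slack in the preceding induction: one section is a single set and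
  each section lies in the neighbourhood of the other, which exhibits the centre of the
  star.\<close>

lemma star_of_extremal:
 assumes V: "finite V" "\<C> \<subseteq> Pow V" and c: "1 \<le> card \<C>" "card \<C> \<le> card V"
  and N: "card (nbd V \<C>) + ((card V + 1 - card \<C>) choose 2) \<le> 1 + card V + (card V choose 2)"
 shows "\<exists>q\<subseteq>V. \<C> \<subseteq> nbd V {q}"
proof (cases "card \<C> = 1")
 case True
 then obtain q where "\<C> = {q}" by (auto simp: card_1_singleton_iff)
 thus ?thesis using V nbd_superset[of \<C> V] by auto
next
 case False
 hence c2: "2 \<le> card \<C>" using c by simp
 have fC: "finite \<C>" using V finite_subset_Pow by blast
 obtain x y where xy: "x \<in> \<C>" "y \<in> \<C>" "x \<noteq> y"
  using c2 fC by (metis card_le_Suc0_iff_eq not_less_eq_eq numeral_2_eq_2)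
 then obtain i where i0: "(i \<in> x) \<noteq> (i \<in> y)" by blast
 hence i: "i \<in> V" using xy V by blast
 define U D where "U = upsec i \<C>" and "D = dnsec i \<C>"
 define n where "n = card V"
 have n: "1 \<le> n" "card (V - {i}) = n - 1" using i V by (auto simp: n_def Suc_le_eq card_gt_0_iff)
 have sub: "U \<subseteq> Pow (V - {i})" "D \<subseteq> Pow (V - {i})" using V by (auto simp: U_def D_def upsec_def dnsec_def)
 have fin: "finite U" "finite D" using fC finite_upsec by (auto simp: U_def D_def dnsec_def)
 have "U \<noteq> {}" "D \<noteq> {}"
 proof -
  obtain u d where ud: "u \<in> \<C>" "i \<in> u" "d \<in> \<C>" "i \<notin> d" using xy i0 by blast
  have "insert i (u - {i}) = u" using ud by auto
  hence "u - {i} \<in> U" using ud by (simp add: upsec_def U_def)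
  thus "U \<noteq> {}" by auto
  show "D \<noteq> {}" using ud by (auto simp: D_def dnsec_def)
 qed
 hence c1: "1 \<le> card U" "1 \<le> card D" using fin by (auto simp: Suc_le_eq card_gt_0_iff)
 have cs: "card \<C> = card U + card D" using card_sections[OF fC, of i] by (simp add: U_def D_def)
 define W where "W = V - {i}"
 have fW: "finite W" using V by (simp add: W_def)
 have small: "n + ((n - 1) choose 2) \<le> card (nbd W \<D>) + ((n - card \<D>) choose 2)"
  if "\<D> \<subseteq> Pow W" "1 \<le> card \<D>" "card \<D> \<le> n" for \<D>
  using nbd_small[of W \<D>] that n V by (simp add: W_def)
 have sU: "n + ((n - 1) choose 2) \<le> card (nbd W U) + ((n - card U) choose 2)"
  and sD: "n + ((n - 1) choose 2) \<le> card (nbd W D) + ((n - card D) choose 2)"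
  using small sub c1 cs c by (auto simp: W_def n_def)
 have tot: "card (nbd V \<C>) = card (nbd W U \<union> D) + card (nbd W D \<union> U)"
  using card_nbd_sections[OF V i] by (simp add: U_def D_def W_def)
 have uni: "card (nbd W P \<union> Q) = card (nbd W P) + card (Q - nbd W P)" if "finite Q" for P Q
  using card_Un_disjoint[of "nbd W P" "Q - nbd W P"] that fW by simp
 have le: "card U + card D \<le> n + 1" using cs c by (simp add: n_def)
 have count: "1 + n + (n choose 2) + (card U - 1) * (card D - 1)
   \<le> card (nbd W U) + card (nbd W D) + ((n + 1 - card \<C>) choose 2)"
  unfolding cs by (rule star_count[OF n(1) c1 le sU sD])
 have z: "card (D - nbd W U) + card (U - nbd W D) + (card U - 1) * (card D - 1) = 0"
  using count N unfolding tot uni[OF fin(1)] uni[OF fin(2)] n_def by linarith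
 hence DU: "D \<subseteq> nbd W U" "U \<subseteq> nbd W D" using fin by auto
 from z have "card U = 1 \<or> card D = 1" using c1 by auto
 thus ?thesis
 proof
  assume "card U = 1"
  then obtain q where q: "U = {q}" by (auto simp: card_1_singleton_iff)
  have qW: "q \<subseteq> W" using q sub by (auto simp: W_def)
  have "x \<in> nbd V {q}" if x: "x \<in> \<C>" for x
  proof (cases "i \<in> x")
   case True
   hence "insert i (x - {i}) = x" by auto
   hence "x - {i} \<in> U" using x True by (simp add: U_def upsec_def)
   hence "x = insert i q" using q True by auto
   thus ?thesis using i qW V by (intro nbdI_remove[of V _ q _ i]) (auto simp: W_def)
  next
   case False
   hence "x \<in> nbd W {q}" using x DU q by (auto simp: D_def dnsec_def)
   thus ?thesis by (auto simp: nbd_def W_def)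
  qed
  thus ?thesis using qW by (intro exI[of _ q]) (auto simp: W_def)
 next
  assume "card D = 1"
  then obtain q where q: "D = {q}" by (auto simp: card_1_singleton_iff)
  have qW: "q \<subseteq> W" using q sub by (auto simp: W_def)
  have iq: "i \<notin> q" using qW by (auto simp: W_def)
  have "x \<in> nbd V {insert i q}" if x: "x \<in> \<C>" for x
  proof (cases "i \<in> x")
   case True
   hence xe: "insert i (x - {i}) = x" by auto
   hence "x - {i} \<in> U" using x True by (simp add: U_def upsec_def)
   hence "x - {i} \<in> nbd W {q}" using DU q by auto
   hence "card (sym_diff q (x - {i})) \<le> 1" by (auto simp: nbd_def)
   moreover have "sym_diff (insert i q) x = sym_diff q (x - {i})" using True iq by auto
   ultimately show ?thesis using x V by (auto simp: nbd_def)
  next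
   case False
   hence "x = q" using x q by (auto simp: D_def dnsec_def)
   thus ?thesis using i qW V by (intro nbdI_insert[of V _ i]) (auto simp: W_def)
  qed
  thus ?thesis using qW i by (intro exI[of _ "insert i q"]) (auto simp: W_def)
 qed
qed

lemma two_pow_binom_ge: "2 ^ n = 1 + n + binom_ge n 2"
proof -
 have "2 ^ n = binom_ge n 0" using choose_row_sum[of n] by (simp add: binom_ge_def atLeast0AtMost)
 also have "\<dots> = 1 + n + binom_ge n 2"
  using binom_ge_rec[of n 0] binom_ge_rec[of n 1] by (simp add: numeral_2_eq_2)
 finally show ?thesis .
qed

text \<open>Pass to the complement: \<open>n + 1 - s\<close> sets outside the neighbourhood of
  \<open>\<A>\<close> form a small family whose neighbourhood misses \<open>\<A>\<close>. By
  \<open>nbd_small\<close> that neighbourhood is the whole complement of \<open>\<A>\<close>, and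
  the small family lies in a star. With the centre moved to the empty set it consists of singletons,
  together with the empty set or without it; these cases are the two shapes of ball.\<close>

lemma extremal_k2:
 assumes V: "finite V" "\<A> \<subseteq> Pow V" and s: "2 \<le> s" "s \<le> card V"
  and A: "card \<A> = msize (card V) s 2" "card (nbd V \<A>) \<le> msize_nbd (card V) s 2"
 shows "gball V s 2 \<A>"
proof -
 define n where "n = card V"
 have nA: "nbd V \<A> \<subseteq> Pow V" by (rule nbd_subset_Pow)
 have cP: "card (Pow V) = 1 + n + binom_ge n 2" using card_Pow[OF V(1)] two_pow_binom_ge by (simp add: n_def)
 have "card (Pow V - nbd V \<A>) = card (Pow V) - card (nbd V \<A>)"
  using V nA by (intro card_Diff_subset) auto
 hence "n + 1 - s \<le> card (Pow V - nbd V \<A>)" using A(2) cP by (simp add: msize_nbd_def n_def)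
 then obtain \<C> where C: "\<C> \<subseteq> Pow V - nbd V \<A>" "card \<C> = n + 1 - s"
  using obtain_subset_with_card_n by metis
 have CV: "\<C> \<subseteq> Pow V" using C by auto
 have dis: "\<A> \<subseteq> Pow V - nbd V \<C>"
 proof
  fix x assume x: "x \<in> \<A>"
  have "x \<notin> nbd V \<C>"
  proof
   assume "x \<in> nbd V \<C>"
   then obtain y where y: "y \<in> \<C>" "card (sym_diff y x) \<le> 1" by (auto simp: nbd_def)
   have "card (sym_diff x y) \<le> 1" using y(2) by (simp only: Un_commute)
   hence "y \<in> nbd V \<A>" using y(1) x CV unfolding nbd_def by blast
   thus False using y C by auto
  qed
  thus "x \<in> Pow V - nbd V \<C>" using x V by auto
 qed
 have cD: "card (Pow V - nbd V \<C>) = card (Pow V) - card (nbd V \<C>)"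
  using V nbd_subset_Pow by (intro card_Diff_subset) auto
 have leP: "card (nbd V \<C>) \<le> card (Pow V)" using V nbd_subset_Pow by (intro card_mono) auto
 have b2: "binom_ge n 2 = (n choose 2) + binom_ge n 3" using binom_ge_rec[of n 2] by (simp add: numeral_3_eq_3 numeral_2_eq_2)
 have "card \<A> \<le> card (Pow V - nbd V \<C>)" using dis V by (intro card_mono) auto
 hence N: "card (nbd V \<C>) + (s choose 2) \<le> 1 + n + (n choose 2)"
  using cD leP cP A(1) b2 by (simp add: msize_def n_def numeral_3_eq_3 numeral_2_eq_2)
 have ns: "n + 1 - (n + 1 - s) = s" "1 \<le> n + 1 - s" "n + 1 - s \<le> n" using s by (auto simp: n_def)
 have H: "1 + n + (n choose 2) \<le> card (nbd V \<C>) + (s choose 2)"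
  using nbd_small[OF V(1) CV] C(2) ns by (simp add: n_def)
 hence "card (Pow V - nbd V \<C>) \<le> card \<A>"
  using cD leP cP A(1) b2 by (simp add: msize_def n_def numeral_3_eq_3 numeral_2_eq_2)
 hence A_eq: "\<A> = Pow V - nbd V \<C>" using dis V by (intro card_seteq) auto
 obtain q where q: "q \<subseteq> V" "\<C> \<subseteq> nbd V {q}"
  using star_of_extremal[OF V(1) CV] N C(2) ns by (auto simp: n_def)
 define \<E> where "\<E> = flip q \<C>"
 have E: "\<E> \<subseteq> nbd V {{}}" 
 proof -
  have "flip q {q} = {{}}" unfolding flip_image by simp
  thus ?thesis using flip_mono[OF q(2), of q] nbd_flip[OF q(1), of "{q}"] by (simp add: \<E>_def)
 qed
 have E1: "x = {} \<or> (\<exists>v\<in>V. x = {v})" if "x \<in> \<E>" for x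
 proof -
  have x: "x \<subseteq> V" "card x \<le> 1" using E that by (auto simp: nbd_def)
  have "finite x" using x V finite_subset by auto
  thus ?thesis using x by (cases "x = {}") (auto simp: le_Suc_eq card_1_singleton_iff)
 qed
 have cE: "card \<E> = n + 1 - s" by (simp add: \<E>_def C)
 have fq: "flip q \<A> = Pow V - nbd V \<E>"
 proof -
  have "flip q (Pow V) = Pow V" using q unfolding flip_def by auto
  thus ?thesis unfolding A_eq flip_Diff \<E>_def nbd_flip[OF q(1)] by simp
 qed
 have cfq: "card (flip q \<A>) = msize n s 2" using A by (simp add: n_def)
 define X where "X = {v. {v} \<in> \<E>}"
 have XV: "X \<subseteq> V" using E1 by (auto simp: X_def)
 define S where "S = V - X"
 have cS: "card S = n - card X" using XV V finite_subset[OF XV] by (simp add: S_def card_Diff_subset n_def)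
 have inj: "inj_on (\<lambda>v. {v}) X" by auto
 \<comment> \<open>Any family of the right size that avoids the forbidden neighbourhood equals
   \<open>flip q \<A>\<close>; this is applied to the two standard balls.\<close>
 have key: "flip q \<A> = T" if T: "T \<subseteq> Pow V" "card T = msize n s 2"
   "\<And>x. x \<in> T \<Longrightarrow> 2 \<le> card x \<or> (x \<subseteq> S \<and> x \<noteq> {} \<and> {} \<notin> \<E>)"
   "\<And>x. x \<in> T \<Longrightarrow> card x = 2 \<Longrightarrow> x \<subseteq> S" for T
 proof -
  have "T \<subseteq> Pow V - nbd V \<E>"
  proof
   fix x assume x: "x \<in> T"
   have fx: "finite x" using x T(1) V(1) by (meson PowD finite_subset subsetD)
   have "x \<notin> nbd V \<E>"
   proof
    assume "x \<in> nbd V \<E>"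
    then obtain y where y: "y \<in> \<E>" "card (sym_diff y x) \<le> 1" by (auto simp: nbd_def)
    have fy: "finite y" using E1[OF y(1)] by auto
    from E1[OF y(1)] show False
    proof
     assume "y = {}"
     thus False using y T(3)[OF x] fx by (auto simp: le_Suc_eq card_1_singleton_iff) (metis One_nat_def card_1_singleton_iff card_eq_0_iff)?
    next
     assume "\<exists>v\<in>V. y = {v}"
     then obtain v where v: "y = {v}" by blast
     hence vX: "v \<in> X" "v \<notin> S" using y by (auto simp: X_def S_def)
     have "x = {v} \<or> (\<exists>a. a \<noteq> v \<and> x = {a, v}) \<or> x = {}"
      using iffD1[OF sym_diff_card_le_1_iff[OF fy fx] y(2)] unfolding v
      by (auto simp: singleton_insert_inj_eq singleton_insert_inj_eq')
     thus False using T(3)[OF x] T(4)[OF x] vX by (auto simp: card_insert_if)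
    qed
   qed
   thus "x \<in> Pow V - nbd V \<E>" using x T by auto
  qed
  hence "T = Pow V - nbd V \<E>" using T(2) cfq V unfolding fq by (intro card_subset_eq) auto
  thus ?thesis using fq by simp
 qed
 have fV: "S \<subseteq> V" by (auto simp: S_def)
 have "\<exists>b. card S + (if b then 0 else 1) = s \<and> flip q \<A> = std_ball b V 2 S"
 proof (cases "{} \<in> \<E>")
  case True
  hence "\<E> = insert {} ((\<lambda>v. {v}) ` X)" using E1 by (auto simp: X_def)
  hence "card \<E> = card (insert {} ((\<lambda>v. {v}) ` X))" by simp
  also have "\<dots> = Suc (card ((\<lambda>v. {v}) ` X))"
   using finite_subset[OF XV V(1)] by (intro card_insert_disjoint) auto
  also have "\<dots> = Suc (card X)" using inj by (simp add: card_image)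
  finally have "card \<E> = Suc (card X)" .
  hence "card S + (if True then 0 else 1) = s" using cS cE s by (simp add: n_def)
  moreover have "flip q \<A> = std_ball True V 2 S"
  proof (rule key[OF std_ball_subset])
   show "card (std_ball True V 2 S) = msize n s 2"
    using card_std_ball[OF V(1) fV, of 2 True] \<open>card S + (if True then 0 else 1) = s\<close> by (simp add: n_def)
  qed (auto simp: std_ball_def T1_def)
  ultimately show ?thesis by blast
 next
  case False
  hence "\<E> = (\<lambda>v. {v}) ` X" using E1 by (auto simp: X_def)
  hence "card \<E> = card X" using inj by (simp add: card_image)
  hence "card S + (if False then 0 else 1) = s" using cS cE s by (simp add: n_def)
  moreover have "flip q \<A> = std_ball False V 2 S"
  proof (rule key[OF std_ball_subset])
   show "card (std_ball False V 2 S) = msize n s 2"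
    using card_std_ball[OF V(1) fV, of 2 False] \<open>card S + (if False then 0 else 1) = s\<close> by (simp add: n_def)
  qed (use False in \<open>auto simp: std_ball_def T2_def\<close>)
  ultimately show ?thesis by blast
 qed
 then obtain b where b: "card S + (if b then 0 else 1) = s" "flip q \<A> = std_ball b V 2 S" by blast
 hence "\<A> = flip q (std_ball b V 2 S)" by (metis flip_flip)
 thus ?thesis unfolding gball_def using b q fV s by blast
qed

section \<open>Stability along a direction of the distinguished set\<close>

text \<open>The unit of error: equal to \<open>1\<close> for \<open>k = 2\<close> and obeying Pascal's rule.\<close>

definition Zc :: "nat \<Rightarrow> nat \<Rightarrow> real"
 where "Zc s k = real ((s - 3) choose (k - 2))"

lemma Zc_nonneg: "0 \<le> Zc s k"
 by (simp add: Zc_def)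

lemma Zc_pascal:
 assumes "3 \<le> k" "k < s" shows "Zc s k = Zc (s - 1) (k - 1) + Zc (s - 1) k"
proof -
 have "(s - 3) choose (k - 2) = ((s - 4) choose (k - 3)) + ((s - 4) choose (k - 2))"
  using binomial_eq_0_iff assms choose_reduce_nat[of "s - 3" "k - 2"] by (simp add: numeral_eq_Suc add.commute)
 moreover have "s - 1 - 3 = s - 4" "k - 1 - 2 = k - 3" by auto
 ultimately show ?thesis by (simp add: Zc_def)
qed

lemma Zc_eqs:
 assumes "3 \<le> k" "k \<le> s"
 defines "M \<equiv> incr s k"
  and "Mp \<equiv> real ((s - 2) choose (k - 2))" and "Mm \<equiv> real ((s - 2) choose (k - 1))"
 shows "(real s - 2) * Zc s k = (real s - real k) * Mp" "(real s - 2) * Zc s k = (real k - 1) * Mm"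
  "(real s - 1) * Mp = (real k - 1) * M" "(real s - 1) * Mm = (real s - real k) * M" "Mp + Mm = M"
  "Zc s k \<le> Mp" "Zc s k \<le> Mm" "1 \<le> Mp"
proof -
 define a r where "a = s - 3" and "r = k - 2"
 have ar: "s = a + 3" "k = r + 2" "r \<le> a + 1" "1 \<le> r" using assms(1,2) unfolding a_def r_def by linarith+
 have b1: "(a + 1) * (a choose r) = (a + 1 - r) * ((a + 1) choose r)"
  using binomial_absorb_comp[of "a + 1" r] by simp
 have b2: "(a + 1) * (a choose r) = (r + 1) * ((a + 1) choose (r + 1))"
  using Suc_times_binomial_eq[of a r] by (simp add: mult.commute)
 have b3: "(a + 2) * ((a + 1) choose r) = (r + 1) * ((a + 2) choose (r + 1))"
  using Suc_times_binomial_eq[of "a + 1" r] by (simp add: mult.commute)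
 have b4: "(a + 2) * ((a + 1) choose (r + 1)) = (a + 1 - r) * ((a + 2) choose (r + 1))"
  using binomial_absorb_comp[of "a + 2" "r + 1"] by simp
 have e: "Zc s k = real (a choose r)" "M = real ((a + 2) choose (r + 1))"
  "Mp = real ((a + 1) choose r)" "Mm = real ((a + 1) choose (r + 1))"
  unfolding Zc_def M_def Mp_def Mm_def ar(1,2) by simp_all
 have rk: "real s = real a + 3" "real k = real r + 2" using ar by simp_all
 have re: "real (a + 1 - r) = real a + 1 - real r" using ar(3) by (simp add: of_nat_diff)
 show "(real s - 2) * Zc s k = (real s - real k) * Mp"
  using arg_cong[OF b1, of real] unfolding of_nat_mult re e(1,3) rk by (simp add: algebra_simps)
 show "(real s - 2) * Zc s k = (real k - 1) * Mm"
  using arg_cong[OF b2, of real] unfolding of_nat_mult e(1,4) rk by (simp add: algebra_simps)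
 show "(real s - 1) * Mp = (real k - 1) * M"
  using arg_cong[OF b3, of real] unfolding of_nat_mult e(2,3) rk by (simp add: algebra_simps)
 show "(real s - 1) * Mm = (real s - real k) * M"
  using arg_cong[OF b4, of real] unfolding of_nat_mult re e(2,4) rk by (simp add: algebra_simps)
 show "Mp + Mm = M" unfolding e by simp
 show "Zc s k \<le> Mp" unfolding e by (cases r) (use ar in auto)
 show "Zc s k \<le> Mm" unfolding e by simp
 show "1 \<le> Mp" unfolding e using ar(3) by (metis One_nat_def Suc_leI of_nat_1 of_nat_mono zero_less_binomial)
qed

text \<open>An error \<open>\<eta> * Zc s k\<close> is later multiplied by \<open>\<theta>\<close>,
  \<open>s\<close>, \<open>k - 1\<close> or \<open>p\<close> and must stay small against
  \<open>M\<close>, \<open>Mp\<close> and \<open>Mm\<close>, the increments for the cube and for its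
  upper and lower sections. The pivot is
  \<open>(s - 1) * (s - 2) * Z = (s - k) * (k - 1) * M\<close>.\<close>

lemma Zc_ineqs:
 assumes k: "3 \<le> k" "k \<le> s"
 defines "M \<equiv> incr s k" and "p \<equiv> real s - real k + 1"
  and "Mp \<equiv> real ((s - 2) choose (k - 2))" and "Mm \<equiv> real ((s - 2) choose (k - 1))"
 shows "th (s - 1) (k - 1) * Zc s k \<le> M" "th (s - 2) (k - 2) * Zc s k \<le> Mp"
  "Zc s k * real s \<le> 2 * M * p" "Zc s k * (real k - 1) \<le> M * (real s - real k)"
  "p * Zc s k \<le> (real k - 1) * M" "Zc s k * (real k - 1) \<le> p * Mp"
  "real s \<le> 4 * real s - 8 \<Longrightarrow> Zc s k * real s \<le> 4 * Mm * (real k - 1)" "Zc s k \<le> M" "Mp \<le> M" "Mm \<le> M" "1 \<le> M"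
proof -
 define Z S K where "Z = Zc s k" and "S = real s" and "K = real k"
 note eq = Zc_eqs[OF k, folded M_def Mp_def Mm_def Z_def S_def K_def]
 have r: "3 \<le> K" "K \<le> S" "p = S - K + 1" using k by (auto simp: S_def K_def p_def)
 have nn: "0 \<le> Z" "0 \<le> Mm" "1 \<le> Mp" using Zc_nonneg eq(8) by (auto simp: Z_def Mm_def)
 have M: "1 \<le> M" "Mp \<le> M" "Mm \<le> M" using eq(5) nn by linarith+
 have c0: "(S - 1) * (S - 2) * Z = (S - K) * (K - 1) * M"
 proof -
  have "(S - 1) * (S - 2) * Z = (S - K) * ((S - 1) * Mp)" using eq(1) by (simp add: mult.assoc mult.left_commute)
  thus ?thesis unfolding eq(3) by (simp add: mult.assoc)
 qed
 have pos: "0 < (S - 1) * (S - 2)" using r by simp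
 have canc: "x \<le> y" if "(S - 1) * (S - 2) * x \<le> (S - 1) * (S - 2) * y" for x y
  using that pos by (simp only: mult_le_cancel_left_pos)
 have K1: "K \<le> S - 1" if "K < S"
 proof -
  have "Suc k \<le> s" using that by (simp add: K_def S_def)
  hence "real (Suc k) \<le> real s" by (rule of_nat_mono)
  thus ?thesis by (simp add: K_def S_def)
 qed
 have kk: "(K - 1) * (K - 1) \<le> (S - 1) * (S - 2)" if "K < S"
 proof -
  show ?thesis using K1[OF that] r by (intro mult_mono) auto
 qed
 have Z0: "Z = 0" if "\<not> K < S" using that r eq(1) by simp
 have m0: "0 \<le> (S - K) * M" "0 \<le> (S - K) * (K - 1) * M" using r M by auto
 show g4: "Zc s k * (real k - 1) \<le> M * (real s - real k)"
  unfolding Z_def[symmetric] S_def[symmetric] K_def[symmetric]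
 proof (cases "K < S")
  case True
  have "(S - 1) * (S - 2) * (Z * (K - 1)) = ((S - 1) * (S - 2) * Z) * (K - 1)" by (simp only: mult_ac)
  also have "\<dots> = ((K - 1) * (K - 1)) * ((S - K) * M)" unfolding c0 by (simp only: mult_ac)
  also have "\<dots> \<le> ((S - 1) * (S - 2)) * ((S - K) * M)" by (intro mult_right_mono kk m0 True)
  finally have "Z * (K - 1) \<le> (S - K) * M" by (rule canc)
  thus "Z * (K - 1) \<le> M * (S - K)" by (simp only: mult.commute)
 qed (use Z0 m0 in \<open>simp add: mult.commute\<close>)
 have K2: "K - 1 \<le> S - 2" if "K < S" using K1[OF that] by simp
 have g3': "(S - 1) * Z \<le> p * M"
 proof (cases "K < S")
  case True
  have "(S - 2) * ((S - 1) * Z) = (K - 1) * ((S - K) * M)" using c0 by (simp add: algebra_simps)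
  also have "\<dots> \<le> (S - 2) * ((S - K) * M)" by (intro mult_right_mono K2 m0 True)
  finally have "(S - 1) * Z \<le> (S - K) * M" using r by (simp only: mult_le_cancel_left_pos[of "S - 2"])
  thus ?thesis using M unfolding r(3) by (simp add: algebra_simps)
 qed (use Z0 r M in simp)
 show "Zc s k * real s \<le> 2 * M * p" unfolding Z_def[symmetric] S_def[symmetric]
 proof -
  have "Z * S \<le> Z * (2 * (S - 1))" using nn r by (intro mult_left_mono) auto
  thus "Z * S \<le> 2 * M * p" using g3' by (simp add: algebra_simps)
 qed
 show "p * Zc s k \<le> (real k - 1) * M" unfolding Z_def[symmetric] K_def[symmetric]
 proof (rule canc)
  have "(S - 1) * (S - 2) * (p * Z) = p * ((S - 1) * (S - 2) * Z)" by (simp only: mult_ac)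
  also have "\<dots> = (p * (S - K)) * ((K - 1) * M)" unfolding c0 by (simp only: mult_ac)
  also have "\<dots> \<le> ((S - 1) * (S - 2)) * ((K - 1) * M)" using r M by (intro mult_mono) auto
  finally show "(S - 1) * (S - 2) * (p * Z) \<le> (S - 1) * (S - 2) * ((K - 1) * M)" .
 qed
 show "Zc s k * (real k - 1) \<le> p * Mp" unfolding Z_def[symmetric] K_def[symmetric]
 proof (cases "K < S")
  case True
  have "Z * (K - 1) \<le> Z * (S - 2)" using nn K2[OF True] by (intro mult_left_mono) auto
  also have "\<dots> = (S - K) * Mp" using eq(1) by (simp add: mult.commute)
  also have "\<dots> \<le> p * Mp" using r nn by (intro mult_right_mono) auto
  finally show "Z * (K - 1) \<le> p * Mp" .
 qed (use Z0 nn r in simp)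
 show "th (s - 1) (k - 1) * Zc s k \<le> M" unfolding Z_def[symmetric]
 proof -
  have "th (s - 1) (k - 1) * p \<le> S - 1" using slope_facts(4)[of k s] k by (simp add: p_def S_def)
  hence "(th (s - 1) (k - 1) * p) * Z \<le> (S - 1) * Z" using nn by (intro mult_right_mono) auto
  hence "p * (th (s - 1) (k - 1) * Z) \<le> p * M" using g3' by (simp add: algebra_simps)
  thus "th (s - 1) (k - 1) * Z \<le> M" using r by (simp only: mult_le_cancel_left_pos)
 qed
 show "th (s - 2) (k - 2) * Zc s k \<le> Mp" unfolding Z_def[symmetric]
 proof -
  have "real (s - 1) = S - 1" "real (k - 1) = K - 1" "s - 1 - 1 = s - 2" "k - 1 - 1 = k - 2"
   using k by (auto simp: S_def K_def of_nat_diff)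
  hence "th (s - 2) (k - 2) * p \<le> S - 2" using slope_facts(4)[of "k - 1" "s - 1"] k r by simp
  hence "(th (s - 2) (k - 2) * p) * Z \<le> (S - 2) * Z" using nn by (intro mult_right_mono) auto
  also have "\<dots> = (S - K) * Mp" by (rule eq(1))
  also have "\<dots> \<le> p * Mp" using r nn by (intro mult_right_mono) auto
  finally have "p * (th (s - 2) (k - 2) * Z) \<le> p * Mp" by (simp add: algebra_simps)
  thus "th (s - 2) (k - 2) * Z \<le> Mp" using r by (simp only: mult_le_cancel_left_pos)
 qed
 show "Zc s k * real s \<le> 4 * Mm * (real k - 1)" if "real s \<le> 4 * real s - 8"
 proof -
  have "Z * S \<le> Z * (4 * (S - 2))" using nn that by (intro mult_left_mono) (auto simp: S_def)
  thus ?thesis unfolding Z_def[symmetric] S_def[symmetric] K_def[symmetric] using eq(2) by (simp add: algebra_simps)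
 qed
 show "Zc s k \<le> M" using eq(6) M unfolding Z_def by linarith
 show "Mp \<le> M" "Mm \<le> M" "1 \<le> M" by (rule M)+
qed

text \<open>Sizes along an inside direction: the sections have parameters (s-1,k-1) and (s-1,k), and
  the neighbourhood of the second has exactly the size of the first.\<close>

lemma msize_split:
 assumes "2 \<le> k" "k \<le> s" "1 \<le> n"
 shows "msize n s k = msize (n - 1) (s - 1) (k - 1) + msize (n - 1) (s - 1) k"
  "msize_nbd n s k = msize_nbd (n - 1) (s - 1) (k - 1) + msize (n - 1) (s - 1) (k - 1)"
  "msize_nbd (n - 1) (s - 1) k = msize (n - 1) (s - 1) (k - 1)"
proof -
 obtain n' where n: "n = Suc n'" using assms by (cases n) auto
 obtain k' where k: "k = Suc k'" using assms by (cases k) auto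
 obtain k'' where k': "k' = Suc k''" using assms k by (cases k') auto
 obtain s' where s: "s = Suc s'" using assms by (cases s) auto
 show "msize n s k = msize (n - 1) (s - 1) (k - 1) + msize (n - 1) (s - 1) k"
  unfolding n k s msize_def by (simp add: binom_ge_pascal)
 show "msize_nbd n s k = msize_nbd (n - 1) (s - 1) (k - 1) + msize (n - 1) (s - 1) (k - 1)"
  unfolding n k k' s msize_def msize_nbd_def by (simp add: binom_ge_pascal)
 show "msize_nbd (n - 1) (s - 1) k = msize (n - 1) (s - 1) (k - 1)"
  unfolding k msize_def msize_nbd_def by simp
qed

text \<open>The first two conditions are the window of \<open>excess_lower\<close>. The same
  \<open>\<eta>\<close> bounds the excess and the distance, which is what makes the property
  inheritable.\<close>

definition stable :: "nat set \<Rightarrow> nat \<Rightarrow> nat \<Rightarrow> real \<Rightarrow> bool"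
 where "stable V s k \<eta> \<longleftrightarrow> (\<forall>\<A>\<subseteq>Pow V.
  2 * (real (card \<A>) - real (msize (card V) s k)) \<le> incr s k \<longrightarrow>
  - 6 * th (s - 1) (k - 1) * (real (card \<A>) - real (msize (card V) s k)) \<le> incr s k \<longrightarrow>
  excess V s k \<A> \<le> \<eta> * Zc s k \<longrightarrow>
  (\<exists>\<G>. gball V s k \<G> \<and> real (card (\<G> - \<A>)) + real (card (\<A> - \<G>)) \<le> 4 * (\<eta> * Zc s k)))"

lemma stableD:
 assumes "stable V s k \<eta>" "\<A> \<subseteq> Pow V"
  "2 * (real (card \<A>) - real (msize (card V) s k)) \<le> incr s k"
  "- 6 * th (s - 1) (k - 1) * (real (card \<A>) - real (msize (card V) s k)) \<le> incr s k"
  "excess V s k \<A> \<le> \<eta> * Zc s k"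
 obtains b C S where "C \<subseteq> V" "S \<subseteq> V" "card S + (if b then 0 else 1) = s"
  "real (card (flip C (std_ball b V k S) - \<A>)) + real (card (\<A> - flip C (std_ball b V k S))) \<le> 4 * (\<eta> * Zc s k)"
proof -
 obtain \<G> where "gball V s k \<G>" "real (card (\<G> - \<A>)) + real (card (\<A> - \<G>)) \<le> 4 * (\<eta> * Zc s k)"
  using assms unfolding stable_def by blast
 thus ?thesis using that unfolding gball_def by blast
qed

text \<open>Closeness of the sections at the scale of \<open>M\<close> becomes closeness within
  \<open>4 * U\<close> by \<open>excess_stable\<close>.\<close>

lemma glue_close:
 assumes V: "finite V" "\<A> \<subseteq> Pow V" "i \<in> V" and k: "2 \<le> k" "k \<le> s" "s \<le> card V"
  and PQ: "\<P> \<subseteq> Pow (V - {i})" "\<Q> \<subseteq> Pow (V - {i})" "gball V s k (glue i \<P> \<Q>)"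
 defines "M \<equiv> incr s k"
 assumes U: "excess V s k \<A> \<le> U" "96 * th (s - 1) (k - 1) * U \<le> M"
  "\<bar>real (card \<A>) - real (msize (card V) s k)\<bar> \<le> 6 * U"
  and DE: "10 * (real (card (\<P> - upsec i \<A>)) + real (card (\<Q> - dnsec i \<A>))) \<le> M"
   "10 * (real (card (upsec i \<A> - \<P>)) + real (card (dnsec i \<A> - \<Q>))) \<le> M"
 shows "\<exists>\<G>. gball V s k \<G> \<and> real (card (\<G> - \<A>)) + real (card (\<A> - \<G>)) \<le> 4 * U"
proof (intro exI conjI)
 define \<G> where "\<G> = glue i \<P> \<Q>"
 have sub: "\<G> \<subseteq> Pow V" using gball_subset[OF PQ(3)] by (simp add: \<G>_def)
 have fin: "finite \<A>" "finite \<G>" using finite_subset_Pow[OF V(2,1)] finite_subset_Pow[OF sub V(1)] by simp_all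
 have D: "card (\<G> - \<A>) = card (\<P> - upsec i \<A>) + card (\<Q> - dnsec i \<A>)"
  unfolding card_Diff_sections[OF fin(2,1), of i] by (simp add: \<G>_def upsec_glue[OF PQ(1)] dnsec_glue[OF PQ(2)])
 have E: "card (\<A> - \<G>) = card (upsec i \<A> - \<P>) + card (dnsec i \<A> - \<Q>)"
  unfolding card_Diff_sections[OF fin, of i] by (simp add: \<G>_def upsec_glue[OF PQ(1)] dnsec_glue[OF PQ(2)])
 show "real (card (glue i \<P> \<Q> - \<A>)) + real (card (\<A> - glue i \<P> \<Q>)) \<le> 4 * U"
  unfolding \<G>_def[symmetric]
  by (rule excess_stable[OF V(1,2) sub k])
   (use PQ(3) card_gball[OF V(1) PQ(3) k(1,2)] U DE in \<open>auto simp: \<G>_def[symmetric] D E M_def\<close>)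
qed (rule PQ(3))

text \<open>Once the sizes of both sections are confined to their windows, one section is within its
  share of the excess and by induction close to a ball. The other section follows because the
  neighbourhood of the lower ball is exactly the upper ball, so that a discrepancy between them
  would show up in the lower half of the neighbourhood.\<close>

lemma S_step:
 assumes V: "finite V" "\<A> \<subseteq> Pow V" "i \<in> V" and k: "3 \<le> k" "k < s" "s \<le> card V"
  and \<eta>: "0 \<le> \<eta>" "10000 * \<eta> \<le> 1"
 defines "U \<equiv> \<eta> * Zc s k" and "t \<equiv> real (card \<A>) - real (msize (card V) s k)"
 assumes t: "\<bar>t\<bar> \<le> 6 * U" and ex: "excess V s k \<A> \<le> U"
  and big: "real (msize (card V - 1) (s - 1) (k - 1)) - 14 * U \<le> real (card (upsec i \<A>))"
  and IH: "stable (V - {i}) (s - 1) (k - 1) \<eta>" "stable (V - {i}) (s - 1) k \<eta>"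
 shows "\<exists>\<G>. gball V s k \<G> \<and> real (card (\<G> - \<A>)) + real (card (\<A> - \<G>)) \<le> 4 * U"
proof -
 define V' where "V' = V - {i}"
 define n' where "n' = card V - 1"
 define up dn where "up = upsec i \<A>" and "dn = dnsec i \<A>"
 have V': "finite V'" "card V' = n'" "up \<subseteq> Pow V'" "dn \<subseteq> Pow V'"
  using V by (auto simp: V'_def n'_def up_def dn_def upsec_def dnsec_def)
 have fin: "finite \<A>" "finite up" "finite dn" using V V' finite_subset_Pow by auto
 have n1: "1 \<le> card V" using k by simp
 define p S K where "p = real s - real k + 1" and "S = real s" and "K = real k"
 define M Mp Mm Z where "M = incr s k" and "Mp = real ((s - 2) choose (k - 2))"
  and "Mm = real ((s - 2) choose (k - 1))" and "Z = Zc s k"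
 have ks: "2 \<le> k" "k \<le> s" using k by auto
 have k3: "3 \<le> k" "k \<le> s" using k by auto
 note eq = Zc_eqs[OF k3, folded M_def Mp_def Mm_def Z_def S_def K_def]
 note iq = Zc_ineqs[OF k3, folded M_def Mp_def Mm_def Z_def S_def K_def p_def]
 have r: "3 \<le> K" "K + 1 \<le> S" "p = S - K + 1" "2 \<le> p" using k by (auto simp: S_def K_def p_def)
 have Z0: "0 \<le> Z" by (simp add: Z_def Zc_nonneg)
 have U_def': "U = \<eta> * Z" by (simp add: U_def Z_def)
 have U0: "0 \<le> U" using \<eta> Z0 by (simp add: U_def')
 have Ub: "10000 * U \<le> x" if "Z \<le> x" for x
 proof -
  have "10000 * U \<le> 1 * Z" unfolding U_def' mult.assoc[symmetric] using \<eta> Z0 by (intro mult_right_mono) auto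
  thus ?thesis using that by simp
 qed
 have Ub2: "10000 * (U * y) \<le> x" if "Z * y \<le> x" "0 \<le> y" for x y
 proof -
  have "10000 * \<eta> * (Z * y) \<le> 1 * (Z * y)" using \<eta> Z0 that by (intro mult_right_mono) auto
  thus ?thesis using that(1) by (simp add: U_def' mult_ac)
 qed
 define g gN where "g = real (msize n' (s - 1) (k - 1))" and "gN = real (msize_nbd n' (s - 1) (k - 1))"
 note ms = msize_split[OF ks n1, folded n'_def]
 \<comment> \<open>Deviations of the sections from their model sizes. Below, \<open>Q\<close> is the
   lower half of the neighbourhood minus its model size \<open>g\<close>, which is also the model
   size of the upper section.\<close>
 define \<tau> \<omega> where "\<tau> = real (card up) - g" and "\<omega> = real (card dn) - real (msize n' (s - 1) k)"
 have \<tau>\<omega>: "\<tau> + \<omega> = t"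
  using card_sections[OF fin(1), of i] ms(1) by (simp add: \<tau>_def \<omega>_def t_def g_def up_def dn_def)
 have om: "\<omega> = t - \<tau>" using \<tau>\<omega> by simp
 define rp rm ro where "rp = rho (s - 1) (k - 1)" and "rm = rho (s - 1) k" and "ro = rho s k"
 define eu ed where "eu = excess V' (s - 1) (k - 1) up" and "ed = excess V' (s - 1) k dn"
 define Nu Nd P Q where "Nu = real (card (nbd V' up))" and "Nd = real (card (nbd V' dn))"
  and "P = real (card (nbd V' up \<union> dn))" and "Q = real (card (nbd V' dn \<union> up)) - g"
 have rs: "real (s - 1) = S - 1" "real (k - 1) = K - 1" using k by (auto simp: S_def K_def of_nat_diff)
 have eu: "eu = p * (Nu - gN) - rp * \<tau>"
  unfolding eu_def excess_def V'(2) rs by (simp add: rp_def Nu_def gN_def \<tau>_def g_def r(3))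
 have ed: "ed = (p - 1) * (Nd - g) - rm * \<omega>"
  unfolding ed_def excess_def V'(2) rs ms(3) by (simp add: rm_def Nd_def g_def \<omega>_def r(3) K_def)
 have PQ: "Nu \<le> P" "Nd \<le> Q + g" "\<tau> \<le> Q"
 proof -
  have "card (nbd V' up) \<le> card (nbd V' up \<union> dn)" "card (nbd V' dn) \<le> card (nbd V' dn \<union> up)"
   "card up \<le> card (nbd V' dn \<union> up)" using V' fin by (auto intro!: card_mono)
  thus "Nu \<le> P" "Nd \<le> Q + g" "\<tau> \<le> Q" by (auto simp: Nu_def Nd_def P_def Q_def \<tau>_def)
 qed
 have exA: "p * (P - gN + Q) - ro * t \<le> U"
 proof -
  have "real (card (nbd V \<A>)) = P + (Q + g)"
   using card_nbd_sections[OF V] by (simp add: P_def Q_def up_def dn_def V'_def)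
  moreover have "real (msize_nbd (card V) s k) = gN + g" using ms(2) by (simp add: g_def gN_def)
  ultimately have "excess V s k \<A> = p * (P - gN + Q) - ro * t"
   unfolding excess_def by (simp add: p_def ro_def t_def algebra_simps)
  thus ?thesis using ex by simp
 qed
 obtain \<kappa> where \<kappa>: "0 \<le> \<kappa>" "\<kappa> \<le> 1" "1 - \<kappa> \<le> 3 * (p - 1) / S" "(1 + rp / p) * \<kappa> = ro / p"
  "rm / (p - 1) * (1 - \<kappa>) = \<kappa>" "rp / p \<le> rm / (p - 1)" "rm \<le> rp + 1" "S / 2 \<le> p + rp"
  using slope_recursion[OF k(1,2), folded p_def S_def ro_def rp_def rm_def] by blast
 have rk: "(p + rp) * \<kappa> = ro" "rm * (1 - \<kappa>) = (p - 1) * \<kappa>" "rp * (p - 1) \<le> p * rm"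
 proof -
  have pp: "p \<noteq> 0" "p - 1 \<noteq> 0" "0 < p" "0 < p - 1" using r(4) by auto
  have "p * ((1 + rp / p) * \<kappa>) = p * (ro / p)" unfolding \<kappa>(4) ..
  moreover have "p * (ro / p) = ro" "p * (1 + rp / p) = p + rp" using pp(3) by (simp_all add: field_simps)
  ultimately show "(p + rp) * \<kappa> = ro" by (metis mult.assoc)
  have "(p - 1) * (rm / (p - 1) * (1 - \<kappa>)) = (p - 1) * \<kappa>" unfolding \<kappa>(5) ..
  moreover have "(p - 1) * (rm / (p - 1)) = rm" using pp by simp
  ultimately show "rm * (1 - \<kappa>) = (p - 1) * \<kappa>" by (metis mult.assoc)
  have "(p * (p - 1)) * (rp / p) \<le> (p * (p - 1)) * (rm / (p - 1))"
   using \<kappa>(6) pp by (intro mult_left_mono) auto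
  moreover have "(p * (p - 1)) * (rp / p) = rp * (p - 1)" "(p * (p - 1)) * (rm / (p - 1)) = p * rm"
   using pp by (simp_all add: field_simps)
  ultimately show "rp * (p - 1) \<le> p * rm" by simp
 qed
 have ru: "0 \<le> rp" "rp \<le> K - 2" "0 \<le> rm" "rm \<le> K - 1" "ro \<le> K - 1" "0 \<le> ro"
  using slope_facts(1,6)[of "k - 1" "s - 1"] slope_facts(1,6)[of k "s - 1"] slope_facts(1,6)[of k s] k
  unfolding rp_def rm_def ro_def rs K_def by auto
 \<comment> \<open>The deviation from the tangential division, in which the upper section receives
   the share \<open>\<kappa>\<close> of the surplus \<open>t\<close>.\<close>
 define \<delta> where "\<delta> = \<tau> - \<kappa> * t"
 have star: "eu + rp * \<delta> + p * (Q - \<kappa> * t) \<le> U"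
 proof -
  have "p * (Nu - gN) \<le> p * (P - gN)" using PQ(1) r by (intro mult_left_mono) auto
  moreover have "ro * t = p * (\<kappa> * t) + rp * (\<kappa> * t)" unfolding rk(1)[symmetric] by (simp add: algebra_simps)
  ultimately show ?thesis using exA eu unfolding \<delta>_def by (simp add: algebra_simps)
 qed
 \<comment> \<open>Two lower bounds for the lower half: it contains the upper section, and it
   contains the neighbourhood of the lower section.\<close>
 have Q2: "\<delta> \<le> Q - \<kappa> * t" using PQ(3) by (simp add: \<delta>_def)
 have Q1: "ed - rm * \<delta> \<le> (p - 1) * (Q - \<kappa> * t)"
 proof -
  have "(p - 1) * (Nd - g) \<le> (p - 1) * Q" using PQ(2) r by (intro mult_left_mono) auto
  moreover have "rm * \<omega> = rm * (1 - \<kappa>) * t - rm * \<delta>" unfolding om \<delta>_def by (simp add: algebra_simps)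
  ultimately show ?thesis using ed unfolding rk(2) by (simp add: algebra_simps)
 qed
 have thn: "1 \<le> th (s - 2) (k - 2)" "1 \<le> th (s - 2) (k - 1)" "th (s - 2) (k - 1) * (p - 1) \<le> S - 2" "1 \<le> th (s - 1) (k - 1)"
 proof -
  have e: "s - 1 - 1 = s - 2" "k - 1 - 1 = k - 2" by auto
  show "1 \<le> th (s - 2) (k - 2)" by (rule slope_facts(3)[of "k - 1" "s - 1", unfolded e]) (use k in auto)
  show "1 \<le> th (s - 2) (k - 1)" by (rule slope_facts(3)[of k "s - 1", unfolded e]) (use k in auto)
  have "th (s - 2) (k - 1) * (real (s - 1) - real k + 1) \<le> real (s - 1) - 1"
   by (rule slope_facts(4)[of k "s - 1", unfolded e]) (use k in auto)
  thus "th (s - 2) (k - 1) * (p - 1) \<le> S - 2" unfolding rs r(3) K_def by simp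
  show "1 \<le> th (s - 1) (k - 1)" using slope_facts(3)[of k s] k by simp
 qed
 have abs_rot: "ro * t \<le> 6 * ((K - 1) * U)" "rp * (\<kappa> * t) \<le> x \<Longrightarrow> rp * (\<kappa> * t) \<le> x" for x
 proof -
  have "ro * t \<le> ro * (6 * U)" using t ru by (intro mult_left_mono) auto
  also have "\<dots> \<le> (K - 1) * (6 * U)" using ru U0 by (intro mult_right_mono) auto
  finally show "ro * t \<le> 6 * ((K - 1) * U)" by (simp add: mult_ac)
 qed
 have e2: "s - 1 - 1 = s - 2" "k - 1 - 1 = k - 2" by auto
 have Mp1: "1 \<le> Mp" by (rule eq(8))
 have UMp: "10000 * U \<le> Mp" and UMm: "10000 * U \<le> Mm" and UM: "10000 * U \<le> M"
  using Ub eq(6,7) iq(8) by auto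
 have tau_le: "\<tau> \<le> 6 * U"
 proof (cases "\<tau> \<le> 0")
  case False
  \<comment> \<open>Truncated at \<open>Mp\<close> so that \<open>nbd_bound_above\<close> applies
    before the surplus is known to be small; the resulting bound shows that nothing was cut
    off.\<close>
  define E where "E = min (card up - msize n' (s - 1) (k - 1)) ((s - 2) choose (k - 2))"
  have gl: "msize n' (s - 1) (k - 1) \<le> card up" using False by (simp add: \<tau>_def g_def)
  have E1: "E \<le> (s - 1 - 1) choose (k - 1 - 1)" "msize (card V') (s - 1) (k - 1) + E \<le> card up"
   unfolding e2 V'(2) E_def using gl by linarith+
  have E\<tau>: "real E \<le> \<tau>" using E1(2) unfolding V'(2) \<tau>_def g_def by linarith
  have "(real (k - 1) - 1) * real E + th (s - 1 - 1) (k - 1 - 1) * real E * (1 - real E / real ((s - 1 - 1) choose (k - 1 - 1)))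
   \<le> (real (s - 1) - real (k - 1) + 1) * (real (card (nbd V' up)) - real (msize_nbd (card V') (s - 1) (k - 1)))"
   by (rule nbd_bound_above[OF V'(1,3)]) (use k E1 V'(2) in \<open>auto simp: n'_def\<close>)
  hence h: "(K - 2) * real E + th (s - 2) (k - 2) * real E * (1 - real E / Mp) \<le> p * (Nu - gN)"
   unfolding rs e2 V'(2) by (simp add: Nu_def gN_def Mp_def r(3) algebra_simps)
  have EMp: "real E \<le> Mp" by (simp add: E_def Mp_def)
  have "0 \<le> th (s - 2) (k - 2) * real E * (1 - real E / Mp)"
   using thn EMp Mp1 by (intro mult_nonneg_nonneg) (auto simp: divide_le_eq_1)
  hence "(K - 2) * real E \<le> p * (P - gN)"
   using h mult_left_mono[of "Nu - gN" "P - gN" p] PQ(1) r by linarith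
  moreover have "p * real E \<le> p * Q" using E\<tau> PQ(3) r by (intro mult_left_mono) auto
  ultimately have "(K - 2) * real E + p * real E - 6 * ((K - 1) * U) \<le> U"
   using exA abs_rot(1) by (simp add: algebra_simps)
  hence "(S - 1) * real E \<le> U + 6 * ((K - 1) * U)" using r(3) by (simp add: algebra_simps)
  also have "\<dots> \<le> (S - 1) * (6 * U)"
  proof -
   have "(K - 1) * U + U \<le> (S - 1) * U" using mult_right_mono[of "K - 1 + 1" "S - 1" U] r U0 by (simp add: algebra_simps)
   thus ?thesis using U0 by linarith
  qed
  finally have E6: "real E \<le> 6 * U" using r by (simp only: mult_le_cancel_left_pos)
  hence "real E < Mp" using UMp Mp1 U0 by linarith
  hence "E < (s - 2) choose (k - 2)" by (simp add: Mp_def)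
  hence "real E = \<tau>" using gl by (auto simp: E_def \<tau>_def g_def of_nat_diff min_def split: if_splits)
  thus ?thesis using E6 by simp
 qed (use U0 in simp)
 have tau_ge: "- (14 * U) \<le> \<tau>" using big unfolding \<tau>_def g_def n'_def up_def by simp
 have wu: "2 * (real (card up) - real (msize (card V') (s - 1) (k - 1))) \<le> real ((s - 1 - 1) choose (k - 1 - 1))"
  "- 6 * th (s - 1 - 1) (k - 1 - 1) * (real (card up) - real (msize (card V') (s - 1) (k - 1))) \<le> real ((s - 1 - 1) choose (k - 1 - 1))"
 proof -
  show "2 * (real (card up) - real (msize (card V') (s - 1) (k - 1))) \<le> real ((s - 1 - 1) choose (k - 1 - 1))"
   using tau_le UMp U0 unfolding e2 V'(2) by (simp add: \<tau>_def g_def Mp_def)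
  have "th (s - 2) (k - 2) * (- \<tau>) \<le> th (s - 2) (k - 2) * (14 * U)"
   using tau_ge thn by (intro mult_left_mono) auto
  moreover have "10000 * (U * th (s - 2) (k - 2)) \<le> Mp" using iq(2) thn by (intro Ub2) (auto simp: mult.commute)
  ultimately have "- 6 * th (s - 2) (k - 2) * \<tau> \<le> Mp" using thn U0 Mp1 by (simp add: algebra_simps)
  thus "- 6 * th (s - 1 - 1) (k - 1 - 1) * (real (card up) - real (msize (card V') (s - 1) (k - 1))) \<le> real ((s - 1 - 1) choose (k - 1 - 1))"
   unfolding e2 V'(2) by (simp add: \<tau>_def g_def Mp_def)
 qed
 have eu0: "\<bar>\<tau>\<bar> \<le> 6 * eu"
  using excess_lower[OF V'(1,3) _ _ _ wu] k V'(2) by (simp add: eu_def \<tau>_def g_def n'_def)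
 have eu_nn: "0 \<le> eu" using eu0 by linarith
 have pd: "p * \<delta> \<le> p * (Q - \<kappa> * t)" using Q2 r by (intro mult_left_mono) auto
 \<comment> \<open>As \<open>p + rp\<close> is at least \<open>s / 2\<close>, a positive
   \<open>\<delta>\<close> is at most \<open>2 * U / s\<close>. The factor \<open>1 / s\<close> is
   needed for the window of the lower section.\<close>
 have \<delta>_up: "S * \<delta> \<le> 2 * U"
 proof (cases "\<delta> \<le> 0")
  case True
  hence "S * \<delta> \<le> 0" using r by (simp add: mult_nonneg_nonpos)
  thus ?thesis using U0 by linarith
 next
  case False
  have "(S / 2) * \<delta> \<le> (p + rp) * \<delta>" using \<kappa>(8) False by (intro mult_right_mono) auto
  thus ?thesis using star pd eu_nn by (simp add: algebra_simps)
 qed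
 have kt: "\<bar>\<kappa> * t\<bar> \<le> 6 * U"
 proof -
  have "\<bar>\<kappa> * t\<bar> \<le> 1 * \<bar>t\<bar>" unfolding abs_mult using \<kappa> by (intro mult_right_mono) auto
  thus ?thesis using t by simp
 qed
 have \<delta>_lo: "- (20 * U) \<le> \<delta>" using tau_ge kt unfolding \<delta>_def by linarith
 have \<omega>_up: "\<omega> \<le> 20 * U" using \<tau>\<omega> t tau_ge by linarith
 have \<omega>_lo: "S * (- \<omega>) \<le> 20 * ((p - 1) * U)"
 proof -
  have "S * (1 - \<kappa>) \<le> 3 * (p - 1)" using \<kappa>(3) r by (simp add: field_simps)
  hence "(S * (1 - \<kappa>)) * (6 * U) \<le> (3 * (p - 1)) * (6 * U)" using U0 by (intro mult_right_mono) auto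
  moreover have "(S * (1 - \<kappa>)) * (- t) \<le> (S * (1 - \<kappa>)) * (6 * U)"
   using t r \<kappa> by (intro mult_left_mono) auto
  moreover have "S * (- \<omega>) = S * \<delta> + (S * (1 - \<kappa>)) * (- t)" unfolding om \<delta>_def by (simp add: algebra_simps)
  moreover have "2 * U \<le> 2 * ((p - 1) * U)" using mult_right_mono[of 1 "p - 1" U] r U0 by simp
  moreover have "(3 * (p - 1)) * (6 * U) = 18 * ((p - 1) * U)" by simp
  ultimately show ?thesis using \<delta>_up by linarith
 qed
 have wd: "2 * (real (card dn) - real (msize (card V') (s - 1) k)) \<le> real ((s - 1 - 1) choose (k - 1))"
  "- 6 * th (s - 1 - 1) (k - 1) * (real (card dn) - real (msize (card V') (s - 1) k)) \<le> real ((s - 1 - 1) choose (k - 1))"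
 proof -
  show "2 * (real (card dn) - real (msize (card V') (s - 1) k)) \<le> real ((s - 1 - 1) choose (k - 1))"
   using \<omega>_up UMm U0 unfolding e2 V'(2) by (simp add: \<omega>_def Mm_def)
  have "th (s - 2) (k - 1) * (S * (- \<omega>)) \<le> th (s - 2) (k - 1) * (20 * ((p - 1) * U))"
   using \<omega>_lo thn by (intro mult_left_mono) auto
  also have "\<dots> = (th (s - 2) (k - 1) * (p - 1)) * (20 * U)" by (simp add: mult_ac)
  also have "\<dots> \<le> S * (20 * U)" using thn U0 by (intro mult_right_mono) auto
  finally have "S * (th (s - 2) (k - 1) * (- \<omega>)) \<le> S * (20 * U)" by (simp only: mult_ac)
  hence "th (s - 2) (k - 1) * (- \<omega>) \<le> 20 * U" using r by (simp only: mult_le_cancel_left_pos)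
  hence "- 6 * th (s - 2) (k - 1) * \<omega> \<le> Mm" using UMm U0 by (simp add: algebra_simps)
  thus "- 6 * th (s - 1 - 1) (k - 1) * (real (card dn) - real (msize (card V') (s - 1) k)) \<le> real ((s - 1 - 1) choose (k - 1))"
   unfolding e2 V'(2) by (simp add: \<omega>_def Mm_def)
 qed
 have ed0: "\<bar>\<omega>\<bar> \<le> 6 * ed"
  using excess_lower[OF V'(1,4) _ _ _ wd] k V'(2) by (simp add: ed_def \<omega>_def n'_def)
 have ed_nn: "0 \<le> ed" using ed0 by linarith
 text \<open>If both sections had excess above their share, superadditivity would contradict the bound on \<open>\<A>\<close>.\<close>
 have "eu \<le> \<eta> * Zc (s - 1) (k - 1) \<or> ed \<le> \<eta> * Zc (s - 1) k"
 proof (rule ccontr)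
  assume "\<not> ?thesis"
  moreover have "U = \<eta> * Zc (s - 1) (k - 1) + \<eta> * Zc (s - 1) k"
   unfolding U_def Zc_pascal[OF k(1,2)] by (simp add: distrib_left)
  ultimately have gt: "U < eu + ed" by linarith
  show False
  proof (cases "0 \<le> \<delta>")
   case True
   \<comment> \<open>Of the \<open>p\<close> copies of the lower half, one is bounded by the upper
     section and the other \<open>p - 1\<close> by the neighbourhood of the lower section; then
     \<open>rm \<le> rp + 1\<close> suffices.\<close>
   have "0 \<le> (rp + 1 - rm) * \<delta>" using True \<kappa>(7) by (intro mult_nonneg_nonneg) auto
   thus False using star Q1 Q2 gt by (simp add: algebra_simps)
  next
   case False
   \<comment> \<open>For negative \<open>\<delta>\<close> all \<open>p\<close> copies go to the
     neighbourhood of the lower section, and \<open>rp / p \<le> rm / (p - 1)\<close>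
     decides.\<close>
   have "p * (ed - rm * \<delta>) \<le> p * ((p - 1) * (Q - \<kappa> * t))" using Q1 r by (intro mult_left_mono) auto
   moreover have "(p - 1) * (eu + rp * \<delta> + p * (Q - \<kappa> * t)) \<le> (p - 1) * U" using star r by (intro mult_left_mono) auto
   moreover have "rp * (p - 1) * (- \<delta>) \<le> p * rm * (- \<delta>)" using rk(3) False by (intro mult_right_mono) auto
   ultimately have "(p - 1) * eu + p * ed \<le> (p - 1) * U" by (simp add: algebra_simps)
   hence "(p - 1) * (eu + ed) \<le> (p - 1) * U" using ed_nn by (simp add: algebra_simps)
   thus False using gt r by (simp add: mult_le_cancel_left_pos)
  qed
 qed
 moreover have pQ: "p * Q \<le> 21 * (S * U)"
 proof -
  have "rp * (- \<delta>) \<le> rp * (20 * U)" using \<delta>_lo ru by (intro mult_left_mono) auto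
  also have "\<dots> \<le> (K - 2) * (20 * U)" using ru U0 by (intro mult_right_mono) auto
  finally have "rp * (- \<delta>) \<le> 20 * ((K - 2) * U)" by (simp add: mult_ac)
  moreover have "p * (\<kappa> * t) \<le> p * (6 * U)" using kt r by (intro mult_left_mono) auto
  ultimately have "p * Q \<le> U + 20 * ((K - 2) * U) + 6 * (p * U)" using star eu_nn by (simp add: algebra_simps)
  moreover have "S * U = p * U + (K - 2) * U + U" unfolding r(3) by (simp add: algebra_simps)
  moreover have "0 \<le> p * U" "0 \<le> (K - 2) * U" using r U0 by auto
  ultimately show ?thesis using U0 by linarith
 qed
 have UM': "10000 * (th (s - 1) (k - 1) * U) \<le> M"
  using Ub2[of "th (s - 1) (k - 1)" M] iq(1) thn by (simp add: mult.commute)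
 have SUp: "10000 * (S * U) \<le> 2 * (M * p)" using Ub2[of S "2 * (M * p)"] iq(3) r by (simp add: mult_ac)
 have M1: "1 \<le> M" using iq by simp
 have Q_le: "200 * Q \<le> M"
 proof -
  have "10000 * (p * Q) \<le> 42 * (M * p)" using pQ SUp by linarith
  hence "p * (10000 * Q) \<le> p * (42 * M)" by (simp add: mult_ac)
  hence "10000 * Q \<le> 42 * M" using r by (simp only: mult_le_cancel_left_pos)
  thus ?thesis using M1 by linarith
 qed
 have kV: "k - 1 \<le> s - 1" "s - 1 \<le> card V'" "k \<le> s - 1" using k V' by (auto simp: n'_def)
 have finish: "\<exists>\<G>. gball V s k \<G> \<and> real (card (\<G> - \<A>)) + real (card (\<A> - \<G>)) \<le> 4 * U"
  if fb: "C \<subseteq> V'" "S' \<subseteq> V'" "card S' + (if b then 0 else 1) = s - 1"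
   "10 * (real (card (flip C (std_ball b V' (k - 1) S') - up)) + real (card (flip C (std_ball b V' k S') - dn))) \<le> M"
   "10 * (real (card (up - flip C (std_ball b V' (k - 1) S'))) + real (card (dn - flip C (std_ball b V' k S')))) \<le> M"
  for C S' b
 proof (rule glue_close[OF V ks k(3)])
  show "flip C (std_ball b V' (k - 1) S') \<subseteq> Pow (V - {i})" "flip C (std_ball b V' k S') \<subseteq> Pow (V - {i})"
   using flip_subset_Pow[OF fb(1) std_ball_subset] by (auto simp: V'_def)
  show "gball V s k (glue i (flip C (std_ball b V' (k - 1) S')) (flip C (std_ball b V' k S')))"
   unfolding V'_def by (rule gball_glue[OF V(1,3)]) (use fb k in \<open>auto simp: V'_def\<close>)
  show "96 * th (s - 1) (k - 1) * U \<le> real (s - 1 choose (k - 1))"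
   using UM' thn U0 unfolding M_def[symmetric] by (simp add: mult.assoc) (smt (verit) mult_nonneg_nonneg)
 qed (use ex t fb in \<open>auto simp: t_def up_def dn_def M_def\<close>)
 ultimately show ?thesis
 proof (elim disjE)
  assume *: "eu \<le> \<eta> * Zc (s - 1) (k - 1)"
  obtain b C S' where g: "C \<subseteq> V'" "S' \<subseteq> V'" "card S' + (if b then 0 else 1) = s - 1"
   "real (card (flip C (std_ball b V' (k - 1) S') - up)) + real (card (up - flip C (std_ball b V' (k - 1) S'))) \<le> 4 * (\<eta> * Zc (s - 1) (k - 1))"
   by (rule stableD[OF IH(1)[folded V'_def] V'(3) wu *[unfolded eu_def]])
  define Gp Gm where "Gp = flip C (std_ball b V' (k - 1) S')" and "Gm = flip C (std_ball b V' k S')"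
  define xa xb xc xd where "xa = real (card (Gp - up))" and "xb = real (card (up - Gp))"
   and "xc = real (card (Gm - dn))" and "xd = real (card (dn - Gm))"
  have xnn: "0 \<le> xa" "0 \<le> xb" "0 \<le> xc" "0 \<le> xd" by (simp_all add: xa_def xb_def xc_def xd_def)
  have sub: "Gp \<subseteq> Pow V'" "Gm \<subseteq> Pow V'" using flip_subset_Pow[OF g(1) std_ball_subset] by (auto simp: Gp_def Gm_def)
  have fG: "finite Gp" "finite Gm" using finite_subset_Pow[OF _ V'(1)] sub by auto
  have Zp: "\<eta> * Zc (s - 1) (k - 1) \<le> U"
   unfolding U_def Zc_pascal[OF k(1,2)] using \<eta> Zc_nonneg by (intro mult_left_mono) auto
  have nG: "nbd V' Gm = Gp"
   unfolding Gm_def Gp_def nbd_flip[OF g(1)] using nbd_std_ball(1)[OF V'(1) g(2) ks(1) g(3)[symmetric]] kV by simp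
  have cGm: "card Gm = msize n' (s - 1) k"
   using card_std_ball[OF V'(1) g(2), of k b] g(3) k V'(2) by (simp add: Gm_def)
  define X where "X = card (dn - Gm)"
  have cX: "card (Gm \<union> dn) = card Gm + X" unfolding X_def
   using card_Un_disjoint[of Gm "dn - Gm"] fG fin by (simp add: Un_Diff_cancel)
  have XD: "real X = xd" by (simp add: X_def xd_def)
  define Y where "Y = min X ((s - 2) choose (k - 1))"
  have "(K - 1) * real Y + th (s - 1 - 1) (k - 1) * real Y * (1 - real Y / real ((s - 1 - 1) choose (k - 1)))
   \<le> (real (s - 1) - K + 1) * (real (card (nbd V' (Gm \<union> dn))) - real (msize_nbd (card V') (s - 1) k))"
  proof -
   have Y: "Y \<le> (s - 1 - 1) choose (k - 1)" "msize (card V') (s - 1) k + Y \<le> card (Gm \<union> dn)"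
    unfolding e2 V'(2) cX cGm Y_def by simp_all
   have "Gm \<union> dn \<subseteq> Pow V'" using sub(2) V'(4) by (rule Un_least)
   thus ?thesis unfolding K_def by (rule nbd_bound_above[OF V'(1) _ ks(1) kV(3,2) Y])
  qed
  hence h: "(K - 1) * real Y + th (s - 2) (k - 1) * real Y * (1 - real Y / Mm)
   \<le> (p - 1) * (real (card (nbd V' (Gm \<union> dn))) - g)"
   unfolding rs e2 V'(2) ms(3) by (simp add: Mm_def g_def r(3))
  have YM: "real Y \<le> Mm" by (simp add: Y_def Mm_def)
  have "0 < (s - 2) choose (k - 1)" using k by (intro zero_less_binomial) linarith
  hence Mm1: "1 \<le> Mm" unfolding Mm_def by linarith
  have nn: "0 \<le> th (s - 2) (k - 1) * real Y * (1 - real Y / Mm)"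
   using thn YM Mm1 by (intro mult_nonneg_nonneg) (auto simp: divide_le_eq_1)
  have "real (card (nbd V' (Gm \<union> dn))) - g \<le> Q + xa"
  proof -
   \<comment> \<open>Adding \<open>Gm\<close> to the lower section enlarges its half of the
     neighbourhood only by the members of \<open>Gp\<close> missing from \<open>up\<close>. So the
     surplus \<open>X\<close> of \<open>Gm \<union> dn\<close> over \<open>Gm\<close> is cheap,
     hence small.\<close>
   have "nbd V' (Gm \<union> dn) \<subseteq> (nbd V' dn \<union> up) \<union> (Gp - up)" unfolding nbd_Un nG by auto
   hence "card (nbd V' (Gm \<union> dn)) \<le> card ((nbd V' dn \<union> up) \<union> (Gp - up))"
    using V' fin fG by (intro card_mono) auto
   also have "\<dots> \<le> card (nbd V' dn \<union> up) + card (Gp - up)" by (rule card_Un_le)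
   finally show ?thesis by (simp add: Q_def xa_def xb_def)
  qed
  moreover have DEp: "xa + xb \<le> 4 * U" using g(4) Zp unfolding xa_def xb_def Gp_def by linarith
  ultimately have nb: "real (card (nbd V' (Gm \<union> dn))) - g \<le> Q + 4 * U" using xnn(2) by linarith
  have Yle: "(K - 1) * real Y \<le> (p - 1) * (Q + 4 * U)"
   using h nn mult_left_mono[OF nb, of "p - 1"] r(4) by linarith
  note Yle
  also have "(p - 1) * (Q + 4 * U) \<le> p * (Q + 4 * U)"
  proof -
   have "0 \<le> Q + 4 * U"
   proof -
    have "0 \<le> (K - 1) * real Y" using r by simp
    hence "0 \<le> (p - 1) * (Q + 4 * U)" using Yle by linarith
    thus ?thesis using r by (simp add: zero_le_mult_iff)
   qed
   thus ?thesis by (intro mult_right_mono) auto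
  qed
  also have "\<dots> \<le> 25 * (S * U)"
  proof -
   have "p * U \<le> S * U" using r U0 by (intro mult_right_mono) auto
   thus ?thesis using pQ by (simp add: algebra_simps)
  qed
  finally have h2: "(K - 1) * real Y \<le> 25 * (S * U)" .
  have "10000 * (U * S) \<le> 4 * Mm * (K - 1)" using iq(7) r by (intro Ub2) (auto simp: S_def)
  hence "(K - 1) * (100 * real Y) \<le> (K - 1) * Mm"
   using h2 Mm1 r mult_nonneg_nonneg[of Mm "K - 1"] by (simp add: algebra_simps)
  hence Y1: "100 * real Y \<le> Mm" using r by (simp only: mult_le_cancel_left_pos)
  hence "real Y < Mm" using Mm1 by linarith
  hence YX: "Y = X" by (auto simp: Y_def Mm_def min_def split: if_splits)
  have "xc = real X - \<omega>"
  proof -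
   have "card (Gm \<union> dn) = card dn + card (Gm - dn)"
    using card_Un_disjoint[of dn "Gm - dn"] fG fin by (simp add: Un_Diff_cancel Un_commute)
   thus ?thesis using cX cGm by (simp add: \<omega>_def xc_def)
  qed
  moreover have "- \<omega> \<le> 20 * U" using \<tau>\<omega> t tau_le by linarith
  ultimately have "100 * xc \<le> Mm + 2000 * U" using Y1 YX by linarith
  note step = this
  have fin1: "10 * (xa + xc) \<le> M"
   using step DEp Y1 UM iq(10) M1 U0 xnn XD unfolding YX distrib_left by linarith
  have fin2: "10 * (xb + xd) \<le> M"
   using step DEp Y1 UM iq(10) M1 U0 xnn XD unfolding YX distrib_left by linarith
  show ?thesis by (rule finish[OF g(1-3) fin1[unfolded xa_def xb_def xc_def xd_def Gp_def Gm_def] fin2[unfolded xa_def xb_def xc_def xd_def Gp_def Gm_def]])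
 next
  assume *: "ed \<le> \<eta> * Zc (s - 1) k"
  obtain b C S' where g: "C \<subseteq> V'" "S' \<subseteq> V'" "card S' + (if b then 0 else 1) = s - 1"
   "real (card (flip C (std_ball b V' k S') - dn)) + real (card (dn - flip C (std_ball b V' k S'))) \<le> 4 * (\<eta> * Zc (s - 1) k)"
   by (rule stableD[OF IH(2)[folded V'_def] V'(4) wd *[unfolded ed_def]])
  define Gp Gm where "Gp = flip C (std_ball b V' (k - 1) S')" and "Gm = flip C (std_ball b V' k S')"
  define xa xb xc xd where "xa = real (card (Gp - up))" and "xb = real (card (up - Gp))"
   and "xc = real (card (Gm - dn))" and "xd = real (card (dn - Gm))"
  have xnn: "0 \<le> xa" "0 \<le> xb" "0 \<le> xc" "0 \<le> xd" by (simp_all add: xa_def xb_def xc_def xd_def)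
  have sub: "Gp \<subseteq> Pow V'" "Gm \<subseteq> Pow V'" using flip_subset_Pow[OF g(1) std_ball_subset] by (auto simp: Gp_def Gm_def)
  have fG: "finite Gp" "finite Gm" using finite_subset_Pow[OF _ V'(1)] sub by auto
  have Zm: "\<eta> * Zc (s - 1) k \<le> U"
   unfolding U_def Zc_pascal[OF k(1,2)] using \<eta> Zc_nonneg by (intro mult_left_mono) auto
  have nG: "nbd V' Gm = Gp"
   unfolding Gm_def Gp_def nbd_flip[OF g(1)] using nbd_std_ball(1)[OF V'(1) g(2) ks(1) g(3)[symmetric]] kV by simp
  have cGm: "card Gm = msize n' (s - 1) k" and cGp: "card Gp = msize n' (s - 1) (k - 1)"
   using card_std_ball[OF V'(1) g(2), of k b] card_std_ball[OF V'(1) g(2), of "k - 1" b] g(3) k V'(2)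
   by (auto simp: Gm_def Gp_def)
  have DEm: "xc + xd \<le> 4 * U" using g(4) Zm unfolding xc_def xd_def Gm_def by linarith
  define D where "D = card (Gm - dn)"
  have cD: "card (dn \<inter> Gm) + D = card Gm" unfolding D_def
   using card_Int_Diff[OF fG(2), of dn] by (simp add: Int_commute)
  have D_xc: "real D = xc" by (simp add: D_def xc_def)
  have DM: "D \<le> (s - 2) choose (k - 1)" using DEm UMm xnn D_xc U0 unfolding Mm_def by linarith
  \<comment> \<open>For \<open>s = k + 1\<close> the unit of the lower section is 0, so
    \<open>dn\<close> contains the ball exactly.\<close>
  have D0: "k < s - 1 \<or> D = 0"
  proof (cases "k < s - 1")
   case False
   hence "s = k + 1" using k by simp
   hence "Zc (s - 1) k = 0" using k by (simp add: Zc_def)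
   thus ?thesis using g(4) xnn D_xc unfolding xc_def xd_def Gm_def by simp
  qed simp
  have "th (s - 1 - 1) (k - 1) * real D * (1 - real D / real ((s - 1 - 1) choose (k - 1))) - (K - 1) * real D
   \<le> (real (s - 1) - K + 1) * (real (card (nbd V' (dn \<inter> Gm))) - real (msize_nbd (card V') (s - 1) k))"
  proof -
   have Y: "D \<le> (s - 1 - 1) choose (k - 1)" "msize (card V') (s - 1) k \<le> card (dn \<inter> Gm) + D"
    unfolding e2 V'(2) using DM cD cGm by simp_all
   have "dn \<inter> Gm \<subseteq> Pow V'" using V'(4) by (rule le_infI1)
   thus ?thesis unfolding K_def by (rule nbd_bound_below[OF V'(1) _ ks(1) kV(3,2) Y D0])
  qed
  hence h: "th (s - 2) (k - 1) * real D * (1 - real D / Mm) - (K - 1) * real D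
   \<le> (p - 1) * (real (card (nbd V' (dn \<inter> Gm))) - g)"
   unfolding rs e2 V'(2) ms(3) by (simp add: Mm_def g_def r(3))
  have "0 \<le> th (s - 2) (k - 1) * real D * (1 - real D / Mm)"
   using thn DM by (intro mult_nonneg_nonneg) (auto simp: divide_le_eq_1 Mm_def)
  \<comment> \<open>The neighbourhood of \<open>dn \<inter> Gm\<close> lies in \<open>Gp\<close>, so
    every member of \<open>up\<close> outside \<open>Gp\<close> is an additional element of the
    lower half.\<close>
  moreover have "real (card (nbd V' (dn \<inter> Gm))) + xb \<le> Q + g"
  proof -
   have "nbd V' (dn \<inter> Gm) \<subseteq> Gp" using nbd_mono[of "dn \<inter> Gm" Gm V'] nG by auto
   hence "nbd V' (dn \<inter> Gm) \<inter> (up - Gp) = {}" by auto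
   hence "card (nbd V' (dn \<inter> Gm)) + card (up - Gp) = card (nbd V' (dn \<inter> Gm) \<union> (up - Gp))"
    using V' fin by (intro card_Un_disjoint[symmetric]) auto
   also have "\<dots> \<le> card (nbd V' dn \<union> up)"
    using V' fin nbd_mono[of "dn \<inter> Gm" dn V'] by (intro card_mono) auto
   finally show ?thesis by (simp add: Q_def xa_def xb_def)
  qed
  ultimately have tn: "0 \<le> th (s - 2) (k - 1) * real D * (1 - real D / Mm)"
   and nb: "xb - Q \<le> g - real (card (nbd V' (dn \<inter> Gm)))" by auto
  have "(p - 1) * (xb - Q) \<le> (p - 1) * (g - real (card (nbd V' (dn \<inter> Gm))))"
   using nb r(4) by (intro mult_left_mono) auto
  also have "\<dots> = - ((p - 1) * (real (card (nbd V' (dn \<inter> Gm))) - g))" by (simp add: algebra_simps)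
  also have "\<dots> \<le> (K - 1) * real D" using h tn by linarith
  also have "\<dots> \<le> (K - 1) * (4 * U)" using DEm r xnn D_xc by (intro mult_left_mono) auto
  finally have a1: "(p - 1) * (xb - Q) \<le> 4 * (U * (K - 1))" by (simp add: mult_ac)
  have "10000 * (U * (K - 1)) \<le> M * (p - 1)" using iq(4) r by (intro Ub2) auto
  moreover have "(p - 1) * (10000 * (xb - Q)) = 10000 * ((p - 1) * (xb - Q))" by (simp only: mult_ac)
  moreover have "(p - 1) * (4 * M) = 4 * (M * (p - 1))" by (simp only: mult_ac)
  ultimately have "(p - 1) * (10000 * (xb - Q)) \<le> (p - 1) * (4 * M)" using a1 by linarith
  hence "10000 * (xb - Q) \<le> 4 * M" using r by (simp only: mult_le_cancel_left_pos)
  hence E1: "100 * xb \<le> M" using Q_le M1 unfolding right_diff_distrib by linarith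
  have "xa = xb - \<tau>"
  proof -
   have "card (Gp \<union> up) = card up + card (Gp - up)" "card (Gp \<union> up) = card Gp + card (up - Gp)"
    using card_Un_disjoint[of up "Gp - up"] card_Un_disjoint[of Gp "up - Gp"] fG fin
    by (simp_all add: Un_Diff_cancel Un_commute)
   thus ?thesis using cGp by (simp add: \<tau>_def g_def xa_def xb_def)
  qed
  hence "100 * xa \<le> M + 1400 * U" using E1 tau_ge by linarith
  note step = this
  have fin1: "10 * (xa + xc) \<le> M"
   using step DEm E1 UM M1 U0 xnn unfolding distrib_left by linarith
  have fin2: "10 * (xb + xd) \<le> M"
   using step DEm E1 UM M1 U0 xnn unfolding distrib_left by linarith
  show ?thesis by (rule finish[OF g(1-3) fin1[unfolded xa_def xb_def xc_def xd_def Gp_def Gm_def] fin2[unfolded xa_def xb_def xc_def xd_def Gp_def Gm_def]])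
 qed
qed

lemma card_flip_Diff: "card (flip C \<A> - flip C \<B>) = card (\<A> - \<B>)"
 unfolding flip_Diff[symmetric] by simp

lemma closeness_flip:
 assumes "C \<subseteq> V" "\<exists>\<G>. gball V s k \<G> \<and> real (card (\<G> - flip C \<A>)) + real (card (flip C \<A> - \<G>)) \<le> x"
 shows "\<exists>\<G>. gball V s k \<G> \<and> real (card (\<G> - \<A>)) + real (card (\<A> - \<G>)) \<le> x"
proof -
 obtain \<G> where G: "gball V s k \<G>" "real (card (\<G> - flip C \<A>)) + real (card (flip C \<A> - \<G>)) \<le> x"
  using assms by blast
 have "card (flip C \<G> - \<A>) = card (\<G> - flip C \<A>)" "card (\<A> - flip C \<G>) = card (flip C \<A> - \<G>)"
  using card_flip_Diff[of C "flip C \<G>" \<A>] card_flip_Diff[of C \<A> "flip C \<G>"] by simp_all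
 thus ?thesis using G gball_flip[OF G(1) assms(1)] by (intro exI[of _ "flip C \<G>"]) simp
qed

text \<open>The case \<open>s = k\<close>, where \<open>Zc s k = 0\<close> and everything is exact.\<close>

lemma S_step_exact:
 assumes V: "finite V" "\<A> \<subseteq> Pow V" "i \<in> V" and k: "3 \<le> k" "k < card V"
  and A: "card \<A> = msize (card V) k k" "card (nbd V \<A>) \<le> msize_nbd (card V) k k"
  and big: "msize (card V - 1) (k - 1) (k - 1) \<le> card (upsec i \<A>)"
  and IH: "stable (V - {i}) (k - 1) (k - 1) 0"
 shows "gball V k k \<A>"
proof -
 define V' where "V' = V - {i}"
 define n' where "n' = card V - 1"
 define up dn where "up = upsec i \<A>" and "dn = dnsec i \<A>"
 have V': "finite V'" "card V' = n'" "up \<subseteq> Pow V'" "dn \<subseteq> Pow V'"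
  using V by (auto simp: V'_def n'_def up_def dn_def upsec_def dnsec_def)
 have fin: "finite \<A>" "finite up" "finite dn" using finite_subset_Pow[OF V(2,1)] finite_subset_Pow[OF V'(3,1)] finite_subset_Pow[OF V'(4,1)] by simp_all
 define g gN where "g = msize n' (k - 1) (k - 1)" and "gN = msize_nbd n' (k - 1) (k - 1)"
 have n1: "1 \<le> card V" and k2: "2 \<le> k" "k \<le> k" and k1: "2 \<le> k - 1" "k - 1 \<le> k - 1" "k - 1 \<le> card V'"
  and kn: "k \<le> card V'"
  using k V'(2) by (auto simp: n'_def)
 note ms = msize_split[OF k2 n1, folded n'_def, folded g_def gN_def]
 have cA: "card up + card dn = g + msize n' (k - 1) k"
  using card_sections[OF fin(1), of i] A(1) ms(1) by (simp add: up_def dn_def)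
 have cN: "card (nbd V' up \<union> dn) + card (nbd V' dn \<union> up) \<le> gN + g"
  using card_nbd_sections[OF V] A(2) ms(2) by (simp add: up_def dn_def V'_def)
 have le: "card (nbd V' up) \<le> card (nbd V' up \<union> dn)" "card up \<le> card (nbd V' dn \<union> up)"
  using V' fin by (auto intro!: card_mono)
 have gle: "g \<le> card up" using big by (simp add: g_def n'_def up_def)
 have ng: "gN \<le> card (nbd V' up)"
  using nbd_bound_above[OF V'(1,3) k1, of 0] gle V'(2) by (simp add: g_def gN_def)
 have up: "card up = g" "card (nbd V' up) = gN" "card (nbd V' dn \<union> up) = card up" using le gle ng cN by linarith+
 have t0: "real (card up) - real (msize (card V') (k - 1) (k - 1)) = 0" using up(1) V'(2) by (simp add: g_def)
 have w: "2 * (real (card up) - real (msize (card V') (k - 1) (k - 1))) \<le> real ((k - 1 - 1) choose (k - 1 - 1))"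
  "- 6 * th (k - 1 - 1) (k - 1 - 1) * (real (card up) - real (msize (card V') (k - 1) (k - 1))) \<le> real ((k - 1 - 1) choose (k - 1 - 1))"
  unfolding t0 by simp_all
 have ex: "excess V' (k - 1) (k - 1) up \<le> 0 * Zc (k - 1) (k - 1)"
  unfolding excess_def t0 using up(2) V'(2) by (simp add: gN_def)
 obtain b C S where g: "C \<subseteq> V'" "S \<subseteq> V'" "card S + (if b then 0 else 1) = k - 1"
  "real (card (flip C (std_ball b V' (k - 1) S) - up)) + real (card (up - flip C (std_ball b V' (k - 1) S))) \<le> 4 * (0 * Zc (k - 1) (k - 1))"
  by (rule stableD[OF IH(1)[folded V'_def] V'(3) w ex])
 define Gp Gm where "Gp = flip C (std_ball b V' (k - 1) S)" and "Gm = flip C (std_ball b V' k S)"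
 have sub: "Gp \<subseteq> Pow V'" "Gm \<subseteq> Pow V'" using flip_subset_Pow[OF g(1) std_ball_subset] by (auto simp: Gp_def Gm_def)
 have fG: "finite Gp" "finite Gm" using finite_subset_Pow[OF _ V'(1)] sub by auto
 have z: "real (card (Gp - up)) + real (card (up - Gp)) \<le> 0" using g(4) by (simp add: Gp_def)
 have "card (Gp - up) = 0 \<and> card (up - Gp) = 0"
  using z of_nat_0_le_iff[of "card (Gp - up)", where 'a = real] of_nat_0_le_iff[of "card (up - Gp)", where 'a = real]
  by (smt (verit) of_nat_eq_0_iff)
 hence upG: "up = Gp" using fG fin by auto
 have cGm: "card Gm = msize n' (k - 1) k" using card_std_ball[OF V'(1) g(2), of k b] g(3) k V'(2) by (simp add: Gm_def)
 have nGm: "nbd V' Gm \<subseteq> Gp"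
  unfolding Gm_def Gp_def nbd_flip[OF g(1)] using nbd_std_ball_subset[OF V'(1) g(2), of k b] k flip_mono by simp
 have ndn: "nbd V' dn \<subseteq> Gp"
 proof -
  have "up = nbd V' dn \<union> up" using up(3) V' fin by (intro card_subset_eq) auto
  thus ?thesis using upG by blast
 qed
 have cdn: "card dn = card Gm" using cA up cGm by simp
 \<comment> \<open>A larger union would have at least the size of the ball with parameters
   \<open>k\<close>, \<open>k\<close>, whose neighbourhood is larger than \<open>Gp\<close> by
   \<open>k - 1\<close> sets.\<close>
 have "card (Gm \<union> dn) \<le> card Gm"
 proof (rule ccontr)
  assume "\<not> ?thesis"
  moreover have "msize n' (k - 1) k = binom_ge n' (Suc k)" using k by (simp add: msize_def binomial_eq_0)
  ultimately have "msize (card V') k k + 0 \<le> card (Gm \<union> dn)" using cGm V'(2) by (simp add: msize_def)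
  hence "0 \<le> (real k - real k + 1) * (real (card (nbd V' (Gm \<union> dn))) - real (msize_nbd (card V') k k))"
   using nbd_bound_above[OF V'(1), of "Gm \<union> dn" k k 0] sub(2) V'(4) k2 kn by simp
  hence "msize_nbd n' k k \<le> card (nbd V' (Gm \<union> dn))" using V'(2) by simp
  also have "\<dots> \<le> card Gp" using nGm ndn fG by (intro card_mono) (auto simp: nbd_Un)
  finally have "msize_nbd n' k k \<le> g" using up(1) upG by simp
  moreover have "k choose (k - 1) = k" using binomial_symmetric[of "k - 1" k] k by simp
  ultimately show False using k by (simp add: msize_nbd_def g_def msize_def)
 qed
 hence cU: "card (Gm \<union> dn) = card Gm" using card_mono[of "Gm \<union> dn" Gm] fG fin by simp
 have "Gm = Gm \<union> dn" by (rule card_subset_eq) (use fG fin cU in auto)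
 moreover have "dn = Gm \<union> dn" by (rule card_subset_eq) (use fG fin cU cdn in auto)
 ultimately have "dn = Gm" by simp
 have "gball V k k (glue i Gp Gm)" unfolding V'_def Gp_def Gm_def
  by (rule gball_glue[OF V(1,3)]) (use g k in \<open>auto simp: V'_def\<close>)
 thus ?thesis using glue_sections[of i \<A>] upG \<open>dn = Gm\<close> by (simp add: up_def dn_def)
qed

text \<open>All sets of size at least \<open>k\<close> form the block boundary
  \<open>j = card V\<close>, and the extra \<open>g\<close> sets lie one layer below. The parameter
  \<open>s\<close> only fixes the number of points in the shadow estimate, so that the result can be
  added to bounds for a ball of parameter \<open>s\<close>.\<close>

lemma full_plus:
 assumes V: "finite V" "\<A> \<subseteq> Pow V" and k: "2 \<le> k" "k \<le> s" "s \<le> card V + 1" "k \<le> card V"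
  and g: "binom_ge (card V) k + g \<le> card \<A>" "g \<le> (s - 1) choose (k - 1)"
 defines "M \<equiv> incr s k"
 shows "(real k - 1) * real g + th (s - 1) (k - 1) * real g * (1 - real g / M)
  \<le> (real s - real k + 1) * (real (card (nbd V \<A>)) - real (binom_ge (card V) (k - 1)))"
proof -
 have "(s - 1) choose (k - 1) \<le> card V choose (k - 1)" using k by (intro binomial_right_mono) auto
 then obtain \<F> where F: "uniform (k - 1) \<F>" "card \<F> = g"
  "binom_ge (card V) k + (card V choose (k - 1)) + card (shadow \<F>) \<le> card (nbd V \<A>)"
  using nbd_bound[OF V, of k "card V" g] k g binom_ge_rec[of "card V" k] by auto
 have b: "binom_ge (card V) (k - 1) = (card V choose (k - 1)) + binom_ge (card V) k"
  using binom_ge_rec[of "card V" "k - 1"] k by simp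
 have rs: "real (s - 1) = real s - 1" "real (k - 1) = real k - 1" using k by (auto simp: of_nat_diff)
 have "(real k - 1) * real g + th (s - 1) (k - 1) * real g * (1 - real g / M)
   \<le> (real s - real k + 1) * real (card (shadow \<F>))"
  using shadow_bound[OF F(1), of "s - 1"] k g(2) unfolding F(2) rs M_def by (simp add: algebra_simps)
 also have "\<dots> \<le> (real s - real k + 1) * (real (card (nbd V \<A>)) - real (binom_ge (card V) (k - 1)))"
  using F(3) b k by (intro mult_left_mono) auto
 finally show ?thesis .
qed

section \<open>Sizes of the sections along an arbitrary direction\<close>

lemma concave_term:
 fixes a M :: real
 assumes "0 \<le> a" "0 < M" "5 * a \<le> 3 * M"
 shows "2 * a \<le> 5 * (a * (1 - a / M))"
proof -
 have "a / M \<le> 3 / 5" using assms(2,3) by (simp add: divide_le_eq)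
 hence "a * (2 / 5) \<le> a * (1 - a / M)" using assms(1) by (intro mult_left_mono) auto
 moreover have "2 * a = 5 * (a * (2 / 5))" by simp
 ultimately show ?thesis by linarith
qed

lemma two_term_bound:
 fixes U \<theta> t c A B :: real
 assumes "1 \<le> \<theta>" "0 \<le> c" "c \<le> \<theta>" "\<bar>t\<bar> \<le> 6 * U" "c * t + \<theta> * (A + B) \<le> U"
 shows "A + B \<le> 7 * U"
proof -
 have U: "0 \<le> U" using assms(4) by linarith
 have "- (c * t) \<le> c * (6 * U)" using mult_left_mono[of "- t" "6 * U" c] assms(2,4) by simp
 also have "\<dots> \<le> \<theta> * (6 * U)" using assms(3) U by (intro mult_right_mono) auto
 finally have "\<theta> * (A + B) \<le> U + \<theta> * (6 * U)" using assms(5) by linarith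
 moreover have "U \<le> \<theta> * U" using mult_right_mono[OF assms(1) U] by simp
 ultimately have "\<theta> * (A + B) \<le> \<theta> * (7 * U)" by simp
 thus ?thesis using assms(1) by (simp add: mult_le_cancel_left)
qed

text \<open>By \<open>concave_term\<close> the sum \<open>2 * x + 2 * y\<close> is at most
  \<open>35 * U\<close>, and \<open>y\<close> is at least \<open>x - 6 * U\<close>; hence
  47.\<close>

lemma two_term_small:
 fixes x y M U t :: real
 assumes "0 \<le> x" "0 \<le> y" "0 < M" "5 * x \<le> 3 * M" "5 * y \<le> 3 * M" "\<bar>y - x\<bar> \<le> 6 * U"
  "x * (1 - x / M) + y * (1 - y / M) \<le> 7 * U"
 shows "4 * x \<le> 47 * U"
 using concave_term[OF assms(1,3,4)] concave_term[OF assms(2,3,5)] assms(6,7) by linarith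

lemma msize_split':
 assumes "1 \<le> k" "1 \<le> n"
 shows "msize n s k = binom_ge (n - 1) k + msize (n - 1) s k"
  "msize_nbd n s k = binom_ge (n - 1) (k - 1) + msize_nbd (n - 1) s k"
proof -
 obtain n' where n: "n = Suc n'" using assms by (cases n) auto
 obtain k' where k: "k = Suc k'" using assms by (cases k) auto
 show "msize n s k = binom_ge (n - 1) k + msize (n - 1) s k"
  unfolding n k msize_def by (simp add: binom_ge_pascal)
 show "msize_nbd n s k = binom_ge (n - 1) (k - 1) + msize_nbd (n - 1) s k"
  unfolding n k msize_nbd_def by (simp add: binom_ge_pascal)
qed

lemma nbd_sections_ge:
 assumes "finite V" "\<A> \<subseteq> Pow V" "i \<in> V"
 shows "card (nbd (V - {i}) (upsec i \<A>)) + card (nbd (V - {i}) (dnsec i \<A>)) \<le> card (nbd V \<A>)"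
proof -
 have "finite (upsec i \<A>)" "finite (dnsec i \<A>)"
  using finite_subset_Pow[OF upsec_subset[OF assms(2)]] finite_subset_Pow[OF dnsec_subset[OF assms(2)]] assms(1) by simp_all
 thus ?thesis unfolding card_nbd_sections[OF assms] using assms(1) by (intro add_mono card_mono) auto
qed

text \<open>In a ball the upper section exceeds \<open>binom_ge (card V - 1) k\<close> by 0 for an
  outside direction and by \<open>M\<close> for an inside one. For a surplus \<open>a\<close> in
  between, the upper section pays \<open>a * (1 - a / M)\<close> in the concave term, and the lower
  section, with deficit \<open>a - t\<close>, pays nearly the same. This exceeds the budget unless
  \<open>a\<close> is within \<open>47 * U / 4\<close> of an end, which is below
  \<open>14 * U\<close>.\<close>

lemma dichotomy:
 assumes V: "finite V" "\<A> \<subseteq> Pow V" "i \<in> V" and k: "3 \<le> k" "k \<le> s" "s < card V"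
 defines "M \<equiv> incr s k" and "t \<equiv> real (card \<A>) - real (msize (card V) s k)"
  and "a \<equiv> real (card (upsec i \<A>)) - real (binom_ge (card V - 1) k)"
 assumes U: "0 \<le> U" "1000 * U \<le> M" "s = k \<Longrightarrow> U = 0" and t: "\<bar>t\<bar> \<le> 6 * U" and ex: "excess V s k \<A> \<le> U"
  and a: "14 * U < a"
 shows "M - 14 * U \<le> a"
proof (rule ccontr)
 assume "\<not> ?thesis"
 hence a2: "a < M - 14 * U" by simp
 define V' where "V' = V - {i}"
 define n' where "n' = card V - 1"
 define up dn where "up = upsec i \<A>" and "dn = dnsec i \<A>"
 have V': "finite V'" "card V' = n'" "up \<subseteq> Pow V'" "dn \<subseteq> Pow V'"
  using V by (auto simp: V'_def n'_def up_def dn_def upsec_def dnsec_def)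
 have fin: "finite \<A>" using finite_subset_Pow[OF V(2,1)] .
 have k2: "2 \<le> k" "k \<le> s" "s \<le> card V'" "1 \<le> k" "1 \<le> card V" using k V'(2) by (auto simp: n'_def)
 define \<theta> p where "\<theta> = th (s - 1) (k - 1)" and "p = real s - real k + 1"
 note sf = slope_facts[OF k2(1,2), folded \<theta>_def p_def]
 note ms = msize_split'[OF k2(4,5), of s, folded n'_def]
 define g where "g = card up - binom_ge n' k"
 have gl: "binom_ge n' k \<le> card up" using a U(1) unfolding a_def n'_def up_def by linarith
 have ga: "real g = a" using gl unfolding g_def a_def n'_def up_def by (simp add: of_nat_diff)
 have gM: "g \<le> (s - 1) choose (k - 1)" using a2 ga U(1) unfolding M_def by linarith
 have cs: "real (card up) + real (card dn) = real (binom_ge n' k) + real (msize n' s k) + t"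
  using card_sections[OF fin, of i] ms(1) by (simp add: up_def dn_def t_def)
 have tU: "t \<le> 6 * U" "- (6 * U) \<le> t" using t by linarith+
 define d where "d = msize n' s k - card dn"
 have dl: "card dn \<le> msize n' s k" using cs a U(1) tU(1) unfolding a_def n'_def[symmetric] up_def[symmetric] by linarith
 have da: "real d = a - t" using dl cs unfolding d_def a_def n'_def[symmetric] up_def[symmetric] by (simp add: of_nat_diff)
 have dM: "d \<le> (s - 1) choose (k - 1)" using a2 da tU U(1) unfolding M_def by linarith
 have d0: "k < s \<or> d = 0"
 proof (cases "k < s")
  case False
  hence "U = 0" "M = 1" using k U(3) by (auto simp: M_def)
  hence "0 < real g" "real g < 1" using a a2 ga by auto
  thus ?thesis by simp
 qed simp
 have h1: "(real k - 1) * a + \<theta> * a * (1 - a / M) \<le> p * (real (card (nbd V' up)) - real (binom_ge n' (k - 1)))"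
 proof -
  have pre: "binom_ge (card V') k + g \<le> card up" "s \<le> card V' + 1" "k \<le> card V'"
   using gl k2(2,3) unfolding V'(2) g_def by simp_all
  show ?thesis using full_plus[OF V'(1,3) k2(1,2) pre(2,3,1) gM]
   unfolding ga V'(2) M_def[symmetric] \<theta>_def[symmetric] p_def[symmetric] .
 qed
 have h2: "\<theta> * (a - t) * (1 - (a - t) / M) - (real k - 1) * (a - t) \<le> p * (real (card (nbd V' dn)) - real (msize_nbd n' s k))"
 proof -
  have pre: "msize (card V') s k \<le> card dn + d" using dl unfolding V'(2) d_def by simp
  show ?thesis using nbd_bound_below[OF V'(1,4) k2(1-3) dM pre d0]
   unfolding da V'(2) M_def[symmetric] \<theta>_def[symmetric] p_def[symmetric] .
 qed
 define A1 A2 where "A1 = a * (1 - a / M)" and "A2 = (a - t) * (1 - (a - t) / M)"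
 have h1': "(real k - 1) * a + \<theta> * A1 \<le> p * (real (card (nbd V' up)) - real (binom_ge n' (k - 1)))"
  using h1 by (simp add: A1_def mult.assoc)
 have h2': "\<theta> * A2 - (real k - 1) * (a - t) \<le> p * (real (card (nbd V' dn)) - real (msize_nbd n' s k))"
  using h2 by (simp add: A2_def mult.assoc)
 have "p * (real (card (nbd V' up)) + real (card (nbd V' dn)) - real (binom_ge n' (k - 1)) - real (msize_nbd n' s k)) - rho s k * t \<le> U"
 proof -
  have "real (card (nbd V' up)) + real (card (nbd V' dn)) \<le> real (card (nbd V \<A>))"
   using nbd_sections_ge[OF V] unfolding up_def dn_def V'_def by linarith
  hence "p * (real (card (nbd V' up)) + real (card (nbd V' dn)) - real (binom_ge n' (k - 1)) - real (msize_nbd n' s k))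
   \<le> p * (real (card (nbd V \<A>)) - real (msize_nbd (card V) s k))"
   using ms(2) sf(7) by (intro mult_left_mono) auto
  thus ?thesis using ex unfolding excess_def p_def t_def by linarith
 qed
 hence "(real k - 1 - rho s k) * t + \<theta> * (A1 + A2) \<le> U"
  using h1' h2' by (simp add: algebra_simps)
 hence AB: "a * (1 - a / M) + (a - t) * (1 - (a - t) / M) \<le> 7 * U"
  using sf(1-3) t unfolding A1_def A2_def by (intro two_term_bound[of \<theta> "real k - 1 - rho s k" t]) auto
 have M0: "0 < M" using k by (simp add: M_def)
 show False
 proof (cases "2 * a \<le> M")
  case True
  have c: "0 \<le> a" "0 \<le> a - t" "5 * a \<le> 3 * M" "5 * (a - t) \<le> 3 * M" "\<bar>a - t - a\<bar> \<le> 6 * U"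
   using True a tU U(1,2) t unfolding right_diff_distrib by auto
  have "4 * a \<le> 47 * U" by (rule two_term_small[OF c(1,2) M0 c(3-5) AB])
  thus False using a U(1) by linarith
 next
  case False
  \<comment> \<open>The concave term is symmetric about \<open>M / 2\<close>, so the upper end
    reduces to the lower one.\<close>
  have e: "a * (1 - a / M) = (M - a) * (1 - (M - a) / M)"
   "(a - t) * (1 - (a - t) / M) = (M - (a - t)) * (1 - (M - (a - t)) / M)"
   using M0 by (simp_all add: field_simps)
  have c: "0 \<le> M - a" "0 \<le> M - (a - t)" "5 * (M - a) \<le> 3 * M" "5 * (M - (a - t)) \<le> 3 * M" "\<bar>M - (a - t) - (M - a)\<bar> \<le> 6 * U"
   using False a2 tU U(1,2) t M0 unfolding right_diff_distrib by auto
  have "4 * (M - a) \<le> 47 * U" by (rule two_term_small[OF c(1,2) M0 c(3-5) AB[unfolded e]])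
  thus False using a2 U(1) unfolding right_diff_distrib by linarith
 qed
qed

text \<open>For \<open>s = card V\<close> both sections are measured from the same full ball and
  together have surplus \<open>M + t\<close>. Concavity pushes one surplus to 0 and the other to
  \<open>M\<close>, and the larger section gets \<open>M\<close>: every direction is inside, up to a
  flip.\<close>

lemma full_big:
 assumes V: "finite V" "\<A> \<subseteq> Pow V" "i \<in> V" and k: "3 \<le> k" "k < card V"
 defines "n \<equiv> card V"
 defines "M \<equiv> incr n k" and "t \<equiv> real (card \<A>) - real (msize n n k)"
 assumes U: "0 \<le> U" "1000 * U \<le> M" and t: "\<bar>t\<bar> \<le> 6 * U" and ex: "excess V n k \<A> \<le> U"
  and le: "card (dnsec i \<A>) \<le> card (upsec i \<A>)"
 shows "real (msize (n - 1) (n - 1) (k - 1)) - 14 * U \<le> real (card (upsec i \<A>))"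
proof (rule ccontr)
 assume neg: "\<not> ?thesis"
 define V' where "V' = V - {i}"
 define n' where "n' = n - 1"
 define up dn where "up = upsec i \<A>" and "dn = dnsec i \<A>"
 have V': "finite V'" "card V' = n'" "up \<subseteq> Pow V'" "dn \<subseteq> Pow V'"
  using V by (auto simp: V'_def n'_def n_def up_def dn_def upsec_def dnsec_def)
 have fin: "finite \<A>" using finite_subset_Pow[OF V(2,1)] .
 have k2: "2 \<le> k" "k \<le> n" "n \<le> card V' + 1" "k \<le> card V'" "1 \<le> k" "1 \<le> n" using k V'(2) by (auto simp: n'_def n_def)
 define \<theta> p where "\<theta> = th (n - 1) (k - 1)" and "p = real n - real k + 1"
 note sf = slope_facts[OF k2(1,2), folded \<theta>_def p_def]
 define B where "B = real (binom_ge n' k)"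
 have bM: "real (binom_ge n' (k - 1)) = B + M"
  using binom_ge_rec[of n' "k - 1"] k2(5) by (simp add: B_def M_def n'_def)
 have mg: "real (msize (n - 1) (n - 1) (k - 1)) = B + M" using k2(5) by (simp add: msize_def B_def M_def n'_def)
 have mA: "real (msize n n k) = B + (B + M)"
 proof -
  have "msize n n k = binom_ge n k" unfolding msize_def using binom_ge_rec[of n k] by simp
  also have "\<dots> = binom_ge n' k + binom_ge n' (k - 1)"
   using binom_ge_pascal[of n' "k - 1"] k2(5,6) by (simp add: n'_def)
  finally show ?thesis using bM by (simp add: B_def)
 qed
 have mN: "real (msize_nbd n n k) = 2 * (B + M) + real (n' choose (k - 2))"
 proof -
  have e: "Suc (k - 2) = k - 1" using k2 by simp
  have "msize_nbd n n k = binom_ge n (k - 1)"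
   unfolding msize_nbd_def using binom_ge_rec[of n "k - 1"] k2(5) by simp
  also have "\<dots> = binom_ge n' (k - 1) + binom_ge n' (k - 2)"
   using binom_ge_pascal[of n' "k - 2"] k2(6) e by (simp add: n'_def)
  also have "binom_ge n' (k - 2) = (n' choose (k - 2)) + binom_ge n' (k - 1)"
   using binom_ge_rec[of n' "k - 2"] e by simp
  finally show ?thesis using bM by simp
 qed
 have pc: "p * real (n' choose (k - 2)) = (real k - 1) * M"
  using binom_ratio[OF k2(1,2)] by (simp add: p_def n'_def M_def)
 define a b where "a = real (card up) - B" and "b = real (card dn) - B"
 have tU: "t \<le> 6 * U" "- (6 * U) \<le> t" using t by linarith+
 have ab: "a + b = M + t" "b \<le> a" "a < M - 14 * U"
  using card_sections[OF fin, of i] mA le neg mg by (auto simp: a_def b_def up_def dn_def t_def)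
 have M0: "0 < M" using k2 by (simp add: M_def)
 have pos: "0 \<le> a" "0 \<le> b" "b \<le> M" using ab tU U M0 by linarith+
 define ga gb where "ga = card up - binom_ge n' k" and "gb = card dn - binom_ge n' k"
 have gl: "binom_ge n' k \<le> card up" "binom_ge n' k \<le> card dn" using pos unfolding a_def b_def B_def by linarith+
 have ge: "real ga = a" "real gb = b" using gl by (simp_all add: ga_def gb_def a_def b_def B_def of_nat_diff)
 have gM: "ga \<le> (n - 1) choose (k - 1)" "gb \<le> (n - 1) choose (k - 1)"
  using ab(3) pos(3) ge U(1) unfolding M_def by linarith+
 have pre: "binom_ge (card V') k + ga \<le> card up" "binom_ge (card V') k + gb \<le> card dn"
  using gl V'(2) by (simp_all add: ga_def gb_def)
 define A1 A2 where "A1 = a * (1 - a / M)" and "A2 = b * (1 - b / M)"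
 have h1: "(real k - 1) * a + \<theta> * a * (1 - a / M) \<le> p * (real (card (nbd V' up)) - (B + M))"
  using full_plus[OF V'(1,3) k2(1-4) pre(1) gM(1)] unfolding ge V'(2) bM M_def[symmetric] \<theta>_def[symmetric] p_def[symmetric] .
 have h2: "(real k - 1) * b + \<theta> * b * (1 - b / M) \<le> p * (real (card (nbd V' dn)) - (B + M))"
  using full_plus[OF V'(1,4) k2(1-4) pre(2) gM(2)] unfolding ge V'(2) bM M_def[symmetric] \<theta>_def[symmetric] p_def[symmetric] .
 have "p * (real (card (nbd V' up)) + real (card (nbd V' dn)) - 2 * (B + M)) - (real k - 1) * M - rho n k * t \<le> U"
 proof -
  have "real (card (nbd V' up)) + real (card (nbd V' dn)) \<le> real (card (nbd V \<A>))"
   using nbd_sections_ge[OF V] unfolding up_def dn_def V'_def by linarith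
  hence "p * (real (card (nbd V' up)) + real (card (nbd V' dn)) - 2 * (B + M) - real (n' choose (k - 2)))
   \<le> p * (real (card (nbd V \<A>)) - real (msize_nbd n n k))"
   using mN sf(7) by (intro mult_left_mono) auto
  hence "p * (real (card (nbd V' up)) + real (card (nbd V' dn)) - 2 * (B + M)) - p * real (n' choose (k - 2))
   \<le> p * (real (card (nbd V \<A>)) - real (msize_nbd n n k))" by (simp add: right_diff_distrib)
  thus ?thesis using ex unfolding excess_def n_def[symmetric] p_def[symmetric] t_def pc by linarith
 qed
 moreover have "(real k - 1) * (a + b) = (real k - 1) * (M + t)" unfolding ab(1) ..
 ultimately have "(real k - 1 - rho n k) * t + \<theta> * (A1 + A2) \<le> U"
  using h1[unfolded mult.assoc, folded A1_def] h2[unfolded mult.assoc, folded A2_def] by (simp add: algebra_simps)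
 hence AB: "a * (1 - a / M) + b * (1 - b / M) \<le> 7 * U"
  using sf(1-3) t unfolding A1_def A2_def by (intro two_term_bound[of \<theta> "real k - 1 - rho n k" t]) auto
 have e: "a * (1 - a / M) = (M - a) * (1 - (M - a) / M)" using M0 by (simp add: field_simps)
 have c: "0 \<le> M - a" "5 * (M - a) \<le> 3 * M" "5 * b \<le> 3 * M" "\<bar>b - (M - a)\<bar> \<le> 6 * U"
  using ab pos tU U t M0 unfolding right_diff_distrib by auto
 have "4 * (M - a) \<le> 47 * U" by (rule two_term_small[OF c(1) pos(2) M0 c(2-4) AB[unfolded e]])
 thus False using ab(3) U(1) unfolding right_diff_distrib by linarith
qed

text \<open>The budget is so small that integrality makes both the size and the neighbourhood
  extremal, and the ball is then exact.\<close>

lemma stable_k2: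
 assumes V: "finite V" and s: "2 \<le> s" "s \<le> card V" and \<eta>: "0 \<le> \<eta>" "10000 * \<eta> \<le> 1"
 shows "stable V s 2 \<eta>"
 unfolding stable_def
proof (intro allI impI)
 fix \<A> :: "nat set set"
 define t where "t = real (card \<A>) - real (msize (card V) s 2)"
 assume A: "\<A> \<subseteq> Pow V" and w: "2 * (real (card \<A>) - real (msize (card V) s 2)) \<le> real ((s - 1) choose (2 - 1))"
  "- 6 * th (s - 1) (2 - 1) * (real (card \<A>) - real (msize (card V) s 2)) \<le> real ((s - 1) choose (2 - 1))"
  and ex: "excess V s 2 \<A> \<le> \<eta> * Zc s 2"
 have Z: "Zc s 2 = 1" by (simp add: Zc_def)
 have "\<bar>t\<bar> \<le> 6 * excess V s 2 \<A>" unfolding t_def by (rule excess_lower[OF V A _ s w]) simp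
 hence "\<bar>t\<bar> < 1" using ex \<eta> Z by simp
 hence t0: "card \<A> = msize (card V) s 2" unfolding t_def by linarith
 have "(real s - 1) * (real (card (nbd V \<A>)) - real (msize_nbd (card V) s 2)) < 1"
  using ex \<eta> Z t0 unfolding excess_def by simp
 hence "card (nbd V \<A>) \<le> msize_nbd (card V) s 2"
 proof (rule contrapos_pp)
  assume "\<not> card (nbd V \<A>) \<le> msize_nbd (card V) s 2"
  hence "1 * 1 \<le> (real s - 1) * (real (card (nbd V \<A>)) - real (msize_nbd (card V) s 2))"
   using s by (intro mult_mono) auto
  thus "\<not> (real s - 1) * (real (card (nbd V \<A>)) - real (msize_nbd (card V) s 2)) < 1" by simp
 qed
 hence "gball V s 2 \<A>" using extremal_k2[OF V A s t0] by simp
 thus "\<exists>\<G>. gball V s 2 \<G> \<and> real (card (\<G> - \<A>)) + real (card (\<A> - \<G>)) \<le> 4 * (\<eta> * Zc s 2)"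
  using \<eta> Z by (intro exI[of _ \<A>]) simp
qed

text \<open>The ball is a single point and \<open>Zc k k = 0\<close>; any one-element family is a
  flip of \<open>{V}\<close>.\<close>

lemma stable_top:
 assumes V: "finite V" and k: "3 \<le> k" "k = card V"
 shows "stable V k k \<eta>"
 unfolding stable_def
proof (intro allI impI)
 fix \<A> :: "nat set set"
 assume A: "\<A> \<subseteq> Pow V" and w: "2 * (real (card \<A>) - real (msize (card V) k k)) \<le> incr k k"
  "- 6 * th (k - 1) (k - 1) * (real (card \<A>) - real (msize (card V) k k)) \<le> incr k k"
  and ex: "excess V k k \<A> \<le> \<eta> * Zc k k"
 have Z: "Zc k k = 0" using k by (simp add: Zc_def binomial_eq_0)
 have "\<bar>real (card \<A>) - real (msize (card V) k k)\<bar> \<le> 6 * excess V k k \<A>"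
  by (rule excess_lower[OF V A _ _ _ w]) (use k in auto)
 hence "card \<A> = msize (card V) k k" using ex Z by simp
 moreover have "msize (card V) k k = 1" using k by (simp add: msize_def binom_ge_def)
 ultimately obtain x where x: "\<A> = {x}" by (auto simp: card_1_singleton_iff)
 have "T1 V k V = {V}"
 proof (intro set_eqI iffI)
  fix y assume "y \<in> T1 V k V"
  hence y: "y \<subseteq> V" "k \<le> card y" by (auto simp: T1_def)
  hence "y = V" using V k(2) card_seteq by blast
  thus "y \<in> {V}" by simp
 qed (use k in \<open>auto simp: T1_def\<close>)
 hence "flip (V - x) (std_ball True V k V) = {sym_diff V (V - x)}" by (simp add: std_ball_def flip_image)
 also have "sym_diff V (V - x) = x" using A x by auto
 finally have fl: "flip (V - x) (std_ball True V k V) = {x}" .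
 have "gball V k k \<A>" unfolding gball_def
 proof (intro exI conjI)
  show "V - x \<subseteq> V" by auto
  show "V \<subseteq> V" by (rule subset_refl)
  show "card V + (if True then 0 else 1) = k" using k by simp
  show "k \<le> card V" using k by simp
  show "\<A> = flip (V - x) (std_ball True V k V)" using fl x by simp
 qed
 thus "\<exists>\<G>. gball V k k \<G> \<and> real (card (\<G> - \<A>)) + real (card (\<A> - \<G>)) \<le> 4 * (\<eta> * Zc k k)"
  using Z by (intro exI[of _ \<A>]) simp
qed

lemma U_bounds:
 assumes k: "3 \<le> k" "k \<le> s" and \<eta>: "0 \<le> \<eta>" "N * \<eta> \<le> 1" "0 \<le> N"
 defines "U \<equiv> \<eta> * Zc s k" and "M \<equiv> incr s k" and "p \<equiv> real s - real k + 1"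
  and "Mp \<equiv> real ((s - 2) choose (k - 2))"
 shows "0 \<le> U" "N * U \<le> M" "N * U \<le> Mp" "N * (th (s - 1) (k - 1) * U) \<le> M" "N * (U * (real k - 1)) \<le> p * Mp"
  "N * (p * U) \<le> (real k - 1) * M" "N * (U * real s) \<le> 2 * M * p" "N * (U * (real k - 1)) \<le> M * (real s - real k)"
  "s = k \<Longrightarrow> U = 0"
proof -
 have sc: "N * (U * y) \<le> x" if "Zc s k * y \<le> x" "0 \<le> y" for x y
 proof -
  have "(N * \<eta>) * (Zc s k * y) \<le> 1 * (Zc s k * y)" using \<eta> Zc_nonneg that by (intro mult_right_mono) auto
  thus ?thesis using that(1) by (simp add: U_def mult_ac)
 qed
 have r: "3 \<le> real k" "real k \<le> real s" using k by auto
 have th1: "1 \<le> th (s - 1) (k - 1)" using slope_facts(3)[of k s] k by simp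
 note iq = Zc_ineqs[OF k, folded M_def p_def Mp_def]
 show "0 \<le> U" using \<eta> Zc_nonneg by (simp add: U_def)
 show "N * U \<le> M" using sc[of 1 M] iq(8) by simp
 show "N * U \<le> Mp" using sc[of 1 Mp] Zc_eqs(6)[OF k] by (simp add: Mp_def)
 show "N * (th (s - 1) (k - 1) * U) \<le> M" using sc[of "th (s - 1) (k - 1)" M] iq(1) th1 by (simp add: mult.commute)
 show "N * (U * (real k - 1)) \<le> p * Mp" using sc[of "real k - 1"] iq(6) r by simp
 show "N * (p * U) \<le> (real k - 1) * M" using sc[of p] iq(5) r by (simp add: mult.commute p_def)
 show "N * (U * real s) \<le> 2 * M * p" using sc[of "real s"] iq(3) by simp
 show "N * (U * (real k - 1)) \<le> M * (real s - real k)" using sc[of "real k - 1"] iq(4) r by simp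
 show "U = 0" if "s = k"
 proof -
  have "Zc s k = 0" using that k by (simp add: Zc_def binomial_eq_0)
  thus ?thesis by (simp add: U_def)
 qed
qed

text \<open>Kept separate because only inside directions occur here, while the treatment of outside
  directions relies on this result.\<close>

lemma stable_full:
 assumes "finite V" "2 \<le> k" "k \<le> card V" "0 \<le> \<eta>" "10000 * \<eta> \<le> 1"
 shows "stable V (card V) k \<eta>"
 using assms
proof (induction "card V" arbitrary: V k)
 case (Suc n')
 define n where "n = card V"
 have V: "finite V" and \<eta>: "0 \<le> \<eta>" "10000 * \<eta> \<le> 1" using Suc.prems by auto
 have n: "n = Suc n'" using Suc.hyps(2) by (simp add: n_def)
 have "k = 2 \<or> (3 \<le> k \<and> k = n) \<or> (3 \<le> k \<and> k < n)" using Suc.prems(2,3) unfolding n_def by linarith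
 then consider "k = 2" | "3 \<le> k" "k = n" | "3 \<le> k" "k < n" by blast
 thus ?case
 proof cases
  case 1 thus ?thesis using stable_k2[OF V _ _ \<eta>] Suc.prems by simp
 next
  case 2 thus ?thesis using stable_top[OF V, of k] by (simp add: n_def)
 next
  case 3
  have k2: "2 \<le> k" "k \<le> n" "n \<le> card V" "k < card V" using 3 by (auto simp: n_def)
  show ?thesis unfolding n_def[symmetric] stable_def
  proof (intro allI impI)
   fix \<A> :: "nat set set"
   define U where "U = \<eta> * Zc n k"
   define t where "t = real (card \<A>) - real (msize n n k)"
   assume A: "\<A> \<subseteq> Pow V" and w: "2 * (real (card \<A>) - real (msize n n k)) \<le> incr n k"
    "- 6 * th (n - 1) (k - 1) * (real (card \<A>) - real (msize n n k)) \<le> incr n k"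
    and ex: "excess V n k \<A> \<le> \<eta> * Zc n k"
   have "\<bar>t\<bar> \<le> 6 * excess V n k \<A>" unfolding t_def
    using excess_lower[OF V A k2(1) _ _ w[unfolded n_def]] k2 by (simp add: n_def)
   hence t: "\<bar>t\<bar> \<le> 6 * U" using ex by (simp add: U_def)
   note ub = U_bounds[OF 3(1) k2(2) \<eta>, folded U_def]
   have U: "0 \<le> U" "1000 * U \<le> incr n k" using ub(1,2) by auto
   obtain i where i: "i \<in> V" using n n_def by fastforce
   have cV: "n' = card (V - {i})" "n - 1 = card (V - {i})" using i V n by (simp_all add: n_def)
   have le: "2 \<le> k - 1" "k - 1 \<le> card (V - {i})" "2 \<le> k" "k \<le> card (V - {i})"
    using 3 n unfolding cV(1)[symmetric] by linarith+
   have fV: "finite (V - {i})" using V by simp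
   have IH: "stable (V - {i}) (n - 1) (k - 1) \<eta>" "stable (V - {i}) (n - 1) k \<eta>"
    unfolding cV(2) by (rule Suc.hyps(1)[OF cV(1) fV le(1,2) \<eta>] Suc.hyps(1)[OF cV(1) fV le(3,4) \<eta>])+
   have step: "\<exists>\<G>. gball V n k \<G> \<and> real (card (\<G> - \<B>)) + real (card (\<B> - \<G>)) \<le> 4 * U"
    if B: "\<B> \<subseteq> Pow V" "card \<B> = card \<A>" "excess V n k \<B> \<le> U" "card (dnsec i \<B>) \<le> card (upsec i \<B>)" for \<B>
   proof -
    have tB: "\<bar>real (card \<B>) - real (msize (card V) n k)\<bar> \<le> 6 * (\<eta> * Zc n k)"
     using t B(2) unfolding t_def U_def n_def by simp
    have big: "real (msize (card V - 1) (n - 1) (k - 1)) - 14 * (\<eta> * Zc n k) \<le> real (card (upsec i \<B>))"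
     using full_big[OF V B(1) i 3(1) k2(4), folded n_def, OF U tB[folded U_def, unfolded n_def, folded n_def] B(3,4)]
     unfolding U_def n_def .
    show ?thesis unfolding U_def
     by (rule S_step[OF V B(1) i 3(1,2) k2(3) \<eta> tB B(3)[unfolded U_def] big IH])
   qed
   have "\<exists>\<G>. gball V n k \<G> \<and> real (card (\<G> - \<A>)) + real (card (\<A> - \<G>)) \<le> 4 * U"
   proof (cases "card (dnsec i \<A>) \<le> card (upsec i \<A>)")
    case True
    thus "\<exists>\<G>. gball V n k \<G> \<and> real (card (\<G> - \<A>)) + real (card (\<A> - \<G>)) \<le> 4 * U"
     using step[OF A] ex by (simp add: U_def)
   next
    case False
    \<comment> \<open>A flip along \<open>i\<close> exchanges the two sections, so the upper one may
      be taken to be the larger.\<close>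
    have iV: "{i} \<subseteq> V" using i by simp
    show "\<exists>\<G>. gball V n k \<G> \<and> real (card (\<G> - \<A>)) + real (card (\<A> - \<G>)) \<le> 4 * U"
     by (rule closeness_flip[OF iV], rule step)
      (use False ex flip_subset_Pow[OF iV A] in \<open>simp_all add: U_def excess_flip[OF iV] upsec_flip1 dnsec_flip1\<close>)
   qed
   thus "\<exists>\<G>. gball V n k \<G> \<and> real (card (\<G> - \<A>)) + real (card (\<A> - \<G>)) \<le> 4 * (\<eta> * Zc n k)"
    unfolding U_def .
  qed
 qed
qed simp

section \<open>The chain of integer points on the Lovasz curve\<close>

lemma Sg_chord: "real k * (real a + 2) \<le> (real a + 1) * (real a + real k + 1) * Sg (a + k) k"
proof (induction k)
 case 0 show ?case by (simp add: Sg_def)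
next
 case (Suc k)
 define P K T where "P = real a + 1" and "K = real k" and "T = Sg (a + k) k"
 have pos: "0 < P" "0 \<le> K" by (auto simp: P_def K_def)
 have T: "Sg (a + Suc k) (Suc k) = T + 1 / (P + K)" using Sg_Suc[of "a + k" k] by (simp add: T_def P_def K_def add_ac)
 have IH: "K * (P + 1) \<le> P * (P + K) * T" using Suc by (simp add: P_def K_def T_def add_ac)
 have "(K + 1) * (P + 1) * (P + K) \<le> (K * (P + 1) + P) * (P + K + 1)"
  using pos by (simp add: algebra_simps)
 also have "\<dots> \<le> (P * (P + K) * T + P) * (P + K + 1)" using IH pos by (intro mult_right_mono) auto
 also have "\<dots> = (P * (P + K + 1) * (T + 1 / (P + K))) * (P + K)" using pos by (simp add: field_simps)
 finally have "(K + 1) * (P + 1) \<le> P * (P + K + 1) * (T + 1 / (P + K))" using pos by simp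
 thus ?case unfolding T by (simp add: P_def K_def add_ac)
qed

text \<open>By concavity the tangent slope at \<open>s\<close> is at least the slope of the chord
  from \<open>s\<close> to \<open>s + 1\<close>; denominators are cleared.\<close>

lemma rho_chord:
 assumes "2 \<le> k" "k \<le> s"
 defines "p \<equiv> real s - real k + 1"
 shows "(real k - 1) * p \<le> rho s k * (p + 1)"
proof -
 define S where "S = Sg s k"
 define K where "K = real k"
 obtain a where a: "s = a + k" using assms(2) by (metis add.commute le_Suc_ex)
 have p: "p = real a + 1" using a by (simp add: p_def)
 have S0: "0 < S" using Sg_pos[of k s] assms by (simp add: S_def)
 have p0: "0 < p" by (simp add: p)
 have c: "K * (p + 1) \<le> p * (p + K) * S" using Sg_chord[of k a] by (simp add: p a S_def K_def add_ac)
 have r: "rho s k = K * (1 - 1 / (p * S))" by (simp add: rho_def p_def S_def K_def)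
 have "rho s k * (p + 1) - (K - 1) * p = (p + K) - K * (p + 1) / (p * S)"
  unfolding r using p0 S0 by (simp add: field_simps)
 moreover have "K * (p + 1) / (p * S) \<le> p + K"
  using c p0 S0 by (simp add: pos_divide_le_eq mult_ac)
 ultimately show ?thesis unfolding K_def by linarith
qed

definition sig :: "nat \<Rightarrow> nat \<Rightarrow> real"
 where "sig j k = (real k - 1) / (real j - real k + 2)"

lemma sig_mono:
 assumes "2 \<le> k" "k \<le> Suc i" "i \<le> j"
 shows "sig j k \<le> sig i k" "0 \<le> sig j k"
 using assms unfolding sig_def by (auto intro!: divide_left_mono mult_pos_pos)

lemma sig_step:
 assumes "2 \<le> k" "k \<le> Suc j"
 shows "real (j choose (k - 2)) = sig j k * real (j choose (k - 1))"
proof -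
 have "(real j - real k + 2) * real (j choose (k - 2)) = (real k - 1) * real (j choose (k - 1))"
 proof -
  have "(real (Suc j) - real k + 1) * real ((Suc j - 1) choose (k - 2)) = (real k - 1) * real ((Suc j - 1) choose (k - 1))"
   by (rule binom_ratio[OF assms])
  moreover have "real (Suc j) - real k + 1 = real j - real k + 2" "Suc j - 1 = j" by simp_all
  ultimately show ?thesis by (simp only:)
 qed
 moreover have "0 < real j - real k + 2" using assms by linarith
 ultimately show ?thesis unfolding sig_def by (simp add: field_simps)
qed

lemma choose_steps:
 assumes "2 \<le> k"
 shows "Suc x choose (k - 1) = (x choose (k - 1)) + (x choose (k - 2))" "Suc x choose k = (x choose k) + (x choose (k - 1))"
proof -
 obtain r where r: "k = Suc (Suc r)" using assms by (cases k; cases "k - 1") auto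
 show "Suc x choose (k - 1) = (x choose (k - 1)) + (x choose (k - 2))" "Suc x choose k = (x choose k) + (x choose (k - 1))"
  unfolding r by simp_all
qed

text \<open>Consecutive points \<open>(C(j,k), C(j,k-1))\<close> form a concave chain; \<open>sig j k\<close> is the slope from \<open>j\<close> to \<open>j + 1\<close>.\<close>

lemma chord:
 assumes k: "2 \<le> k" "k \<le> Suc j" "k \<le> Suc x"
 shows "real (x choose (k - 1)) - real (j choose (k - 1)) \<le> sig j k * (real (x choose k) - real (j choose k))"
proof -
 define f where "f y = real (y choose (k - 1)) - sig j k * real (y choose k)" for y
 have step: "f (Suc y) = f y + (sig y k - sig j k) * real (y choose (k - 1))" if "k \<le> Suc y" for y
  using sig_step[OF k(1) that] unfolding f_def choose_steps[OF k(1)] by (simp add: algebra_simps)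
 have "f x \<le> f j"
 proof (cases "j \<le> x")
  case True
  thus ?thesis
  proof (induction x rule: dec_induct)
   case (step y)
   have "(sig y k - sig j k) * real (y choose (k - 1)) \<le> 0"
    using sig_mono(1)[OF k(1,2)] step.hyps by (intro mult_nonpos_nonneg) auto
   moreover have "f (Suc y) = f y + (sig y k - sig j k) * real (y choose (k - 1))"
    using \<open>\<And>y. k \<le> Suc y \<Longrightarrow> f (Suc y) = f y + (sig y k - sig j k) * real (y choose (k - 1))\<close>[of y] k(2) step.hyps by simp
   ultimately show ?case using step.IH by linarith
  qed simp
 next
  case False
  hence "x \<le> j" by simp
  thus ?thesis using k(3)
  proof (induction x rule: inc_induct)
   case (step y)
   have "0 \<le> (sig y k - sig j k) * real (y choose (k - 1))"
    using sig_mono(1)[OF k(1) step.prems, of j] step.hyps by (intro mult_nonneg_nonneg) auto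
   moreover have "f (Suc y) = f y + (sig y k - sig j k) * real (y choose (k - 1))"
    using \<open>\<And>y. k \<le> Suc y \<Longrightarrow> f (Suc y) = f y + (sig y k - sig j k) * real (y choose (k - 1))\<close>[of y] step.prems by simp
   ultimately show ?case using step.IH step.prems by simp
  qed simp
 qed
 thus ?thesis by (simp add: f_def algebra_simps)
qed

text \<open>\<open>j\<close> is the block containing \<open>f\<close>, and the linear shadow
  estimate gives the line of slope \<open>sig j k\<close> through the chain point of
  \<open>j\<close>. By \<open>chord\<close> the whole chain lies below this line, so the bound may
  be anchored at any other chain point \<open>x\<close>.\<close>

lemma line:
 assumes V: "finite V" "\<B> \<subseteq> Pow V" and k: "2 \<le> k" "k \<le> s" "s < card V"
  and f: "card \<B> = binom_ge (card V) (Suc k) + f" "s choose k \<le> f" "f \<le> card V choose k"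
 obtains j where "s \<le> j" "j < card V" "j choose k \<le> f" "f \<le> Suc j choose k" 
  "\<And>j'. j < j' \<Longrightarrow> j' < card V \<Longrightarrow> f < j' choose k"
  "\<And>x. k \<le> Suc x \<Longrightarrow> real (binom_ge (card V) k) + real (x choose (k - 1)) + sig j k * (real f - real (x choose k))
   \<le> real (card (nbd V \<B>))"
proof -
 define j where "j = Max {j. j < card V \<and> j choose k \<le> f}"
 have fin: "finite {j. j < card V \<and> j choose k \<le> f}" by simp
 have ne: "s \<in> {j. j < card V \<and> j choose k \<le> f}" using k f by simp
 have "j \<in> {j. j < card V \<and> j choose k \<le> f}" unfolding j_def by (rule Max_in[OF fin]) (use ne in blast)
 hence j: "j < card V" "j choose k \<le> f" by simp_all
 have sj: "s \<le> j" unfolding j_def by (rule Max_ge[OF fin ne])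
 have mx: "f < j' choose k" if "j < j'" "j' < card V" for j'
 proof (rule ccontr)
  assume "\<not> ?thesis"
  hence "j' \<le> j" unfolding j_def using that by (intro Max_ge[OF fin]) auto
  thus False using that by simp
 qed
 have fS: "f \<le> Suc j choose k"
 proof (cases "Suc j < card V")
  case True thus ?thesis using mx[of "Suc j"] by simp
 next
  case False hence "Suc j = card V" using j by simp
  thus ?thesis using f by simp
 qed
 define g where "g = f - (j choose k)"
 have g: "g \<le> j choose (k - 1)" "f = (j choose k) + g" using fS j choose_steps(2)[OF k(1), of j] by (auto simp: g_def)
 obtain \<F> where F: "uniform (k - 1) \<F>" "card \<F> = g"
  "binom_ge (card V) k + (j choose (k - 1)) + card (shadow \<F>) \<le> card (nbd V \<B>)"
  using nbd_bound[OF V, of k j g] k g sj j f(1) by auto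
 have "real (k - 1) * real g \<le> (real j - real (k - 1) + 1) * real (card (shadow \<F>))"
  using shadow_bound_linear[OF F(1), of j] k sj g F(2) by simp
 moreover have "real (k - 1) = real k - 1" using k by (simp add: of_nat_diff)
 moreover have "0 < real j - real k + 2" using k sj by linarith
 ultimately have sh: "sig j k * real g \<le> real (card (shadow \<F>))" unfolding sig_def by (simp add: field_simps)
 have bd: "real (binom_ge (card V) k) + real (x choose (k - 1)) + sig j k * (real f - real (x choose k)) \<le> real (card (nbd V \<B>))"
  if "k \<le> Suc x" for x
 proof -
  have "real (x choose (k - 1)) - real (j choose (k - 1)) \<le> sig j k * (real (x choose k) - real (j choose k))"
   by (rule chord) (use k sj that in auto)
  moreover have "sig j k * (real f - real (x choose k)) = sig j k * real g - sig j k * (real (x choose k) - real (j choose k))"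
   using g(2) by (simp add: algebra_simps)
  moreover have "real (binom_ge (card V) k) + real (j choose (k - 1)) + real (card (shadow \<F>)) \<le> real (card (nbd V \<B>))"
   using F(3) by linarith
  ultimately show ?thesis using sh by linarith
 qed
 show ?thesis by (rule that[OF sj j fS mx bd])
qed

text \<open>Anchoring the line at \<open>card V\<close> bounds the loss by \<open>sig j k\<close>
  for each missing set, and \<open>j \<ge> s\<close> bounds this by \<open>sig s k\<close>.\<close>

lemma full_minus:
 assumes V: "finite V" "\<B> \<subseteq> Pow V" and k: "2 \<le> k" "k \<le> s" "s < card V"
  and q: "card \<B> + q = binom_ge (card V) k" "(s choose k) + q \<le> card V choose k"
 shows "real (binom_ge (card V) (k - 1)) - sig s k * real q \<le> real (card (nbd V \<B>))"
proof -
 define f where "f = (card V choose k) - q"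
 have b: "binom_ge (card V) k = (card V choose k) + binom_ge (card V) (Suc k)"
  "binom_ge (card V) (k - 1) = (card V choose (k - 1)) + binom_ge (card V) k"
  using binom_ge_rec[of "card V" k] binom_ge_rec[of "card V" "k - 1"] k by auto
 have f: "card \<B> = binom_ge (card V) (Suc k) + f" "s choose k \<le> f" "f \<le> card V choose k"
  using q b by (auto simp: f_def)
 obtain j where j: "s \<le> j" "real (binom_ge (card V) k) + real (card V choose (k - 1)) + sig j k * (real f - real (card V choose k))
   \<le> real (card (nbd V \<B>))"
  by (rule line[OF V k f]) (use k in auto)
 have "real f - real (card V choose k) = - real q" using q(2) by (simp add: f_def of_nat_diff)
 moreover have "sig j k * real q \<le> sig s k * real q" using sig_mono(1)[of k s j] k j by (intro mult_right_mono) auto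
 ultimately show ?thesis using j(2) b(2) by simp
qed

lemma sig_mult:
 assumes "2 \<le> k" "k \<le> Suc j" shows "sig j k * (real j - real k + 2) = real k - 1"
proof -
 have "real j - real k + 2 \<noteq> 0" using assms by linarith
 thus ?thesis by (simp add: sig_def)
qed

text \<open>If both sections along \<open>i\<close> are smaller than a full ball, concavity of the chain of points
 \<open>(C(j,k), C(j,k-1))\<close> forces the deficit of the larger one to be small.\<close>

lemma deficit_small:
 assumes V: "finite V" "\<A> \<subseteq> Pow V" "i \<in> V" and k: "3 \<le> k" "k \<le> s" "s + 2 \<le> card V"
 defines "M \<equiv> incr s k" and "t \<equiv> real (card \<A>) - real (msize (card V) s k)"
  and "p \<equiv> real s - real k + 1"
 assumes U: "0 \<le> U" "10000 * U \<le> M" "10000 * (U * (real k - 1)) \<le> p * M" "10000 * (p * U) \<le> (real k - 1) * M"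
  and t: "\<bar>t\<bar> \<le> 6 * U" and ex: "excess V s k \<A> \<le> U"
  and le: "card (dnsec i \<A>) \<le> card (upsec i \<A>)"
  and q: "card (upsec i \<A>) + q = binom_ge (card V - 1) k"
 shows "real q \<le> 12 * U"
proof (rule ccontr)
 assume "\<not> ?thesis"
 hence q12: "12 * U < real q" by simp
 define V' where "V' = V - {i}"
 define n' where "n' = card V - 1"
 define up dn where "up = upsec i \<A>" and "dn = dnsec i \<A>"
 have V': "finite V'" "card V' = n'" "up \<subseteq> Pow V'" "dn \<subseteq> Pow V'"
  using V by (auto simp: V'_def n'_def up_def dn_def upsec_def dnsec_def)
 have fin: "finite \<A>" using finite_subset_Pow[OF V(2,1)] .
 have k2: "2 \<le> k" "k \<le> s" "s \<le> card V'" "1 \<le> k" "1 \<le> card V" "s < card V'" using k V'(2) by (auto simp: n'_def)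
 define K where "K = real k"
 note sf = slope_facts[OF k2(1,2), folded p_def K_def]
 have p1: "1 \<le> p" by (rule sf(7))
 have K3: "3 \<le> K" using k by (simp add: K_def)
 note ms = msize_split'[OF k2(4,5), of s, folded n'_def]
 have tU: "t \<le> 6 * U" "- (6 * U) \<le> t" using t by linarith+
 have M1: "1 \<le> M" using Zc_ineqs(11)[OF k(1,2)] by (simp add: M_def)
 have cs: "real (card up) + real (card dn) = real (binom_ge n' k) + real (msize n' s k) + t"
  using card_sections[OF fin, of i] ms(1) by (simp add: up_def dn_def t_def)
 define E where "E = card dn - msize n' s k"
 have gl: "msize n' s k \<le> card dn" using cs q q12 tU U(1) unfolding up_def n'_def by linarith
 have cE: "card dn = msize n' s k + E" using gl by (simp add: E_def)
 have Eq: "real E = real q + t" using cE cs q unfolding up_def n'_def by linarith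
 have E6: "6 * U < real E" using Eq q12 tU by linarith
 define fb where "fb = (s choose k) + E"
 have fb: "card dn = binom_ge n' (Suc k) + fb" using cE by (simp add: msize_def fb_def)
 have br: "binom_ge n' k = (n' choose k) + binom_ge n' (Suc k)" "binom_ge n' (k - 1) = (n' choose (k - 1)) + binom_ge n' k"
  using binom_ge_rec[of n' k] binom_ge_rec[of n' "k - 1"] k2(4) by auto
 define fa where "fa = card up - binom_ge n' (Suc k)"
 have fa: "card up = binom_ge n' (Suc k) + fa" using le fb by (simp add: fa_def up_def dn_def)
 have faq: "fa + q = n' choose k" using fa q br(1) by (simp add: up_def n'_def)
 have fba: "fb \<le> fa" using le fa fb by (simp add: up_def dn_def)
 define Gu Gd where "Gu = real (card (nbd V' up)) - real (binom_ge n' (k - 1))"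
  and "Gd = real (card (nbd V' dn)) - real (msize_nbd n' s k)"
 have ex2: "p * (Gu + Gd) - rho s k * t \<le> U"
 proof -
  have "real (card (nbd V' up)) + real (card (nbd V' dn)) \<le> real (card (nbd V \<A>))"
   using nbd_sections_ge[OF V] unfolding up_def dn_def V'_def by linarith
  hence "p * (Gu + Gd) \<le> p * (real (card (nbd V \<A>)) - real (msize_nbd (card V) s k))"
   unfolding Gu_def Gd_def using ms(2) p1 by (intro mult_left_mono) auto
  thus ?thesis using ex unfolding excess_def p_def t_def by linarith
 qed
 define \<sigma> where "\<sigma> = sig s k"
 define r where "r = rho s k"
 have sp: "\<sigma> * (p + 1) = K - 1" using sig_mult[of k s] k2 by (simp add: \<sigma>_def p_def K_def add_ac)
 have rc: "(K - 1) * p \<le> r * (p + 1)" using rho_chord[OF k2(1,2)] by (simp add: r_def p_def K_def)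
 have r: "r \<le> K - 1" "0 \<le> r" using sf(1,6) by (auto simp: r_def)
 have psr: "p * \<sigma> \<le> r"
 proof -
  have "(p * \<sigma>) * (p + 1) = (K - 1) * p" unfolding sp[symmetric] by (simp only: mult_ac)
  hence "(p * \<sigma>) * (p + 1) \<le> r * (p + 1)" using rc by (simp only:)
  thus ?thesis using p1 by (simp add: mult_le_cancel_right)
 qed
 \<comment> \<open>\<open>w = (p + 1) * (r - p * \<sigma>)\<close> measures by how much the tangent
   at \<open>s\<close> is steeper than the next chord; it multiplies the error
   \<open>t\<close>.\<close>
 define w where "w = r * (p + 1) - p * (K - 1)"
 have w: "0 \<le> w" "w \<le> K - 1"
  using rc mult_right_mono[OF r(1), of "p + 1"] p1 by (auto simp: w_def algebra_simps)
 have wt: "w * t \<le> 6 * (U * (K - 1))"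
 proof -
  have "w * t \<le> w * (6 * U)" using tU w by (intro mult_left_mono) auto
  also have "\<dots> \<le> (K - 1) * (6 * U)" using w U(1) by (intro mult_right_mono) auto
  finally show ?thesis by (simp add: mult_ac)
 qed
 have fbs: "s choose k \<le> fb" "fb \<le> card V' choose k" using fba faq V'(2) by (auto simp: fb_def)
 have fas: "s choose k \<le> fa" "fa \<le> card V' choose k" using fbs fba faq V'(2) by auto
 obtain ja where ja: "s \<le> ja" "ja < card V'" "fa \<le> Suc ja choose k"
  "\<And>j'. ja < j' \<Longrightarrow> j' < card V' \<Longrightarrow> fa < j' choose k"
  "\<And>x. k \<le> Suc x \<Longrightarrow> real (binom_ge (card V') k) + real (x choose (k - 1)) + sig ja k * (real fa - real (x choose k))
   \<le> real (card (nbd V' up))"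
  using line[OF V'(1,3) k2(1,2,6) _ fas] fa V'(2) by metis
 obtain jb where jb: "s \<le> jb" "jb < card V'" "jb choose k \<le> fb"
  "\<And>x. k \<le> Suc x \<Longrightarrow> real (binom_ge (card V') k) + real (x choose (k - 1)) + sig jb k * (real fb - real (x choose k))
   \<le> real (card (nbd V' dn))"
  using line[OF V'(1,4) k2(1,2,6) _ fbs] fb V'(2) by metis
 have faE: "real fa = real (n' choose k) - real q" using faq by (metis add_diff_cancel_right' of_nat_add)
 have Gu_j: "- (sig ja k * real q) \<le> Gu"
 proof -
  have "real (binom_ge n' k) + real (n' choose (k - 1)) + sig ja k * (real fa - real (n' choose k)) \<le> real (card (nbd V' up))"
   using ja(5)[of n'] k2 V'(2) by simp
  moreover have "real fa - real (n' choose k) = - real q" using faE by simp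
  ultimately show ?thesis using br(2) unfolding Gu_def by simp
 qed
 have sgm: "sig ja k \<le> \<sigma>" using sig_mono(1)[of k s ja] k2 ja by (simp add: \<sigma>_def)
 have Gu_s: "- (\<sigma> * real q) \<le> Gu" using Gu_j mult_right_mono[OF sgm, of "real q"] by linarith
 have fbE: "real fb = real (s choose k) + real E" by (simp add: fb_def)
 have msn: "real (msize_nbd n' s k) = real (binom_ge n' k) + real (s choose (k - 1))" by (simp add: msize_nbd_def)
 have MM1: "M \<le> real (s choose (k - 1))" unfolding M_def by (intro of_nat_mono binomial_right_mono) auto
 show False
 proof (cases "2 * real E \<le> M")
  case True
  \<comment> \<open>A moderate surplus of the lower section is charged by
    \<open>excess_lower\<close>, while the upper section loses only at the chord slope, and
    \<open>p * \<sigma> \<le> r\<close>.\<close>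
  have wd: "2 * (real (card dn) - real (msize (card V') s k)) \<le> incr s k"
   "- 6 * th (s - 1) (k - 1) * (real (card dn) - real (msize (card V') s k)) \<le> incr s k"
  proof -
   have e: "real (card dn) - real (msize (card V') s k) = real E" using cE V'(2) by simp
   show "2 * (real (card dn) - real (msize (card V') s k)) \<le> incr s k"
    unfolding e using True by (simp add: M_def)
   have "0 \<le> th (s - 1) (k - 1) * real E" using sf(3) by simp
   thus "- 6 * th (s - 1) (k - 1) * (real (card dn) - real (msize (card V') s k)) \<le> incr s k"
    unfolding e using M1 by (simp add: M_def)
  qed
  have "\<bar>real E\<bar> \<le> 6 * excess V' s k dn"
   using excess_lower[OF V'(1,4) k2(1-3) wd] cE V'(2) by simp
  moreover have "excess V' s k dn = p * Gd - r * real E"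
   using cE V'(2) by (simp add: excess_def p_def Gd_def r_def)
  moreover have "p * (- (\<sigma> * real q)) \<le> p * Gu" using Gu_s p1 by (intro mult_left_mono) auto
  moreover have "(p * \<sigma>) * real q \<le> r * real q" using psr by (intro mult_right_mono) auto
  moreover have "r * real E = r * real q + r * t" using Eq by (simp add: distrib_left)
  ultimately have "real E \<le> 6 * U" using ex2 unfolding r_def[symmetric] by (simp add: algebra_simps)
  thus False using E6 by simp
 next
  case False
  hence EM: "M < 2 * real E" by simp
  have pM: "0 < p * M" using p1 M1 by simp
  show False
  proof (cases "n' = Suc s")
   case True
   \<comment> \<open>Only the single block from \<open>s\<close> to \<open>s + 1\<close> is
     available, so \<open>E + q\<close> is at most its length \<open>M1\<close>. As \<open>q\<close>
     differs from \<open>E\<close> by \<open>t\<close> only, the concave term of the lower section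
     is of order \<open>E\<close>.\<close>
   have "fb + q \<le> Suc s choose k" using faq fba True by simp
   hence Eq1: "E + q \<le> s choose (k - 1)" using choose_steps(2)[OF k2(1), of s] by (simp add: fb_def)
   define M1 where "M1 = real (s choose (k - 1))"
   have e5: "5 * real E \<le> 3 * M1"
   proof -
    have "real E + real q \<le> M1" using of_nat_mono[OF Eq1, where 'a = real] unfolding M1_def by (simp only: of_nat_add)
    thus ?thesis using Eq tU U(2) MM1 \<open>1 \<le> M\<close> unfolding M1_def[symmetric] by linarith
   qed
   have M1p: "0 < M1" using MM1 \<open>1 \<le> M\<close> unfolding M1_def by linarith
   have El: "E \<le> s choose (k - 1)" using Eq1 by simp
   obtain \<F> where F: "uniform (k - 1) \<F>" "card \<F> = E"
    "binom_ge (card V') k + (s choose (k - 1)) + card (shadow \<F>) \<le> card (nbd V' dn)"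
    using nbd_bound[OF V'(1,4), of k s E] k2 El fb V'(2) unfolding fb_def by auto
   have rk: "real (k - 1) = K - 1" using k2 by (simp add: K_def of_nat_diff)
   have sb: "(K - 1) * real E + th s (k - 1) * real E * (1 - real E / M1) \<le> (p + 1) * real (card (shadow \<F>))"
   proof -
    have "real (k - 1) * real E + th s (k - 1) * real E * (1 - real E / real (s choose (k - 1)))
     \<le> (real s - real (k - 1) + 1) * real (card (shadow \<F>))"
     using shadow_bound[OF F(1), of s] k2 El unfolding F(2) by simp
    moreover have "real s - real (k - 1) + 1 = p + 1" unfolding rk p_def K_def by simp
    ultimately show ?thesis unfolding rk M1_def by simp
   qed
   have ct: "2 * real E \<le> 5 * (real E * (1 - real E / M1))" by (rule concave_term[OF _ M1p e5]) simp
   have th1: "1 \<le> th s (k - 1)" using th_ge_1[of "k - 1" s] k by simp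
   have "1 * (real E * (1 - real E / M1)) \<le> th s (k - 1) * (real E * (1 - real E / M1))"
    using th1 ct by (intro mult_right_mono) auto
   note thE = this
   have sG: "real (card (shadow \<F>)) \<le> Gd"
    using of_nat_mono[OF F(3), where 'a = real] msn unfolding Gd_def V'(2) of_nat_add by linarith
   have "(p + 1) * real (card (shadow \<F>)) \<le> (p + 1) * Gd" using sG p1 by (intro mult_left_mono) auto
   hence gd: "5 * ((K - 1) * real E) + 2 * real E \<le> 5 * ((p + 1) * Gd)"
    using sb[unfolded mult.assoc] ct thE by linarith
   have gu: "- ((K - 1) * real q) \<le> (p + 1) * Gu"
   proof -
    have "(p + 1) * (- (\<sigma> * real q)) \<le> (p + 1) * Gu" using Gu_s p1 by (intro mult_left_mono) auto
    moreover have "(p + 1) * (- (\<sigma> * real q)) = - ((K - 1) * real q)"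
     unfolding sp[symmetric] by (simp add: algebra_simps)
    ultimately show ?thesis by linarith
   qed
   have s1: "5 * ((K - 1) * t) + 2 * real E \<le> 5 * ((p + 1) * (Gu + Gd))"
    using gd gu Eq by (simp add: algebra_simps)
   have "p * (5 * ((K - 1) * t) + 2 * real E) \<le> p * (5 * ((p + 1) * (Gu + Gd)))"
    using s1 p1 by (intro mult_left_mono) auto
   moreover have "(p + 1) * (p * (Gu + Gd) - r * t) \<le> (p + 1) * U"
    using ex2 p1 unfolding r_def by (intro mult_left_mono) auto
   ultimately have "2 * (p * real E) \<le> 5 * ((p + 1) * U) + 5 * (w * t)"
    unfolding w_def by (simp add: algebra_simps)
   moreover have "p * M \<le> p * (2 * real E)" using EM p1 by (intro mult_left_mono) auto
   moreover have "(p + 1) * U \<le> 2 * (p * U)" using mult_right_mono[OF p1 U(1)] by (simp add: algebra_simps)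
   moreover have "10000 * (p * U) \<le> p * M" using mult_left_mono[OF U(2), of p] p1 by (simp add: mult_ac)
   ultimately show False using wt U(3) pM unfolding K_def by linarith
  next
   case False
   hence n2: "s + 2 \<le> n'" using k2 V'(2) by simp
   define \<sigma>' where "\<sigma>' = sig (Suc s) k"
   have sp': "\<sigma>' * (p + 2) = K - 1" using sig_mult[of k "Suc s"] k2 by (simp add: \<sigma>'_def p_def K_def add_ac)
   have ss: "\<sigma>' \<le> \<sigma>" using sig_mono(1)[of k s "Suc s"] k2 by (simp add: \<sigma>_def \<sigma>'_def)
   have q4: "2 / 5 * M \<le> real q" using EM Eq tU U(2) M1 by linarith
   \<comment> \<open>With room beyond \<open>s + 1\<close> the chain slope drops from
     \<open>\<sigma>\<close> to \<open>\<sigma>'\<close>, and the drop acts on at least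
     \<open>2 / 5 * M\<close> sets, whichever blocks the two sections occupy.\<close>
   have main: "\<sigma> * t + (\<sigma> - \<sigma>') * (2 / 5 * M) \<le> Gu + Gd"
   proof (cases "jb = s")
    case True
    have "\<sigma> * real E \<le> Gd"
     using jb(4)[of s] k2 True fbE msn V'(2) unfolding Gd_def \<sigma>_def by simp
    hence gd: "\<sigma> * real q + \<sigma> * t \<le> Gd" using Eq by (simp add: distrib_left)
    show ?thesis
    proof (cases "ja = s")
     case False
     hence "sig ja k \<le> \<sigma>'" using sig_mono(1)[of k "Suc s" ja] k2 ja(1) by (simp add: \<sigma>'_def)
     hence "sig ja k * real q \<le> \<sigma>' * real q" by (intro mult_right_mono) auto
     moreover have "(\<sigma> - \<sigma>') * (2 / 5 * M) \<le> (\<sigma> - \<sigma>') * real q" using q4 ss by (intro mult_left_mono) auto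
     moreover have "(\<sigma> - \<sigma>') * real q = \<sigma> * real q - \<sigma>' * real q" by (rule left_diff_distrib)
     ultimately show ?thesis using gd Gu_j by linarith
    next
     case ja': True
     define X where "X = real (n' choose k) - real (Suc s choose k)"
     have XM: "M \<le> X"
     proof -
      have "Suc (Suc s) choose k \<le> n' choose k" using n2 by (intro binomial_right_mono) auto
      moreover have "(s - 1) choose (k - 1) \<le> Suc s choose (k - 1)" by (intro binomial_right_mono) auto
      ultimately show ?thesis using choose_steps(2)[OF k2(1), of "Suc s"] unfolding X_def M_def by linarith
     qed
     have "real (n' choose (k - 1)) - real (Suc s choose (k - 1)) \<le> \<sigma>' * X"
      unfolding X_def \<sigma>'_def by (rule chord) (use k2 n2 in auto)
     moreover have "real (Suc s choose (k - 1)) + \<sigma> * (X - real q) - real (n' choose (k - 1)) \<le> Gu"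
     proof -
      have "real (binom_ge n' k) + real (Suc s choose (k - 1)) + \<sigma> * (real fa - real (Suc s choose k)) \<le> real (card (nbd V' up))"
       using ja(5)[of "Suc s"] k2 V'(2) ja' unfolding \<sigma>_def by simp
      moreover have "real fa - real (Suc s choose k) = X - real q" using faE by (simp add: X_def)
      ultimately show ?thesis using br(2) unfolding Gu_def by simp
     qed
     moreover have "(\<sigma> - \<sigma>') * (2 / 5 * M) \<le> (\<sigma> - \<sigma>') * X" using XM M1 ss by (intro mult_left_mono) auto
     ultimately show ?thesis using gd by (simp add: algebra_simps)
    qed
   next
    case False
    hence jbs: "Suc s \<le> jb" using jb(1) by simp
    define sj where "sj = sig jb k"
    define M1 where "M1 = real (s choose (k - 1))"
    have sj: "sj \<le> \<sigma>'" "0 \<le> sj" using sig_mono[of k "Suc s" jb] k2 jbs by (auto simp: sj_def \<sigma>'_def)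
    have "jb \<le> ja" using ja(4)[of jb] jb fba by (meson leI le_trans not_less)
    hence "sig ja k \<le> sj" using sig_mono(1)[of k jb ja] k2 jbs by (simp add: sj_def)
    hence gu: "- (sj * real q) \<le> Gu" using Gu_j mult_right_mono[of "sig ja k" sj "real q"] by linarith
    have "real (binom_ge n' k) + real (Suc s choose (k - 1)) + sj * (real fb - real (Suc s choose k)) \<le> real (card (nbd V' dn))"
     using jb(4)[of "Suc s"] k2 V'(2) unfolding sj_def by simp
    moreover have "real fb - real (Suc s choose k) = real E - M1"
     using fbE choose_steps(2)[OF k2(1), of s] by (simp add: M1_def)
    moreover have "real (Suc s choose (k - 1)) = M1 + \<sigma> * M1"
     using choose_steps(1)[OF k2(1), of s] sig_step[of k s] k2 by (simp add: M1_def \<sigma>_def)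
    ultimately have "real (binom_ge n' k) + (M1 + \<sigma> * M1) + sj * (real E - M1) \<le> real (card (nbd V' dn))"
     by (simp only:)
    hence gd: "\<sigma> * M1 + sj * (real E - M1) \<le> Gd" using msn unfolding Gd_def M1_def[symmetric] by linarith
    have "(\<sigma> - \<sigma>') * (2 / 5 * M) \<le> (\<sigma> - sj) * (M1 - t)"
     using sj ss MM1 tU U(2) M1 unfolding M1_def[symmetric] by (intro mult_mono) auto
    thus ?thesis using gd gu Eq by (simp add: algebra_simps)
   qed
   have "p * (\<sigma> * t + (\<sigma> - \<sigma>') * (2 / 5 * M)) \<le> U + r * t"
    using mult_left_mono[OF main, of p] p1 ex2 unfolding r_def by linarith
   hence "((p + 1) * (p + 2)) * (p * (\<sigma> * t + (\<sigma> - \<sigma>') * (2 / 5 * M))) \<le> ((p + 1) * (p + 2)) * (U + r * t)"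
    using p1 by (intro mult_left_mono) auto
   note fA = this
   have fB: "((p + 1) * (p + 2)) * (p * (\<sigma> * t + (\<sigma> - \<sigma>') * m)) = (p + 2) * p * (K - 1) * t + (p * m) * (K - 1)" for m
   proof -
    have "((p + 1) * (p + 2)) * (p * (\<sigma> * t + (\<sigma> - \<sigma>') * m))
     = (p + 2) * p * (\<sigma> * (p + 1)) * t + (p * m) * ((\<sigma> * (p + 1)) * (p + 2) - (\<sigma>' * (p + 2)) * (p + 1))"
     by (simp add: algebra_simps)
    also have "\<dots> = (p + 2) * p * (K - 1) * t + (p * m) * (K - 1)" unfolding sp sp' by (simp add: algebra_simps)
    finally show ?thesis .
   qed
   have fC: "((p + 1) * (p + 2)) * (U + r * t) = (p + 1) * (p + 2) * U + (p + 2) * (w * t) + (p + 2) * p * (K - 1) * t"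
    unfolding w_def by (simp add: algebra_simps)
   have f: "(p * (2 / 5 * M)) * (K - 1) \<le> (p + 1) * (p + 2) * U + (p + 2) * (w * t)"
    using fA fC unfolding fB by linarith
   have "(p + 2) * (w * t) \<le> (p + 2) * (6 * (U * (K - 1)))" using wt p1 by (intro mult_left_mono) auto
   also have "\<dots> \<le> (3 * p) * (6 * (U * (K - 1)))" using p1 U(1) K3 by (intro mult_right_mono) auto
   finally have f2: "(p + 2) * (w * t) \<le> 18 * (p * (U * (K - 1)))" by (simp add: mult_ac)
   have "(p + 1) * (p + 2) * U \<le> (2 * p) * (3 * p) * U" using p1 U(1) by (intro mult_right_mono mult_mono) auto
   hence f3: "(p + 1) * (p + 2) * U \<le> 6 * (p * (p * U))" by (simp add: mult_ac)
   have f4: "10000 * (p * (p * U)) \<le> p * ((K - 1) * M)" using mult_left_mono[OF U(4), of p] p1 unfolding K_def by (simp add: mult_ac)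
   have f5: "10000 * (p * (U * (K - 1))) \<le> p * ((K - 1) * M)"
   proof -
    have "(10000 * U) * (p * (K - 1)) \<le> M * (p * (K - 1))" using U(2) p1 K3 by (intro mult_right_mono) auto
    thus ?thesis by (simp add: mult_ac)
   qed
   have "0 < p * ((K - 1) * M)" using p1 K3 M1 by simp
   moreover have "(p * (2 / 5 * M)) * (K - 1) = 2 / 5 * (p * ((K - 1) * M))" by (simp add: mult_ac)
   ultimately show False using f f2 f3 f4 f5 by linarith
  qed
 qed
qed

section \<open>Full Hamming balls\<close>

definition fullb :: "nat set \<Rightarrow> nat \<Rightarrow> nat set set"
 where "fullb V k = {x. x \<subseteq> V \<and> k \<le> card x}"

lemma fullb_subset: "fullb V k \<subseteq> Pow V"
 by (auto simp: fullb_def)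

lemma card_fullb: "finite V \<Longrightarrow> card (fullb V k) = binom_ge (card V) k"
 unfolding fullb_def by (rule card_subsets_ge)

lemma fullb_T1: "finite V \<Longrightarrow> std_ball True V k V = fullb V k"
 by (auto simp: std_ball_def T1_def fullb_def le_Suc_eq)

lemma card_sym_diff_singleton:
 assumes "finite x"
 shows "card (sym_diff x {j}) = (if j \<in> x then card x - 1 else Suc (card x))"
proof (cases "j \<in> x")
 case True
 hence "sym_diff x {j} = x - {j}" by auto
 thus ?thesis using True assms by simp
next
 case False
 hence "sym_diff x {j} = insert j x" by auto
 thus ?thesis using False assms by simp
qed

text \<open>For \<open>s = card V\<close> the two shapes coincide up to a flip, which leaves only
  the centre of a full ball to be determined.\<close>

lemma fullb_T2:
 assumes "finite V" "j \<in> V" "1 \<le> k"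
 shows "std_ball False V k (V - {j}) = flip {j} (fullb V k)"
proof (rule set_eqI)
 fix x
 have V: "x \<subseteq> V \<longleftrightarrow> sym_diff x {j} \<subseteq> V" using assms(2) by auto
 show "x \<in> std_ball False V k (V - {j}) \<longleftrightarrow> x \<in> flip {j} (fullb V k)"
 proof (cases "x \<subseteq> V")
  case True
  hence fx: "finite x" using assms finite_subset by auto
  have c: "j \<in> x \<Longrightarrow> 1 \<le> card x" using fx by (auto simp: Suc_le_eq card_gt_0_iff)
  have "x \<in> flip {j} (fullb V k) \<longleftrightarrow> k \<le> card (sym_diff x {j})" using True V by (simp add: flip_def fullb_def)
  thus ?thesis using True c assms(3) unfolding card_sym_diff_singleton[OF fx]
   by (auto simp: std_ball_def T2_def split: if_splits)
 next
  case False
  thus ?thesis using V by (auto simp: std_ball_def T2_def flip_def fullb_def)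
 qed
qed

lemma gball_full:
 assumes V: "finite V" "1 \<le> k" and g: "gball V (card V) k \<G>"
 obtains C where "C \<subseteq> V" "\<G> = flip C (fullb V k)"
proof -
 obtain b C S where g: "C \<subseteq> V" "S \<subseteq> V" "card S + (if b then 0 else 1) = card V" "\<G> = flip C (std_ball b V k S)"
  using g unfolding gball_def by blast
 show ?thesis
 proof (cases b)
  case True
  hence "S = V" using g V by (intro card_subset_eq) auto
  thus ?thesis using that[of C] g True fullb_T1[OF V(1)] by simp
 next
  case False
  have "card (V - S) = 1" using g(2,3) False V finite_subset[OF g(2)] by (simp add: card_Diff_subset)
  then obtain j where j: "V - S = {j}" by (auto simp: card_1_singleton_iff)
  hence S: "S = V - {j}" "j \<in> V" using g(2) by auto
  have "\<G> = flip (sym_diff C {j}) (fullb V k)"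
   using g(4) False fullb_T2[OF V(1) S(2) V(2)] S(1) by (simp add: flip_flip_sym_diff)
  moreover have "sym_diff C {j} \<subseteq> V" using g(1) S(2) by auto
  ultimately show ?thesis using that by blast
 qed
qed

lemma nbd_fullb:
 assumes "finite V"
 shows "nbd V (fullb V k) \<subseteq> fullb V (k - 1)"
proof
 fix y assume "y \<in> nbd V (fullb V k)"
 then obtain x where x: "x \<subseteq> V" "k \<le> card x" "y \<subseteq> V" "card (sym_diff x y) \<le> 1" by (auto simp: nbd_def fullb_def)
 have fin: "finite x" "finite y" using x assms finite_subset by auto
 have "card x \<le> card (y \<union> sym_diff x y)" using fin by (intro card_mono) auto
 also have "\<dots> \<le> card y + card (sym_diff x y)" by (rule card_Un_le)
 finally show "y \<in> fullb V (k - 1)" using x by (simp add: fullb_def)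
qed

text \<open>For \<open>i\<close> outside \<open>S\<close>, a set containing \<open>i\<close> lies in
  the ball exactly when it has at least \<open>k + 1\<close> elements, that is, \<open>k\<close>
  besides \<open>i\<close>.\<close>

lemma glue_full:
 assumes V: "finite V" "i \<in> V" and S: "S \<subseteq> V - {i}" "C \<subseteq> V - {i}"
 shows "glue i (flip C (fullb (V - {i}) k)) (flip C (std_ball b (V - {i}) k S)) = flip C (std_ball b V k S)"
proof -
 have "i \<notin> C" using S by auto
 have "glue i (fullb (V - {i}) k) (std_ball b (V - {i}) k S) = std_ball b V k S"
 proof (rule set_eqI)
  fix x
  show "x \<in> glue i (fullb (V - {i}) k) (std_ball b (V - {i}) k S) \<longleftrightarrow> x \<in> std_ball b V k S"
  proof (cases "x \<subseteq> V")
   case True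
   hence fx: "finite x" using V finite_subset by auto
   show ?thesis
   proof (cases "i \<in> x")
    case i: True
    have "1 \<le> card x" using fx i by (auto simp: Suc_le_eq card_gt_0_iff)
    moreover have "\<not> x \<subseteq> S" "x - {i} \<subseteq> V - {i}" using S i True by auto
    ultimately show ?thesis using i fx True
     by (auto simp: glue_def fullb_def std_ball_def T1_def T2_def)
   next
    case i: False
    hence "x \<subseteq> V - {i}" using True by auto
    thus ?thesis using i True by (auto simp: glue_def std_ball_def T1_def T2_def)
   qed
  next
   case False
   hence "\<not> x \<subseteq> V - {i}" "i \<in> x \<Longrightarrow> \<not> x - {i} \<subseteq> V - {i}" using V(2) by auto
   thus ?thesis using False by (auto simp: glue_def fullb_def std_ball_def T1_def T2_def)
  qed
 qed
 thus ?thesis unfolding flip_glue[OF \<open>i \<notin> C\<close>] by simp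
qed

lemma gball_glue_full:
 assumes V: "finite V" "i \<in> V" and S: "S \<subseteq> V - {i}" "C \<subseteq> V - {i}"
  and s: "card S + (if b then 0 else 1) = s" "s \<le> card V"
 shows "gball V s k (glue i (flip C (fullb (V - {i}) k)) (flip C (std_ball b (V - {i}) k S)))"
 unfolding glue_full[OF V S] gball_def using S s by (intro exI[of _ b] exI[of _ C] exI[of _ S]) auto

text \<open>With one outside point, membership amounts to
  \<open>card (x \<inter> S) \<ge> k\<close>. With two, the threshold is \<open>k\<close> if exactly
  one of them is in \<open>x\<close> and \<open>k - 1\<close> otherwise. Both conditions are
  symmetric under complementing the outside part; this is the ambiguity of the centre met in
  \<open>full_step\<close>.\<close>

lemma std_ball_flip_invariant:
 assumes V: "finite V" "S \<subseteq> V" "card (V - S) = (if b then 1 else 2)" "1 \<le> k"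
 shows "flip (V - S) (std_ball b V k S) = std_ball b V k S"
proof (rule set_eqI)
 fix x
 show "x \<in> flip (V - S) (std_ball b V k S) \<longleftrightarrow> x \<in> std_ball b V k S"
 proof (cases "x \<subseteq> V")
  case False
  hence "\<not> sym_diff x (V - S) \<subseteq> V" by auto
  thus ?thesis using False std_ball_subset[of b V k S] by (auto simp: flip_def)
 next
  case True
  define y z where "y = x \<inter> S" and "z = x - S"
  have f: "finite x" "finite y" "finite z" using finite_subset[OF True V(1)] by (auto simp: y_def z_def)
  have zR: "z \<subseteq> V - S" using True by (auto simp: z_def)
  have xe: "x = y \<union> z" "y \<inter> z = {}" by (auto simp: y_def z_def)
  have sx: "sym_diff x (V - S) = y \<union> (V - S - z)" "y \<inter> (V - S - z) = {}" using True by (auto simp: y_def z_def)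
  have cx: "card x = card y + card z" using xe f card_Un_disjoint by metis
  have fR: "finite (V - S - z)" using V by simp
  have cz: "card (V - S - z) = card (V - S) - card z" using zR f(3) by (rule card_Diff_subset[rotated])
  have cs: "card (sym_diff x (V - S)) = card y + (card (V - S) - card z)"
   unfolding sx(1) card_Un_disjoint[OF f(2) fR sx(2)] cz ..
  have zc: "card z \<le> card (V - S)" using zR V by (intro card_mono) auto
  have xS: "x \<subseteq> S \<longleftrightarrow> card z = 0" using f(3) by (auto simp: z_def)
  have sS: "sym_diff x (V - S) \<subseteq> S \<longleftrightarrow> card z = card (V - S)"
  proof -
   have "sym_diff x (V - S) \<subseteq> S \<longleftrightarrow> V - S - z = {}" using sx(1) by (auto simp: y_def)
   also have "\<dots> \<longleftrightarrow> card (V - S - z) = 0" using fR by simp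
   finally show ?thesis using cz zc by auto
  qed
  have sV: "sym_diff x (V - S) \<subseteq> V" using True by auto
  show ?thesis
   using V(3,4) True sV xS sS zc unfolding flip_def mem_Collect_eq std_ball_def T1_def T2_def
   by (cases b) (simp_all add: cs cx, auto)
 qed
qed

text \<open>For \<open>u \<in> \<Delta>\<close> and \<open>y\<close> an \<open>r\<close>-set avoiding \<open>u\<close>, either \<open>y\<close> or \<open>(y \<triangle> \<Delta>) - {u}\<close> is counted.\<close>

lemma count_displaced:
 assumes W: "finite W" "\<Delta> \<subseteq> W" "\<Delta> \<noteq> {}"
 shows "(card W - 1) choose r \<le> card {y. y \<subseteq> W \<and> card y \<le> r \<and> Suc r \<le> card (sym_diff y \<Delta>)}" (is "_ \<le> card ?X")
proof -
 obtain u where u: "u \<in> \<Delta>" using W by auto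
 define Y where "Y = {y. y \<subseteq> W - {u} \<and> card y = r}"
 define \<phi> where "\<phi> y = (if Suc r \<le> card (sym_diff y \<Delta>) then y else sym_diff y \<Delta> - {u})" for y
 have f: "finite y" if "y \<in> Y" for y using that W finite_subset by (auto simp: Y_def)
 have fD: "finite \<Delta>" using W finite_subset by auto
 have small: "card (sym_diff y \<Delta> - {u}) < r" if "y \<in> Y" "\<not> Suc r \<le> card (sym_diff y \<Delta>)" for y
 proof -
  have "u \<in> sym_diff y \<Delta>" using that(1) u by (auto simp: Y_def)
  hence "card (sym_diff y \<Delta> - {u}) < card (sym_diff y \<Delta>)" using f[OF that(1)] fD by (intro psubset_card_mono) auto
  thus ?thesis using that(2) by simp
 qed
 have bk: "sym_diff (sym_diff y \<Delta> - {u}) \<Delta> = insert u y" if "y \<in> Y" for y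
  using that u by (auto simp: Y_def)
 have "inj_on \<phi> Y"
 proof (rule inj_onI)
  fix y y' assume y: "y \<in> Y" "y' \<in> Y" and e: "\<phi> y = \<phi> y'"
  have c: "card y = r" "card y' = r" "u \<notin> y" "u \<notin> y'" using y by (auto simp: Y_def)
  consider "Suc r \<le> card (sym_diff y \<Delta>)" "Suc r \<le> card (sym_diff y' \<Delta>)"
   | "\<not> Suc r \<le> card (sym_diff y \<Delta>)" "\<not> Suc r \<le> card (sym_diff y' \<Delta>)"
   | "Suc r \<le> card (sym_diff y \<Delta>)" "\<not> Suc r \<le> card (sym_diff y' \<Delta>)"
   | "\<not> Suc r \<le> card (sym_diff y \<Delta>)" "Suc r \<le> card (sym_diff y' \<Delta>)" by blast
  thus "y = y'"
  proof cases
   case 1 thus ?thesis using e by (simp add: \<phi>_def)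
  next
   case 2
   hence "sym_diff y \<Delta> - {u} = sym_diff y' \<Delta> - {u}" using e unfolding \<phi>_def by (simp only: if_False)
   hence "insert u y = insert u y'" using bk[OF y(1)] bk[OF y(2)] by metis
   thus ?thesis using c by (metis insert_ident)
  next
   case 3
   hence "y = sym_diff y' \<Delta> - {u}" using e unfolding \<phi>_def by (simp only: if_False if_True)
   thus ?thesis using small[OF y(2) 3(2)] c by simp
  next
   case 4
   hence "y' = sym_diff y \<Delta> - {u}" using e unfolding \<phi>_def by (simp only: if_False if_True)
   thus ?thesis using small[OF y(1) 4(1)] c by simp
  qed
 qed
 moreover have "\<phi> ` Y \<subseteq> ?X"
 proof
  fix z assume "z \<in> \<phi> ` Y"
  then obtain y where y: "y \<in> Y" "z = \<phi> y" by blast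
  show "z \<in> ?X"
  proof (cases "Suc r \<le> card (sym_diff y \<Delta>)")
   case True thus ?thesis using y by (auto simp: \<phi>_def Y_def)
  next
   case False
   have z: "z = sym_diff y \<Delta> - {u}" using y False unfolding \<phi>_def by (simp only: if_False)
   have "u \<notin> y" "card y = r" using y(1) by (auto simp: Y_def)
   hence "card (insert u y) = Suc r" using f[OF y(1)] by simp
   hence "card (sym_diff z \<Delta>) = Suc r" unfolding z bk[OF y(1)] .
   moreover have "z \<subseteq> W" unfolding z using y(1) W by (auto simp: Y_def)
   moreover have "card z \<le> r" unfolding z using small[OF y(1) False] by simp
   ultimately show ?thesis by simp
  qed
 qed
 ultimately have "card Y \<le> card ?X" using W by (intro card_inj_on_le[of \<phi>]) auto
 moreover have "card Y = (card W - 1) choose r" unfolding Y_def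
  using n_subsets[of "W - {u}" r] W u by auto
 ultimately show ?thesis by simp
qed

text \<open>One element \<open>w\<close> of \<open>\<Delta>\<close> is set aside: sets avoiding
  \<open>w\<close> gain it under the flip, which yields one of the two levels to be crossed. The
  other comes from \<open>count_displaced\<close> applied to the rest of
  \<open>\<Delta>\<close>.\<close>

lemma full_balls_far:
 assumes V: "finite V" "\<Delta> \<subseteq> V" and d: "2 \<le> card \<Delta>" and k: "2 \<le> k"
 shows "(card V - 2) choose (k - 2) \<le> card (flip \<Delta> (fullb V k) - fullb V (k - 1))"
proof -
 have fD: "finite \<Delta>" using V finite_subset by auto
 obtain w where w: "w \<in> \<Delta>" using d by fastforce
 define W where "W = V - {w}"
 have W: "finite W" "\<Delta> - {w} \<subseteq> W" "\<Delta> - {w} \<noteq> {}" "card W - 1 = card V - 2"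
  using V w d fD by (auto simp: W_def dest!: subset_singletonD)
 have "(card V - 2) choose (k - 2) \<le> card {y. y \<subseteq> W \<and> card y \<le> k - 2 \<and> Suc (k - 2) \<le> card (sym_diff y (\<Delta> - {w}))}"
  using count_displaced[OF W(1-3), of "k - 2"] unfolding W(4) .
 also have "\<dots> \<le> card (flip \<Delta> (fullb V k) - fullb V (k - 1))"
 proof (rule card_mono)
  show "finite (flip \<Delta> (fullb V k) - fullb V (k - 1))"
   using finite_subset_Pow[OF flip_subset_Pow[OF V(2) fullb_subset] V(1)] by simp
  show "{y. y \<subseteq> W \<and> card y \<le> k - 2 \<and> Suc (k - 2) \<le> card (sym_diff y (\<Delta> - {w}))} \<subseteq> flip \<Delta> (fullb V k) - fullb V (k - 1)"
  proof
   fix y assume "y \<in> {y. y \<subseteq> W \<and> card y \<le> k - 2 \<and> Suc (k - 2) \<le> card (sym_diff y (\<Delta> - {w}))}"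
   hence y: "y \<subseteq> W" "card y \<le> k - 2" "Suc (k - 2) \<le> card (sym_diff y (\<Delta> - {w}))" by auto
   have fy: "finite y" using y W finite_subset by auto
   have e: "sym_diff y \<Delta> = insert w (sym_diff y (\<Delta> - {w}))" "w \<notin> sym_diff y (\<Delta> - {w})"
    using y(1) w by (auto simp: W_def)
   have "card (sym_diff y \<Delta>) = Suc (card (sym_diff y (\<Delta> - {w})))"
    unfolding e(1) using e(2) fy fD by (intro card_insert_disjoint) auto
   hence "k \<le> card (sym_diff y \<Delta>)" using y(3) k by linarith
   moreover have "sym_diff y \<Delta> \<subseteq> V" "\<not> k - 1 \<le> card y" using y V k by (auto simp: W_def)
   ultimately show "y \<in> flip \<Delta> (fullb V k) - fullb V (k - 1)" by (simp add: flip_def fullb_def)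
  qed
 qed
 finally show ?thesis .
qed

text \<open>A part \<open>z\<close> outside \<open>S\<close>, of at most one point, is chosen to
  differ from \<open>\<Delta>\<close> there. This gains one level, or two if \<open>\<Delta>\<close>
  misses \<open>S\<close>, and the parts inside \<open>S\<close> are then counted as for two full
  balls. For the two excluded values of \<open>\<Delta>\<close> the difference is empty.\<close>

lemma full_ball_far_from_std_ball:
 assumes V: "finite V" "S \<subseteq> V" "\<Delta> \<subseteq> V" and R: "card (V - S) = (if b then 1 else 2)"
  and d: "\<Delta> \<noteq> {}" "\<Delta> \<noteq> V - S" and k: "2 \<le> k" "k \<le> card S + (if b then 0 else 1)"
 shows "(card S + (if b then 0 else 1) - 2) choose (k - 2) \<le> card (flip \<Delta> (fullb V k) - std_ball b V (k - 1) S)"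
proof -
 define R where "R = V - S"
 have fin: "finite S" "finite R" "finite \<Delta>" using V finite_subset by (auto simp: R_def)
 obtain z where z: "z \<subseteq> R" "card z \<le> 1" "z \<noteq> \<Delta> \<inter> R" "b \<or> z \<noteq> {}" "\<Delta> \<inter> S = {} \<Longrightarrow> 2 \<le> card (sym_diff z (\<Delta> \<inter> R))"
 proof (cases b)
  case True
  then obtain v where v: "R = {v}" using R by (auto simp: R_def card_1_singleton_iff)
  have ne: "\<Delta> \<inter> S \<noteq> {}"
  proof
   assume "\<Delta> \<inter> S = {}"
   hence "\<Delta> \<subseteq> {v}" using V(3) v by (auto simp: R_def)
   thus False using d v by (auto simp: R_def)
  qed
  show ?thesis
  proof (cases "v \<in> \<Delta>")
   case True thus ?thesis using that[of "{}"] \<open>b\<close> ne v by auto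
  next
   case False thus ?thesis using that[of "{v}"] \<open>b\<close> ne v by auto
  qed
 next
  case False
  hence "card R = 2" using R by (simp add: R_def)
  then obtain v w where vw: "R = {v, w}" "v \<noteq> w" by (auto simp: card_2_iff)
  show ?thesis
  proof (cases "\<Delta> \<inter> S = {}")
   case True
   hence "\<Delta> \<subseteq> {v, w}" using V(3) vw by (auto simp: R_def)
   hence "\<Delta> = {v} \<or> \<Delta> = {w}" using d vw by (auto simp: R_def)
   thus ?thesis
   proof
    assume D: "\<Delta> = {v}"
    have "sym_diff {w} (\<Delta> \<inter> R) = {v, w}" "{w} \<noteq> \<Delta> \<inter> R" using D vw by auto
    thus ?thesis using that[of "{w}"] vw by simp
   next
    assume D: "\<Delta> = {w}"
    have "sym_diff {v} (\<Delta> \<inter> R) = {v, w}" "{v} \<noteq> \<Delta> \<inter> R" using D vw by auto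
    thus ?thesis using that[of "{v}"] vw by simp
   qed
  next
   case ne: False
   show ?thesis
   proof (cases "\<Delta> \<inter> R = {v}")
    case True
    hence "{w} \<noteq> \<Delta> \<inter> R" using vw by auto
    thus ?thesis using that[of "{w}"] vw ne by auto
   next
    case False thus ?thesis using that[of "{v}"] vw ne by auto
   qed
  qed
 qed
 have fz: "finite z" using z fin finite_subset by auto
 define X where "X = {y. y \<subseteq> S \<and> card y \<le> k - 2 \<and> k \<le> card (sym_diff y (\<Delta> \<inter> S)) + card (sym_diff z (\<Delta> \<inter> R))}"
 have "(card S + (if b then 0 else 1) - 2) choose (k - 2) \<le> card X"
 proof (cases "\<Delta> \<inter> S = {}")
  case True
  have "(card S + (if b then 0 else 1) - 2) choose (k - 2) \<le> card S choose (k - 2)"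
   by (intro binomial_right_mono) auto
  also have "\<dots> = card {y. y \<subseteq> S \<and> card y = k - 2}" using n_subsets[OF fin(1)] by simp
  also have "\<dots> \<le> card X" using z(5)[OF True] True fin unfolding X_def by (intro card_mono) auto
  finally show ?thesis .
 next
  case False
  have "0 < card (sym_diff z (\<Delta> \<inter> R))" using z(3) fz fin by (subst card_gt_0_iff) auto
  hence sub: "{y. y \<subseteq> S \<and> card y \<le> k - 2 \<and> Suc (k - 2) \<le> card (sym_diff y (\<Delta> \<inter> S))} \<subseteq> X"
   using k unfolding X_def by auto
  have "(card S + (if b then 0 else 1) - 2) choose (k - 2) \<le> (card S - 1) choose (k - 2)"
   by (intro binomial_right_mono) auto
  also have "\<dots> \<le> card {y. y \<subseteq> S \<and> card y \<le> k - 2 \<and> Suc (k - 2) \<le> card (sym_diff y (\<Delta> \<inter> S))}"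
   using count_displaced[OF fin(1), of "\<Delta> \<inter> S" "k - 2"] False by simp
  also have "\<dots> \<le> card X" using sub fin by (intro card_mono) (auto simp: X_def)
  finally show ?thesis .
 qed
 also have "card X \<le> card (flip \<Delta> (fullb V k) - std_ball b V (k - 1) S)"
 proof (rule card_inj_on_le[of "\<lambda>y. y \<union> z"])
  show "inj_on (\<lambda>y. y \<union> z) X" by (rule inj_onI) (use z in \<open>auto simp: X_def R_def\<close>)
  show "finite (flip \<Delta> (fullb V k) - std_ball b V (k - 1) S)"
   using finite_subset_Pow[OF flip_subset_Pow[OF V(3) fullb_subset] V(1)] by simp
  show "(\<lambda>y. y \<union> z) ` X \<subseteq> flip \<Delta> (fullb V k) - std_ball b V (k - 1) S"
  proof
   fix x assume "x \<in> (\<lambda>y. y \<union> z) ` X"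
   then obtain y where y: "y \<in> X" "x = y \<union> z" by blast
   have y': "y \<subseteq> S" "card y \<le> k - 2" "k \<le> card (sym_diff y (\<Delta> \<inter> S)) + card (sym_diff z (\<Delta> \<inter> R))"
    using y by (auto simp: X_def)
   have fy: "finite y" using y' fin finite_subset by auto
   have xV: "x \<subseteq> V" using y' z y(2) V by (auto simp: R_def)
   have e: "sym_diff x \<Delta> = sym_diff y (\<Delta> \<inter> S) \<union> sym_diff z (\<Delta> \<inter> R)"
    using y' z(1) V(2,3) unfolding y(2) R_def by auto
   have dj: "sym_diff y (\<Delta> \<inter> S) \<inter> sym_diff z (\<Delta> \<inter> R) = {}" using y' z(1) by (auto simp: R_def)
   have "card (sym_diff x \<Delta>) = card (sym_diff y (\<Delta> \<inter> S)) + card (sym_diff z (\<Delta> \<inter> R))"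
    unfolding e using fy fz fin dj by (intro card_Un_disjoint) auto
   hence "x \<in> flip \<Delta> (fullb V k)" using y'(3) xV V(3) by (auto simp: flip_def fullb_def)
   moreover have "x \<notin> std_ball b V (k - 1) S"
   proof -
    have dz: "y \<inter> z = {}" using y' z(1) by (auto simp: R_def)
    have cx: "card x = card y + card z" unfolding y(2) using fy fz dz by (rule card_Un_disjoint)
    have xS: "x \<subseteq> S \<longleftrightarrow> z = {}" using y' z(1) unfolding y(2) by (auto simp: R_def)
    show ?thesis
    proof (cases "z = {}")
     case True
     hence "b" "card x \<le> k - 2" using z(4) cx y' by auto
     thus ?thesis using k by (auto simp: std_ball_def T1_def)
    next
     case False
     hence "\<not> x \<subseteq> S" "card x \<le> k - 1" using xS cx y' z(2) k by auto
     thus ?thesis using k by (auto simp: std_ball_def T1_def T2_def)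
    qed
   qed
   ultimately show "x \<in> flip \<Delta> (fullb V k) - std_ball b V (k - 1) S" by simp
  qed
 qed
 finally show ?thesis .
qed

section \<open>Stability along a direction outside the distinguished set\<close>

text \<open>Members of \<open>\<U>\<close> outside \<open>nbd W \<G>\<close> are not in the
  neighbourhood of \<open>\<D> \<inter> \<G>\<close>, so each is an extra element of
  \<open>nbd W \<D> \<union> \<U>\<close>; a set of \<open>\<G>\<close> missing from
  \<open>\<D>\<close> is charged at most \<open>k - 1\<close>.\<close>

lemma outside_bound:
 assumes W: "finite W" "\<D> \<subseteq> Pow W" "\<U> \<subseteq> Pow W" "\<G> \<subseteq> Pow W" and k: "2 \<le> k" "k \<le> s" "s \<le> card W"
  and G: "card \<G> = msize (card W) s k" and D: "card (\<G> - \<D>) \<le> (s - 1) choose (k - 1)" "k < s \<or> card (\<G> - \<D>) = 0"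
 shows "(real s - real k + 1) * real (card (\<U> - nbd W \<G>))
  \<le> (real s - real k + 1) * (real (card (nbd W \<D> \<union> \<U>)) - real (msize_nbd (card W) s k)) + (real k - 1) * real (card (\<G> - \<D>))"
proof -
 have fin: "finite \<D>" "finite \<U>" "finite \<G>" using finite_subset_Pow[OF W(2,1)] finite_subset_Pow[OF W(3,1)] finite_subset_Pow[OF W(4,1)] by simp_all
 define d where "d = card (\<G> - \<D>)"
 have "card \<G> = card (\<D> \<inter> \<G>) + d" unfolding d_def using card_Int_Diff[OF fin(3), of \<D>] by (simp add: Int_commute)
 hence pre: "msize (card W) s k \<le> card (\<D> \<inter> \<G>) + d" using G by simp
 have DG: "\<D> \<inter> \<G> \<subseteq> Pow W" using W(2) by (rule le_infI1)
 define T where "T = th (s - 1) (k - 1) * real d * (1 - real d / incr s k)"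
 define N where "N = real (card (nbd W (\<D> \<inter> \<G>)))"
 define p where "p = real s - real k + 1"
 have h: "T - (real k - 1) * real d \<le> p * (N - real (msize_nbd (card W) s k))"
  using nbd_bound_below[OF W(1) DG k D(1)[folded d_def] pre D(2)[folded d_def]] by (simp add: T_def N_def p_def)
 have T0: "0 \<le> T" unfolding T_def
  using slope_facts(3)[OF k(1,2)] D(1)[folded d_def] by (intro mult_nonneg_nonneg) (auto simp: divide_le_eq_1)
 have "nbd W (\<D> \<inter> \<G>) \<inter> (\<U> - nbd W \<G>) = {}" using nbd_mono[of "\<D> \<inter> \<G>" \<G> W] by auto
 hence "card (nbd W (\<D> \<inter> \<G>)) + card (\<U> - nbd W \<G>) = card (nbd W (\<D> \<inter> \<G>) \<union> (\<U> - nbd W \<G>))"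
  using W(1) fin by (intro card_Un_disjoint[symmetric]) auto
 also have "\<dots> \<le> card (nbd W \<D> \<union> \<U>)"
  using W(1) fin nbd_mono[of "\<D> \<inter> \<G>" \<D> W] by (intro card_mono) auto
 finally have "real (card (\<U> - nbd W \<G>)) \<le> real (card (nbd W \<D> \<union> \<U>)) - N" unfolding N_def by linarith
 moreover have "0 \<le> p" using slope_facts(7)[OF k(1,2)] by (simp add: p_def)
 ultimately have "p * real (card (\<U> - nbd W \<G>)) \<le> p * (real (card (nbd W \<D> \<union> \<U>)) - N)" by (intro mult_left_mono)
 also have "\<dots> = p * (real (card (nbd W \<D> \<union> \<U>)) - real (msize_nbd (card W) s k)) - p * (N - real (msize_nbd (card W) s k))"
  by (simp add: algebra_simps)
 finally show ?thesis using h T0 unfolding p_def[symmetric] d_def[symmetric] by linarith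
qed

lemma card_Diff_le_trans: "finite \<A> \<Longrightarrow> finite \<B> \<Longrightarrow> card (\<A> - \<C>) \<le> card (\<A> - \<B>) + card (\<B> - \<C>)"
proof -
 assume f: "finite \<A>" "finite \<B>"
 have "card (\<A> - \<C>) \<le> card ((\<A> - \<B>) \<union> (\<B> - \<C>))" using f by (intro card_mono) auto
 also have "\<dots> \<le> card (\<A> - \<B>) + card (\<B> - \<C>)" by (rule card_Un_le)
 finally show ?thesis .
qed

lemma card_Diff_sym:
 assumes "finite \<A>" "finite \<B>"
 shows "real (card (\<A> - \<B>)) - real (card (\<B> - \<A>)) = real (card \<A>) - real (card \<B>)"
 using card_Int_Diff[OF assms(1), of \<B>] card_Int_Diff[OF assms(2), of \<A>] by (simp add: Int_commute)

lemma msize_full: "msize n n k = binom_ge n k" "1 \<le> k \<Longrightarrow> msize_nbd n n k = binom_ge n (k - 1)"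
 using binom_ge_rec[of n k] binom_ge_rec[of n "k - 1"] by (simp_all add: msize_def msize_nbd_def)

text \<open>Both sections live in dimension \<open>s\<close>, where the balls are full, and
  \<open>stable_full\<close> finds their centres. The upper ball must essentially lie in the
  neighbourhood of the lower one, so by \<open>full_balls_far\<close> the centres differ in at most
  one coordinate. Equal centres give the first shape, adjacent ones the second.\<close>

lemma full_step_one:
 assumes V: "finite V" "\<A> \<subseteq> Pow V" "i \<in> V" and k: "3 \<le> k" "k \<le> s" "card V = s + 1"
  and \<eta>: "0 \<le> \<eta>" "1000000 * \<eta> \<le> 1"
 defines "U \<equiv> \<eta> * Zc s k" and "t \<equiv> real (card \<A>) - real (msize (card V) s k)"
  and "a \<equiv> real (card (upsec i \<A>)) - real (binom_ge (card V - 1) k)"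
 assumes t: "\<bar>t\<bar> \<le> 6 * U" and ex: "excess V s k \<A> \<le> U"
  and le: "card (dnsec i \<A>) \<le> card (upsec i \<A>)" and a: "a \<le> 14 * U"
 shows "\<exists>\<G>. gball V s k \<G> \<and> real (card (\<G> - \<A>)) + real (card (\<A> - \<G>)) \<le> 4 * U"
proof -
 define V' where "V' = V - {i}"
 define up dn where "up = upsec i \<A>" and "dn = dnsec i \<A>"
 have V': "finite V'" "card V' = s" "up \<subseteq> Pow V'" "dn \<subseteq> Pow V'"
  using V k(3) by (auto simp: V'_def up_def dn_def upsec_def dnsec_def)
 have fin: "finite \<A>" "finite up" "finite dn"
  using finite_subset_Pow[OF V(2,1)] finite_subset_Pow[OF V'(3,1)] finite_subset_Pow[OF V'(4,1)] by simp_all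
 have k2: "2 \<le> k" "k \<le> s" "s \<le> card V'" "1 \<le> k" "1 \<le> card V" "s \<le> card V" using k V'(2) by auto
 have cV1: "card V - 1 = s" using k(3) by simp
 define p K M Mp r where "p = real s - real k + 1" and "K = real k" and "M = incr s k"
  and "Mp = real ((s - 2) choose (k - 2))" and "r = rho s k"
 note ub = U_bounds[OF k(1,2) \<eta> zero_le_numeral, folded U_def p_def M_def Mp_def, folded K_def]
 note sf = slope_facts[OF k2(1,2), folded p_def r_def, folded K_def]
 have K3: "3 \<le> K" using k by (simp add: K_def)
 have p1: "1 \<le> p" by (rule sf(7))
 have Mp1: "1 \<le> Mp" using Zc_eqs(8)[OF k(1,2)] by (simp add: Mp_def)
 have M1: "1 \<le> M" "Mp \<le> M" using Zc_ineqs(9,11)[OF k(1,2)] by (auto simp: M_def Mp_def)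
 have U0: "0 \<le> U" by (rule ub(1))
 have tU: "t \<le> 6 * U" "- (6 * U) \<le> t" using t by linarith+
 define B B' where "B = real (binom_ge s k)" and "B' = real (binom_ge s (k - 1))"
 note ms = msize_split'[OF k2(4,5), of s, unfolded cV1, unfolded msize_full(1) msize_full(2)[OF k2(4)]]
 have ca: "real (card up) = B + a" unfolding a_def up_def B_def cV1 by simp
 have cb: "real (card dn) = B + (t - a)"
  using card_sections[OF fin(1), of i] ms(1) ca by (simp add: up_def dn_def t_def B_def)
 have a2: "- (3 * U) \<le> a" using ca cb le tU unfolding up_def dn_def by linarith
 define Nu Nd where "Nu = real (card (nbd V' up)) - B'" and "Nd = real (card (nbd V' dn)) - B'"
 have eu: "excess V' s k up = p * Nu - r * a" and ed: "excess V' s k dn = p * Nd - r * (t - a)"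
  unfolding excess_def V'(2) msize_full(1) msize_full(2)[OF k2(4)] using ca cb
  by (simp_all add: p_def r_def Nu_def Nd_def B_def B'_def)
 define Pu Pd where "Pu = real (card (nbd V' up \<union> dn)) - B'" and "Pd = real (card (nbd V' dn \<union> up)) - B'"
 have PN: "Nu \<le> Pu" "Nd \<le> Pd"
  unfolding Nu_def Nd_def Pu_def Pd_def using V'(1) fin by (auto intro!: card_mono)
 have exA: "p * (Pu + Pd) - r * t \<le> U"
 proof -
  have "real (card (nbd V \<A>)) = (Pu + B') + (Pd + B')"
   using card_nbd_sections[OF V] by (simp add: Pu_def Pd_def up_def dn_def V'_def)
  moreover have "real (msize_nbd (card V) s k) = 2 * B'" using ms(2) by (simp add: B'_def)
  ultimately have "real (card (nbd V \<A>)) - real (msize_nbd (card V) s k) = Pu + Pd" by simp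
  thus ?thesis using ex unfolding excess_def p_def[symmetric] r_def[symmetric] t_def by simp
 qed
 define \<theta> where "\<theta> = th (s - 1) (k - 1)"
 have th1: "1 \<le> \<theta>" using sf(3) by (simp add: \<theta>_def)
 have win: "2 * x \<le> incr s k" "- 6 * th (s - 1) (k - 1) * x \<le> incr s k"
  if x: "\<bar>x\<bar> \<le> 20 * U" for x
 proof -
  show "2 * x \<le> incr s k" using x ub(2) U0 M1 unfolding M_def[symmetric] by linarith
  have "\<theta> * (- x) \<le> \<theta> * (20 * U)" using x th1 by (intro mult_left_mono) auto
  hence "- 6 * \<theta> * x \<le> M" using ub(4) M1 unfolding \<theta>_def[symmetric] by (simp add: mult.assoc)
  thus "- 6 * th (s - 1) (k - 1) * x \<le> incr s k" by (simp add: \<theta>_def M_def)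
 qed
 have xa: "real (card up) - real (msize (card V') s k) = a" "real (card dn) - real (msize (card V') s k) = t - a"
  using ca cb unfolding V'(2) msize_full(1) B_def by simp_all
 have aa: "\<bar>a\<bar> \<le> 20 * U" "\<bar>t - a\<bar> \<le> 20 * U" using a a2 tU U0 by linarith+
 have wu: "2 * (real (card up) - real (msize (card V') s k)) \<le> incr s k"
  "- 6 * th (s - 1) (k - 1) * (real (card up) - real (msize (card V') s k)) \<le> incr s k"
  unfolding xa(1) by (rule win[OF aa(1)])+
 have wd: "2 * (real (card dn) - real (msize (card V') s k)) \<le> incr s k"
  "- 6 * th (s - 1) (k - 1) * (real (card dn) - real (msize (card V') s k)) \<le> incr s k"
  unfolding xa(2) by (rule win[OF aa(2)])+
 have e0: "0 \<le> excess V' s k up" "0 \<le> excess V' s k dn"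
  using excess_lower[OF V'(1,3) k2(1-3) wu] excess_lower[OF V'(1,4) k2(1-3) wd] by linarith+
 have "excess V' s k up + excess V' s k dn \<le> U"
 proof -
  have "p * (Nu + Nd) \<le> p * (Pu + Pd)" using PN p1 by (intro mult_left_mono) auto
  thus ?thesis using exA unfolding eu ed by (simp add: algebra_simps)
 qed
 hence eU: "excess V' s k up \<le> U" "excess V' s k dn \<le> U" using e0 by linarith+
 have \<eta>4: "10000 * \<eta> \<le> 1" using \<eta> by simp
 have kV: "k \<le> card V'" using k2(2,3) by simp
 have S: "stable V' s k \<eta>" using stable_full[OF V'(1) k2(1) kV \<eta>(1) \<eta>4] unfolding V'(2) .
 obtain G1 where G1: "gball V' s k G1" "real (card (G1 - up)) + real (card (up - G1)) \<le> 4 * U"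
  using S V'(3) wu eU(1) unfolding stable_def U_def by blast
 obtain G2 where G2: "gball V' s k G2" "real (card (G2 - dn)) + real (card (dn - G2)) \<le> 4 * U"
  using S V'(4) wd eU(2) unfolding stable_def U_def by blast
 obtain C1 where C1: "C1 \<subseteq> V'" "G1 = flip C1 (fullb V' k)"
  using gball_full[OF V'(1) k2(4)] G1(1) V'(2) by metis
 obtain C2 where C2: "C2 \<subseteq> V'" "G2 = flip C2 (fullb V' k)"
  using gball_full[OF V'(1) k2(4)] G2(1) V'(2) by metis
 have sG: "G1 \<subseteq> Pow V'" "G2 \<subseteq> Pow V'" using gball_subset G1(1) G2(1) by auto
 have fG: "finite G1" "finite G2" using finite_subset_Pow[OF sG(1) V'(1)] finite_subset_Pow[OF sG(2) V'(1)] by simp_all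
 define y1 y2 y3 y4 e where "y1 = real (card (G1 - up))" and "y2 = real (card (up - G1))"
  and "y3 = real (card (G2 - dn))" and "y4 = real (card (dn - G2))" and "e = real (card (up - nbd V' G2))"
 have y: "0 \<le> y1" "0 \<le> y2" "0 \<le> y3" "0 \<le> y4" "y1 + y2 \<le> 4 * U" "y3 + y4 \<le> 4 * U"
  using G1(2) G2(2) by (simp_all add: y1_def y2_def y3_def y4_def)
 have "p * e \<le> p * Pd + (K - 1) * y3"
 proof -
  have cd: "card (G2 - dn) \<le> (s - 1) choose (k - 1)" "k < s \<or> card (G2 - dn) = 0"
  proof -
   show "card (G2 - dn) \<le> (s - 1) choose (k - 1)" using y ub(2) U0 unfolding M_def y3_def by linarith
   show "k < s \<or> card (G2 - dn) = 0"
   proof (cases "k < s")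
    case False
    hence "U = 0" using k ub(9) by simp
    thus ?thesis using y unfolding y3_def by simp
   qed simp
  qed
  show ?thesis
   using outside_bound[OF V'(1,4,3) sG(2) k2(1-3) card_gball(1)[OF V'(1) G2(1) k2(1,2)] cd]
   unfolding V'(2) msize_full(2)[OF k2(4)] p_def K_def e_def y3_def Pd_def B'_def .
 qed
 also have "\<dots> \<le> U + 13 * (U * (K - 1))"
 proof -
  have "p * Nu \<le> p * Pu" using PN p1 by (intro mult_left_mono) auto
  hence "r * a \<le> p * Pu" using e0(1) unfolding eu by linarith
  moreover have "r * (t - a) \<le> r * (9 * U)" using tU a2 sf(6) by (intro mult_left_mono) auto
  moreover have "r * (9 * U) \<le> (K - 1) * (9 * U)" using sf(1) U0 by (intro mult_right_mono) auto
  moreover have "(K - 1) * y3 \<le> (K - 1) * (4 * U)" using y K3 by (intro mult_left_mono) auto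
  ultimately show ?thesis using exA by (simp add: algebra_simps)
 qed
 finally have pe: "p * e \<le> U + 13 * (U * (K - 1))" .
 have e_small: "100000 * e \<le> 2 * Mp"
 proof -
  have "U \<le> p * U" using mult_right_mono[OF p1 U0] by simp
  moreover have "1000000 * (p * U) \<le> p * Mp" using mult_left_mono[OF ub(3), of p] p1 by (simp add: mult_ac)
  ultimately have "1000000 * (p * e) \<le> 14 * (p * Mp)" using pe ub(5) by linarith
  hence "p * (1000000 * e) \<le> p * (14 * Mp)" by (simp add: mult_ac)
  hence "1000000 * e \<le> 14 * Mp" using p1 by (simp add: mult_le_cancel_left)
  thus ?thesis using Mp1 by linarith
 qed
 have far: "real (card (G1 - flip C2 (fullb V' (k - 1)))) < Mp"
 proof -
  have "nbd V' G2 \<subseteq> flip C2 (fullb V' (k - 1))"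
   unfolding C2(2) nbd_flip[OF C2(1)] by (rule flip_mono[OF nbd_fullb[OF V'(1)]])
  hence "card (up - flip C2 (fullb V' (k - 1))) \<le> card (up - nbd V' G2)" using fin by (intro card_mono) auto
  hence "real (card (G1 - flip C2 (fullb V' (k - 1)))) \<le> y1 + e"
   using card_Diff_le_trans[OF fG(1) fin(2), of "flip C2 (fullb V' (k - 1))"] unfolding y1_def e_def by linarith
  thus ?thesis using e_small y ub(3) U0 Mp1 by linarith
 qed
 define \<Delta> where "\<Delta> = sym_diff C2 C1"
 have \<Delta>V: "\<Delta> \<subseteq> V'" using C1 C2 by (auto simp: \<Delta>_def)
 have fV': "finite \<Delta>" using \<Delta>V V'(1) finite_subset by auto
 have "card \<Delta> \<le> 1"
 proof (rule ccontr)
  assume "\<not> ?thesis"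
  hence "(card V' - 2) choose (k - 2) \<le> card (flip \<Delta> (fullb V' k) - fullb V' (k - 1))"
   using full_balls_far[OF V'(1) \<Delta>V _ k2(1)] by simp
  moreover have "card (flip C2 (flip \<Delta> (fullb V' k)) - flip C2 (fullb V' (k - 1))) = card (flip \<Delta> (fullb V' k) - fullb V' (k - 1))"
   by (rule card_flip_Diff)
  moreover have "flip C2 (flip \<Delta> (fullb V' k)) = G1"
  proof -
   have "sym_diff C2 \<Delta> = C1" by (auto simp: \<Delta>_def)
   thus ?thesis unfolding flip_flip_sym_diff C1(2) by simp
  qed
  ultimately show False using far unfolding Mp_def V'(2) by simp
 qed
 hence "card \<Delta> = 0 \<or> card \<Delta> = 1" by linarith
 then obtain b S where bS: "S \<subseteq> V'" "card S + (if b then 0 else 1) = s" "G2 = flip C1 (std_ball b V' k S)"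
 proof
  assume "card \<Delta> = 0"
  hence "\<Delta> = {}" using fV' by simp
  hence "C1 = C2" by (auto simp: \<Delta>_def)
  thus ?thesis using that[of V' True] C2(2) fullb_T1[OF V'(1)] V'(2) by simp
 next
  assume "card \<Delta> = 1"
  then obtain j where j: "\<Delta> = {j}" by (auto simp: card_1_singleton_iff)
  hence jV: "j \<in> V'" using \<Delta>V by auto
  have "C2 = sym_diff C1 {j}" using j by (auto simp: \<Delta>_def)
  hence "G2 = flip C1 (std_ball False V' k (V' - {j}))"
   using C2(2) fullb_T2[OF V'(1) jV k2(4)] by (simp add: flip_flip_sym_diff)
  moreover have "card (V' - {j}) + (if False then 0 else 1) = s" using jV V' k2 by simp
  ultimately show ?thesis using that[of "V' - {j}" False] by blast
 qed
 have gb: "gball V s k (glue i G1 G2)"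
  unfolding C1(2) bS(3) V'_def by (rule gball_glue_full[OF V(1,3)]) (use bS C1 k2 in \<open>auto simp: V'_def\<close>)
 have fin1: "10 * (y1 + y3) \<le> M" using y ub(2) U0 M1 unfolding distrib_left by linarith
 have fin2: "10 * (y2 + y4) \<le> M" using y ub(2) U0 M1 unfolding distrib_left by linarith
 have th96: "96 * th (s - 1) (k - 1) * U \<le> real (s - 1 choose (k - 1))"
  using ub(4) U0 th1 mult_nonneg_nonneg[of \<theta> U] unfolding \<theta>_def[symmetric] M_def[symmetric] mult.assoc by linarith
 show ?thesis
  by (rule glue_close[OF V k2(1,2,6) sG[unfolded V'_def] gb ex th96 t[unfolded t_def]
   fin1[unfolded y1_def y3_def M_def up_def dn_def] fin2[unfolded y2_def y4_def M_def up_def dn_def]])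
qed

text \<open>The lower section keeps the parameters \<open>s\<close>, \<open>k\<close>, so induction
  gives it a ball \<open>Gm\<close>. The upper section has nearly the size of a full ball and must
  be shown close to the one centred like \<open>Gm\<close>; by \<open>outside_bound\<close> it
  almost lies in the neighbourhood of \<open>Gm\<close>.\<close>

lemma full_step:
 assumes V: "finite V" "\<A> \<subseteq> Pow V" "i \<in> V" and k: "3 \<le> k" "k \<le> s" "s + 2 \<le> card V"
  and \<eta>: "0 \<le> \<eta>" "1000000 * \<eta> \<le> 1"
 defines "U \<equiv> \<eta> * Zc s k" and "t \<equiv> real (card \<A>) - real (msize (card V) s k)"
  and "a \<equiv> real (card (upsec i \<A>)) - real (binom_ge (card V - 1) k)"
 assumes t: "\<bar>t\<bar> \<le> 6 * U" and ex: "excess V s k \<A> \<le> U"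
  and le: "card (dnsec i \<A>) \<le> card (upsec i \<A>)" and a: "a \<le> 14 * U"
  and IH: "stable (V - {i}) s k \<eta>"
 shows "\<exists>\<G>. gball V s k \<G> \<and> real (card (\<G> - \<A>)) + real (card (\<A> - \<G>)) \<le> 4 * U"
proof -
 define V' where "V' = V - {i}"
 define n' where "n' = card V - 1"
 define up dn where "up = upsec i \<A>" and "dn = dnsec i \<A>"
 have V': "finite V'" "card V' = n'" "up \<subseteq> Pow V'" "dn \<subseteq> Pow V'"
  using V by (auto simp: V'_def n'_def up_def dn_def upsec_def dnsec_def)
 have fin: "finite \<A>" "finite up" "finite dn"
  using finite_subset_Pow[OF V(2,1)] finite_subset_Pow[OF V'(3,1)] finite_subset_Pow[OF V'(4,1)] by simp_all
 have k2: "2 \<le> k" "k \<le> s" "s \<le> card V'" "1 \<le> k" "1 \<le> card V" "s \<le> card V" "s < n'" "k \<le> n'" using k V'(2) by (auto simp: n'_def)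
 define p K M Mp r where "p = real s - real k + 1" and "K = real k" and "M = incr s k"
  and "Mp = real ((s - 2) choose (k - 2))" and "r = rho s k"
 note ub = U_bounds[OF k(1,2) \<eta> zero_le_numeral, folded U_def p_def M_def Mp_def, folded K_def]
 note sf = slope_facts[OF k2(1,2), folded p_def r_def, folded K_def]
 have K3: "3 \<le> K" using k by (simp add: K_def)
 have p1: "1 \<le> p" by (rule sf(7))
 have Mp1: "1 \<le> Mp" using Zc_eqs(8)[OF k(1,2)] by (simp add: Mp_def)
 have M1: "1 \<le> M" "Mp \<le> M" using Zc_ineqs(9,11)[OF k(1,2)] by (auto simp: M_def Mp_def)
 have U0: "0 \<le> U" by (rule ub(1))
 have tU: "t \<le> 6 * U" "- (6 * U) \<le> t" using t by linarith+
 define B B' where "B = real (binom_ge n' k)" and "B' = real (binom_ge n' (k - 1))"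
 note ms = msize_split'[OF k2(4,5), of s, folded n'_def]
 have ca: "real (card up) = B + a" by (simp add: a_def up_def B_def n'_def)
 have cb: "real (card dn) = real (msize n' s k) + (t - a)"
  using card_sections[OF fin(1), of i] ms(1) ca by (simp add: up_def dn_def t_def B_def)
 define mn where "mn = real (msize_nbd n' s k)"
 define X where "X = real (card (nbd V' up)) - B'"
 define Nd where "Nd = real (card (nbd V' dn)) - mn"
 define \<sigma> where "\<sigma> = sig s k"
 have sp: "\<sigma> * (p + 1) = K - 1" using sig_mult[of k s] k2 by (simp add: \<sigma>_def p_def K_def add_ac)
 have rc: "(K - 1) * p \<le> r * (p + 1)" using rho_chord[OF k2(1,2)] by (simp add: r_def p_def K_def)
 have psr: "p * \<sigma> \<le> r"
 proof -
  have "(p * \<sigma>) * (p + 1) = (K - 1) * p" unfolding sp[symmetric] by (simp only: mult_ac)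
  hence "(p * \<sigma>) * (p + 1) \<le> r * (p + 1)" using rc by (simp only:)
  thus ?thesis using p1 by (simp add: mult_le_cancel_right)
 qed
 have UpM: "1000000 * (p * U) \<le> p * M" "U \<le> p * U" "1000000 * (p * U) \<le> p * Mp"
  using mult_left_mono[OF ub(2), of p] mult_left_mono[OF ub(3), of p] mult_right_mono[OF p1 U0] p1 by (simp_all add: mult_ac)
 have UK: "1000000 * (U * (K - 1)) \<le> p * Mp" "0 \<le> U * (K - 1)" "U \<le> U * (K - 1)"
  using ub(5) U0 K3 mult_left_mono[of 1 "K - 1" U] by simp_all
 have pMp: "p * Mp \<le> p * M" using M1 p1 by (intro mult_left_mono) auto
 have a_lo: "- (12 * U) \<le> a"
 proof (cases "0 \<le> a")
  case False
  define q where "q = binom_ge n' k - card up"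
  have q: "card (upsec i \<A>) + q = binom_ge (card V - 1) k" "real q = - a"
   using False ca unfolding q_def B_def up_def n'_def by (auto simp: of_nat_diff)
  have h: "10000 * U \<le> M" "10000 * (U * (K - 1)) \<le> p * M" "10000 * (p * U) \<le> (K - 1) * M"
  proof -
   have "0 \<le> p * U" using UpM(2) U0 by linarith
   thus "10000 * (p * U) \<le> (K - 1) * M" using ub(6) by linarith
   show "10000 * U \<le> M" using ub(2) U0 by linarith
   show "10000 * (U * (K - 1)) \<le> p * M" using UK(1,2) pMp by linarith
  qed
  have "real q \<le> 12 * U"
   by (rule deficit_small[OF V k U0 h[unfolded p_def K_def M_def] t[unfolded t_def] ex le q(1)])
  thus ?thesis using q(2) by simp
 qed (use U0 in simp)
 have MM: "M \<le> real (s choose (k - 1))" unfolding M_def by (intro of_nat_mono binomial_right_mono) auto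
 \<comment> \<open>The upper section alone contributes at least its tangential part
   \<open>r * a\<close>, so the excess of the lower section is at most the whole budget
   \<open>U\<close>.\<close>
 have Xr: "r * a \<le> p * X"
 proof (cases "0 \<le> a")
  case True
  define g where "g = card up - binom_ge n' k"
  have g: "real g = a" "binom_ge (card V') k + g \<le> card up"
   using True ca unfolding g_def B_def V'(2) by (auto simp: of_nat_diff)
  have gM: "g \<le> (s - 1) choose (k - 1)" using g(1) a ub(2) U0 unfolding M_def by linarith
  have pre: "s \<le> card V' + 1" "k \<le> card V'" using k2 V'(2) by auto
  define T where "T = th (s - 1) (k - 1) * a * (1 - a / M)"
  have "(K - 1) * a + T \<le> p * X"
   using full_plus[OF V'(1,3) k2(1,2) pre g(2) gM] unfolding g(1) T_def M_def K_def p_def X_def B'_def V'(2) .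
  moreover have "0 \<le> T" unfolding T_def using sf(3) True a ub(2) U0 M1
   by (intro mult_nonneg_nonneg) (auto simp: divide_le_eq_1)
  moreover have "r * a \<le> (K - 1) * a" using sf(1) True by (intro mult_right_mono) auto
  ultimately show ?thesis by linarith
 next
  case False
  define q where "q = binom_ge n' k - card up"
  have q: "card up + q = binom_ge (card V') k" "real q = - a"
   using False ca unfolding q_def B_def V'(2) by (auto simp: of_nat_diff)
  have "Suc s choose k \<le> n' choose k" using k2 by (intro binomial_right_mono) auto
  moreover have "q \<le> s choose (k - 1)" using q(2) a_lo ub(2) U0 MM by linarith
  ultimately have "(s choose k) + q \<le> card V' choose k" using choose_steps(2)[OF k2(1), of s] V'(2) by simp
  hence "B' - \<sigma> * real q \<le> real (card (nbd V' up))"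
   using full_minus[OF V'(1,3) k2(1,2) _ q(1)] k2(7) V'(2) by (simp add: \<sigma>_def B'_def)
  hence "\<sigma> * a \<le> X" unfolding q(2) X_def by simp
  hence "p * (\<sigma> * a) \<le> p * X" using p1 by (intro mult_left_mono) auto
  moreover have "r * a \<le> (p * \<sigma>) * a" using psr False by (intro mult_right_mono_neg) auto
  ultimately show ?thesis by (simp add: mult.assoc)
 qed
 define Pu Pd where "Pu = real (card (nbd V' up \<union> dn)) - B'" and "Pd = real (card (nbd V' dn \<union> up)) - mn"
 have PN: "X \<le> Pu" "Nd \<le> Pd"
  unfolding X_def Nd_def Pu_def Pd_def using V'(1) fin by (auto intro!: card_mono)
 have exA: "p * (Pu + Pd) - r * t \<le> U"
 proof -
  have "real (card (nbd V \<A>)) = (Pu + B') + (Pd + mn)"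
   using card_nbd_sections[OF V] by (simp add: Pu_def Pd_def up_def dn_def V'_def)
  moreover have "real (msize_nbd (card V) s k) = B' + mn" using ms(2) by (simp add: B'_def mn_def)
  ultimately have "real (card (nbd V \<A>)) - real (msize_nbd (card V) s k) = Pu + Pd" by simp
  thus ?thesis using ex unfolding excess_def p_def[symmetric] r_def[symmetric] t_def by simp
 qed
 have pPu: "p * X \<le> p * Pu" "p * Nd \<le> p * Pd" using PN p1 by (intro mult_left_mono; simp)+
 have ed: "excess V' s k dn = p * Nd - r * (t - a)"
  unfolding excess_def V'(2) using cb by (simp add: p_def r_def Nd_def mn_def)
 have xd: "real (card dn) - real (msize (card V') s k) = t - a" using cb V'(2) by simp
 define \<theta> where "\<theta> = th (s - 1) (k - 1)"
 have th1: "1 \<le> \<theta>" using sf(3) by (simp add: \<theta>_def)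
 have ta: "\<bar>t - a\<bar> \<le> 20 * U" using a a_lo tU U0 by linarith
 have wd: "2 * (real (card dn) - real (msize (card V') s k)) \<le> incr s k"
  "- 6 * th (s - 1) (k - 1) * (real (card dn) - real (msize (card V') s k)) \<le> incr s k"
  unfolding xd
 proof -
  show "2 * (t - a) \<le> incr s k" using ta ub(2) U0 M1 unfolding M_def[symmetric] right_diff_distrib by linarith
  have "\<theta> * (- (t - a)) \<le> \<theta> * (20 * U)" using ta th1 by (intro mult_left_mono) auto
  moreover have "\<theta> * (- (t - a)) = - (\<theta> * (t - a))" "\<theta> * (20 * U) = 20 * (\<theta> * U)" by (simp_all only: mult_minus_right mult.left_commute)
  ultimately have "- 6 * (\<theta> * (t - a)) \<le> M" using ub(4) M1 unfolding \<theta>_def[symmetric] by linarith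
  thus "- 6 * th (s - 1) (k - 1) * (t - a) \<le> incr s k" unfolding \<theta>_def M_def by (simp only: mult.assoc)
 qed
 have e0: "0 \<le> excess V' s k dn" using excess_lower[OF V'(1,4) k2(1-3) wd] by linarith
 have pX: "p * X \<le> U + r * a"
  using exA pPu e0 unfolding ed by (simp add: algebra_simps)
 have ed_le: "excess V' s k dn \<le> U"
  using exA pPu Xr unfolding ed by (simp add: algebra_simps)
 obtain b C S where g: "C \<subseteq> V'" "S \<subseteq> V'" "card S + (if b then 0 else 1) = s"
  "real (card (flip C (std_ball b V' k S) - dn)) + real (card (dn - flip C (std_ball b V' k S))) \<le> 4 * (\<eta> * Zc s k)"
  by (rule stableD[OF IH[folded V'_def] V'(4) wd ed_le[unfolded U_def]])
 define Gm where "Gm = flip C (std_ball b V' k S)"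
 have sGm: "Gm \<subseteq> Pow V'" using flip_subset_Pow[OF g(1) std_ball_subset] by (simp add: Gm_def)
 have gGm: "gball V' s k Gm" unfolding gball_def Gm_def using g k2(3) by blast
 have cGm: "card Gm = msize (card V') s k" "card (nbd V' Gm) = msize_nbd (card V') s k"
  using card_gball[OF V'(1) gGm k2(1,2)] by auto
 have nGm: "nbd V' Gm = flip C (std_ball b V' (k - 1) S)"
  unfolding Gm_def nbd_flip[OF g(1)] using nbd_std_ball(1)[OF V'(1) g(2) k2(1) g(3)[symmetric] k2(2,3)] by simp
 define y3 y4 e where "y3 = real (card (Gm - dn))" and "y4 = real (card (dn - Gm))" and "e = real (card (up - nbd V' Gm))"
 have y: "0 \<le> y3" "0 \<le> y4" "y3 + y4 \<le> 4 * U" "0 \<le> e"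
  using g(4) by (simp_all add: y3_def y4_def e_def Gm_def U_def)
 have "p * e \<le> p * Pd + (K - 1) * y3"
 proof -
  have cd: "card (Gm - dn) \<le> (s - 1) choose (k - 1)" "k < s \<or> card (Gm - dn) = 0"
  proof -
   show "card (Gm - dn) \<le> (s - 1) choose (k - 1)" using y ub(2) U0 unfolding M_def y3_def by linarith
   show "k < s \<or> card (Gm - dn) = 0"
   proof (cases "k < s")
    case False
    hence "U = 0" using k ub(9) by simp
    thus ?thesis using y unfolding y3_def by simp
   qed simp
  qed
  show ?thesis
   using outside_bound[OF V'(1,4,3) sGm k2(1-3) cGm(1) cd]
   unfolding V'(2) p_def K_def e_def y3_def mn_def Pd_def .
 qed
 also have "\<dots> \<le> U + 22 * (U * (K - 1))"
 proof -
  have "r * (t - a) \<le> r * (18 * U)" using tU a_lo sf(6) by (intro mult_left_mono) auto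
  moreover have "r * (18 * U) \<le> (K - 1) * (18 * U)" using sf(1) U0 by (intro mult_right_mono) auto
  moreover have "(K - 1) * y3 \<le> (K - 1) * (4 * U)" using y K3 by (intro mult_left_mono) auto
  ultimately show ?thesis using exA Xr pPu by (simp add: algebra_simps)
 qed
 finally have pe: "p * e \<le> U + 22 * (U * (K - 1))" .
 have e_small: "1000000 * e \<le> 23 * Mp"
 proof -
  have "1000000 * (p * e) \<le> 23 * (p * Mp)" using pe UK UpM by linarith
  hence "p * (1000000 * e) \<le> p * (23 * Mp)" by (simp add: mult_ac)
  thus ?thesis using p1 by (simp add: mult_le_cancel_left)
 qed
 have th96: "96 * th (s - 1) (k - 1) * U \<le> real (s - 1 choose (k - 1))"
  using ub(4) U0 th1 mult_nonneg_nonneg[of \<theta> U] unfolding \<theta>_def[symmetric] M_def[symmetric] mult.assoc by linarith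
 have finish: ?thesis
  if f: "C1 \<subseteq> V'" "Gm = flip C1 (std_ball b V' k S)"
   "10000 * real (card (flip C1 (fullb V' k) - up)) \<le> 200 * M" "10000 * real (card (up - flip C1 (fullb V' k))) \<le> 200 * M" for C1
 proof -
  define G1 where "G1 = flip C1 (fullb V' k)"
  have sG1: "G1 \<subseteq> Pow V'" unfolding G1_def by (rule flip_subset_Pow[OF f(1) fullb_subset])
  have gb: "gball V s k (glue i G1 Gm)"
   unfolding f(2) G1_def V'_def by (rule gball_glue_full[OF V(1,3)]) (use g f(1) k2 in \<open>auto simp: V'_def\<close>)
  have fin1: "10 * (real (card (G1 - up)) + y3) \<le> M" using y ub(2) U0 M1 f(3) unfolding distrib_left G1_def by linarith
  have fin2: "10 * (real (card (up - G1)) + y4) \<le> M" using y ub(2) U0 M1 f(4) unfolding distrib_left G1_def by linarith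
  show ?thesis
   by (rule glue_close[OF V k2(1,2,6) sG1[unfolded V'_def] sGm[unfolded V'_def] gb ex th96 t[unfolded t_def]
    fin1[unfolded y3_def M_def up_def dn_def] fin2[unfolded y4_def M_def up_def dn_def]])
 qed
 show ?thesis
 proof (cases "n' = s + 1")
  case True
  text \<open>Here the larger section is close to a full ball by \<open>stable_full\<close>; its centre is the one of
   \<open>Gm\<close> up to a flip of \<open>V' - S\<close>, under which \<open>Gm\<close> is invariant.\<close>
  define r' where "r' = rho (s + 1) k"
  have s1: "k \<le> s + 1" "s + 1 - 1 = s" "s + 1 = card V'" "real (s + 1) - real k + 1 = p + 1"
   using k2 True V'(2) by (auto simp: p_def)
  define ex' where "ex' = excess V' (s + 1) k up"
  have eu: "ex' = (p + 1) * X - r' * a"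
   unfolding ex'_def excess_def s1(4) using ca True V'(2)
   by (simp add: msize_full msize_full(2)[OF k2(4)] r'_def X_def B_def B'_def)
  have r'f: "r' \<le> K - 1" "(K - 1) * (p + 1) \<le> r' * (p + 2)"
   using slope_facts(1)[OF k2(1) s1(1)] rho_chord[OF k2(1) s1(1)] unfolding s1(4) by (simp_all add: r'_def K_def add_ac)
  \<comment> \<open>The upper section is bounded with the slope at \<open>s\<close>, whereas its
    ball is full and has parameter \<open>s + 1\<close>; \<open>c\<close> is the cost of changing
    between the scaled slopes.\<close>
  define c where "c = (p + 1) * r - p * r'"
  have c0: "0 \<le> c"
   using rc mult_left_mono[OF r'f(1), of p] p1 by (simp add: c_def algebra_simps)
  have c1: "c \<le> 2 * (K - 1)"
  proof -
   have "(p + 2) * c \<le> (p + 2) * ((p + 1) * (K - 1)) - p * ((K - 1) * (p + 1))"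
    using mult_left_mono[OF r'f(2), of p] mult_left_mono[OF sf(1), of "(p + 2) * (p + 1)"] p1
    by (simp add: c_def algebra_simps)
   also have "\<dots> = 2 * ((p + 1) * (K - 1))" by (simp add: algebra_simps)
   also have "\<dots> \<le> (p + 2) * (2 * (K - 1))" using K3 by (simp add: algebra_simps)
   finally show ?thesis using p1 by (simp add: mult_le_cancel_left)
  qed
  have pex: "p * ex' \<le> 2 * (p * U) + 28 * (U * (K - 1))"
  proof -
   have "c * a \<le> c * (14 * U)" using a c0 by (intro mult_left_mono) auto
   also have "\<dots> \<le> (2 * (K - 1)) * (14 * U)" using c1 U0 by (intro mult_right_mono) auto
   finally have ca': "c * a \<le> 28 * (U * (K - 1))" by (simp add: mult_ac)
   have "(p + 1) * (p * X) \<le> (p + 1) * (U + r * a)" using pX p1 by (intro mult_left_mono) auto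
   hence "p * ex' \<le> (p + 1) * U + c * a" unfolding eu c_def by (simp add: algebra_simps)
   thus ?thesis using ca' UpM(2) by (simp add: algebra_simps)
  qed
  have exs: "1000000 * ex' \<le> 30 * Mp"
  proof -
   have "1000000 * (p * ex') \<le> 30 * (p * Mp)" using pex UK UpM by linarith
   hence "p * (1000000 * ex') \<le> p * (30 * Mp)" by (simp add: mult_ac)
   thus ?thesis using p1 by (simp add: mult_le_cancel_left)
  qed
  have xu: "real (card up) - real (msize (card V') (s + 1) k) = a"
   using ca True V'(2) by (simp add: msize_full B_def)
  have wu: "2 * (real (card up) - real (msize (card V') (s + 1) k)) \<le> real ((s + 1 - 1) choose (k - 1))"
   "- 6 * th (s + 1 - 1) (k - 1) * (real (card up) - real (msize (card V') (s + 1) k)) \<le> real ((s + 1 - 1) choose (k - 1))"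
   unfolding xu s1(2)
  proof -
   show "2 * a \<le> real (s choose (k - 1))" using a ub(2) U0 MM M1 by linarith
   define \<theta>' where "\<theta>' = th s (k - 1)"
   have th': "1 \<le> \<theta>'" "\<theta>' * (p + 1) \<le> real s"
    using slope_facts(3,4)[OF k2(1) s1(1)] unfolding s1(2,4) by (simp_all add: \<theta>'_def)
   have "(\<theta>' * (p + 1)) * U \<le> real s * U" using th' U0 by (intro mult_right_mono) auto
   hence "(p + 1) * (\<theta>' * U) \<le> U * real s" by (simp only: mult_ac)
   hence "1000000 * ((p + 1) * (\<theta>' * U)) \<le> 2 * M * p" using ub(7) by linarith
   also have "\<dots> \<le> 2 * M * (p + 1)" using M1 by simp
   finally have "(p + 1) * (1000000 * (\<theta>' * U)) \<le> (p + 1) * (2 * M)" by (simp add: mult_ac)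
   hence "1000000 * (\<theta>' * U) \<le> 2 * M" using p1 by (simp add: mult_le_cancel_left)
   moreover have "\<theta>' * (- a) \<le> \<theta>' * (12 * U)" using a_lo th' by (intro mult_left_mono) auto
   moreover have "\<theta>' * (- a) = - (\<theta>' * a)" "\<theta>' * (12 * U) = 12 * (\<theta>' * U)" by simp_all
   ultimately have "- 6 * (\<theta>' * a) \<le> real (s choose (k - 1))" using MM M1 by linarith
   thus "- 6 * th s (k - 1) * a \<le> real (s choose (k - 1))" unfolding \<theta>'_def by (simp only: mult.assoc)
  qed
  have "\<bar>a\<bar> \<le> 6 * ex'" using excess_lower[OF V'(1,3) k2(1) s1(1) _ wu] s1(3) xu by (simp add: ex'_def)
  hence ex0: "0 \<le> ex'" by linarith
  \<comment> \<open>The upper section gets its own budget constant, its excess divided by the unit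
    \<open>Zc (s + 1) k = Mp\<close>; \<open>stable_full\<close> tolerates this larger
    constant.\<close>
  define \<eta>' where "\<eta>' = ex' / Mp"
  have Z': "Zc (s + 1) k = Mp" using k2 k by (simp add: Zc_def Mp_def)
  have \<eta>': "0 \<le> \<eta>'" "10000 * \<eta>' \<le> 1" "\<eta>' * Zc (s + 1) k = ex'"
   using ex0 exs Mp1 unfolding Z' \<eta>'_def by (simp_all add: divide_le_eq)
  have S': "stable V' (s + 1) k \<eta>'" unfolding s1(3) by (rule stable_full[OF V'(1) k2(1) _ \<eta>'(1,2)]) (use k2 V' in simp)
  obtain G1 where G1: "gball V' (s + 1) k G1" "real (card (G1 - up)) + real (card (up - G1)) \<le> 4 * ex'"
   using S' V'(3) wu \<eta>'(3) unfolding stable_def ex'_def by (metis order_refl)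
  obtain C1 where C1: "C1 \<subseteq> V'" "G1 = flip C1 (fullb V' k)"
   using gball_full[OF V'(1) k2(4)] G1(1) s1(3) by metis
  have fG1: "finite G1" using finite_subset_Pow[OF gball_subset[OF G1(1)] V'(1)] .
  define y1 y2 where "y1 = real (card (G1 - up))" and "y2 = real (card (up - G1))"
  have y12: "0 \<le> y1" "0 \<le> y2" "y1 + y2 \<le> 4 * ex'" using G1(2) by (simp_all add: y1_def y2_def)
  have far: "real (card (G1 - nbd V' Gm)) < Mp"
   using card_Diff_le_trans[OF fG1 fin(2), of "nbd V' Gm"] y12 exs e_small Mp1 unfolding y1_def e_def by linarith
  define \<Delta> where "\<Delta> = sym_diff C C1"
  have \<Delta>V: "\<Delta> \<subseteq> V'" using C1 g(1) by (auto simp: \<Delta>_def)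
  have sC: "sym_diff C \<Delta> = C1" "sym_diff C1 \<Delta> = C" by (auto simp: \<Delta>_def)
  have fS: "finite S" using g(2) V'(1) finite_subset by auto
  have R: "card (V' - S) = (if b then 1 else 2)"
   using card_Diff_subset[OF fS g(2)] g(3) True V'(2) by (cases b) auto
  have "\<Delta> = {} \<or> \<Delta> = V' - S"
  proof (rule ccontr)
   assume neg: "\<not> ?thesis"
   have "(card S + (if b then 0 else 1) - 2) choose (k - 2) \<le> card (flip \<Delta> (fullb V' k) - std_ball b V' (k - 1) S)"
    using full_ball_far_from_std_ball[OF V'(1) g(2) \<Delta>V R _ _ k2(1)] neg g(3) k2(2) by auto
   moreover have "card (flip C (flip \<Delta> (fullb V' k)) - flip C (std_ball b V' (k - 1) S)) = card (flip \<Delta> (fullb V' k) - std_ball b V' (k - 1) S)"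
    by (rule card_flip_Diff)
   moreover have "flip C (flip \<Delta> (fullb V' k)) = G1" unfolding flip_flip_sym_diff sC C1(2) ..
   ultimately show False using far unfolding Mp_def g(3) nGm by simp
  qed
  hence GC: "Gm = flip C1 (std_ball b V' k S)"
  proof
   assume "\<Delta> = {}"
   hence "C1 = C" using sC by simp
   thus ?thesis by (simp add: Gm_def)
  next
   assume D: "\<Delta> = V' - S"
   have "flip C1 (std_ball b V' k S) = flip C1 (flip \<Delta> (std_ball b V' k S))"
    unfolding D std_ball_flip_invariant[OF V'(1) g(2) R k2(4)] ..
   also have "\<dots> = Gm" unfolding flip_flip_sym_diff sC Gm_def ..
   finally show ?thesis ..
  qed
  have b1: "10000 * real (card (flip C1 (fullb V' k) - up)) \<le> 200 * M"
   using y12 exs M1 Mp1 unfolding C1(2)[symmetric] y1_def[symmetric] by linarith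
  have b2: "10000 * real (card (up - flip C1 (fullb V' k))) \<le> 200 * M"
   using y12 exs M1 Mp1 unfolding C1(2)[symmetric] y2_def[symmetric] by linarith
  show ?thesis by (rule finish[OF C1(1) GC b1 b2])
 next
  case False
  hence n3: "s + 2 \<le> n'" using k2(7) by simp
  \<comment> \<open>If \<open>V'\<close> has at least \<open>s + 2\<close> points, the upper section
    is compared with the full ball \<open>H\<close> centred like \<open>Gm\<close> through union and
    intersection, whose neighbourhoods give \<open>N1\<close> and \<open>N2\<close>.\<close>
  define H where "H = flip C (fullb V' k)"
  have sH: "H \<subseteq> Pow V'" unfolding H_def by (rule flip_subset_Pow[OF g(1) fullb_subset])
  have fH: "finite H" by (rule finite_subset_Pow[OF sH V'(1)])
  have cH: "card H = binom_ge n' k" unfolding H_def card_flip card_fullb[OF V'(1)] V'(2) ..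
  have nH: "card (nbd V' H) \<le> binom_ge n' (k - 1)"
  proof -
   have "nbd V' H \<subseteq> flip C (fullb V' (k - 1))" unfolding H_def nbd_flip[OF g(1)] by (rule flip_mono[OF nbd_fullb[OF V'(1)]])
   hence "card (nbd V' H) \<le> card (flip C (fullb V' (k - 1)))"
    using finite_subset_Pow[OF flip_subset_Pow[OF g(1) fullb_subset] V'(1)] by (intro card_mono)
   thus ?thesis unfolding card_flip card_fullb[OF V'(1)] V'(2) .
  qed
  define E D where "E = card (up - H)" and "D = card (H - up)"
  have ED: "real E - real D = a" using card_Diff_sym[OF fin(2) fH] ca cH unfolding E_def D_def B_def by simp
  define M1 where "M1 = s choose (k - 1)"
  have E_le: "real E \<le> e + real M1"
  proof -
   have HN: "H \<subseteq> nbd V' Gm" unfolding H_def nGm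
    by (rule flip_mono) (use k2 in \<open>auto simp: fullb_def std_ball_def T1_def T2_def\<close>)
   have fN: "finite (nbd V' Gm)" using V'(1) by simp
   have "card (nbd V' Gm - H) = M1"
    unfolding card_Diff_subset[OF fH HN] cGm(2) cH V'(2) by (simp add: msize_nbd_def M1_def)
   thus ?thesis using card_Diff_le_trans[OF fin(2) fN, of H] unfolding E_def e_def by linarith
  qed
  have cU: "card (up \<union> H) = binom_ge n' k + E"
   using card_Un_disjoint[OF fH finite_Diff[OF fin(2)], of H] cH unfolding E_def by (simp add: Un_commute)
  have cI: "card (up \<inter> H) + D = binom_ge n' k"
   using card_Int_Diff[OF fH, of up] cH unfolding D_def by (simp add: Int_commute)
  have sUI: "up \<union> H \<subseteq> Pow V'" "up \<inter> H \<subseteq> Pow V'" using V'(3) sH by auto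
  define N1 N2 where "N1 = real (card (nbd V' (up \<union> H))) - B'" and "N2 = real (card (nbd V' (up \<inter> H))) - B'"
  have XN: "N1 + N2 \<le> X"
   using card_submodular_nbd[OF V'(1), of up H] nH unfolding N1_def N2_def X_def B'_def by linarith
  have cc: "(s choose (k - 2)) + M1 = Suc s choose (k - 1)" "(Suc s choose (k - 1)) + (Suc s choose k) = Suc (Suc s) choose k"
   using choose_steps[OF k2(1)] by (simp_all add: M1_def)
  have CMp: "Mp \<le> real ((s - 1) choose (k - 2))" "Mp \<le> real (s choose (k - 2))"
   unfolding Mp_def by (intro of_nat_mono binomial_right_mono; simp)+
  \<comment> \<open>The neighbourhood of \<open>Gm\<close> exceeds \<open>H\<close> by
    \<open>M1\<close> sets, so \<open>E\<close> is at most \<open>M1 + e\<close>. If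
    \<open>E\<close> overflows \<open>M1\<close>, the ball with parameters \<open>s\<close>,
    \<open>k - 1\<close> is the reference instead of the full one.\<close>
  have F1: "(K - 1) * real E - e \<le> (p + 1) * N1"
  proof (cases "E \<le> M1")
   case True
   define T where "T = th s (k - 1) * real E * (1 - real E / real M1)"
   have pre: "k \<le> Suc s" "Suc s \<le> card V' + 1" "k \<le> card V'" "binom_ge (card V') k + E \<le> card (up \<union> H)" "E \<le> (Suc s - 1) choose (k - 1)"
    using k2 V'(2) cU True by (auto simp: M1_def)
   have e1: "real (Suc s) - real k + 1 = p + 1" "Suc s - 1 = s" by (auto simp: p_def)
   have "(K - 1) * real E + T \<le> (p + 1) * N1"
    using full_plus[OF V'(1) sUI(1) k2(1) pre] unfolding e1 T_def K_def N1_def B'_def V'(2) M1_def .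
   moreover have "0 \<le> T"
   proof -
    have "1 \<le> th s (k - 1)" by (rule th_ge_1) (use k k2 in linarith)+
    thus ?thesis unfolding T_def using True by (intro mult_nonneg_nonneg) (auto simp: divide_le_eq_1)
   qed
   ultimately show ?thesis using y(4) by linarith
  next
   case False
   define e' where "e' = E - M1"
   have e': "real E = real M1 + real e'" "real e' \<le> e" using False E_le by (auto simp: e'_def of_nat_diff)
   define T where "T = th (s - 1) (k - 1 - 1) * real e' * (1 - real e' / real ((s - 1) choose (k - 1 - 1)))"
   have kk: "k - 1 - 1 = k - 2" "Suc (k - 1) = k" "real (k - 1) = K - 1" using k by (auto simp: K_def of_nat_diff)
   have b1: "real e' \<le> real ((s - 1) choose (k - 1 - 1))"
    using e' e_small CMp(1) Mp1 unfolding kk by linarith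
   have pre: "2 \<le> k - 1" "k - 1 \<le> s" "s \<le> card V'" "e' \<le> (s - 1) choose (k - 1 - 1)"
    "msize (card V') s (k - 1) + e' \<le> card (up \<union> H)"
    using k k2 b1 cU False V'(2) kk by (auto simp: msize_def M1_def e'_def)
   have e1: "real s - (K - 1) + 1 = p + 1" by (simp add: p_def K_def)
   have "(K - 1 - 1) * real e' + T \<le> (p + 1) * (real (card (nbd V' (up \<union> H))) - real (msize_nbd n' s (k - 1)))"
    using nbd_bound_above[OF V'(1) sUI(1) pre] unfolding kk(3) e1 T_def V'(2) .
   moreover have "0 \<le> T"
   proof -
    have "1 \<le> th (s - 1) (k - 1 - 1)" by (rule th_ge_1) (use k k2 in linarith)+
    thus ?thesis unfolding T_def using b1 by (intro mult_nonneg_nonneg) (auto simp: divide_le_eq_1)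
   qed
   moreover have "real (msize_nbd n' s (k - 1)) = B' + real (s choose (k - 2))" unfolding msize_nbd_def B'_def kk by simp
   ultimately have "(K - 2) * real e' + (p + 1) * real (s choose (k - 2)) \<le> (p + 1) * N1"
    unfolding N1_def by (simp add: algebra_simps)
   moreover have "(p + 1) * real (s choose (k - 2)) = (K - 1) * real M1"
   proof -
    have "(real (Suc s) - real k + 1) * real ((Suc s - 1) choose (k - 2)) = (real k - 1) * real ((Suc s - 1) choose (k - 1))"
     by (rule binom_ratio) (use k2 in auto)
    moreover have "real (Suc s) - real k + 1 = p + 1" "Suc s - 1 = s" by (auto simp: p_def)
    ultimately show ?thesis by (simp only: K_def M1_def)
   qed
   ultimately show ?thesis using e' unfolding e'(1) by (simp add: algebra_simps)
  qed
  define \<sigma>' where "\<sigma>' = sig (Suc s) k"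
  have sp': "\<sigma>' * (p + 2) = K - 1" using sig_mult[of k "Suc s"] k2 by (simp add: \<sigma>'_def p_def K_def add_ac)
  \<comment> \<open>Losses are charged at \<open>(K - 1) / (p + 2)\<close>, gains at
    \<open>(K - 1) / (p + 1)\<close>. Since \<open>E - D = a\<close> is small, this difference of
    rates bounds \<open>E\<close>.\<close>
  have F2: "- (\<sigma>' * real D) \<le> N2"
  proof -
   have "real D \<le> real M1 + real (s choose (k - 2))" using ED E_le a_lo ub(3) U0 e_small CMp(2) Mp1 by linarith
   hence D1: "D \<le> Suc s choose (k - 1)" using cc(1) by linarith
   have n1: "Suc (Suc s) choose k \<le> n' choose k" using n3 by (intro binomial_right_mono) auto
   have "(Suc s choose k) + D \<le> (Suc s choose k) + (Suc s choose (k - 1))" using D1 by (rule add_left_mono)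
   also have "\<dots> = Suc (Suc s) choose k" using cc(2) by (simp only: add.commute)
   also have "\<dots> \<le> card V' choose k" unfolding V'(2) by (rule n1)
   finally have "(Suc s choose k) + D \<le> card V' choose k" .
   thus ?thesis
    using full_minus[OF V'(1) sUI(2) k2(1), of "Suc s" D] k2 n3 cI V'(2) unfolding N2_def B'_def \<sigma>'_def by auto
  qed
  define c where "c = (p + 2) * r - p * (K - 1)"
  have c0: "0 \<le> c" using rc sf(6) by (simp add: c_def algebra_simps)
  have c1: "c \<le> 2 * (K - 1)" using mult_left_mono[OF sf(1), of "p + 2"] p1 by (simp add: c_def algebra_simps)
  have main: "p * ((K - 1) * real E) \<le> (p + 1) * ((p + 2) * U) + (p + 1) * (c * a) + (p + 2) * (p * e)"
  proof -
   have x1: "((p + 1) * (p + 2)) * (p * (N1 + N2)) \<le> ((p + 1) * (p + 2)) * (U + r * a)"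
   proof -
    have "p * (N1 + N2) \<le> p * X" using XN p1 by (intro mult_left_mono) auto
    hence "p * (N1 + N2) \<le> U + r * a" using pX by (rule order_trans)
    thus ?thesis using p1 by (intro mult_left_mono) auto
   qed
   have x2: "(p * (p + 2)) * ((K - 1) * real E - e) \<le> (p * (p + 2)) * ((p + 1) * N1)"
    using F1 p1 by (intro mult_left_mono) auto
   have x3: "(p * (p + 1)) * (- ((\<sigma>' * (p + 2)) * real D)) \<le> (p * (p + 1)) * ((p + 2) * N2)"
    using mult_left_mono[OF F2, of "p + 2"] p1 by (intro mult_left_mono) (auto simp: algebra_simps)
   have D: "real D = real E - a" using ED by simp
   show ?thesis using x1 x2 x3 unfolding sp' D c_def by (simp add: algebra_simps)
  qed
  have m1: "(p + 1) * ((p + 2) * U) \<le> 6 * (p * (p * U))"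
  proof -
   have "(p + 1) * (p + 2) * U \<le> (2 * p) * (3 * p) * U" using p1 U0 by (intro mult_right_mono mult_mono) auto
   thus ?thesis by (simp add: mult_ac)
  qed
  have m2: "(p + 1) * (c * a) \<le> 56 * (p * (U * (K - 1)))"
  proof -
   have "c * a \<le> c * (14 * U)" using a c0 by (intro mult_left_mono) auto
   also have "\<dots> \<le> (2 * (K - 1)) * (14 * U)" using c1 U0 by (intro mult_right_mono) auto
   finally have "(p + 1) * (c * a) \<le> (p + 1) * (28 * (U * (K - 1)))" using p1 by (intro mult_left_mono) (auto simp: mult_ac)
   also have "\<dots> \<le> (2 * p) * (28 * (U * (K - 1)))" using p1 UK(2) by (intro mult_right_mono) auto
   finally show ?thesis by (simp add: mult_ac)
  qed
  have m3: "(p + 2) * (p * e) \<le> 69 * (p * (U * (K - 1)))"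
  proof -
   have "(p + 2) * (p * e) \<le> (3 * p) * (p * e)" using p1 y(4) by (intro mult_right_mono) auto
   also have "\<dots> \<le> (3 * p) * (23 * (U * (K - 1)))" using pe UK(3) p1 by (intro mult_left_mono) auto
   finally show ?thesis by (simp add: mult_ac)
  qed
  have "p * ((K - 1) * real E) \<le> p * (6 * (p * U) + 125 * (U * (K - 1)))"
   using main m1 m2 m3 by (simp add: algebra_simps)
  hence "(K - 1) * real E \<le> 6 * (p * U) + 125 * (U * (K - 1))" using p1 by (simp add: mult_le_cancel_left)
  moreover have "1000000 * (U * (K - 1)) \<le> (K - 1) * M" using mult_right_mono[OF ub(2), of "K - 1"] K3 by (simp add: mult_ac)
  ultimately have "1000000 * ((K - 1) * real E) \<le> 131 * ((K - 1) * M)" using ub(6) by linarith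
  hence "(K - 1) * (1000000 * real E) \<le> (K - 1) * (131 * M)" by simp
  hence E_s: "1000000 * real E \<le> 131 * M" using K3 by (simp add: mult_le_cancel_left)
  have b1: "10000 * real (card (flip C (fullb V' k) - up)) \<le> 200 * M"
   using E_s ED a_lo ub(2) U0 M1 unfolding H_def[symmetric] D_def[symmetric] by linarith
  have b2: "10000 * real (card (up - flip C (fullb V' k))) \<le> 200 * M"
   using E_s M1 unfolding H_def[symmetric] E_def[symmetric] by linarith
  show ?thesis by (rule finish[OF g(1) Gm_def b1 b2])
 qed
qed

text \<open>The direction \<open>i\<close> is arbitrary, and \<open>dichotomy\<close> decides which
  kind of step applies to it. The condition on \<open>\<eta>\<close> is stronger than in
  \<open>stable_full\<close> because the outside steps need more room.\<close>

theorem stability: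
 assumes "finite V" "2 \<le> k" "k \<le> s" "s \<le> card V" "0 \<le> \<eta>" "1000000 * \<eta> \<le> 1"
 shows "stable V s k \<eta>"
 using assms
proof (induction "card V" arbitrary: V s k \<eta>)
 case 0
 thus ?case by simp
next
 case (Suc n')
 have V: "finite V" and \<eta>: "0 \<le> \<eta>" "1000000 * \<eta> \<le> 1" "10000 * \<eta> \<le> 1" using Suc.prems by auto
 have "k = 2 \<or> (3 \<le> k \<and> s = card V) \<or> (3 \<le> k \<and> s < card V)" using Suc.prems by linarith
 then consider "k = 2" | "s = card V" | "3 \<le> k" "s < card V" by blast
 thus ?case
 proof cases
  case 1 thus ?thesis using stable_k2[OF V _ _ \<eta>(1,3)] Suc.prems by simp
 next
  case 2 thus ?thesis using stable_full[OF V _ _ \<eta>(1,3)] Suc.prems by simp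
 next
  case 3
  have k: "3 \<le> k" "k \<le> s" "s < card V" "2 \<le> k" "s \<le> card V" using 3 Suc.prems by auto
  show ?thesis unfolding stable_def
  proof (intro allI impI)
   fix \<A> :: "nat set set"
   define U where "U = \<eta> * Zc s k"
   define t where "t = real (card \<A>) - real (msize (card V) s k)"
   assume A: "\<A> \<subseteq> Pow V" and w: "2 * (real (card \<A>) - real (msize (card V) s k)) \<le> incr s k"
    "- 6 * th (s - 1) (k - 1) * (real (card \<A>) - real (msize (card V) s k)) \<le> incr s k"
    and ex: "excess V s k \<A> \<le> \<eta> * Zc s k"
   have "\<bar>t\<bar> \<le> 6 * excess V s k \<A>" unfolding t_def by (rule excess_lower[OF V A k(4,2,5) w])
   hence t: "\<bar>t\<bar> \<le> 6 * U" using ex by (simp add: U_def)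
   note ub = U_bounds[OF k(1,2) \<eta>(1,2) zero_le_numeral, folded U_def]
   have U: "0 \<le> U" "1000 * U \<le> incr s k" "s = k \<Longrightarrow> U = 0" using ub(1,2,9) by auto
   have "V \<noteq> {}" using Suc.hyps(2) by auto
   then obtain i where i: "i \<in> V" by blast
   have cV: "n' = card (V - {i})" "card V - 1 = n'" using i V Suc.hyps(2) by simp_all
   have fV: "finite (V - {i})" using V by simp
   have sn: "s \<le> card (V - {i})" using cV k(3) Suc.hyps(2) by linarith
   have IH: "stable (V - {i}) s' k' \<eta>" if "2 \<le> k'" "k' \<le> s'" "s' \<le> s" for s' k'
    by (rule Suc.hyps(1)[OF cV(1) fV that(1,2) _ \<eta>(1,2)]) (use that(3) sn in linarith)
   have step: "\<exists>\<G>. gball V s k \<G> \<and> real (card (\<G> - \<B>)) + real (card (\<B> - \<G>)) \<le> 4 * U"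
    if B: "\<B> \<subseteq> Pow V" "card \<B> = card \<A>" "excess V s k \<B> \<le> U" "card (dnsec i \<B>) \<le> card (upsec i \<B>)" for \<B>
   proof -
    define a where "a = real (card (upsec i \<B>)) - real (binom_ge (card V - 1) k)"
    have tB: "\<bar>real (card \<B>) - real (msize (card V) s k)\<bar> \<le> 6 * U" using t B(2) unfolding t_def by simp
    show ?thesis
    proof (cases "14 * U < a")
     case True
     have big: "incr s k - 14 * U \<le> a"
      unfolding a_def by (rule dichotomy[OF V B(1) i k(1-3) U(1,2) U(3) tB B(3) True[unfolded a_def]])
     have mg: "real (msize (card V - 1) (s - 1) (k - 1)) = real (binom_ge (card V - 1) k) + incr s k"
      using k by (simp add: msize_def)
     show ?thesis
     proof (cases "k < s")
      case ks: True
      have bg: "real (msize (card V - 1) (s - 1) (k - 1)) - 14 * (\<eta> * Zc s k) \<le> real (card (upsec i \<B>))"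
       using big unfolding mg a_def U_def by linarith
      show ?thesis unfolding U_def
       by (rule S_step[OF V B(1) i k(1) ks k(5) \<eta>(1,3) tB[unfolded U_def] B(3)[unfolded U_def] bg])
        (use k ks IH in auto)
     next
      case False
      hence sk: "s = k" using k by simp
      hence U0: "U = 0" by (rule U(3))
      have cB: "card \<B> = msize (card V) k k" using tB U0 sk by simp
      have nB: "card (nbd V \<B>) \<le> msize_nbd (card V) k k" using B(3) cB U0 sk unfolding excess_def by simp
      have bg: "msize (card V - 1) (k - 1) (k - 1) \<le> card (upsec i \<B>)"
       using big U0 mg unfolding a_def sk by linarith
      have st: "stable (V - {i}) (k - 1) (k - 1) 0"
       by (rule Suc.hyps(1)[OF cV(1) fV]) (use k sn sk in auto)
      have "gball V k k \<B>" by (rule S_step_exact[OF V B(1) i k(1) _ cB nB bg st]) (use k sk in simp)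
      thus ?thesis using sk U0 by (intro exI[of _ \<B>]) simp
     qed
    next
     case False
     hence al: "a \<le> 14 * U" by simp
     show ?thesis
     proof (cases "card V = s + 1")
      case True
      show ?thesis unfolding U_def
       by (rule full_step_one[OF V B(1) i k(1,2) True \<eta>(1,2) tB[unfolded U_def] B(3)[unfolded U_def] B(4) al[unfolded a_def U_def]])
     next
      case False
      hence n2: "s + 2 \<le> card V" using k(3) by simp
      show ?thesis unfolding U_def
       by (rule full_step[OF V B(1) i k(1,2) n2 \<eta>(1,2) tB[unfolded U_def] B(3)[unfolded U_def] B(4) al[unfolded a_def U_def] IH])
        (use k in auto)
     qed
    qed
   qed
   have "\<exists>\<G>. gball V s k \<G> \<and> real (card (\<G> - \<A>)) + real (card (\<A> - \<G>)) \<le> 4 * U"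
   proof (cases "card (dnsec i \<A>) \<le> card (upsec i \<A>)")
    case True
    show ?thesis by (rule step[OF A refl ex[folded U_def] True])
   next
    case False
    have iV: "{i} \<subseteq> V" using i by simp
    have F: "flip {i} \<A> \<subseteq> Pow V" "card (flip {i} \<A>) = card \<A>" "excess V s k (flip {i} \<A>) \<le> U"
     "card (dnsec i (flip {i} \<A>)) \<le> card (upsec i (flip {i} \<A>))"
     using flip_subset_Pow[OF iV A] excess_flip[OF iV] ex False unfolding U_def upsec_flip1 dnsec_flip1 by simp_all
    show ?thesis by (rule closeness_flip[OF iV step[OF F]])
   qed
   thus "\<exists>\<G>. gball V s k \<G> \<and> real (card (\<G> - \<A>)) + real (card (\<A> - \<G>)) \<le> 4 * (\<eta> * Zc s k)"
    unfolding U_def .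
  qed
 qed
qed

section \<open>From real to integer parameters\<close>

text \<open>Between \<open>N\<close> and \<open>N + 1\<close> the convex function C(x,r+1) lies
  below its chord; the induction on \<open>r\<close> carries a lower bound for the gap of the order
  \<open>u * (1 - u)\<close>.\<close>

lemma gb_convex_gap:
 fixes u :: real
 assumes u: "0 \<le> u" "u \<le> 1" and r: "r \<le> N"
 shows "u * (1 - u) * real r * real (N choose r)
  \<le> 2 * (real N + 1) * (real (N choose Suc r) + u * real (N choose r) - ((real N + u) gchoose Suc r))"
 using r
proof (induction r)
 case 0
 show ?case by simp
next
 case (Suc r)
 define n R A B C X Y where "n = real N" and "R = real r" and "A = real (N choose r)" and "B = real (N choose Suc r)"
  and "C = real (N choose Suc (Suc r))" and "X = (real N + u) gchoose Suc r" and "Y = (real N + u) gchoose Suc (Suc r)"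
 define w where "w = u * (1 - u)"
 have r: "R + 1 \<le> n" "0 \<le> R" using Suc.prems by (auto simp: n_def R_def)
 have w: "0 \<le> w" using u by (simp add: w_def)
 have A: "0 \<le> A" by (simp add: A_def)
 have e1: "(n - R) * A = (R + 1) * B" using gb_step[of n r] by (simp add: n_def R_def A_def B_def gb_nat add.commute)
 have e2: "(n - R - 1) * B = (R + 2) * C" using gb_step[of n "Suc r"] by (simp add: n_def R_def B_def C_def gb_nat algebra_simps)
 have e3: "(n + u - R - 1) * X = (R + 2) * Y" using gb_step[of "n + u" "Suc r"] by (simp add: n_def R_def X_def Y_def algebra_simps)
 have IH: "w * R * A \<le> 2 * (n + 1) * (B + u * A - X)"
  using Suc by (simp add: w_def R_def A_def B_def X_def n_def)
 have c1: "(n + u - R - 1) * (w * R * A) \<le> (n + u - R - 1) * (2 * (n + 1) * (B + u * A - X))"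
  using IH r u by (intro mult_left_mono) auto
 have c2: "(n - R - 1) * (w * R * A) \<le> (n + u - R - 1) * (w * R * A)"
  using r u w A by (intro mult_right_mono) auto
 have c3: "(n + u - R - 1) * (B + u * A - X) = (R + 2) * (C + u * B - Y) - w * A"
 proof -
  have "(n + u - R - 1) * (B + u * A - X) = (n - R - 1) * B + u * B + u * ((n - R) * A) - u * (1 - u) * A - (n + u - R - 1) * X"
   by (simp add: algebra_simps)
  thus ?thesis unfolding e1 e2 e3 w_def by (simp add: algebra_simps)
 qed
 have c4: "(n + u - R - 1) * (2 * (n + 1) * (B + u * A - X)) = 2 * (n + 1) * ((n + u - R - 1) * (B + u * A - X))"
  by (simp only: mult_ac)
 have "(n - R - 1) * (w * R * A) \<le> 2 * (n + 1) * ((R + 2) * (C + u * B - Y) - w * A)"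
  using order_trans[OF c2 c1] unfolding c4 c3 .
 hence h: "w * A * ((n - R - 1) * R + 2 * (n + 1)) \<le> (R + 2) * (2 * (n + 1) * (C + u * B - Y))"
  by (simp add: algebra_simps)
 have "(R + 2) * (w * (R + 1) * B) = w * A * ((R + 2) * (n - R))" using e1 by (simp add: mult_ac)
 also have "\<dots> \<le> w * A * ((n - R - 1) * R + 2 * (n + 1))"
  using w A r by (intro mult_left_mono) (auto simp: algebra_simps)
 also note h
 finally have "w * (R + 1) * B \<le> 2 * (n + 1) * (C + u * B - Y)" using r(2) by (simp add: mult_le_cancel_left)
 thus ?case by (simp add: w_def R_def B_def C_def Y_def n_def add.commute)
qed

text \<open>By log-concavity C(s,r)/C(x,r) is at least \<open>exp (- (x - s) * Sg s r)\<close>,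
  hence at least \<open>1 - (x - s) * Sg s r\<close>. The induction proves this algebraically, one
  factor at a time.\<close>

lemma gb_log_tangent:
 fixes x :: real
 assumes "r \<le> s" "real r \<le> x + 1"
 shows "(x gchoose r) * (1 - (x - real s) * Sg s r) \<le> real (s choose r)"
 using assms
proof (induction r)
 case 0 show ?case by (simp add: Sg_def)
next
 case (Suc r)
 define u b f T where "u = x - real s" and "b = real s - real r" and "f = x gchoose r" and "T = Sg s r"
 have b: "1 \<le> b" using Suc.prems by (simp add: b_def)
 have f: "0 \<le> f" unfolding f_def using Suc.prems by (intro gb_nonneg) simp
 have T: "0 \<le> T" unfolding T_def Sg_def using Suc.prems by (intro sum_nonneg) simp
 have S: "Sg s (Suc r) = T + 1 / b" by (simp add: T_def b_def Sg_last)
 have e1: "(b + u) * f = real (Suc r) * (x gchoose Suc r)" using gb_step[of x r] by (simp add: f_def b_def u_def)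
 have e2: "b * real (s choose r) = real (Suc r) * real (s choose Suc r)" using gb_step[of "real s" r] by (simp add: b_def gb_nat)
 have IH: "f * (1 - u * T) \<le> real (s choose r)" using Suc by (simp add: f_def u_def T_def)
 have "(b + u) * (1 - u * (T + 1 / b)) = b * (1 - u * T) - u * u * (T + 1 / b)"
  using b by (simp add: field_simps)
 also have "\<dots> \<le> b * (1 - u * T)" using T b by simp
 finally have "f * ((b + u) * (1 - u * (T + 1 / b))) \<le> f * (b * (1 - u * T))" using f by (rule mult_left_mono)
 also have "\<dots> \<le> b * real (s choose r)" using mult_left_mono[OF IH, of b] b by (simp add: mult_ac)
 finally have "real (Suc r) * ((x gchoose Suc r) * (1 - u * (T + 1 / b))) \<le> real (Suc r) * real (s choose Suc r)"
  unfolding e2[symmetric] mult.assoc[symmetric] e1[symmetric] by (simp only: mult_ac)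
 thus ?case unfolding S u_def[symmetric] by (simp only: mult_le_cancel_left_pos of_nat_0_less_iff zero_less_Suc)
qed

text \<open>The Lovasz curve lies below its tangent at the integer \<open>s\<close> on either side,
  so after passing from \<open>x\<close> to \<open>s\<close> the excess is at most the scaled
  slack.\<close>

lemma tangent:
 fixes x :: real
 assumes k: "2 \<le> k" "k \<le> s" "real k \<le> x + 1"
 shows "(real s - real k + 1) * ((x gchoose (k - 1)) - real (s choose (k - 1))) \<le> rho s k * ((x gchoose k) - real (s choose k))"
proof -
 define p K u f f0 T where "p = real s - real k + 1" and "K = real k" and "u = x - real s"
  and "f = x gchoose (k - 1)" and "f0 = real (s choose (k - 1))" and "T = Sg s (k - 1)"
 have p: "1 \<le> p" using k by (simp add: p_def)
 have K: "2 \<le> K" using k by (simp add: K_def)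
 have T: "0 < T" unfolding T_def using k by (intro Sg_pos) auto
 have S: "Sg s k = T + 1 / p"
  using Sg_last[of s "k - 1"] k by (simp add: T_def p_def of_nat_diff)
 have e1: "(p + u) * f = K * (x gchoose k)" using gb_step'[of k x] k by (simp add: p_def u_def f_def K_def algebra_simps)
 have e2: "p * f0 = K * real (s choose k)" using gb_step'[of k "real s"] k by (simp add: p_def f0_def K_def gb_nat algebra_simps)
 have "f * (1 - u * T) \<le> f0" unfolding f_def u_def T_def f0_def using k by (intro gb_log_tangent) (auto simp: of_nat_diff)
 hence c: "f - f0 \<le> u * T * f" by (simp add: algebra_simps)
 have pS: "p * (T + 1 / p) = p * T + 1" using p by (simp add: field_simps)
 have r: "rho s k * (p * T + 1) = K * (p * T)"
 proof -
  have "0 < p * T + 1" using p T by (simp add: add_pos_pos)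
  moreover have "rho s k = K * (1 - 1 / (p * (T + 1 / p)))" unfolding rho_def S K_def p_def ..
  ultimately show ?thesis unfolding pS by (simp add: field_simps)
 qed
 have "(p * T + 1) * (p * (f - f0)) \<le> (p * T) * ((p + u) * f - p * f0)"
 proof -
  have "p * (f - f0) \<le> p * (u * T * f)" using c p by (intro mult_left_mono) auto
  thus ?thesis by (simp add: algebra_simps)
 qed
 also have "\<dots> = (p * T + 1) * (rho s k * ((x gchoose k) - real (s choose k)))"
 proof -
  have "(p * T) * (K * X - K * Y) = (rho s k * (p * T + 1)) * (X - Y)" for X Y
   unfolding r by (simp only: right_diff_distrib left_diff_distrib mult_ac)
  from this[of "x gchoose k" "real (s choose k)"] show ?thesis unfolding e1 e2 by (simp only: mult_ac)
 qed
 finally show ?thesis using p T unfolding p_def[symmetric] f_def[symmetric] f0_def[symmetric]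
  by (simp add: mult_le_cancel_left add_pos_pos less_asym)
qed

text \<open>For non-integer \<open>x\<close> the Lovasz bound is not sharp: only the surplus over
  C(N,k) is interpolated here, by a real index \<open>w \<le> x - 1\<close>. The gain is, up to
  scaling, the distance of C(x,k) from the chord between consecutive integers.\<close>

lemma shadow_excess:
 fixes x :: real
 assumes F: "uniform (k - 1) \<F>" and k: "2 \<le> k" "k \<le> N" and x: "real N \<le> x" "x \<le> real N + 1"
  and g: "real (card \<F>) = (x gchoose k) - real (N choose k)" "1 \<le> card \<F>"
 shows "(x - real N) * real (N choose (k - 1)) - real (card \<F>)
  \<le> (x - real k + 1) * (real (card (shadow \<F>)) - ((x gchoose (k - 1)) - real (N choose (k - 1))))"
proof -
 define K u f M gg where "K = real k" and "u = x - real N" and "f = x gchoose (k - 1)" and "M = real (N choose (k - 1))" and "gg = real (card \<F>)"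
 have k1: "1 \<le> k" "1 \<le> k - 1" "real (k - 1) = K - 1" using k by (auto simp: K_def of_nat_diff)
 obtain w where w: "real (k - 1) - 1 \<le> w" "w gchoose (k - 1) = gg"
  by (rule gb_ex[OF k1(2), of gg]) (auto simp: gg_def)
 have w1: "real (k - 1) \<le> w"
 proof (rule gb_le_cancel[OF _ w(1) _ k1(2)])
  show "real (k - 1) gchoose (k - 1) \<le> w gchoose (k - 1)" using g(2) unfolding gb_nat w(2) gg_def by simp
 qed simp
 \<comment> \<open>By Pascal's rule the surplus is C(x-1,k-1) + C(x-1,k) - C(N,k), at most
   C(x-1,k-1) because \<open>x - 1 \<le> N\<close>.\<close>
 have wx: "w \<le> x - 1"
 proof (rule gb_le_cancel[OF w(1) _ _ k1(2)])
  show "real (k - 1) - 1 \<le> x - 1" using k x k1 by (simp add: K_def)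
  have "x gchoose k = ((x - 1) gchoose (k - 1)) + ((x - 1) gchoose k)" by (rule gb_pascal[OF k1(1)])
  moreover have "(x - 1) gchoose k \<le> real N gchoose k" using k x by (intro gb_mono) auto
  ultimately show "w gchoose (k - 1) \<le> (x - 1) gchoose (k - 1)" using g(1) unfolding w(2) gg_def gb_nat by linarith
 qed
 have "w gchoose (k - 1) \<le> real (card \<F>)" unfolding w(2) gg_def by simp
 hence sh: "w gchoose (k - 1 - 1) \<le> real (card (shadow \<F>))" by (rule Lovasz_Kruskal_Katona[OF F k1(2) w1])
 have "(w - real (k - 1) + 1) * (w gchoose (k - 1 - 1)) = real (k - 1) * (w gchoose (k - 1))" by (rule gb_step'[OF k1(2)])
 hence e0: "(w - K + 2) * (w gchoose (k - 1 - 1)) = (K - 1) * gg" proof -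
  assume a: "(w - real (k - 1) + 1) * (w gchoose (k - 1 - 1)) = real (k - 1) * (w gchoose (k - 1))"
  have "w - (K - 1) + 1 = w - K + 2" by simp
  thus ?thesis using a unfolding w(2) k1(3) by (simp only:)
 qed
 have nn: "0 \<le> w gchoose (k - 1 - 1)" by (rule gb_nonneg) (use w1 k in \<open>simp add: of_nat_diff\<close>)
 have "(K - 1) * gg \<le> (x - K + 1) * (w gchoose (k - 1 - 1))"
  unfolding e0[symmetric] using wx nn by (intro mult_right_mono) auto
 also have "\<dots> \<le> (x - K + 1) * real (card (shadow \<F>))" using sh x k by (intro mult_left_mono) (auto simp: K_def)
 finally have a: "(K - 1) * gg \<le> (x - K + 1) * real (card (shadow \<F>))" .
 have e1: "(x - K + 1) * f = K * (x gchoose k)" unfolding f_def K_def by (rule gb_step'[OF k1(1)])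
 have e2: "(real N - K + 1) * M = K * real (N choose k)" using gb_step'[OF k1(1), of "real N"] unfolding gb_nat M_def K_def .
 have "(x - K + 1) * (f - M) = K * gg - u * M"
 proof -
  have "(x - K + 1) * M = (real N - K + 1) * M + u * M" unfolding u_def by (simp add: algebra_simps)
  hence "(x - K + 1) * (f - M) = K * (x gchoose k) - K * real (N choose k) - u * M"
   using e1 e2 by (simp add: right_diff_distrib)
  thus ?thesis unfolding gg_def g(1) by (simp add: right_diff_distrib)
 qed
 thus ?thesis using a unfolding K_def[symmetric] u_def[symmetric] f_def[symmetric] M_def[symmetric] gg_def[symmetric]
  by (simp add: algebra_simps)
qed

text \<open>Failure of the window at \<open>N\<close> bounds \<open>u\<close> below, failure of the
  one at \<open>N + 1\<close> bounds \<open>1 - u\<close> below, each by a constant times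
  \<open>(N - k + 1) / (N + 1)\<close>; and one of the two factors is at least 1/2.\<close>

lemma midrange_product:
 fixes u :: real
 assumes k: "2 \<le> k" "k \<le> N" and u: "0 \<le> u" "u \<le> 1"
 defines "M \<equiv> real (N choose (k - 1))" and "g \<equiv> ((real N + u) gchoose k) - real (N choose k)"
 assumes lo: "incr N k < 2 * g" and hi: "M < 6 * th N (k - 1) * (M - g)"
 shows "real N - real k + 1 \<le> 24 * (real N + 1) * (u * (1 - u))"
proof -
 define n K p where "n = real N" and "K = real k" and "p = n - K + 1"
 have r: "2 \<le> K" "K \<le> n" "1 \<le> p" using k by (auto simp: n_def K_def p_def)
 have M0: "0 < M" using k by (simp add: M_def)
 have "0 \<le> u * (1 - u) * real (k - 1) * real (N choose (k - 1))" using u by simp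
 also have "\<dots> \<le> 2 * (real N + 1) * (real (N choose Suc (k - 1)) + u * real (N choose (k - 1)) - ((real N + u) gchoose Suc (k - 1)))"
  using k by (intro gb_convex_gap u) auto
 finally have "0 \<le> real (N choose k) + u * M - ((real N + u) gchoose k)"
  using k by (simp add: zero_le_mult_iff M_def)
 hence gu: "g \<le> u * M" by (simp add: g_def)
 have "p * M \<le> 2 * n * (u * M)"
 proof -
  have "n * incr N k = p * M"
  proof -
   have "(N - (k - 1)) * (N choose (k - 1)) = N * ((N - 1) choose (k - 1))" by (rule binomial_absorb_comp)
   hence "real (N - (k - 1)) * M = n * incr N k" unfolding M_def n_def by (metis of_nat_mult)
   moreover have "real (N - (k - 1)) = p" using k by (simp add: p_def n_def K_def of_nat_diff)
   ultimately show ?thesis by simp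
  qed
  moreover have "n * incr N k \<le> n * (2 * (u * M))" using lo gu r by (intro mult_left_mono) auto
  ultimately show ?thesis by (simp add: mult_ac)
 qed
 hence u1: "p \<le> 2 * n * u" using M0 by (simp add: mult.assoc[symmetric])
 define d where "d = 1 - u"
 define T S' where "T = Sg N (k - 1)" and "S' = Sg (Suc N) k"
 have T: "0 < T" unfolding T_def using k by (intro Sg_pos) auto
 have S': "S' = T + 1 / (n + 1)" using Sg_Suc[of N "k - 1"] k by (simp add: S'_def T_def n_def)
 have Tn: "1 \<le> (n + 1) * T"
 proof -
  have "real (k - 1) \<le> n * T" unfolding n_def T_def using k by (intro Sg_ge) auto
  moreover have "1 \<le> real (k - 1)" using k by simp
  ultimately show ?thesis using T by (simp add: algebra_simps)
 qed
 have S2: "S' \<le> 2 * T"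
 proof -
  have "1 / (n + 1) \<le> T" using Tn r by (simp add: divide_le_eq mult.commute)
  thus ?thesis by (simp add: S')
 qed
 define C where "C = real (Suc N choose k)"
 have C: "C = real (N choose k) + M" using k by (cases k) (auto simp: C_def M_def)
 have KC: "K * C = (n + 1) * M"
 proof -
  have "Suc N * (N choose (k - 1)) = (Suc N choose Suc (k - 1)) * Suc (k - 1)" by (rule Suc_times_binomial_eq)
  moreover have "Suc (k - 1) = k" using k by simp
  ultimately have "real (Suc N * (N choose (k - 1))) = real ((Suc N choose k) * k)" by (simp only:)
  thus ?thesis by (simp add: C_def M_def K_def n_def algebra_simps)
 qed
 have Dd: "M - g \<le> d * S' * C"
 proof -
  define y where "y = (real N + u) gchoose k"
  text \<open>Bernoulli: each of the \<open>k\<close> factors of \<open>C(N + u, k)\<close> is \<open>1 - d / (N + 1 - i)\<close> times that of \<open>C(N + 1, k)\<close>.\<close>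
  have "1 - (\<Sum>i<k. d / (n + 1 - real i)) \<le> (\<Prod>i<k. 1 - d / (n + 1 - real i))"
  proof (rule prod_ge_one_minus_sum)
   fix i assume "i \<in> {..<k}"
   hence "1 \<le> n + 1 - real i" using k by (simp add: n_def)
   thus "0 \<le> d / (n + 1 - real i) \<and> d / (n + 1 - real i) \<le> 1" using u by (auto simp: d_def divide_le_eq_1)
  qed simp
  moreover have "(\<Sum>i<k. d / (n + 1 - real i)) = d * S'"
   unfolding S'_def Sg_def sum_distrib_left n_def by (intro sum.cong) (auto simp: add.commute)
  moreover have "y = C * (\<Prod>i<k. 1 - d / (n + 1 - real i))"
  proof -
   have "(\<Prod>i<k. (real N + u) - real i) = (\<Prod>i<k. (real (Suc N) - real i) * (1 - d / (n + 1 - real i)))"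
   proof (rule prod.cong)
    fix i assume "i \<in> {..<k}"
    hence "n + 1 - real i \<noteq> 0" using k by (simp add: n_def)
    thus "(real N + u) - real i = (real (Suc N) - real i) * (1 - d / (n + 1 - real i))"
     unfolding d_def n_def by (simp add: field_simps)
   qed simp
   thus ?thesis unfolding y_def C_def gb_nat[symmetric] gb_prod prod.distrib by simp
  qed
  ultimately have "C * (1 - d * S') \<le> y" using mult_left_mono[of "1 - d * S'" "\<Prod>i<k. 1 - d / (n + 1 - real i)" C] by (simp add: C_def)
  thus ?thesis unfolding g_def C y_def[symmetric] by (simp add: C algebra_simps)
 qed
 have d1: "p \<le> 12 * (n + 1) * d"
 proof -
  define P where "P = n - K + 2"
  have th: "th N (k - 1) * (P * T) = K - 1"
  proof -
   have "real N - real (k - 1) + 1 = P" using k by (simp add: P_def n_def K_def of_nat_diff)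
   moreover have "0 < P" using r by (simp add: P_def)
   ultimately show ?thesis using T k unfolding th_def T_def[symmetric] by (simp add: K_def of_nat_diff)
  qed
  have "1 \<le> th N (k - 1)" by (rule th_ge_1) (use k in linarith)+
  hence th1: "0 \<le> th N (k - 1)" by linarith
  have PT: "0 < P * T" using r T by (simp add: P_def)
  have d0: "0 \<le> d" using u by (simp add: d_def)
  have "M \<le> 6 * th N (k - 1) * (d * S' * C)" using hi Dd th1 mult_left_mono[OF Dd, of "6 * th N (k - 1)"] by simp
  hence "(K * (P * T)) * M \<le> (K * (P * T)) * (6 * th N (k - 1) * (d * S' * C))" using r PT by (intro mult_left_mono) auto
  also have "\<dots> = 6 * (th N (k - 1) * (P * T)) * (d * S') * (K * C)" by (simp only: mult_ac)
  also have "\<dots> = (6 * (K - 1) * (d * S') * (n + 1)) * M" unfolding th KC by (simp only: mult_ac)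
  finally have "K * (P * T) \<le> 6 * (K - 1) * (d * S') * (n + 1)" using M0 by (simp only: mult_le_cancel_right_pos)
  also have "\<dots> \<le> 6 * K * (d * (2 * T)) * (n + 1)"
  proof -
   have "d * S' \<le> d * (2 * T)" using S2 d0 by (rule mult_left_mono)
   moreover have "0 \<le> d * (2 * T)" using d0 T by simp
   ultimately have "6 * (K - 1) * (d * S') \<le> 6 * K * (d * (2 * T))"
    using mult_mono[of "6 * (K - 1)" "6 * K" "d * S'" "d * (2 * T)"] mult_nonneg_nonneg[OF d0, of S'] T r S' by simp
   thus ?thesis using r by (intro mult_right_mono) auto
  qed
  finally have "(K * T) * P \<le> (K * T) * (12 * (n + 1) * d)" by (simp only: mult_ac)
  hence "P \<le> 12 * (n + 1) * d" using r T by (simp only: mult_le_cancel_left_pos mult_pos_pos)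
  thus ?thesis by (simp add: P_def p_def)
 qed
 have "p \<le> 24 * (n + 1) * (u * d)"
 proof (cases "u \<le> 1 / 2")
  case True
  have a: "u * (1 / 2) \<le> u * d" by (rule mult_left_mono) (use True u in \<open>auto simp: d_def\<close>)
  have "24 * (n + 1) * (u * (1 / 2)) \<le> 24 * (n + 1) * (u * d)" by (rule mult_left_mono[OF a]) (use r in auto)
  moreover have "24 * (n + 1) * (u * (1 / 2)) = 12 * (n * u) + 12 * u" by (simp add: algebra_simps)
  moreover have "0 \<le> n * u" using u r by simp
  ultimately show ?thesis using u1 u(1) by (simp add: mult.assoc)
 next
  case False
  have a: "(1 / 2) * d \<le> u * d" by (rule mult_right_mono) (use False u in \<open>auto simp: d_def\<close>)
  have "24 * (n + 1) * ((1 / 2) * d) \<le> 24 * (n + 1) * (u * d)" by (rule mult_left_mono[OF a]) (use r in auto)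
  moreover have "24 * (n + 1) * ((1 / 2) * d) = 12 * (n + 1) * d" by simp
  ultimately show ?thesis using d1 by linarith
 qed
 thus ?thesis by (simp add: p_def n_def K_def d_def)
qed

text \<open>Both sides are the same product of linear factors over a factorial. This explains the
  slack in the theorem: multiplied by the scaling factor, k(x-k)/x^3 times C(x,k-1) is of the order
  of C(x-3,k-2).\<close>

lemma Zc_compare:
 fixes x :: real
 assumes "3 \<le> k" "k \<le> s" "real k \<le> x"
 shows "(real s) * (real s - 1) * (real s - 2) * Zc s k = (real k * (real k - 1)) * ((real s - real k) * real (s choose k))"
  "x * (x - 1) * (x - 2) * ((x - 3) gchoose (k - 2)) = (real k * (real k - 1)) * ((x - real k) * (x gchoose k))"
proof -
 have gen: "y * (y - 1) * (y - 2) * ((y - 3) gchoose (k - 2)) = (real k * (real k - 1)) * ((y - real k) * (y gchoose k))" for y :: real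
 proof -
  obtain r where r: "k = Suc (Suc r)" using assms(1) by (cases k; cases "k - 1") auto
  have s3: "(\<Prod>i<Suc (Suc (Suc r)). y - real i) = y * ((y - 1) * ((y - 2) * (\<Prod>i<r. (y - 3) - real i)))"
   unfolding prod.lessThan_Suc_shift by (simp add: algebra_simps)
  have "(\<Prod>i<Suc (Suc (Suc r)). y - real i) = (\<Prod>i<k. y - real i) * (y - real k)" unfolding r by simp
  hence "(y - real k) * ((y gchoose k) * fact k) = y * ((y - 1) * ((y - 2) * (((y - 3) gchoose r) * fact r)))"
   unfolding gb_prod using s3 by (simp add: mult_ac)
  moreover have "(fact k :: real) = real k * (real k - 1) * fact r" unfolding r by (simp add: algebra_simps)
  ultimately have "(fact r) * (y * (y - 1) * (y - 2) * ((y - 3) gchoose r)) = (fact r :: real) * ((real k * (real k - 1)) * ((y - real k) * (y gchoose k)))"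
   by (simp add: mult_ac)
  thus ?thesis by (simp add: r)
 qed
 show "x * (x - 1) * (x - 2) * ((x - 3) gchoose (k - 2)) = (real k * (real k - 1)) * ((x - real k) * (x gchoose k))" by (rule gen)
 have "real s - 3 = real (s - 3)" using assms by (simp add: of_nat_diff)
 thus "(real s) * (real s - 1) * (real s - 2) * Zc s k = (real k * (real k - 1)) * ((real s - real k) * real (s choose k))"
  using gen[of "real s"] by (simp only: gb_nat Zc_def)
qed

text \<open>For k at least 3 the losses are at most 3/2 for replacing \<open>k\<close> by
  \<open>k - 1\<close>, 2 for \<open>x - k\<close> against \<open>s - k\<close>, and 3/2 from the
  assumed bound on C(x,k-1); their product 9/2 is below 7.\<close>

lemma slack_bound:
 fixes x c :: real
 assumes k: "2 \<le> k" "k \<le> s" and x: "real k \<le> x" "real s - 1 \<le> x" "x - real k \<le> 2 * (real s - real k)" and c: "0 \<le> c"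
  and s3: "3 \<le> k \<Longrightarrow> k < s"
  and Cx: "(real s - real k + 1) * (x gchoose (k - 1)) \<le> 3 / 2 * (real s * incr s k)"
  and big: "(real s) \<le> x \<or> x - real k \<le> real s - real k"
 shows "(real s - real k + 1) * (c * real k * (x - real k) / x ^ 3 * (x gchoose (k - 1))) \<le> 7 * c * Zc s k"
proof -
 define p K S M Z y where "p = real s - real k + 1" and "K = real k" and "S = real s" and "M = incr s k"
  and "Z = Zc s k" and "y = x gchoose (k - 1)"
 have r: "2 \<le> K" "K \<le> S" "K \<le> x" "S - 1 \<le> x" "x - K \<le> 2 * (S - K)" using k x by (auto simp: K_def S_def)
 have Z0: "0 \<le> Z" by (simp add: Z_def Zc_nonneg)
 have M0: "0 \<le> M" by (simp add: M_def)
 have x3: "0 < x ^ 3" using r by simp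
 have Q: "p * (K * (x - K) * y) \<le> 7 * Z * x ^ 3"
 proof (cases "k = 2")
  case True
  have Zk: "Z = 1" "K = 2" "y = x" using True by (simp_all add: Z_def Zc_def K_def y_def)
  have pS: "p \<le> x" using r(4) True by (simp add: p_def S_def)
  have p0: "0 \<le> p" using k by (simp add: p_def)
  have "(x - 2) * x \<le> x * x" using r Zk by (intro mult_right_mono) auto
  hence "p * ((x - 2) * x) \<le> x * (x * x)" using pS p0 r Zk by (intro mult_mono) auto
  hence "p * (2 * (x - 2) * x) \<le> 2 * (x * (x * x))" by (simp add: algebra_simps)
  also have "\<dots> \<le> 7 * (x * (x * x))" using r Zk by simp
  finally show ?thesis unfolding Zk by (simp add: power3_eq_cube mult.assoc)
 next
  case False
  hence k3: "3 \<le> k" "k \<le> s" "k < s" using k s3 by auto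
  have K3: "3 \<le> K" "K + 1 \<le> S" using k3 by (auto simp: K_def S_def)
  have eq: "(S - 1) * ((S - 2) * Z) = (K - 1) * ((S - K) * M)"
  proof -
   have a: "(S - 2) * Z = (K - 1) * real ((s - 2) choose (k - 1))" "(S - 1) * real ((s - 2) choose (k - 1)) = (S - K) * M"
    using Zc_eqs(2,4)[OF k3(1,2)] by (simp_all add: S_def K_def Z_def M_def)
   have "(S - 1) * ((S - 2) * Z) = (K - 1) * ((S - 1) * real ((s - 2) choose (k - 1)))" unfolding a(1) by (simp only: mult_ac)
   thus ?thesis unfolding a(2) .
  qed
  have py: "p * y \<le> 3 / 2 * (S * M)" using Cx by (simp add: p_def y_def S_def M_def)
  have SM: "0 \<le> S * M" using r M0 by simp
  have Kk: "K \<le> 3 / 2 * (K - 1)" using K3 by simp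
  have xx: "0 \<le> x - K" using r by simp
  have "p * (K * (x - K) * y) = K * ((x - K) * (p * y))" by (simp only: mult_ac)
  also have "\<dots> \<le> K * ((x - K) * (3 / 2 * (S * M)))" using py xx r by (intro mult_left_mono) auto
  finally have st: "p * (K * (x - K) * y) \<le> K * ((x - K) * (3 / 2 * (S * M)))" .
  have arr: "(3 / 2 * a) * ((2 * b) * (3 / 2 * (i * m))) = 9 / 2 * (i * (a * (b * m)))"
   "(3 / 2 * a) * (b * (3 / 2 * (i * m))) = 9 / 4 * (i * (a * (b * m)))" for a b i m :: real
   by (simp_all add: field_simps)
  show ?thesis
  proof (cases "S \<le> x")
   case True
   have a: "(x - K) * (3 / 2 * (S * M)) \<le> (2 * (S - K)) * (3 / 2 * (S * M))" using r SM by (intro mult_right_mono) auto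
   have "K * ((x - K) * (3 / 2 * (S * M))) \<le> (3 / 2 * (K - 1)) * ((2 * (S - K)) * (3 / 2 * (S * M)))"
    by (rule mult_mono[OF Kk a]) (use r SM xx in \<open>auto intro!: mult_nonneg_nonneg\<close>)
   also have "\<dots> = 9 / 2 * (S * ((S - 1) * ((S - 2) * Z)))" unfolding eq by (rule arr)
   also have "\<dots> \<le> 9 / 2 * (S * (S * (S * Z)))"
    using K3 Z0 by (intro mult_left_mono mult_mono) auto
   also have "\<dots> \<le> 7 * (x * (x * (x * Z)))"
   proof -
    have "S * (S * (S * Z)) \<le> x * (x * (x * Z))" using True r Z0 by (intro mult_mono) auto
    moreover have "0 \<le> S * (S * (S * Z))" using r Z0 by simp
    ultimately show ?thesis by linarith
   qed
   finally have "K * ((x - K) * (3 / 2 * (S * M))) \<le> 7 * (x * (x * (x * Z)))" .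
   moreover have "7 * (x * (x * (x * Z))) = 7 * Z * x ^ 3" by (simp add: power3_eq_cube)
   ultimately show ?thesis using order_trans[OF st] by (simp only:)
  next
   case False
   hence xs: "x - K \<le> S - K" using big by (simp add: S_def K_def)
   have a: "(x - K) * (3 / 2 * (S * M)) \<le> (S - K) * (3 / 2 * (S * M))" using xs SM by (intro mult_right_mono) auto
   have "K * ((x - K) * (3 / 2 * (S * M))) \<le> (3 / 2 * (K - 1)) * ((S - K) * (3 / 2 * (S * M)))"
    by (rule mult_mono[OF Kk a]) (use r SM xx in \<open>auto intro!: mult_nonneg_nonneg\<close>)
   also have "\<dots> = 9 / 4 * (S * ((S - 1) * ((S - 2) * Z)))" unfolding eq by (rule arr)
   also have "\<dots> = 9 / 4 * ((S * (S - 2)) * ((S - 1) * Z))" by (simp only: mult_ac)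
   also have "\<dots> \<le> 9 / 4 * (((S - 1) * (S - 1)) * ((S - 1) * Z))"
   proof -
    have "S * (S - 2) \<le> (S - 1) * (S - 1)" by (simp add: algebra_simps)
    moreover have "0 \<le> (S - 1) * Z" using K3 Z0 by simp
    ultimately have "(S * (S - 2)) * ((S - 1) * Z) \<le> ((S - 1) * (S - 1)) * ((S - 1) * Z)" by (rule mult_right_mono)
    thus ?thesis by linarith
   qed
   also have "\<dots> \<le> 9 / 4 * ((x * x) * (x * Z))"
    using r K3 Z0 by (intro mult_left_mono mult_mono) auto
   also have "\<dots> \<le> 7 * ((x * x) * (x * Z))" using r Z0 by simp
   finally have "K * ((x - K) * (3 / 2 * (S * M))) \<le> 7 * ((x * x) * (x * Z))" .
   moreover have "7 * ((x * x) * (x * Z)) = 7 * Z * x ^ 3" by (simp add: power3_eq_cube)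
   ultimately show ?thesis using order_trans[OF st] by (simp only:)
  qed
 qed
 have "p * (c * K * (x - K) / x ^ 3 * y) = c * (p * (K * (x - K) * y)) / x ^ 3" by (simp add: mult_ac)
 also have "\<dots> \<le> c * (7 * Z * x ^ 3) / x ^ 3" using Q c x3 by (intro divide_right_mono mult_left_mono) auto
 also have "\<dots> = 7 * c * Z" using x3 by simp
 finally show ?thesis by (simp add: p_def K_def Z_def y_def)
qed

text \<open>The Lovasz parameter \<open>x\<close> is replaced by the integer \<open>s\<close> next to it, whichever side fits the
 window of \<open>excess_lower\<close>; in between, \<open>shadow_excess\<close> and \<open>gb_convex_gap\<close> contradict the slack.\<close>

lemma integer_parameter:
 fixes x c :: real
 assumes V: "finite V" "\<A> \<subseteq> Pow V" and k: "2 \<le> k" "real k \<le> x" "x \<le> real (card V)" and c: "0 \<le> c" "1000 * c \<le> 1"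
  and A: "real (card \<A>) = real (binom_ge (card V) (Suc k)) + (x gchoose k)"
  and N: "real (card (nbd V \<A>)) \<le> real (binom_ge (card V) k) + (x gchoose (k - 1)) + c * real k * (x - real k) / x ^ 3 * (x gchoose (k - 1))"
 obtains s where "k \<le> s" "s \<le> card V"
  "2 * (real (card \<A>) - real (msize (card V) s k)) \<le> incr s k"
  "- 6 * th (s - 1) (k - 1) * (real (card \<A>) - real (msize (card V) s k)) \<le> incr s k"
  "excess V s k \<A> \<le> 7 * c * Zc s k" "Zc s k \<le> 3 * ((x - 3) gchoose (k - 2))"
proof -
 define sl where "sl = c * real k * (x - real k) / x ^ 3 * (x gchoose (k - 1))"
 define Nn where "Nn = nat \<lfloor>x\<rfloor>"
 have x0: "0 < x" "2 \<le> x" using k by auto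
 have Nx: "real Nn \<le> x" "x < real Nn + 1" using x0 unfolding Nn_def by linarith+
 have kN: "k \<le> Nn" using k(2) unfolding Nn_def by (simp add: le_nat_floor)
 have Nn: "Nn \<le> card V" using Nx(1) k(3) by linarith
 define u where "u = x - real Nn"
 have u: "0 \<le> u" "u \<le> 1" "u < 1" "real Nn + u = x" using Nx by (auto simp: u_def)
 define M where "M = real (Nn choose (k - 1))"
 define \<gamma> where "\<gamma> = (x gchoose k) - real (Nn choose k)"
 have f0: "0 \<le> x gchoose (k - 1)" using k by (intro gb_nonneg) (auto simp: of_nat_diff)
 have sl0: "0 \<le> sl" unfolding sl_def using c k x0 f0 by (intro mult_nonneg_nonneg divide_nonneg_nonneg) auto
 have g0: "0 \<le> \<gamma>"
 proof -
  have "real Nn gchoose k \<le> x gchoose k" using kN Nx by (intro gb_mono) auto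
  thus ?thesis by (simp add: \<gamma>_def gb_nat)
 qed
 have cSuc: "real (Suc Nn choose k) = real (Nn choose k) + M" using k(1) by (cases k) (auto simp: M_def)
 have gM: "\<gamma> \<le> M"
 proof -
  have "x gchoose k \<le> real (Suc Nn) gchoose k" using k Nx by (intro gb_mono) auto
  thus ?thesis unfolding gb_nat cSuc by (simp add: \<gamma>_def)
 qed
 have tN: "real (card \<A>) - real (msize (card V) Nn k) = \<gamma>" using A by (simp add: msize_def \<gamma>_def)
 have tS: "real (card \<A>) - real (msize (card V) (Suc Nn) k) = \<gamma> - M" using A unfolding msize_def of_nat_add cSuc by (simp add: \<gamma>_def)
 have excess_le: "excess V s k \<A> \<le> (real s - real k + 1) * sl" if s: "k \<le> s" for s
 proof -
  have p: "0 \<le> real s - real k + 1" using s by simp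
  have "(real s - real k + 1) * (real (card (nbd V \<A>)) - real (msize_nbd (card V) s k))
   \<le> (real s - real k + 1) * (((x gchoose (k - 1)) - real (s choose (k - 1))) + sl)"
   using N p unfolding sl_def[symmetric] msize_nbd_def by (intro mult_left_mono) auto
  moreover have "(real s - real k + 1) * ((x gchoose (k - 1)) - real (s choose (k - 1))) \<le> rho s k * ((x gchoose k) - real (s choose k))"
   using k by (intro tangent s) auto
  moreover have "real (card \<A>) - real (msize (card V) s k) = (x gchoose k) - real (s choose k)" using A by (simp add: msize_def)
  ultimately show ?thesis unfolding excess_def by (simp add: distrib_left)
 qed
 have kx: "(x - real k + 1) * (x gchoose (k - 1)) = real k * (x gchoose k)" using k by (intro gb_step') auto
 have ks: "real k * real (s choose k) = real s * incr s k" if "1 \<le> s" for s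
 proof -
  have "Suc (k - 1) = k" using k by simp
  hence "k * (s choose k) = s * ((s - 1) choose (k - 1))" using binomial_absorption[of "k - 1" s] by (simp only:)
  thus ?thesis by (metis of_nat_mult)
 qed
 consider "2 * \<gamma> \<le> incr Nn k" | "6 * th Nn (k - 1) * (M - \<gamma>) \<le> M"
  | "incr Nn k < 2 * \<gamma>" "M < 6 * th Nn (k - 1) * (M - \<gamma>)" by linarith
 thus ?thesis
 proof cases
  case 1
  have "1 \<le> th (Nn - 1) (k - 1)" by (rule th_ge_1) (use k kN in linarith)+
  hence th0: "0 \<le> th (Nn - 1) (k - 1)" by linarith
  have ex: "excess V Nn k \<A> \<le> 7 * c * Zc Nn k" 
  proof (cases "3 \<le> k \<and> Nn = k")
   case True
   \<comment> \<open>Here the unit \<open>Zc\<close> is 0. But C(x,k) is an integer between 1 and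
     3/2, so \<open>x = k\<close> and the slack vanishes too.\<close>
   hence "real (Nn choose k) \<le> x gchoose k" "x gchoose k \<le> 3 / 2" using 1 g0 by (auto simp: \<gamma>_def)
   moreover have "real (card \<A>) - real (binom_ge (card V) (Suc k)) = x gchoose k" using A by simp
   ultimately have "x gchoose k = 1" using True
   proof -
    define z where "z = int (card \<A>) - int (binom_ge (card V) (Suc k))"
    have "real_of_int z = x gchoose k" using A by (simp add: z_def)
    moreover have "1 \<le> x gchoose k" "x gchoose k < 2" using \<open>real (Nn choose k) \<le> x gchoose k\<close> \<open>x gchoose k \<le> 3 / 2\<close> True by auto
    ultimately have "z = 1" by linarith
    thus ?thesis using \<open>real_of_int z = x gchoose k\<close> by simp
   qed
   hence "x gchoose k \<le> real k gchoose k" unfolding gb_nat by simp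
   hence "x \<le> real k" using k by (intro gb_le_cancel[of k x "real k"]) auto
   hence "sl = 0" using k(2) by (simp add: sl_def)
   hence "excess V Nn k \<A> \<le> 0" using excess_le[OF kN] by simp
   moreover have "0 \<le> 7 * c * Zc Nn k" using c Zc_nonneg[of Nn k] by (intro mult_nonneg_nonneg) auto
   ultimately show ?thesis by (rule order_trans)
  next
   case False
   have "(real Nn - real k + 1) * sl \<le> 7 * c * Zc Nn k" unfolding sl_def
   proof (rule slack_bound[OF k(1) kN k(2) _ _ c(1)])
    show "real Nn - 1 \<le> x" "real Nn \<le> x \<or> x - real k \<le> real Nn - real k" using Nx by auto
    show "k < Nn" if "3 \<le> k" using that False kN by auto
    show "x - real k \<le> 2 * (real Nn - real k)"
    proof (cases "k < Nn")
     case True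
     hence "real k + 1 \<le> real Nn" by simp
     thus ?thesis using Nx by (simp add: right_diff_distrib)
    next
     case nk: False
     hence N2: "Nn = k" "k = 2" using kN False k by auto
     hence "2 * \<gamma> \<le> 1" using 1 by simp
     moreover have "\<gamma> = x * (x - 1) / 2 - 1" using N2 by (simp add: \<gamma>_def gbinomial_prod_rev numeral_2_eq_2)
     ultimately have g1: "\<gamma> \<le> 1 / 2" by simp
     define z where "z = int (card \<A>) - int (binom_ge (card V) (Suc k))"
     have zx: "real_of_int z = x gchoose k" using A by (simp add: z_def)
     have "x gchoose k = 1 + \<gamma>" using N2 by (simp add: \<gamma>_def)
     hence "z = 1" using zx g0 g1 by linarith
     hence "x gchoose k \<le> real k gchoose k" using zx unfolding gb_nat by simp
     hence "x \<le> real k" using k by (intro gb_le_cancel[of k x "real k"]) auto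
     thus ?thesis using N2 by simp
    qed
    have "(real Nn - real k + 1) * (x gchoose (k - 1)) \<le> (x - real k + 1) * (x gchoose (k - 1))"
     using Nx f0 by (intro mult_right_mono) auto
    also have "\<dots> = real Nn * incr Nn k + real k * \<gamma>"
     unfolding kx \<gamma>_def right_diff_distrib using ks[of Nn] kN k by simp
    also have "real k * \<gamma> \<le> real Nn * (1 / 2 * incr Nn k)"
     using 1 g0 kN by (intro mult_mono) auto
    finally show "(real Nn - real k + 1) * (x gchoose (k - 1)) \<le> 3 / 2 * (real Nn * incr Nn k)"
     by simp
   qed
   thus ?thesis using excess_le[OF kN] by simp
  qed
  have Zle: "Zc Nn k \<le> 3 * ((x - 3) gchoose (k - 2))"
  proof (cases "k = 2")
   case True thus ?thesis by (simp add: Zc_def)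
  next
   case False
   hence k3: "3 \<le> k" using k by simp
   define S w W where "S = real Nn" and "w = (x - 3) gchoose (k - 2)" and "W = x * (x - 1) * (x - 2)"
   have S: "3 \<le> S" "S \<le> x" "x \<le> S + 1" using k3 kN Nx by (auto simp: S_def)
   have cz: "S * (S - 1) * (S - 2) * Zc Nn k = (real k * (real k - 1)) * ((S - real k) * real (Nn choose k))"
    "W * w = (real k * (real k - 1)) * ((x - real k) * (x gchoose k))"
    using Zc_compare[OF k3 kN k(2)] by (simp_all add: S_def w_def W_def)
   have "(S - real k) * real (Nn choose k) \<le> (x - real k) * (x gchoose k)"
    using S k g0 kN by (intro mult_mono) (auto simp: S_def \<gamma>_def)
   hence "S * (S - 1) * (S - 2) * Zc Nn k \<le> W * w" unfolding cz using k3 by (intro mult_left_mono) auto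
   moreover have w0: "0 \<le> w"
   proof -
    have "0 \<le> W * w" unfolding cz(2) using k3 k(2) gb_nonneg[of k x] by (intro mult_nonneg_nonneg) auto
    moreover have "0 < W" using S by (simp add: W_def)
    ultimately show ?thesis by (simp add: zero_le_mult_iff)
   qed
   show ?thesis
   proof (cases "Nn = k")
    case True
    hence "Zc Nn k = 0" using k3 by (simp add: Zc_def binomial_eq_0)
    thus ?thesis using w0 by (simp add: w_def)
   next
    case False
    hence S4: "4 \<le> S" using k3 kN by (simp add: S_def)
    have "W \<le> (S + 1) * S * (S - 1)" unfolding W_def using S by (intro mult_mono) auto
    also have "\<dots> \<le> 3 * (S * (S - 1) * (S - 2))"
    proof -
     have "(S * (S - 1)) * (S + 1) \<le> (S * (S - 1)) * (3 * (S - 2))" using S4 by (intro mult_left_mono) auto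
     thus ?thesis by (simp add: mult_ac)
    qed
    finally have "W * w \<le> 3 * (S * (S - 1) * (S - 2)) * w" using w0 by (intro mult_right_mono) auto
    hence "(S * (S - 1) * (S - 2)) * Zc Nn k \<le> (S * (S - 1) * (S - 2)) * (3 * w)"
     using \<open>S * (S - 1) * (S - 2) * Zc Nn k \<le> W * w\<close> by simp
    moreover have "0 < S * (S - 1) * (S - 2)" using S4 by simp
    ultimately show ?thesis unfolding w_def by (simp only: mult_le_cancel_left_pos)
   qed
  qed
  have w1: "2 * (real (card \<A>) - real (msize (card V) Nn k)) \<le> incr Nn k" unfolding tN by (rule 1)
  have "0 \<le> th (Nn - 1) (k - 1) * \<gamma>" using th0 g0 by simp
  hence "- 6 * th (Nn - 1) (k - 1) * \<gamma> \<le> incr Nn k"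
   using of_nat_0_le_iff[of "(Nn - 1) choose (k - 1)", where 'a = real] by linarith
  thus ?thesis using that[OF kN Nn w1 _ ex Zle] unfolding tN by blast
 next
  case 2
  define s where "s = Suc Nn"
  have M0: "0 < M" using kN by (simp add: M_def)
  have th1: "1 \<le> th Nn (k - 1)" using k kN by (intro th_ge_1) auto
  have D: "6 * (M - \<gamma>) \<le> M"
  proof -
   have "1 * (M - \<gamma>) \<le> th Nn (k - 1) * (M - \<gamma>)" using th1 gM by (intro mult_right_mono) auto
   thus ?thesis using 2 by linarith
  qed
  have sn: "s \<le> card V"
  proof (rule ccontr)
   assume "\<not> ?thesis"
   hence "Nn = card V" using Nn by (simp add: s_def)
   hence "x = real Nn" using k(3) Nx by simp
   hence "\<gamma> = 0" by (simp add: \<gamma>_def gb_nat)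
   thus False using D M0 by simp
  qed
  have sk: "k \<le> s" "k < s" using kN by (auto simp: s_def)
  have ex: "excess V s k \<A> \<le> 7 * c * Zc s k"
  proof -
   have "(real s - real k + 1) * sl \<le> 7 * c * Zc s k" unfolding sl_def
   proof (rule slack_bound[OF k(1) sk(1) k(2) _ _ c(1)])
    show "real s - 1 \<le> x" "real s \<le> x \<or> x - real k \<le> real s - real k" using Nx by (auto simp: s_def)
    show "k < s" by (rule sk(2))
    show "x - real k \<le> 2 * (real s - real k)" using Nx kN by (simp add: s_def)
    have "x gchoose (k - 1) \<le> real s gchoose (k - 1)" using k Nx by (intro gb_mono) (auto simp: s_def of_nat_diff)
    hence "(real s - real k + 1) * (x gchoose (k - 1)) \<le> (real s - real k + 1) * (real s gchoose (k - 1))"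
     using sk by (intro mult_left_mono) auto
    also have "\<dots> = real s * incr s k"
     using gb_step'[of k "real s"] k ks[of s] sk unfolding gb_nat by simp
    also have "\<dots> \<le> 3 / 2 * (real s * incr s k)" by simp
    finally show "(real s - real k + 1) * (x gchoose (k - 1)) \<le> 3 / 2 * (real s * incr s k)" .
   qed
   thus ?thesis using excess_le[OF sk(1)] by simp
  qed
  have Zle: "Zc s k \<le> 3 * ((x - 3) gchoose (k - 2))"
  proof (cases "k = 2")
   case True thus ?thesis by (simp add: Zc_def)
  next
   case False
   hence k3: "3 \<le> k" using k by simp
   define S w where "S = real s" and "w = (x - 3) gchoose (k - 2)"
   define W P where "W = x * (x - 1) * (x - 2)" and "P = S * (S - 1) * (S - 2)"
   have S: "4 \<le> S" "x \<le> S" "S - 1 \<le> x" using k3 sk Nx by (auto simp: S_def s_def)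
   have cz: "P * Zc s k = (real k * (real k - 1)) * ((S - real k) * real (s choose k))"
    "W * w = (real k * (real k - 1)) * ((x - real k) * (x gchoose k))"
    using Zc_compare[OF k3 sk(1) k(2)] by (simp_all add: S_def w_def W_def P_def)
   have a1: "5 * real (s choose k) \<le> 6 * (x gchoose k)" 
   proof -
    have "5 * M \<le> 6 * \<gamma>" using D by (simp add: right_diff_distrib)
    moreover have "0 \<le> real (Nn choose k)" "6 * \<gamma> = 6 * (x gchoose k) - 6 * real (Nn choose k)" by (simp_all add: \<gamma>_def)
    ultimately have "5 * real (Nn choose k) + 5 * M \<le> 6 * (x gchoose k)" by linarith
    thus ?thesis unfolding s_def cSuc distrib_left .
   qed
   \<comment> \<open>C(x,k) lies below the chord, so \<open>(1 - u) * M\<close> is at most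
     \<open>M - \<gamma>\<close>, and this is at most \<open>M / 6\<close>.\<close>
   have du: "6 * (1 - u) \<le> 1"
   proof -
    have "0 \<le> u * (1 - u) * real (k - 1) * real (Nn choose (k - 1))" using u by simp
    also have "\<dots> \<le> 2 * (real Nn + 1) * (real (Nn choose Suc (k - 1)) + u * real (Nn choose (k - 1)) - ((real Nn + u) gchoose Suc (k - 1)))"
     using k kN u by (intro gb_convex_gap) auto
    finally have "0 \<le> real (Nn choose k) + u * M - (x gchoose k)"
     using k u(4) by (simp add: zero_le_mult_iff M_def)
    hence w: "(1 - u) * M \<le> M - \<gamma>" by (simp add: \<gamma>_def algebra_simps)
    have "(6 * (1 - u)) * M = 6 * ((1 - u) * M)" by simp
    also have "\<dots> \<le> 6 * (M - \<gamma>)" using w by (rule mult_left_mono) simp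
    also have "\<dots> \<le> 1 * M" using D by simp
    finally have "(6 * (1 - u)) * M \<le> 1 * M" .
    thus ?thesis using M0 by (simp only: mult_le_cancel_right_pos)
   qed
   have a2: "5 * (S - real k) \<le> 6 * (x - real k)"
   proof -
    have "real k + 1 \<le> S" using sk by (simp add: S_def)
    thus ?thesis using du unfolding u_def S_def s_def by simp
   qed
   have "(5 * (S - real k)) * (5 * real (s choose k)) \<le> (6 * (x - real k)) * (6 * (x gchoose k))"
    by (rule mult_mono[OF a2 a1]) (use k in auto)
   hence "25 * ((S - real k) * real (s choose k)) \<le> 36 * ((x - real k) * (x gchoose k))"
    by (simp add: algebra_simps)
   moreover have "25 * (q * z) \<le> 36 * (q * v)" if "25 * z \<le> 36 * v" "0 \<le> q" for q z v :: real
    using mult_left_mono[OF that] by (simp only: mult_ac)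
   ultimately have "25 * (P * Zc s k) \<le> 36 * (W * w)" unfolding cz using k3 by simp
   moreover have W0: "0 < W" "W \<le> P" unfolding W_def P_def using S by (auto intro!: mult_mono)
   moreover have w0: "0 \<le> w"
   proof -
    have "0 \<le> W * w" unfolding cz(2) using k3 k(2) gb_nonneg[of k x] by (intro mult_nonneg_nonneg) auto
    thus ?thesis using W0(1) by (simp add: zero_le_mult_iff)
   qed
   ultimately have "25 * (P * Zc s k) \<le> 36 * (P * w)" using mult_right_mono[OF W0(2) w0] by linarith
   moreover have "0 \<le> P * w" using W0 w0 by simp
   ultimately have "P * Zc s k \<le> P * (3 * w)" by simp
   moreover have "0 < P" using W0 by simp
   ultimately show ?thesis unfolding w_def by (simp only: mult_le_cancel_left_pos)
  qed
  have e: "s - 1 = Nn" by (simp add: s_def)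
  have tS': "real (card \<A>) - real (msize (card V) s k) = \<gamma> - M" using tS by (simp add: s_def)
  have w1: "2 * (real (card \<A>) - real (msize (card V) s k)) \<le> incr s k"
   unfolding tS' e M_def[symmetric] right_diff_distrib using gM M0 by linarith
  have w2: "- 6 * th (s - 1) (k - 1) * (real (card \<A>) - real (msize (card V) s k)) \<le> incr s k"
   unfolding tS' e M_def[symmetric] using 2 by (simp add: algebra_simps)
  show ?thesis by (rule that[OF sk(1) sn w1 w2 ex Zle])
 next
  case 3
  \<comment> \<open>Neither window fits. The slack bounds the gap \<open>u * M - \<gamma>\<close>
    above, while \<open>gb_convex_gap\<close> and \<open>midrange_product\<close> bound it below;
    the outcome \<open>K - 1 \<le> 384 * (c * K)\<close> is impossible for
    \<open>1000 * c \<le> 1\<close> and \<open>K \<ge> 2\<close>.\<close>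
  define g where "g = card \<A> - (binom_ge (card V) (Suc k) + (Nn choose k))"
  have g: "card \<A> = binom_ge (card V) (Suc k) + (Nn choose k) + g" "real g = \<gamma>"
   using tN g0 unfolding g_def msize_def by linarith+
  have "g \<le> Nn choose (k - 1)" using gM g(2) unfolding M_def by simp
  then obtain \<F> where F: "uniform (k - 1) \<F>" "card \<F> = g"
   "binom_ge (card V) k + (Nn choose (k - 1)) + card (shadow \<F>) \<le> card (nbd V \<A>)"
   using nbd_bound[OF V, of k Nn g] k kN Nn g(1) by auto
  have "0 < real g" using 3(1) g(2) of_nat_0_le_iff[of "(Nn - 1) choose (k - 1)", where 'a = real] by linarith
  hence g1: "1 \<le> card \<F>" using F(2) by simp
  have gF: "real (card \<F>) = (x gchoose k) - real (Nn choose k)" using F(2) g(2) by (simp add: \<gamma>_def)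
  have x1: "x \<le> real Nn + 1" using Nx by simp
  define q where "q = x - real k + 1"
  have q0: "0 < q" using k by (simp add: q_def)
  have "real (card (shadow \<F>)) - ((x gchoose (k - 1)) - real (Nn choose (k - 1))) \<le> sl"
   using of_nat_mono[OF F(3), where 'a = real] N unfolding sl_def[symmetric] of_nat_add by linarith
  hence "q * (real (card (shadow \<F>)) - ((x gchoose (k - 1)) - real (Nn choose (k - 1)))) \<le> q * sl"
   using q0 by (intro mult_left_mono) auto
  hence up: "u * M - \<gamma> \<le> q * sl"
   using shadow_excess[OF F(1) k(1) kN Nx(1) x1 gF g1] unfolding gF \<gamma>_def[symmetric] u_def[symmetric] M_def[symmetric] q_def[symmetric] by linarith
  define n K p where "n = real Nn" and "K = real k" and "p = n - K + 1"
  have r: "2 \<le> K" "K \<le> n" "1 \<le> p" "p \<le> n" using k kN by (auto simp: n_def K_def p_def)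
  have M0: "0 < M" using kN by (simp add: M_def)
  have mp: "p \<le> 24 * (n + 1) * (u * (1 - u))"
   using midrange_product[OF k(1) kN u(1,2)] 3 unfolding u(4) \<gamma>_def[symmetric] M_def[symmetric] n_def K_def p_def by simp
  have gap: "u * (1 - u) * (K - 1) * M \<le> 2 * (n + 1) * (u * M - \<gamma>)"
  proof -
   have "u * (1 - u) * real (k - 1) * real (Nn choose (k - 1))
    \<le> 2 * (real Nn + 1) * (real (Nn choose Suc (k - 1)) + u * real (Nn choose (k - 1)) - ((real Nn + u) gchoose Suc (k - 1)))"
    using k kN u by (intro gb_convex_gap) auto
   moreover have "Suc (k - 1) = k" "real (k - 1) = K - 1" using k by (auto simp: K_def of_nat_diff)
   ultimately show ?thesis unfolding u(4) M_def[symmetric] n_def \<gamma>_def by (simp add: diff_diff_eq2 add.commute)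
  qed
  have "p * ((K - 1) * M) \<le> (24 * (n + 1) * (u * (1 - u))) * ((K - 1) * M)" using mp r M0 by (intro mult_right_mono) auto
  also have "\<dots> = 24 * (n + 1) * (u * (1 - u) * (K - 1) * M)" by (simp only: mult_ac)
  also have "\<dots> \<le> 24 * (n + 1) * (2 * (n + 1) * (u * M - \<gamma>))" using gap r by (intro mult_left_mono) auto
  also have "\<dots> \<le> 24 * (n + 1) * (2 * (n + 1) * (q * sl))" using up r by (intro mult_left_mono) auto
  finally have h1: "p * ((K - 1) * M) \<le> 48 * ((n + 1) * ((n + 1) * (q * sl)))" by (simp add: algebra_simps)
  have qs: "q * sl * x ^ 3 = c * (K * ((x - K) * (K * (x gchoose k))))"
  proof -
   have "sl * x ^ 3 = c * (K * ((x - K) * (x gchoose (k - 1))))" using x0 by (simp add: sl_def K_def)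
   hence "q * sl * x ^ 3 = c * (K * ((x - K) * (q * (x gchoose (k - 1)))))" by (simp add: mult_ac)
   thus ?thesis unfolding q_def kx K_def .
  qed
  have Kx: "K * (x gchoose k) \<le> (n + 1) * M"
  proof -
   have "x gchoose k \<le> real (Nn choose k) + M" using gM by (simp add: \<gamma>_def)
   hence "K * (x gchoose k) \<le> K * real (Suc Nn choose k)" unfolding cSuc by (rule mult_left_mono) (use r in simp)
   moreover have "K * real (Suc Nn choose k) = (n + 1) * M"
    using ks[of "Suc Nn"] by (simp add: K_def n_def M_def add.commute)
   ultimately show ?thesis by linarith
  qed
  have xK: "0 \<le> x - K" "x - K \<le> p" using k Nx by (auto simp: K_def p_def n_def)
  have "q * sl * x ^ 3 \<le> c * (K * (p * ((n + 1) * M)))" 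
  proof -
   have "0 \<le> K * (x gchoose k)" using gb_nonneg[of k x] k r by simp
   hence "(x - K) * (K * (x gchoose k)) \<le> p * ((n + 1) * M)" by (intro mult_mono[OF xK(2) Kx]) (use r in auto)
   hence "K * ((x - K) * (K * (x gchoose k))) \<le> K * (p * ((n + 1) * M))" by (rule mult_left_mono) (use r in simp)
   thus ?thesis unfolding qs by (rule mult_left_mono) (rule c)
  qed
  moreover have "q * sl * n ^ 3 \<le> q * sl * x ^ 3"
   using q0 sl0 Nx r by (intro mult_left_mono power_mono) (auto simp: n_def)
  ultimately have h2: "q * sl * n ^ 3 \<le> c * (K * (p * ((n + 1) * M)))" by linarith
  have n2: "n + 1 \<le> 2 * n" using r by simp
  have "(p * ((K - 1) * M)) * n ^ 3 \<le> 48 * ((n + 1) * ((n + 1) * (q * sl))) * n ^ 3"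
   using h1 r by (intro mult_right_mono) auto
  also have "\<dots> = 48 * ((n + 1) * (n + 1)) * (q * sl * n ^ 3)" by (simp only: mult_ac)
  also have "\<dots> \<le> 48 * ((n + 1) * (n + 1)) * (c * (K * (p * ((n + 1) * M))))" using h2 r by (intro mult_left_mono) auto
  also have "\<dots> = (48 * (c * K) * (p * M)) * ((n + 1) * ((n + 1) * (n + 1)))" by (simp only: mult_ac)
  also have "\<dots> \<le> (48 * (c * K) * (p * M)) * ((2 * n) * ((2 * n) * (2 * n)))"
   using n2 r c M0 by (intro mult_left_mono mult_mono) auto
  also have "\<dots> = (384 * (c * K)) * ((p * M) * n ^ 3)" by (simp add: power3_eq_cube)
  finally have h3: "(K - 1) * ((p * M) * n ^ 3) \<le> (384 * (c * K)) * ((p * M) * n ^ 3)" by (simp add: mult_ac)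
  have "0 < (p * M) * n ^ 3" using r M0 by simp
  hence "K - 1 \<le> 384 * (c * K)" using h3 by (simp only: mult_le_cancel_right_pos)
  moreover have "1000 * (c * K) \<le> K" using mult_right_mono[OF c(2), of K] r by simp
  ultimately show ?thesis using r by linarith
 qed
qed

section \<open>Generalised Hamming balls and the comparison family\<close>

lemma card_vboundary:
 assumes "\<A> \<subseteq> cube n"
 shows "card (vboundary n \<A>) + card \<A> = card (nbd {1..n} \<A>)"
proof -
 have A: "\<A> \<subseteq> Pow {1..n}" using assms by (simp add: cube_def)
 have fin: "finite \<A>" "finite (nbd {1..n} \<A>)" using finite_subset_Pow[OF A] by auto
 have "vboundary n \<A> = nbd {1..n} \<A> - \<A>"
 proof (rule set_eqI)
  fix y
  have "card (sym_diff x y) = 1 \<longleftrightarrow> card (sym_diff x y) \<le> 1" if "x \<in> \<A>" "y \<subseteq> {1..n}" "y \<notin> \<A>" for x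
  proof -
   have f: "finite (sym_diff x y)" using that A finite_subset[of _ "{1..n}"] by auto
   have "sym_diff x y \<noteq> {}" using that by auto
   hence "card (sym_diff x y) \<noteq> 0" using f by simp
   thus ?thesis by linarith
  qed
  thus "y \<in> vboundary n \<A> \<longleftrightarrow> y \<in> nbd {1..n} \<A> - \<A>"
   unfolding vboundary_def nbd_def adjacent_def cube_def by auto
 qed
 hence "card (vboundary n \<A>) = card (nbd {1..n} \<A>) - card \<A>"
  using nbd_superset[OF A] fin by (simp add: card_Diff_subset)
 moreover have "card \<A> \<le> card (nbd {1..n} \<A>)" using nbd_superset[OF A] fin by (intro card_mono)
 ultimately show ?thesis by simp
qed

lemma obtain_permutation:
 assumes "S \<subseteq> {1..n::nat}"
 obtains \<pi> where "\<pi> permutes {1..n}" "\<pi> ` {1..card S} = S"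
proof -
 have fS: "finite S" using assms finite_subset by blast
 have le: "card S \<le> n" using card_mono[OF _ assms] by simp
 obtain f where f: "bij_betw f {1..card S} S" using finite_same_card_bij[of "{1..card S}" S] fS by auto
 have "card ({1..n} - {1..card S}) = card ({1..n} - S)"
  using le card_Diff_subset[OF fS assms] by (subst card_Diff_subset) auto
 then obtain g where g: "bij_betw g ({1..n} - {1..card S}) ({1..n} - S)"
  using finite_same_card_bij[of "{1..n} - {1..card S}" "{1..n} - S"] by auto
 define \<pi> where "\<pi> x = (if x \<in> {1..card S} then f x else if x \<in> {1..n} then g x else x)" for x
 have b1: "bij_betw \<pi> {1..card S} S" using f by (rule bij_betw_cong[THEN iffD1, rotated]) (simp add: \<pi>_def)
 have b2: "bij_betw \<pi> ({1..n} - {1..card S}) ({1..n} - S)"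
  using g by (rule bij_betw_cong[THEN iffD1, rotated]) (auto simp: \<pi>_def)
 have "bij_betw \<pi> ({1..card S} \<union> ({1..n} - {1..card S})) (S \<union> ({1..n} - S))"
  by (rule bij_betw_combine[OF b1 b2]) auto
 moreover have "{1..card S} \<union> ({1..n} - {1..card S}) = {1..n}" "S \<union> ({1..n} - S) = {1..n}" using le assms by auto
 ultimately have "bij_betw \<pi> {1..n} {1..n}" by simp
 moreover have "\<pi> x = x" if "x \<notin> {1..n}" for x using that le by (auto simp: \<pi>_def)
 ultimately have "\<pi> permutes {1..n}" by (rule bij_imp_permutes)
 thus ?thesis using that b1 by (simp add: bij_betw_def)
qed

text \<open>Both shapes restrict layers by inclusion in one set, so they are treated together, with
  predicates \<open>P\<close> and \<open>Q\<close> on cardinalities.\<close>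

lemma permute_family:
 assumes p: "\<pi> permutes V" and T: "T \<subseteq> V" "\<pi> ` T = S"
 shows "(`) \<pi> ` {A. A \<subseteq> V \<and> (P (card A) \<or> A \<subseteq> T \<and> Q (card A))} = {x. x \<subseteq> V \<and> (P (card x) \<or> x \<subseteq> S \<and> Q (card x))}"
proof (intro set_eqI iffI)
 have inj: "inj \<pi>" using p by (rule permutes_inj)
 have c: "card (\<pi> ` A) = card A" for A using inj by (intro card_image inj_on_subset[OF inj]) simp
 {
  fix x assume "x \<in> (`) \<pi> ` {A. A \<subseteq> V \<and> (P (card A) \<or> A \<subseteq> T \<and> Q (card A))}"
  then obtain A where A: "A \<subseteq> V" "P (card A) \<or> A \<subseteq> T \<and> Q (card A)" "x = \<pi> ` A" by blast
  have "\<pi> ` A \<subseteq> V" using A(1) permutes_image[OF p] by blast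
  moreover have "A \<subseteq> T \<Longrightarrow> \<pi> ` A \<subseteq> S" using T by blast
  ultimately show "x \<in> {x. x \<subseteq> V \<and> (P (card x) \<or> x \<subseteq> S \<and> Q (card x))}" using A c by auto
 }
 fix x assume x: "x \<in> {x. x \<subseteq> V \<and> (P (card x) \<or> x \<subseteq> S \<and> Q (card x))}"
 define A where "A = inv \<pi> ` x"
 have pA: "\<pi> ` A = x" unfolding A_def using permutes_surj[OF p] by (rule image_f_inv_f)
 have "A \<subseteq> V" unfolding A_def using x permutes_image[OF permutes_inv[OF p]] by blast
 moreover have "x \<subseteq> S \<Longrightarrow> A \<subseteq> T"
 proof -
  assume "x \<subseteq> S"
  hence "\<pi> ` A \<subseteq> \<pi> ` T" using pA T by simp
  thus "A \<subseteq> T" using inj by (simp add: inj_image_subset_iff)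
 qed
 moreover have "card A = card x" using c[of A] pA by simp
 ultimately have "A \<in> {A. A \<subseteq> V \<and> (P (card A) \<or> A \<subseteq> T \<and> Q (card A))}" using x by auto
 thus "x \<in> (`) \<pi> ` {A. A \<subseteq> V \<and> (P (card A) \<or> A \<subseteq> T \<and> Q (card A))}" using pA by blast
qed

lemma gball_gen_hamming_ball:
 assumes g: "gball {1..n} s k \<G>" and k: "1 \<le> k" "k \<le> s"
 shows "gen_hamming_ball n \<G>"
proof -
 obtain b C S where g: "C \<subseteq> {1..n}" "S \<subseteq> {1..n}" "card S + (if b then 0 else 1) = s" "s \<le> n"
  "\<G> = flip C (std_ball b {1..n} k S)" using g unfolding gball_def by auto
 obtain \<pi> where p: "\<pi> permutes {1..n}" "\<pi> ` {1..card S} = S" using obtain_permutation[OF g(2)] .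
 define \<phi> where "\<phi> = (\<lambda>A. sym_diff (\<pi> ` A) C)"
 have aut: "cube_automorphism n \<phi>" unfolding cube_automorphism_def \<phi>_def using p(1) g(1) by blast
 have cS: "{1..card S} \<subseteq> {1..n}" using card_mono[OF _ g(2)] by auto
 have im: "\<phi> ` X = flip C ((`) \<pi> ` X)" for X unfolding flip_image \<phi>_def by (simp add: image_image)
 have ls: "int k \<le> int s" "int s \<le> int n" using k g by auto
 show ?thesis
 proof (cases b)
  case True
  have "upper_layers n (int k + 1) \<union> layer (int s) (int k)
   = {A. A \<subseteq> {1..n} \<and> (Suc k \<le> card A \<or> A \<subseteq> {1..card S} \<and> card A = k)}"
   using g(3) True cS unfolding upper_layers_def layer_def by auto
  note eqU = this
  have "\<phi> ` (upper_layers n (int k + 1) \<union> layer (int s) (int k)) = flip C (T1 {1..n} k S)"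
  proof -
   have "T1 {1..n} k S = {x. x \<subseteq> {1..n} \<and> (Suc k \<le> card x \<or> x \<subseteq> S \<and> card x = k)}" by (auto simp: T1_def)
   thus ?thesis unfolding im eqU
    using permute_family[OF p(1) cS p(2), of "\<lambda>c. Suc k \<le> c" "\<lambda>c. c = k"] by (simp only:)
  qed
  hence "\<G> = \<phi> ` (upper_layers n (int k + 1) \<union> layer (int s) (int k))" using g(5) True by (simp add: std_ball_def)
  thus ?thesis unfolding gen_hamming_ball_def using aut ls by blast
 next
  case False
  have s1: "nat (int s - 1) = card S" using g(3) False by simp
  have "upper_layers n (int k + 1) \<union> layer (int s - 1) (int k) \<union> layer (int s - 1) (int k - 1)
   = {A. A \<subseteq> {1..n} \<and> (Suc k \<le> card A \<or> A \<subseteq> {1..card S} \<and> (card A = k \<or> Suc (card A) = k))}"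
   using cS unfolding upper_layers_def layer_def s1 by auto
  note eqU = this
  have "\<phi> ` (upper_layers n (int k + 1) \<union> layer (int s - 1) (int k) \<union> layer (int s - 1) (int k - 1)) = flip C (T2 {1..n} k S)"
  proof -
   have "T2 {1..n} k S = {x. x \<subseteq> {1..n} \<and> (Suc k \<le> card x \<or> x \<subseteq> S \<and> (card x = k \<or> Suc (card x) = k))}" by (auto simp: T2_def)
   thus ?thesis unfolding im eqU
    using permute_family[OF p(1) cS p(2), of "\<lambda>c. Suc k \<le> c" "\<lambda>c. c = k \<or> Suc c = k"] by (simp only:)
  qed
  hence "\<G> = \<phi> ` (upper_layers n (int k + 1) \<union> layer (int s - 1) (int k) \<union> layer (int s - 1) (int k - 1))"
   using g(5) False by (simp add: std_ball_def)
  thus ?thesis unfolding gen_hamming_ball_def using aut ls by blast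
 qed
qed

text \<open>Just after \<open>T1 {1..n} k {1..s}\<close>, the simplicial order lists sets that contain a \<open>(k-1)\<close>-set
 inside \<open>{1..s}\<close> only if that set avoids \<open>s\<close>; there are \<open>C(s-1,k-1)\<close> of these.\<close>

lemma early_successor:
 assumes s: "1 \<le> k" "k \<le> s" "s \<le> n" and E: "E \<le> (s - 1) choose (k - 1)"
  and I: "is_initial_segment n \<I>" "T1 {1..n} k {1..s} \<subseteq> \<I>" "card \<I> = card (T1 {1..n} k {1..s}) + E"
  and x: "x \<in> \<I>" "x \<notin> T1 {1..n} k {1..s}" and y: "card (sym_diff x y) \<le> 1" "y \<subseteq> {1..s}" "Suc (card y) = k"
 shows "s \<notin> y"
proof
 assume sy: "s \<in> y"
 define \<B> where "\<B> = {B. B \<subseteq> {1..s - 1} \<and> card B = k - 1}"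
 have cB: "card \<B> = (s - 1) choose (k - 1)" unfolding \<B>_def using n_subsets[of "{1..s - 1}" "k - 1"] by simp
 have Ic: "\<I> \<subseteq> Pow {1..n}" using I(1) by (simp add: is_initial_segment_def cube_def)
 have fI: "finite \<I>" using finite_subset_Pow[OF Ic] by simp
 have xV: "x \<subseteq> {1..n}" using x(1) Ic by auto
 have fx: "finite x" "finite y" using xV y(2) finite_subset by auto
 have pred: "A \<in> \<I>" if "A \<subseteq> {1..n}" "simplicial_less A x" for A
  using I(1) x(1) that unfolding is_initial_segment_def cube_def by blast
 have Bf: "finite B" "s \<notin> B" "B \<subseteq> {1..n}" "B \<subseteq> {1..s}" "card B = k - 1" if B: "B \<in> \<B>" for B
 proof -
  have b: "B \<subseteq> {1..s - 1}" "card B = k - 1" using B by (auto simp: \<B>_def)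
  have s': "{1..s - 1} \<subseteq> {1..s}" "{1..s} \<subseteq> {1..n}" "s \<notin> {1..s - 1}" using s by auto
  show "finite B" using b(1) by (rule finite_subset) simp
  show "s \<notin> B" "B \<subseteq> {1..n}" "B \<subseteq> {1..s}" using b(1) s' by blast+
  show "card B = k - 1" by (rule b(2))
 qed
 have "B \<notin> T1 {1..n} k {1..s}" if "B \<in> \<B>" for B
 proof -
  have "\<not> Suc k \<le> card B" "card B \<noteq> k" using Bf(5)[OF that] s(1) by linarith+
  thus ?thesis by (simp add: T1_def)
 qed
 hence BT: "\<B> \<inter> T1 {1..n} k {1..s} = {}" by blast
 have less: "simplicial_less (Z \<union> B) (Z \<union> y)" if "B \<in> \<B>" "Z \<inter> {1..s} = {}" "finite Z" for B Z
 proof -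
  have d: "Z \<inter> B = {}" "Z \<inter> y = {}" using that(2) Bf[OF that(1)] y(2) by auto
  have c: "card (Z \<union> B) = card (Z \<union> y)"
   using card_Un_disjoint[OF that(3) Bf(1)[OF that(1)] d(1)] card_Un_disjoint[OF that(3) fx(2) d(2)] Bf(5)[OF that(1)] y(3) by simp
  have sd: "sym_diff (Z \<union> B) (Z \<union> y) \<subseteq> {1..s}" using Bf(4)[OF that(1)] y(2) by auto
  have "s \<in> sym_diff (Z \<union> B) (Z \<union> y)" using sy Bf(2)[OF that(1)] that(2) s by auto
  hence "Max (sym_diff (Z \<union> B) (Z \<union> y)) = s"
   using sd finite_subset[OF sd] by (intro Max_eqI) auto
  thus ?thesis unfolding simplicial_less_def using c sy Bf(2)[OF that(1)] that(2) s by auto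
 qed
 \<comment> \<open>If \<open>y\<close> contained \<open>s\<close>, then \<open>x\<close> would be
   preceded, outside the ball, by C(s-1,k-1) further sets: the sets \<open>B\<close> or
   \<open>insert a B\<close>, according to how \<open>x\<close> and \<open>y\<close> differ. With
   \<open>x\<close> itself this is more than the \<open>E\<close> members available.\<close>
 have "\<exists>\<W>. \<W> \<subseteq> \<I> \<and> \<W> \<inter> T1 {1..n} k {1..s} = {} \<and> x \<notin> \<W> \<and> card \<W> = card \<B>"
 proof -
  from y(1) consider "x = y" | a where "a \<notin> x" "y = insert a x" | a where "a \<notin> y" "x = insert a y"
   unfolding sym_diff_card_le_1_iff[OF fx] by blast
  thus ?thesis
  proof cases
   case 1
   have "B \<in> \<I>" if "B \<in> \<B>" for B
    using pred[OF Bf(3)[OF that]] less[OF that, of "{}"] 1 by simp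
   moreover have "x \<notin> \<B>" using 1 sy Bf(2)[of x] by blast
   ultimately show ?thesis using BT by blast
  next
   case 2
   have cx: "Suc (card x) = card y" using 2 fx by simp
   have "simplicial_less B x" if "B \<in> \<B>" for B unfolding simplicial_less_def using Bf(5)[OF that] cx y(3) by auto
   hence "B \<in> \<I>" if "B \<in> \<B>" for B using pred[OF Bf(3)[OF that]] that by blast
   moreover have "x \<notin> \<B>"
   proof
    assume "x \<in> \<B>"
    from Bf(5)[OF this] show False using cx y(3) by simp
   qed
   ultimately show ?thesis using BT by blast
  next
   case 3
   have cx: "card x = k" using 3 fx y(3) by simp
   have as: "a \<notin> {1..s}"
   proof
    assume "a \<in> {1..s}"
    hence "x \<subseteq> {1..s}" using 3 y(2) by simp
    thus False using x(2) cx xV by (simp add: T1_def)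
   qed
   have aV: "a \<in> {1..n}" using 3 xV by auto
   define \<W> where "\<W> = insert a ` \<B>"
   have aB: "a \<notin> B" if "B \<in> \<B>" for B using Bf(4)[OF that] as by auto
   have inj: "inj_on (insert a) \<B>" by (rule inj_onI) (metis aB insert_ident)
   have "\<W> \<subseteq> \<I>"
   proof
    fix w assume "w \<in> \<W>"
    then obtain B where B: "B \<in> \<B>" "w = insert a B" unfolding \<W>_def by blast
    have "simplicial_less ({a} \<union> B) ({a} \<union> y)" using B as by (intro less) auto
    thus "w \<in> \<I>" using pred[of w] B 3 aV Bf(3)[OF B(1)] by simp
   qed
   moreover have "\<W> \<inter> T1 {1..n} k {1..s} = {}"
   proof -
    have "w \<notin> T1 {1..n} k {1..s}" if w: "w \<in> \<W>" for w
    proof -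
     obtain B where B: "B \<in> \<B>" "w = insert a B" using w unfolding \<W>_def by blast
     have "card w = k" using B aB[OF B(1)] Bf[OF B(1)] s by simp
     moreover have "\<not> w \<subseteq> {1..s}" using B as by auto
     ultimately show ?thesis by (simp add: T1_def)
    qed
    thus ?thesis by auto
   qed
   moreover have "x \<notin> \<W>"
   proof
    assume "x \<in> \<W>"
    then obtain B where B: "B \<in> \<B>" "x = insert a B" unfolding \<W>_def by blast
    have "s \<in> insert a B" using 3 sy B by auto
    thus False using Bf(2)[OF B(1)] as s by auto
   qed
   moreover have "card \<W> = card \<B>" unfolding \<W>_def using inj by (rule card_image)
   ultimately show ?thesis by blast
  qed
 qed
 then obtain \<W> where W: "\<W> \<subseteq> \<I>" "\<W> \<inter> T1 {1..n} k {1..s} = {}" "x \<notin> \<W>" "card \<W> = card \<B>" by blast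
 have fW: "finite \<W>" using W(1) fI finite_subset by auto
 have fT: "finite (T1 {1..n} k {1..s})" using finite_subset_Pow[OF T1_subset] by simp
 have "card (T1 {1..n} k {1..s} \<union> insert x \<W>) = card (T1 {1..n} k {1..s}) + card (insert x \<W>)"
  using fT fW W(2) x(2) by (intro card_Un_disjoint) auto
 moreover have "card (insert x \<W>) = Suc (card \<W>)" using fW W(3) by simp
 moreover have "card (T1 {1..n} k {1..s} \<union> insert x \<W>) \<le> card \<I>"
  using I(2) W(1) x(1) fI by (intro card_mono) auto
 ultimately show False using I(3) W(4) cB E by linarith
qed

text \<open>Submodularity and Harper's theorem bound the neighbourhood of \<open>\<A>\<close> below
  by that of \<open>I0\<close> plus that of \<open>I2\<close> minus that of \<open>I1\<close>. The
  comparison family does not exceed this, because neighbours of the added sets that lie in the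
  neighbourhood of \<open>I1\<close> already lie in that of \<open>I0\<close>. As the two families
  have equal size, boundaries compare like neighbourhoods.\<close>

lemma vboundary_J_family_le:
 assumes A: "\<A> \<subseteq> cube n" and g: "gball {1..n} s k \<G>" and k: "2 \<le> k" "k \<le> s" "s \<le> n"
 defines "D \<equiv> card (\<G> - \<A>)" and "E \<equiv> card (\<A> - \<G>)"
 assumes D: "D \<le> (s - 1) choose (k - 1)" "k < s \<or> D = 0" and E: "E \<le> (s - 1) choose (k - 1)"
 shows "card (vboundary n (J_family n (card \<G>) D E)) \<le> card (vboundary n \<A>)"
proof -
 define V where "V = {1..n}"
 have V: "finite V" "card V = n" by (auto simp: V_def)
 have AV: "\<A> \<subseteq> Pow V" using A by (simp add: cube_def V_def)
 have gV: "gball V s k \<G>" using g by (simp add: V_def)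
 have GV: "\<G> \<subseteq> Pow V" using gball_subset[OF gV] .
 have fin: "finite \<A>" "finite \<G>" using finite_subset_Pow[OF AV V(1)] finite_subset_Pow[OF GV V(1)] by auto
 define m where "m = card \<G>"
 have m: "m = msize n s k" "card (nbd V \<G>) = msize_nbd n s k" using card_gball[OF V(1) gV k(1,2)] V(2) by (auto simp: m_def)
 have cI: "card (\<A> \<inter> \<G>) + D = m" unfolding D_def m_def using card_Int_Diff[OF fin(2), of \<A>] by (simp add: Int_commute)
 have cU: "card (\<A> \<union> \<G>) = m + E" unfolding E_def m_def
  using card_Un_disjoint[OF fin(2) finite_Diff[OF fin(1)], of \<G>] by (simp add: Un_commute)
 have P: "card (Pow V) = 2 ^ n" using V by (simp add: card_Pow)
 have UV: "\<A> \<union> \<G> \<subseteq> Pow V" "\<A> \<inter> \<G> \<subseteq> Pow V" using AV GV by auto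
 have mE: "m + E \<le> 2 ^ n" using card_mono[OF _ UV(1)] V(1) P cU by simp
 define I1 I0 I2 where "I1 = initial_segment n m" and "I0 = initial_segment n (m - D)" and "I2 = initial_segment n (m + E)"
 note p1 = initial_segment_props[of m n, folded I1_def] and p0 = initial_segment_props[of "m - D" n, folded I0_def]
  and p2 = initial_segment_props[of "m + E" n, folded I2_def]
 have ini: "is_initial_segment n I1" "is_initial_segment n I0" "is_initial_segment n I2"
  and cs: "card I1 = m" "card I0 = m - D" "card I2 = m + E" using p1 p0 p2 mE by auto
 have sub: "I0 \<subseteq> I1" "I1 \<subseteq> I2" using initial_segments_mono[OF ini(2,1)] initial_segments_mono[OF ini(1,3)] cs by auto
 have IV: "I1 \<subseteq> Pow V" "I0 \<subseteq> Pow V" "I2 \<subseteq> Pow V" using ini by (auto simp: is_initial_segment_def cube_def V_def)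
 have fI: "finite I1" "finite I0" "finite I2" using finite_subset_Pow[OF IV(1) V(1)] finite_subset_Pow[OF IV(2) V(1)] finite_subset_Pow[OF IV(3) V(1)] by auto
 have sV: "{1..s} \<subseteq> V" "{1..s - 1} \<subseteq> V" using k by (auto simp: V_def)
 have cT: "card (T1 V k {1..s}) = m" using card_T1[OF V(1) sV(1)] m V(2) by (simp add: msize_def)
 have I1T: "I1 = T1 V k {1..s}" using initial_segment_eqI[OF T1_initial[of n k s]] cT unfolding I1_def V_def by simp
 have sb: "std_ball True V k {1..s} = I1" by (simp add: std_ball_def I1T)
 have ks: "s = card {1..s} + (if True then 0 else 1)" "s \<le> card V" using k V by auto
 have n1: "nbd V I1 = T1 V (k - 1) {1..s}" "card (nbd V I1) = msize_nbd n s k"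
  using nbd_std_ball[OF V(1) sV(1) k(1) ks(1) k(2) ks(2)] V(2) unfolding sb by (auto simp: std_ball_def)
 have "card (nbd V (\<A> \<inter> \<G>)) + card (nbd V (\<A> \<union> \<G>)) \<le> card (nbd V \<A>) + card (nbd V \<G>)"
  by (rule card_submodular_nbd[OF V(1)])
 moreover have "card (nbd V I0) \<le> card (nbd V (\<A> \<inter> \<G>))"
 proof -
  have "card (\<A> \<inter> \<G>) = m - D" using cI by simp
  thus ?thesis using Harper[of "\<A> \<inter> \<G>" n] UV(2) unfolding I0_def V_def cube_def by simp
 qed
 moreover have "card (nbd V I2) \<le> card (nbd V (\<A> \<union> \<G>))"
  using Harper[of "\<A> \<union> \<G>" n] UV(1) cU unfolding I2_def V_def cube_def by simp
 ultimately have A_ge: "card (nbd V I0) + card (nbd V I2) \<le> card (nbd V \<A>) + card (nbd V I1)"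
  using m(2) n1(2) by linarith
 define J where "J = I0 \<union> (I2 - I1)"
 have J: "J_family n m D E = J" by (simp add: J_family_def J_def I0_def I1_def I2_def)
 have key: "nbd V (I2 - I1) \<inter> nbd V I1 \<subseteq> nbd V I0"
 proof (cases "D = 0")
  case True
  hence "I0 = I1" by (simp add: I0_def I1_def)
  thus ?thesis by auto
 next
  case False
  hence ks': "k < s" using D(2) by simp
  \<comment> \<open>As \<open>D\<close> is at most \<open>incr s k\<close>, the shortened segment
    still contains the ball of parameter \<open>s - 1\<close>, whose neighbourhood covers every
    (k-1)-set avoiding \<open>s\<close> that is needed.\<close>
  have T0: "T1 V k {1..s - 1} \<subseteq> I0"
  proof -
   have "s choose k = ((s - 1) choose k) + ((s - 1) choose (k - 1))" by (rule binom_M_shift) (use k in auto)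
   moreover define P Q where "P = (s - 1) choose k" and "Q = (s - 1) choose (k - 1)"
   ultimately have "m = binom_ge n (Suc k) + (P + Q)" "D \<le> Q" using m(1) D(1) by (simp_all add: msize_def)
   hence "binom_ge n (Suc k) + P \<le> m - D" by linarith
   hence "card (T1 V k {1..s - 1}) \<le> card I0"
    using card_T1[OF V(1) sV(2)] cs(2) V(2) by (simp add: P_def)
   thus ?thesis using initial_segments_mono[OF T1_initial[of n k "s - 1"] ini(2)] unfolding V_def by simp
  qed
  have k1: "s - 1 = card {1..s - 1} + (if True then 0 else 1)" "k \<le> s - 1" "s - 1 \<le> card V" using k ks' V by auto
  have n0: "T1 V (k - 1) {1..s - 1} \<subseteq> nbd V I0"
   using nbd_std_ball(1)[OF V(1) sV(2) k(1) k1] nbd_mono[OF T0, of V] by (simp add: std_ball_def)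
  show ?thesis
  proof
   fix y assume y: "y \<in> nbd V (I2 - I1) \<inter> nbd V I1"
   then obtain x where x: "x \<in> I2" "x \<notin> I1" "card (sym_diff x y) \<le> 1" "y \<subseteq> V" by (auto simp: nbd_def)
   have yT: "y \<in> T1 V (k - 1) {1..s}" using y n1(1) by auto
   have "y \<in> T1 V (k - 1) {1..s - 1}"
   proof (cases "Suc (k - 1) \<le> card y")
    case True
    thus ?thesis using x(4) by (simp add: T1_def)
   next
    case False
    hence yk: "y \<subseteq> {1..s}" "Suc (card y) = k" using yT k by (auto simp: T1_def)
    have "s \<notin> y"
    proof (rule early_successor[OF _ k(2,3) E ini(3) _ _ x(1) _ x(3) yk])
     show "1 \<le> k" using k by simp
     show "T1 {1..n} k {1..s} \<subseteq> I2" using sub(2) unfolding I1T V_def .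
     show "card I2 = card (T1 {1..n} k {1..s}) + E" using cs(3) cT unfolding V_def by simp
     show "x \<notin> T1 {1..n} k {1..s}" using x(2) unfolding I1T V_def .
    qed
    have "y \<subseteq> {1..s - 1}"
    proof
     fix z assume z: "z \<in> y"
     hence "1 \<le> z" "z \<le> s" "z \<noteq> s" using yk(1) \<open>s \<notin> y\<close> by auto
     thus "z \<in> {1..s - 1}" by simp
    qed
    thus ?thesis using x(4) yk(2) by (auto simp: T1_def)
   qed
   thus "y \<in> nbd V I0" using n0 by auto
  qed
 qed
 have "card (nbd V J) + card (nbd V I1) \<le> card (nbd V I0) + card (nbd V I2)"
 proof -
  have "nbd V J \<subseteq> nbd V I0 \<union> (nbd V I2 - nbd V I1)"
   unfolding J_def nbd_Un using key nbd_mono[of "I2 - I1" I2 V] by auto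
  hence "card (nbd V J) \<le> card (nbd V I0 \<union> (nbd V I2 - nbd V I1))" using V(1) by (intro card_mono) auto
  also have "\<dots> \<le> card (nbd V I0) + card (nbd V I2 - nbd V I1)" by (rule card_Un_le)
  finally show ?thesis
   using card_Diff_subset[OF finite_nbd[OF V(1)] nbd_mono[OF sub(2), of V]] card_nbd_mono[OF V(1) sub(2)] by simp
 qed
 hence NJ: "card (nbd V J) \<le> card (nbd V \<A>)" using A_ge by linarith
 have JV: "J \<subseteq> cube n" using IV unfolding J_def cube_def V_def by auto
 have "card J = card I0 + card (I2 - I1)" unfolding J_def using fI sub by (intro card_Un_disjoint) auto
 also have "card (I2 - I1) = E" using card_Diff_subset[OF fI(1) sub(2)] cs by simp
 finally have cJ: "card J = m - D + E" using cs by simp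
 have cA: "card \<A> = m - D + E" using card_Int_Diff[OF fin(1), of \<G>] cI unfolding E_def by simp
 show ?thesis unfolding m_def[symmetric] J
  using card_vboundary[OF JV] card_vboundary[OF A] NJ cJ cA unfolding V_def by linarith
qed

section \<open>The theorem\<close>

text \<open>The bound \<open>r\<close> serves twice: against \<open>y\<close> for closeness, and
  against \<open>incr s k\<close> for the comparison of boundaries. For \<open>s = k\<close> the
  alternative \<open>r < 1\<close> turns closeness into the vanishing of the deficit.\<close>

lemma conclusion_from_ball:
 assumes A: "\<A> \<subseteq> cube n" and g: "gball {1..n} s k \<G>" and k: "2 \<le> k" "k \<le> s" "s \<le> n"
  and DE: "real (card (\<G> - \<A>)) + real (card (\<A> - \<G>)) \<le> r" "r \<le> y" "r \<le> incr s k" "k < s \<or> r < 1"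
 shows "\<exists>\<G>. gen_hamming_ball n \<G> \<and> real (card (sym_diff \<A> \<G>)) \<le> y \<and>
  (let m = card \<G>; D = card (\<G> - \<A>); E = card (\<A> - \<G>)
   in card (vboundary n \<A>) \<ge> card (vboundary n (J_family n m D E)))"
proof (intro exI conjI)
 show "gen_hamming_ball n \<G>" by (rule gball_gen_hamming_ball[OF g]) (use k in auto)
 have "card (sym_diff \<A> \<G>) \<le> card (\<A> - \<G>) + card (\<G> - \<A>)" by (rule card_Un_le)
 thus "real (card (sym_diff \<A> \<G>)) \<le> y" using DE(1,2) by linarith
 have nn: "0 \<le> real (card (\<G> - \<A>))" "0 \<le> real (card (\<A> - \<G>))" by simp_all
 have "card (vboundary n (J_family n (card \<G>) (card (\<G> - \<A>)) (card (\<A> - \<G>)))) \<le> card (vboundary n \<A>)"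
 proof (rule vboundary_J_family_le[OF A g k])
  show "card (\<G> - \<A>) \<le> (s - 1) choose (k - 1)" "card (\<A> - \<G>) \<le> (s - 1) choose (k - 1)"
   using DE(1,3) nn of_nat_le_iff[where 'a = real] by (meson add_increasing add_increasing2 order_trans order_refl)+
  show "k < s \<or> card (\<G> - \<A>) = 0"
  proof (cases "k < s")
   case False
   hence "real (card (\<G> - \<A>)) < 1" using DE(1,4) nn(2) by linarith
   thus ?thesis by simp
  qed simp
 qed
 thus "let m = card \<G>; D = card (\<G> - \<A>); E = card (\<A> - \<G>)
   in card (vboundary n (J_family n m D E)) \<le> card (vboundary n \<A>)"
  by (simp only: Let_def)
qed

theorem theorem1p3:
 fixes \<delta> c x :: real and n k :: nat and \<A> :: "nat set set"
 assumes "0 < \<delta>" and "\<delta> < 1"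
  and "c = \<delta> / 10 ^ 10"
  and "2 \<le> k"
  and "real k - 1 \<le> x" and "x \<le> real n"
  and "\<not> (k = 3 \<and> x = 2)"
  and "\<A> \<subseteq> cube n" and "\<A> \<noteq> {}"
  and "real (card \<A>) = real (binom_ge n (k + 1)) + (x gchoose k)"
  and "real (card (vboundary n \<A>))
      \<le> B_lov n k x + c * real k * (x - real k) / x ^ 3 * (x gchoose (k - 1))"
 shows "\<exists>\<G>. gen_hamming_ball n \<G> \<and>
      real (card (sym_diff \<A> \<G>)) \<le> \<delta> * ((x - 3) gchoose (k - 2)) \<and>
      (let m = card \<G>; D = card (\<G> - \<A>); E = card (\<A> - \<G>)
      in card (vboundary n \<A>) \<ge> card (vboundary n (J_family n m D E)))"
proof -
 define V where "V = {1..n}"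
 have V: "finite V" "card V = n" by (auto simp: V_def)
 have AV: "\<A> \<subseteq> Pow V" using assms(8) by (simp add: cube_def V_def)
 have fA: "finite \<A>" by (rule finite_subset_Pow[OF AV V(1)])
 have c: "0 < c" "10000000000 * c = \<delta>" using assms(1,3) by simp_all
 have cA: "real (card \<A>) = real (binom_ge (card V) (Suc k)) + (x gchoose k)" using assms(10) V(2) by simp
 have N: "real (card (nbd V \<A>)) \<le> real (binom_ge (card V) k) + (x gchoose (k - 1)) + c * real k * (x - real k) / x ^ 3 * (x gchoose (k - 1))"
 proof -
  have "real (card (nbd V \<A>)) = real (card (vboundary n \<A>)) + real (card \<A>)"
   using card_vboundary[OF assms(8)] unfolding V_def by (metis of_nat_add)
  moreover have "real (binom_ge n k) = real (n choose k) + real (binom_ge n (Suc k))" using binom_ge_rec[of n k] by simp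
  ultimately show ?thesis using assms(11) cA unfolding B_lov_def V(2) by linarith
 qed
 show ?thesis
 proof (cases "real k \<le> x")
  case True
  have c1: "0 \<le> c" "1000 * c \<le> 1" using c assms(2) by linarith+
  have xn: "x \<le> real (card V)" using assms(6) V(2) by simp
  obtain s where s: "k \<le> s" "s \<le> card V"
   "2 * (real (card \<A>) - real (msize (card V) s k)) \<le> incr s k"
   "- 6 * th (s - 1) (k - 1) * (real (card \<A>) - real (msize (card V) s k)) \<le> incr s k"
   "excess V s k \<A> \<le> 7 * c * Zc s k" "Zc s k \<le> 3 * ((x - 3) gchoose (k - 2))"
   by (rule integer_parameter[OF V(1) AV assms(4) True xn c1 cA N])
  \<comment> \<open>The factor 7 comes from \<open>slack_bound\<close>. With the factor 4 of
    \<open>stable\<close> and the factor 3 between \<open>Zc s k\<close> and C(x-3,k-2), the final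
    error is at most \<open>84 * c\<close> times C(x-3,k-2).\<close>
  have \<eta>: "0 \<le> 7 * c" "1000000 * (7 * c) \<le> 1" using c assms(2) by linarith+
  have st: "stable V s k (7 * c)" by (rule stability[OF V(1) assms(4) s(1,2) \<eta>])
  obtain \<G> where G: "gball V s k \<G>" "real (card (\<G> - \<A>)) + real (card (\<A> - \<G>)) \<le> 4 * (7 * c * Zc s k)"
   using st AV s(3,4,5) unfolding stable_def by blast
  have Z0: "0 \<le> Zc s k" by (rule Zc_nonneg)
  have small: "4 * (7 * c * Zc s k) \<le> Zc s k"
  proof -
   have "(28 * c) * Zc s k \<le> 1 * Zc s k" using c assms(2) Z0 by (intro mult_right_mono) linarith+
   thus ?thesis by simp
  qed
  show ?thesis
  proof (rule conclusion_from_ball[OF assms(8) G(1)[unfolded V_def] assms(4) s(1) _ G(2)])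
   show "s \<le> n" using s(2) V(2) by simp
   show "4 * (7 * c * Zc s k) \<le> \<delta> * ((x - 3) gchoose (k - 2))"
   proof -
    define w where "w = (x - 3) gchoose (k - 2)"
    have w: "0 \<le> w" "Zc s k \<le> 3 * w" using s(6) Z0 unfolding w_def by linarith+
    have "4 * (7 * c * Zc s k) = (28 * c) * Zc s k" by simp
    also have "\<dots> \<le> (28 * c) * (3 * w)" using w c by (intro mult_left_mono) auto
    also have "\<dots> = (84 * c) * w" by simp
    also have "\<dots> \<le> \<delta> * w" using w c by (intro mult_right_mono) linarith+
    finally show ?thesis by (simp add: w_def)
   qed
   have "Zc s k \<le> incr s k \<and> (k < s \<or> 4 * (7 * c * Zc s k) < 1)"
   proof (cases "k = 2")
    case True
    have "Zc s k = 1" using True by (simp add: Zc_def)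
    moreover have "1 \<le> incr s k" using True s(1) by simp
    moreover have "4 * (7 * c * 1) < 1" using c assms(2) by linarith
    ultimately show ?thesis by simp
   next
    case False
    hence k3: "3 \<le> k" using assms(4) by simp
    have "Zc s k \<le> incr s k" by (rule Zc_ineqs(8)[OF k3 s(1)])
    moreover have "k < s \<or> Zc s k = 0" using k3 s(1) by (cases "k < s") (auto simp: Zc_def binomial_eq_0)
    ultimately show ?thesis by auto
   qed
   thus "4 * (7 * c * Zc s k) \<le> incr s k" "k < s \<or> 4 * (7 * c * Zc s k) < 1"
    using small by linarith+
  qed
 next
  case False
  text \<open>By integrality \<open>x = k - 1\<close>, and \<open>\<A>\<close> has the size of a full ball, the \<open>(k + 1, n)\<close> ball.\<close>
  have xk: "x = real k - 1"
  proof (rule ccontr)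
   assume "x \<noteq> real k - 1"
   hence lt: "real k - 1 < x" "x < real k" using assms(5) False by auto
   have "0 < x gchoose k" by (rule gb_pos[OF lt(1)])
   moreover have "x gchoose k < real k gchoose k" using lt assms(4) by (intro gb_strict_mono) auto
   moreover have "real k gchoose k = 1" unfolding gb_nat by simp
   ultimately have "0 < real_of_int (int (card \<A>) - int (binom_ge n (k + 1)))"
    "real_of_int (int (card \<A>) - int (binom_ge n (k + 1))) < 1" using assms(10) by simp_all
   thus False unfolding of_int_0_less_iff of_int_less_1_iff by linarith
  qed
  have xe: "x = real (k - 1)" using xk assms(4) by (simp add: of_nat_diff)
  have gk: "x gchoose k = 0" "x gchoose (k - 1) = 1" unfolding xe gb_nat using assms(4) by (simp_all add: binomial_eq_0)
  have cA': "card \<A> = binom_ge n (k + 1)" using assms(10) gk by simp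
  have kn: "k + 1 \<le> n"
  proof (rule ccontr)
   assume "\<not> ?thesis"
   hence "card \<A> = 0" unfolding cA' binom_ge_def by simp
   thus False using fA assms(9) by simp
  qed
  \<comment> \<open>At \<open>x = k - 1\<close> the slack is negative, so the neighbourhood is no
    larger than that of the full ball.\<close>
  have "c * real k * (x - real k) / x ^ 3 < 0"
   unfolding xk using c assms(4) by (intro divide_neg_pos) (auto simp: mult_neg_pos)
  hence "real (card (nbd V \<A>)) < real (binom_ge n k) + 1" using N gk V(2) by simp
  hence nA: "card (nbd V \<A>) \<le> binom_ge n k" by linarith
  have ms: "msize (card V) n (k + 1) = binom_ge n (k + 1)" "msize_nbd (card V) n (k + 1) = binom_ge n k"
   using msize_full(1)[of n "k + 1"] msize_full(2)[of "k + 1" n] V(2) by simp_all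
  have k1: "2 \<le> k + 1" "k + 1 \<le> card V" "k + 1 \<le> n" using assms(4) kn V(2) by auto
  have t0: "real (card \<A>) - real (msize (card V) n (k + 1)) = 0" using ms(1) cA' by simp
  have w: "2 * (real (card \<A>) - real (msize (card V) n (k + 1))) \<le> real ((n - 1) choose (k + 1 - 1))"
   "- 6 * th (n - 1) (k + 1 - 1) * (real (card \<A>) - real (msize (card V) n (k + 1))) \<le> real ((n - 1) choose (k + 1 - 1))"
   unfolding t0 by simp_all
  have "(real n - real (k + 1) + 1) * (real (card (nbd V \<A>)) - real (msize_nbd (card V) n (k + 1))) \<le> 0"
   using nA ms(2) kn by (intro mult_nonneg_nonpos) auto
  hence ex: "excess V n (k + 1) \<A> \<le> 0 * Zc n (k + 1)" unfolding excess_def t0 by simp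
  have st: "stable V n (k + 1) 0" using stable_full[OF V(1) k1(1,2), of 0] V(2) by simp
  obtain \<G> where G: "gball V n (k + 1) \<G>" "real (card (\<G> - \<A>)) + real (card (\<A> - \<G>)) \<le> 4 * (0 * Zc n (k + 1))"
   using st AV w ex unfolding stable_def by blast
  show ?thesis
  proof (rule conclusion_from_ball[OF assms(8) G(1)[unfolded V_def] k1(1,3) order_refl])
   show "real (card (\<G> - \<A>)) + real (card (\<A> - \<G>)) \<le> 0" using G(2) by simp
   show "0 \<le> \<delta> * ((x - 3) gchoose (k - 2))"
   \<comment> \<open>With x = k - 1 the binomial is 1 for \<open>k = 2\<close>, 0 for
     \<open>k \<ge> 4\<close>, and -1 for \<open>k = 3\<close>, the case that the hypotheses
     exclude.\<close>
   proof (cases "k \<le> 3")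
    case True
    hence "k = 2" using assms(4,7) xk by force
    thus ?thesis using assms(1) by simp
   next
    case False
    hence "x - 3 = real (k - 4)" using xk by (simp add: of_nat_diff)
    hence "(x - 3) gchoose (k - 2) = real ((k - 4) choose (k - 2))" by (simp only: gb_nat)
    hence "(x - 3) gchoose (k - 2) = 0" using False by (simp add: binomial_eq_0)
    thus ?thesis by simp
   qed
   show "0 \<le> real ((n - 1) choose (k + 1 - 1))" by simp
   show "k + 1 < n \<or> (0::real) < 1" by simp
  qed
 qed
qed

end
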